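(* Assume (A1)--(A5), $0<\Delta x\le\delta\le 1$, and the CFL condition (CFL) (all listed in the context). Let $u$ be the bounded viscosity solution of the initial value problem (E)--(IC), and let $U_h^\delta$ be the bounded solution of the scheme (S) with initial data $U^0_{\mathbf j}=u_0(x_{\mathbf j})$. Then there exists a constant $C>0$, depending only on the constants in (A1)--(A5), such that for all $(t,x)\in\mathcal G_h^N$, $$|U_h^\delta(t,x)-u(t,x)|\le C(1+T)\begin{cases}(T\wedge1)^{\frac12}\Big(\Delta t^{\frac12}+\Delta x^{\frac12}+\delta^{1-\frac\sigma2}\Big)&\text{if }\sigma\in[0,1),\\[2mm](T\wedge1)^{\frac12}\Big(\Delta t^{\frac12}|\log\Delta t|+\Delta t^{\frac12}|\log\delta|+\Delta x^{\frac12}|\log\delta|+\delta^{\frac12}\Big)&\text{if }\sigma=1,\\[2mm](T\wedge1)^{\frac1{2\sigma}}\Delta t^{\frac1{2\sigma}}+(T\wedge1)^{\frac12}\Big(\Delta t^{\frac12}\delta^{1-\sigma}+\Delta x^{\frac12}\delta^{1-\sigma}+\delta^{1-\frac\sigma2}\Big)&\text{if }\sigma\in(1,2),\end{cases}$$ where $\sigma$ is the exponent in (A5).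
   Context: **Equation.** Let $T>0$, $Q_T=(0,T]\times\mathbb R^N$. Consider (E) $\;u_t+\inf_{\alpha\in\mathcal A}\sup_{\beta\in\mathcal B}\{-f^{\alpha,\beta}(t,x)+c^{\alpha,\beta}(t,x)u(t,x)-b^{\alpha,\beta}(t,x)\cdot\nabla u(t,x)-\mathcal I^{\alpha,\beta}[u](t,x)\}=0$ in $Q_T$, (IC) $\;u(0,x)=u_0(x)$ in $\mathbb R^N$, where $\mathcal I^{\alpha,\beta}[\phi](t,x)=\int_{\mathbb R^M\setminus\{0\}}\big(\phi(t,x+\eta^{\alpha,\beta}(t,x;z))-\phi(t,x)-\eta^{\alpha,\beta}(t,x;z)\cdot\nabla_x\phi(t,x)\big)\nu(dz)$. Here $f,c$ are real valued, $b,\eta$ are $\mathbb R^N$-valued. **Norms.** $\|w\|_0=\sup|w|$; $\|w\|_1=\|w\|_0+\sup_{(t,x)\ne(s,y)}\frac{|w(t,x)-w(s,y)|}{|t-s|+|x-y|}$ (for $t$-independent $w$ this is the Lipschitz norm). **Assumptions.** (A1) $\mathcal A,\mathcal B$ are separable metric spaces, $c^{\alpha,\beta}\ge0$, and $c^{\alpha,\beta}(t,x),f^{\alpha,\beta}(t,x),b^{\alpha,\beta}(t,x),\eta^{\alpha,\beta}(t,x;z)$ are continuous in $\alpha,\beta,t,x,z$. (A2) There is $K>0$ with $\|u_0\|_1+\|f^{\alpha,\beta}\|_1+\|c^{\alpha,\beta}\|_1+\|b^{\alpha,\beta}\|_1\le K$ for all $\alpha,\beta$. (A3) There is a function $\rho(z)\ge0$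 with $|\eta^{\alpha,\beta}(t,x;z)-\eta^{\alpha,\beta}(s,y;z)|\le\rho(z)(|x-y|+|t-s|)$ and $|\eta^{\alpha,\beta}(t,x;z)|\le\rho(z)$ for all arguments, $\rho(z)\le K|z|$ for $|z|<1$, and $1\le\rho(z)\le\rho(z)^2$ for $|z|\ge1$. (A4) $\nu$ is a nonnegative Radon measure on $\mathbb R^M\setminus\{0\}$ with $\int_{|z|<1}|z|^2\nu(dz)+\int_{|z|\ge1}\rho(z)^2\nu(dz)<\infty$. (A5) There are $\sigma\in(0,2)$, $C>0$, and a density $k(z)$ of $\nu(dz)$ for $|z|<1$ with $0\le k(z)\le C|z|^{-M-\sigma}$ for $|z|<1$. **Viscosity solutions.** For $\kappa\in(0,1)$ let $\mathcal I_\kappa^{\alpha,\beta}[\phi]$ be the integral defining $\mathcal I^{\alpha,\beta}[\phi]$ restricted to $|z|<\kappa$, and $\mathcal I^{\alpha,\beta,\kappa}[u;p](t,x)=\int_{|z|\ge\kappa}(u(t,x+\eta^{\alpha,\beta}(t,x;z))-u(t,x)-\eta^{\alpha,\beta}(t,x;z)\cdot p)\nu(dz)$. A bounded usc (resp. lsc) function $u$ is a viscosity subsolution (resp. supersolution) of (E) if for all $\kappa\in(0,1)$, $\phi\in C^2(Q_T)$ and every global maximum (resp. minimum) point $(t,x)\in Q_T$ of $u-\phi$, one has $\phi_t+\inf_\alpha\sup_\beta\{-f^{\alpha,\beta}+c^{\alpha,\beta}u-b^{\alpha,\beta}\cdot\nabla\phi-\mathcal I_\kappa^{\alpha,\beta}[\phi]-\mathcal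 I^{\alpha,\beta,\kappa}[u;\nabla_x\phi(t,x)]\}\le0$ (resp. $\ge0$) at $(t,x)$. A viscosity solution is a bounded continuous function that is both; solutions of the initial value problem are continuous on $[0,T]\times\mathbb R^N$. **Grid.** $\Delta x>0$, $\Delta t=T/M_T$ with $M_T\in\mathbb N$, $h=(\Delta t,\Delta x)$, $t_n=n\Delta t$, $x_{\mathbf m}=\mathbf m\Delta x$, $\mathcal G_h^N=\{(t_n,x_{\mathbf m}):\mathbf m\in\mathbb Z^N,\ 0\le n\le M_T\}$. **Discrete operators.** Let $\tilde b_\delta^{\alpha,\beta}(t,x)=b^{\alpha,\beta}(t,x)-\int_{|z|>\delta}\eta^{\alpha,\beta}(t,x;z)\nu(dz)$ with components $\tilde b_{\delta,i}^{\alpha,\beta}$, and $r^\pm=\max(\pm r,0)$. With $e_i$ the standard basis of $\mathbb R^N$, $\mathcal D_h^{\alpha,\beta,\delta}[u](t,x)=\sum_{i=1}^N\big[\tilde b_{\delta,i}^{\alpha,\beta,+}(t,x)\frac{u(t,x+e_i\Delta x)-u(t,x)}{\Delta x}+\tilde b_{\delta,i}^{\alpha,\beta,-}(t,x)\frac{u(t,x-e_i\Delta x)-u(t,x)}{\Delta x}\big]=\sum_{\mathbf j\ne0}d_{h,\mathbf j}^{\alpha,\beta,\delta}(t,x)[u(t,x+x_{\mathbf j})-u(t,x)]$. Let $\omega_{\mathbf j}(\cdot;h)$, $\mathbf j\in\mathbb Z^N$, be the basis ("tent") functions of standard piecewise linear/multilinear interpolation on $\Delta x\,\mathbb Z^N$: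 $0\le\omega_{\mathbf j}\le1$, $\omega_{\mathbf j}(x_{\mathbf k};h)=\delta_{\mathbf j,\mathbf k}$, $\sum_{\mathbf j}\omega_{\mathbf j}=1$, $\operatorname{supp}\omega_{\mathbf j}\subset B(x_{\mathbf j},c_N\Delta x)$, $\|D\omega_{\mathbf j}\|_0\le C/\Delta x$, and $|\sum_{\mathbf j}\varphi(x_{\mathbf j})\omega_{\mathbf j}(x;h)-\varphi(x)|\le K\|D^2\varphi\|_0\Delta x^2$. Then $\mathcal J_h^{\alpha,\beta,\delta}[\varphi](t,x)=\sum_{\mathbf j\in\mathbb Z^N}(\varphi(t,x+x_{\mathbf j})-\varphi(t,x))\kappa_{h,\mathbf j}^{\alpha,\beta,\delta}(t,x)$, $\kappa_{h,\mathbf j}^{\alpha,\beta,\delta}(t,x)=\int_{|z|>\delta}\omega_{\mathbf j}(\eta^{\alpha,\beta}(t,x;z);h)\nu(dz)$. **Scheme.** Fix $\theta,\vartheta\in[0,1]$. Write $g^n_{\mathbf j}=g(t_n,x_{\mathbf j})$, and $\mathcal D_h[U]^n_{\mathbf j},\mathcal J_h[U]^n_{\mathbf j}$ for the operators evaluated at $(t_n,x_{\mathbf j})$ (coefficients and $U$ at time $t_n$). The scheme is: for $\mathbf j\in\mathbb Z^N$, $1\le n\le M_T$, (S) $\;U^n_{\mathbf j}=U^{n-1}_{\mathbf j}-\Delta t\inf_{\alpha}\sup_{\beta}\{-f^{\alpha,\beta,n-1}_{\mathbf j}+c^{\alpha,\beta,n}_{\mathbf j}U^{n-1}_{\mathbf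 j}-\theta\mathcal D_h^{\alpha,\beta,\delta}[U]^n_{\mathbf j}-(1-\theta)\mathcal D_h^{\alpha,\beta,\delta}[U]^{n-1}_{\mathbf j}-\vartheta\mathcal J_h^{\alpha,\beta,\delta}[U]^n_{\mathbf j}-(1-\vartheta)\mathcal J_h^{\alpha,\beta,\delta}[U]^{n-1}_{\mathbf j}\}$, and $U^\delta_h(t_n,x_{\mathbf j})=U^n_{\mathbf j}$. (CFL) For all $\alpha,\beta$, $\bar{\mathbf j}\in\mathbb Z^N$, $1\le n\le M_T$: $\Delta t\big[(1-\theta)\sum_{\mathbf j\ne0}d_{h,\mathbf j}^{\alpha,\beta,\delta}(t_{n-1},x_{\bar{\mathbf j}})+(1-\vartheta)\sum_{\mathbf j\ne0}\kappa_{h,\mathbf j}^{\alpha,\beta,\delta}(t_{n-1},x_{\bar{\mathbf j}})+c^{\alpha,\beta}(t_n,x_{\bar{\mathbf j}})\big]\le1$. $T\wedge1=\min(T,1)$.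
   Formalization: C may also depend on an upper bound T0 for the horizon T (one C for all 0<T≤T0), since a C independent of T is impossible: take ν=0, f=c=0, b=u0=clip(x,-1,1), θ=1, δ=Δx, T=log(1/Δx), Δt→0. *)

theory Defs
  imports "HOL-Analysis.Analysis"
begin

section \<open>Data of the equation\<close>

text \<open>
  The control sets are subsets of metric types, with the induced metric. As sets (rather than types)
  they can be quantified after a constant has been chosen; every separable metric space is isometric
  to a subset of the metric type of bounded real sequences.
  The Levy measure lives on the Borel sets of the punctured space.
\<close>

record ('a, 'b, 'n, 'm) isaacs =
  ctrlA :: "'a set"
  ctrlB :: "'b set"
  src :: "'a \<Rightarrow> 'b \<Rightarrow> real \<times> (real^'n) \<Rightarrow> real"                  \<comment> \<open>\<open>f\<close>\<close>
  zeroth :: "'a \<Rightarrow> 'b \<Rightarrow> real \<times> (real^'n) \<Rightarrow> real"               \<comment> \<open>\<open>c\<close>\<close>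
  drift :: "'a \<Rightarrow> 'b \<Rightarrow> real \<times> (real^'n) \<Rightarrow> real^'n"             \<comment> \<open>\<open>b\<close>\<close>
  jump :: "'a \<Rightarrow> 'b \<Rightarrow> real \<times> (real^'n) \<Rightarrow> real^'m \<Rightarrow> real^'n"   \<comment> \<open>\<open>\<eta>\<close>\<close>
  levy :: "(real^'m) measure"                               \<comment> \<open>\<open>\<nu>\<close>\<close>

definition cyl :: "real \<Rightarrow> (real \<times> (real^'n)) set" where
  "cyl T = {0..T} \<times> UNIV"

definition QT :: "real \<Rightarrow> (real \<times> (real^'n)) set" where
  "QT T = {0<..T} \<times> UNIV"

definition pdist :: "real \<times> (real^'n) \<Rightarrow> real \<times> (real^'n) \<Rightarrow> real" where
  "pdist p q = \<bar>fst p - fst q\<bar> + norm (snd p - snd q)"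

text \<open>The norms take the value infinity for unbounded or non-Lipschitz functions.\<close>

definition norm0 :: "real \<Rightarrow> (real \<times> (real^'n) \<Rightarrow> 'v::real_normed_vector) \<Rightarrow> ennreal" where
  "norm0 T w = (SUP p\<in>cyl T. ennreal (norm (w p)))"

definition norm1 :: "real \<Rightarrow> (real \<times> (real^'n) \<Rightarrow> 'v::real_normed_vector) \<Rightarrow> ennreal" where
  "norm1 T w = norm0 T w +
     (SUP (p, q)\<in>{(p, q). p \<in> cyl T \<and> q \<in> cyl T \<and> p \<noteq> q}. ennreal (norm (w p - w q) / pdist p q))"

section \<open>Assumptions\<close>

definition A1 :: "('a::metric_space, 'b::metric_space, 'n::finite, 'm::finite) isaacs \<Rightarrow> real \<Rightarrow> bool" where
  "A1 P T \<longleftrightarrow>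
     ctrlA P \<noteq> {} \<and> separable_space (top_of_set (ctrlA P)) \<and>
     ctrlB P \<noteq> {} \<and> separable_space (top_of_set (ctrlB P)) \<and>
     (\<forall>\<alpha>\<in>ctrlA P. \<forall>\<beta>\<in>ctrlB P. \<forall>p\<in>cyl T. 0 \<le> zeroth P \<alpha> \<beta> p) \<and>
     continuous_on (ctrlA P \<times> ctrlB P \<times> cyl T) (\<lambda>(\<alpha>, \<beta>, p). zeroth P \<alpha> \<beta> p) \<and>
     continuous_on (ctrlA P \<times> ctrlB P \<times> cyl T) (\<lambda>(\<alpha>, \<beta>, p). src P \<alpha> \<beta> p) \<and>
     continuous_on (ctrlA P \<times> ctrlB P \<times> cyl T) (\<lambda>(\<alpha>, \<beta>, p). drift P \<alpha> \<beta> p) \<and>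
     continuous_on (ctrlA P \<times> ctrlB P \<times> cyl T \<times> - {0}) (\<lambda>(\<alpha>, \<beta>, p, z). jump P \<alpha> \<beta> p z)"

definition A2 :: "('a, 'b, 'n::finite, 'm::finite) isaacs \<Rightarrow> real \<Rightarrow> (real^'n \<Rightarrow> real) \<Rightarrow> real \<Rightarrow> bool" where
  "A2 P T u0 K \<longleftrightarrow>
     (\<forall>\<alpha>\<in>ctrlA P. \<forall>\<beta>\<in>ctrlB P.
        norm1 T (\<lambda>(t, x). u0 x) + norm1 T (src P \<alpha> \<beta>) + norm1 T (zeroth P \<alpha> \<beta>) + norm1 T (drift P \<alpha> \<beta>)
        \<le> ennreal K)"

definition A3 :: "('a, 'b, 'n::finite, 'm::finite) isaacs \<Rightarrow> real \<Rightarrow> real \<Rightarrow> (real^'m \<Rightarrow> real) \<Rightarrow> bool" where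
  "A3 P T K \<rho> \<longleftrightarrow>
     (\<forall>z\<in>- {0}. 0 \<le> \<rho> z \<and>
        (\<forall>\<alpha>\<in>ctrlA P. \<forall>\<beta>\<in>ctrlB P. \<forall>p\<in>cyl T.
           norm (jump P \<alpha> \<beta> p z) \<le> \<rho> z \<and>
           (\<forall>q\<in>cyl T. norm (jump P \<alpha> \<beta> p z - jump P \<alpha> \<beta> q z) \<le> \<rho> z * pdist p q)) \<and>
        (norm z < 1 \<longrightarrow> \<rho> z \<le> K * norm z) \<and>
        (1 \<le> norm z \<longrightarrow> 1 \<le> \<rho> z \<and> \<rho> z \<le> (\<rho> z)\<^sup>2))"

text \<open>
  A Radon measure on the punctured space is a Borel measure that is finite on compact sets;
  \<open>\<Lambda>\<close> is the size of the finite integral.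
\<close>

definition A4 :: "('a, 'b, 'n::finite, 'm::finite) isaacs \<Rightarrow> (real^'m \<Rightarrow> real) \<Rightarrow> real \<Rightarrow> bool" where
  "A4 P \<rho> \<Lambda> \<longleftrightarrow>
     sets (levy P) = sets (restrict_space borel (- {0})) \<and>
     (\<forall>S. compact S \<and> S \<subseteq> - {0} \<longrightarrow> emeasure (levy P) S < \<infinity>) \<and>
     \<rho> \<in> borel_measurable (levy P) \<and>
     (\<integral>\<^sup>+z. ennreal ((norm z)\<^sup>2) * indicator {z. norm z < 1} z \<partial>levy P) +
     (\<integral>\<^sup>+z. ennreal ((\<rho> z)\<^sup>2) * indicator {z. 1 \<le> norm z} z \<partial>levy P) \<le> ennreal \<Lambda>"

definition A5 :: "('a, 'b, 'n::finite, 'm::finite) isaacs \<Rightarrow> real \<Rightarrow> real \<Rightarrow> bool" where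
  "A5 P \<sigma> C \<longleftrightarrow>
     (\<exists>k :: real^'m \<Rightarrow> real.
        k \<in> borel_measurable borel \<and>
        (\<forall>z. z \<noteq> 0 \<and> norm z < 1 \<longrightarrow> 0 \<le> k z \<and> k z \<le> C * norm z powr (- real CARD('m) - \<sigma>)) \<and>
        (\<forall>S\<in>sets borel. S \<subseteq> {z. z \<noteq> 0 \<and> norm z < 1} \<longrightarrow>
           emeasure (levy P) S = (\<integral>\<^sup>+z. ennreal (k z) * indicator S z \<partial>lborel)))"

section \<open>Viscosity solutions\<close>

text \<open>
  \<open>\<phi>\<close> is twice continuously differentiable on \<open>S\<close> with gradient \<open>g\<close> and Hessian \<open>H\<close>. Derivatives
  are taken within \<open>S\<close>, hence one-sided in time at the terminal time when \<open>S\<close> is \<open>QT T\<close>; there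
  the first component of \<open>g\<close> is the time derivative and the second one the spatial gradient.
\<close>

definition C2_on :: "'v::euclidean_space set \<Rightarrow> ('v \<Rightarrow> real) \<Rightarrow> ('v \<Rightarrow> 'v) \<Rightarrow> ('v \<Rightarrow> 'v \<Rightarrow>\<^sub>L 'v) \<Rightarrow> bool" where
  "C2_on S \<phi> g H \<longleftrightarrow>
     (\<forall>p\<in>S. (\<phi> has_derivative (\<lambda>v. g p \<bullet> v)) (at p within S)) \<and>
     (\<forall>p\<in>S. (g has_derivative blinfun_apply (H p)) (at p within S)) \<and>
     continuous_on S H"

definition usc_on :: "'v::topological_space set \<Rightarrow> ('v \<Rightarrow> real) \<Rightarrow> bool" where
  "usc_on S u \<longleftrightarrow> (\<forall>p\<in>S. \<forall>a>u p. eventually (\<lambda>q. u q < a) (at p within S))"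

definition lsc_on :: "'v::topological_space set \<Rightarrow> ('v \<Rightarrow> real) \<Rightarrow> bool" where
  "lsc_on S u \<longleftrightarrow> (\<forall>p\<in>S. \<forall>a<u p. eventually (\<lambda>q. a < u q) (at p within S))"

definition I_near ::
  "('a, 'b, 'n::finite, 'm::finite) isaacs \<Rightarrow> real \<Rightarrow> (real \<times> (real^'n) \<Rightarrow> real) \<Rightarrow> real^'n \<Rightarrow>
    'a \<Rightarrow> 'b \<Rightarrow> real \<times> (real^'n) \<Rightarrow> real" where
  "I_near P \<kappa> \<phi> d \<alpha> \<beta> = (\<lambda>(t, x).
     LINT z:{z. norm z < \<kappa>}|levy P.
       \<phi> (t, x + jump P \<alpha> \<beta> (t, x) z) - \<phi> (t, x) - jump P \<alpha> \<beta> (t, x) z \<bullet> d)"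

definition I_far ::
  "('a, 'b, 'n::finite, 'm::finite) isaacs \<Rightarrow> real \<Rightarrow> (real \<times> (real^'n) \<Rightarrow> real) \<Rightarrow> real^'n \<Rightarrow>
    'a \<Rightarrow> 'b \<Rightarrow> real \<times> (real^'n) \<Rightarrow> real" where
  "I_far P \<kappa> u d \<alpha> \<beta> = (\<lambda>(t, x).
     LINT z:{z. \<kappa> \<le> norm z}|levy P.
       u (t, x + jump P \<alpha> \<beta> (t, x) z) - u (t, x) - jump P \<alpha> \<beta> (t, x) z \<bullet> d)"

definition visc_op ::
  "('a, 'b, 'n::finite, 'm::finite) isaacs \<Rightarrow> real \<Rightarrow> (real \<times> (real^'n) \<Rightarrow> real) \<Rightarrow>
    (real \<times> (real^'n) \<Rightarrow> real) \<Rightarrow> (real \<times> (real^'n) \<Rightarrow> real \<times> (real^'n)) \<Rightarrow> real \<times> (real^'n) \<Rightarrow> real" where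
  "visc_op P \<kappa> u \<phi> g p =
     fst (g p) +
     (INF \<alpha>\<in>ctrlA P. SUP \<beta>\<in>ctrlB P.
        - src P \<alpha> \<beta> p + zeroth P \<alpha> \<beta> p * u p - drift P \<alpha> \<beta> p \<bullet> snd (g p)
        - I_near P \<kappa> \<phi> (snd (g p)) \<alpha> \<beta> p - I_far P \<kappa> u (snd (g p)) \<alpha> \<beta> p)"

definition visc_subsol ::
  "('a, 'b, 'n::finite, 'm::finite) isaacs \<Rightarrow> real \<Rightarrow> (real \<times> (real^'n) \<Rightarrow> real) \<Rightarrow> bool" where
  "visc_subsol P T u \<longleftrightarrow>
     bounded (u ` QT T) \<and> usc_on (QT T) u \<and>
     (\<forall>\<kappa>\<in>{0<..<1}. \<forall>\<phi> g H. C2_on (QT T) \<phi> g H \<longrightarrow>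
        (\<forall>p\<in>QT T. (\<forall>q\<in>QT T. u q - \<phi> q \<le> u p - \<phi> p) \<longrightarrow> visc_op P \<kappa> u \<phi> g p \<le> 0))"

definition visc_supersol ::
  "('a, 'b, 'n::finite, 'm::finite) isaacs \<Rightarrow> real \<Rightarrow> (real \<times> (real^'n) \<Rightarrow> real) \<Rightarrow> bool" where
  "visc_supersol P T u \<longleftrightarrow>
     bounded (u ` QT T) \<and> lsc_on (QT T) u \<and>
     (\<forall>\<kappa>\<in>{0<..<1}. \<forall>\<phi> g H. C2_on (QT T) \<phi> g H \<longrightarrow>
        (\<forall>p\<in>QT T. (\<forall>q\<in>QT T. u p - \<phi> p \<le> u q - \<phi> q) \<longrightarrow> visc_op P \<kappa> u \<phi> g p \<ge> 0))"

definition visc_sol_ivp ::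
  "('a, 'b, 'n::finite, 'm::finite) isaacs \<Rightarrow> real \<Rightarrow> (real^'n \<Rightarrow> real) \<Rightarrow> (real \<times> (real^'n) \<Rightarrow> real) \<Rightarrow> bool" where
  "visc_sol_ivp P T u0 u \<longleftrightarrow>
     bounded (u ` cyl T) \<and> continuous_on (cyl T) u \<and>
     visc_subsol P T u \<and> visc_supersol P T u \<and> (\<forall>x. u (0, x) = u0 x)"

section \<open>Grid and interpolation\<close>

definition tm :: "real \<Rightarrow> nat \<Rightarrow> real" where
  "tm dt n = real n * dt"

definition lat :: "real \<Rightarrow> int^'n \<Rightarrow> real^'n" where
  "lat dx m = (\<chi> i. real_of_int (m $ i) * dx)"

definition grid :: "real \<Rightarrow> real \<Rightarrow> nat \<Rightarrow> (real \<times> (real^'n)) set" where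
  "grid dt dx MT = {(tm dt n, lat dx m) | n m. n \<le> MT}"

text \<open>
  The basis functions of piecewise linear or multilinear interpolation enter through their common
  properties. They are differentiable only piecewise, so the bound on their gradient is a Lipschitz
  bound. In the last clause \<open>L\<close> bounds the operator norm of the Hessian.
\<close>

definition tent_basis ::
  "real \<Rightarrow> real \<Rightarrow> real \<Rightarrow> real \<Rightarrow> (int^'n \<Rightarrow> real^'n \<Rightarrow> real) \<Rightarrow> bool" where
  "tent_basis cN C1 C2 dx \<omega> \<longleftrightarrow>
     (\<forall>j x. 0 \<le> \<omega> j x \<and> \<omega> j x \<le> 1) \<and>
     (\<forall>j k. \<omega> j (lat dx k) = (if j = k then 1 else 0)) \<and>
     (\<forall>x. ((\<lambda>j. \<omega> j x) has_sum 1) UNIV) \<and>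
     (\<forall>j. closure {x. \<omega> j x \<noteq> 0} \<subseteq> ball (lat dx j) (cN * dx)) \<and>
     (\<forall>j. (C1 / dx)-lipschitz_on UNIV (\<omega> j)) \<and>
     (\<forall>\<phi> g H L. C2_on UNIV \<phi> g H \<and> (\<forall>x. norm (H x) \<le> L) \<longrightarrow>
        (\<forall>x. \<bar>(\<Sum>\<^sub>\<infinity>j. \<phi> (lat dx j) * \<omega> j x) - \<phi> x\<bar> \<le> C2 * L * dx\<^sup>2))"

text \<open>
  Tensor products of one-dimensional hat functions (multilinear interpolation) are an instance,
  with constants that depend only on the dimension.
\<close>

definition hat :: "real \<Rightarrow> int \<Rightarrow> real" where
  "hat y k = max 0 (1 - \<bar>y - real_of_int k\<bar>)"

definition multilin :: "real \<Rightarrow> int^'n \<Rightarrow> real^'n \<Rightarrow> real" where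
  "multilin dx j x = (\<Prod>i\<in>UNIV. hat (x $ i / dx) (j $ i))"

lemma hat_bounds: "0 \<le> hat y k" "hat y k \<le> 1"
  by (auto simp: hat_def)

lemma hat_zero: "k \<notin> {\<lfloor>y\<rfloor>, \<lfloor>y\<rfloor> + 1} \<Longrightarrow> hat y k = 0"
  unfolding hat_def by (cases "k < \<lfloor>y\<rfloor>") (simp_all, linarith+)

lemma hat_sums: "(\<Sum>k\<in>{\<lfloor>y\<rfloor>, \<lfloor>y\<rfloor> + 1}. hat y k) = 1"
  "(\<Sum>k\<in>{\<lfloor>y\<rfloor>, \<lfloor>y\<rfloor> + 1}. hat y k * (real_of_int k - y)) = 0"
proof -
  have a: "hat y \<lfloor>y\<rfloor> = 1 - (y - \<lfloor>y\<rfloor>)" "hat y (\<lfloor>y\<rfloor>+1) = y - \<lfloor>y\<rfloor>"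
    unfolding hat_def by (simp_all add: max_def) linarith+
  show "(\<Sum>k\<in>{\<lfloor>y\<rfloor>, \<lfloor>y\<rfloor> + 1}. hat y k) = 1"
  "(\<Sum>k\<in>{\<lfloor>y\<rfloor>, \<lfloor>y\<rfloor> + 1}. hat y k * (real_of_int k - y)) = 0"
    by (simp_all add: a del: of_int_add) (simp add: algebra_simps)
qed

definition cell :: "real \<Rightarrow> real^'n \<Rightarrow> (int^'n) set" where
  "cell dx x = {j. \<forall>i. j $ i \<in> {\<lfloor>x $ i / dx\<rfloor>, \<lfloor>x $ i / dx\<rfloor> + 1}}"

lemma cell_bij:
  "bij_betw (\<lambda>f. \<chi> i. f i) (Pi\<^sub>E UNIV (\<lambda>i::'n::finite. {\<lfloor>x $ i / dx\<rfloor>, \<lfloor>x $ i / dx\<rfloor> + 1})) (cell dx x)"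
  by (rule bij_betwI[where g="\<lambda>j i. j $ i"]) (auto simp: cell_def PiE_def Pi_def)

lemma finite_cell: "finite (cell dx (x :: real^'n))"
  using bij_betw_finite[OF cell_bij[of x dx]] by (simp add: finite_PiE)

lemma sum_cell:
  "(\<Sum>j\<in>cell dx x. \<Prod>i\<in>UNIV. h i (j $ i)) = (\<Prod>i\<in>UNIV. \<Sum>k\<in>{\<lfloor>x $ i / dx\<rfloor>, \<lfloor>x $ i / dx\<rfloor> + 1}. h i k :: real)"
  by (subst prod_sum_PiE) (auto simp: sum.reindex_bij_betw[OF cell_bij, symmetric])

lemma multilin_zero: "j \<notin> cell dx x \<Longrightarrow> multilin dx j x = 0"
  using hat_zero by (force simp: cell_def multilin_def)

lemma sum_multilin: "(\<Sum>j\<in>cell dx x. multilin dx j x) = 1"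
  unfolding multilin_def by (subst sum_cell) (simp only: hat_sums prod.neutral_const)

lemma moment_multilin:
  assumes "dx > 0" shows "(\<Sum>j\<in>cell dx x. multilin dx j x * (lat dx j $ m - x $ m)) = 0"
proof -
  let ?h = "\<lambda>i k. hat (x $ i / dx) k * (if i = m then real_of_int k - x $ m / dx else 1)"
  have "multilin dx j x * (lat dx j $ m - x $ m) = dx * (\<Prod>i\<in>UNIV. ?h i (j $ i))" for j
    using assms by (simp add: prod.distrib multilin_def lat_def field_simps)
  then have "(\<Sum>j\<in>cell dx x. multilin dx j x * (lat dx j $ m - x $ m))
     = dx * (\<Prod>i\<in>UNIV. \<Sum>k\<in>{\<lfloor>x $ i / dx\<rfloor>, \<lfloor>x $ i / dx\<rfloor> + 1}. ?h i k)"
    by (simp only: sum_distrib_left[symmetric] sum_cell[where h = ?h])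
  also have "(\<Prod>i\<in>UNIV. \<Sum>k\<in>{\<lfloor>x $ i / dx\<rfloor>, \<lfloor>x $ i / dx\<rfloor> + 1}. ?h i k) = 0"
    by (rule prod_zero) (use hat_sums(2)[of "x $ m / dx"] in \<open>auto simp del: sum.insert intro!: exI[of _ m]\<close>)
  finally show ?thesis by simp
qed

lemma multilin_near:
  assumes "dx > 0" "multilin dx j x \<noteq> 0"
  shows "norm (lat dx j - (x::real^'n)) \<le> real CARD('n) * dx"
proof -
  have "\<bar>(lat dx j - x) $ i\<bar> \<le> dx" for i
  proof -
    have "hat (x $ i / dx) (j $ i) \<noteq> 0" using assms(2) by (auto simp: multilin_def)
    then have "\<bar>x $ i / dx - j $ i\<bar> * dx \<le> 1 * dx"
      using assms(1) by (intro mult_right_mono) (auto simp: hat_def max_def split: if_splits)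
    also have "\<bar>x $ i / dx - j $ i\<bar> * dx = \<bar>(x $ i / dx - j $ i) * dx\<bar>"
      using assms(1) by (simp add: abs_mult)
    finally show ?thesis using assms(1) by (simp add: lat_def algebra_simps abs_minus_commute)
  qed
  then have "(\<Sum>i\<in>UNIV. \<bar>(lat dx j - x) $ i\<bar>) \<le> real CARD('n) * dx"
    by (rule sum_bounded_above)
  with norm_le_l1_cart[of "lat dx j - x"] show ?thesis by linarith
qed

lemma taylor1:
  fixes \<phi> :: "real^'n \<Rightarrow> real"
  assumes C2: "C2_on UNIV \<phi> g H" and L: "\<And>x. norm (H x) \<le> L"
  shows "\<bar>\<phi> y - \<phi> x - g x \<bullet> (y - x)\<bar> \<le> L * (norm (y - x))\<^sup>2"
proof -
  have L0: "0 \<le> L" using L[of 0] norm_ge_zero order_trans by blast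
  have dphi: "(\<phi> has_derivative (\<lambda>v. g p \<bullet> v)) (at p within S)" for p S
    using C2 has_derivative_at_withinI by (fastforce simp: C2_on_def)
  have dg: "(g has_derivative blinfun_apply (H p)) (at p)" for p
    using C2 by (auto simp: C2_on_def)
  have gl: "norm (g a - g b) \<le> L * norm (a - b)" for a b
    by (rule differentiable_bound[of UNIV _ "\<lambda>p. blinfun_apply (H p)"])
       (auto simp: dg norm_blinfun.rep_eq[symmetric] L)
  let ?S = "closed_segment x y"
  have "norm ((\<phi> y - g x \<bullet> y) - (\<phi> x - g x \<bullet> x)) \<le> (L * norm (y - x)) * norm (y - x)"
  proof (rule differentiable_bound[of ?S "\<lambda>p. \<phi> p - g x \<bullet> p" "\<lambda>p v. g p \<bullet> v - g x \<bullet> v"])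
    fix p assume p: "p \<in> ?S"
    show "((\<lambda>p. \<phi> p - g x \<bullet> p) has_derivative (\<lambda>v. g p \<bullet> v - g x \<bullet> v)) (at p within ?S)"
      by (intro derivative_intros dphi)
    have "norm (p - x) \<le> norm (y - x)"
      using segment_bound(1)[OF p] by (simp add: norm_minus_commute)
    then have b: "norm (g p - g x) \<le> L * norm (y - x)"
      using gl[of p x] L0 by (meson mult_left_mono order_trans)
    show "onorm (\<lambda>v. g p \<bullet> v - g x \<bullet> v) \<le> L * norm (y - x)"
    proof (rule onorm_le)
      fix v
      have "norm (g p \<bullet> v - g x \<bullet> v) \<le> norm (g p - g x) * norm v"
        by (metis inner_diff_left real_norm_def Cauchy_Schwarz_ineq2)
      also have "\<dots> \<le> L * norm (y - x) * norm v" by (intro mult_right_mono b) auto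
      finally show "norm (g p \<bullet> v - g x \<bullet> v) \<le> L * norm (y - x) * norm v" .
    qed
  qed auto
  then show ?thesis by (simp add: power2_eq_square inner_diff_right algebra_simps)
qed

lemma tent_basis_multilin:
  assumes "dx > 0"
  shows "tent_basis (real CARD('n) + 1) (real CARD('n)) ((real CARD('n))\<^sup>2) dx
           (multilin dx :: int^'n \<Rightarrow> real^'n \<Rightarrow> real)"
  unfolding tent_basis_def
proof (intro conjI allI impI)
  fix j k :: "int^'n" and x :: "real^'n"
  show "0 \<le> multilin dx j x" "multilin dx j x \<le> 1"
    by (auto simp: multilin_def hat_bounds intro: prod_nonneg prod_le_1)
  have h: "hat (real_of_int a) b = (if a = b then 1 else 0)" for a b
    unfolding hat_def by (auto simp: max_def)
  show "multilin dx j (lat dx k) = (if j = k then 1 else 0)"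
    using assms by (auto simp: multilin_def lat_def h vec_eq_iff) metis
  show "((\<lambda>j. multilin dx j x) has_sum 1) UNIV"
    using has_sum_finite[OF finite_cell[of dx x], of "\<lambda>j. multilin dx j x"]
    unfolding sum_multilin
    by (rule has_sum_cong_neutral[THEN iffD1, rotated -1]) (auto simp: multilin_zero)
  have "closure {x. multilin dx j x \<noteq> 0} \<subseteq> cball (lat dx j) (real CARD('n) * dx)"
    by (rule closure_minimal) (use multilin_near[OF assms] in \<open>auto simp: dist_norm\<close>)
  also have "\<dots> \<subseteq> ball (lat dx j) ((real CARD('n) + 1) * dx)"
    using assms by (auto simp: algebra_simps)
  finally show "closure {x. multilin dx j x \<noteq> 0} \<subseteq> ball (lat dx j) ((real CARD('n) + 1) * dx)" .
  show "(real CARD('n) / dx)-lipschitz_on UNIV (multilin dx j)"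
  proof (rule lipschitz_onI)
    fix x y :: "real^'n"
    have "dist (multilin dx j x) (multilin dx j y)
        \<le> (\<Sum>i\<in>UNIV. norm (hat (x $ i / dx) (j $ i) - hat (y $ i / dx) (j $ i)))"
      unfolding multilin_def dist_norm
      by (rule norm_prod_diff) (auto simp: hat_bounds)
    also have "\<dots> \<le> (\<Sum>i\<in>(UNIV::'n set). norm (x - y) / dx)"
    proof (rule sum_mono)
      fix i
      have "norm (hat (x $ i / dx) (j $ i) - hat (y $ i / dx) (j $ i)) \<le> \<bar>x $ i / dx - y $ i / dx\<bar>"
        by (auto simp: hat_def max_def abs_real_def)
      also have "\<dots> = \<bar>(x - y) $ i\<bar> / dx"
        using assms by (simp add: diff_divide_distrib[symmetric])
      also have "\<dots> \<le> norm (x - y) / dx"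
        using assms by (intro divide_right_mono component_le_norm_cart) auto
      finally show "norm (hat (x $ i / dx) (j $ i) - hat (y $ i / dx) (j $ i)) \<le> norm (x - y) / dx" .
    qed
    finally show "dist (multilin dx j x) (multilin dx j y) \<le> real CARD('n) / dx * dist x y"
      by (simp add: dist_norm)
  qed (use assms in auto)
next
  fix \<phi> :: "real^'n \<Rightarrow> real" and g H L and x :: "real^'n"
  assume as: "C2_on UNIV \<phi> g H \<and> (\<forall>x. norm (H x) \<le> L)"
  let ?J = "cell dx x" and ?N = "real CARD('n)"
  let ?w = "\<lambda>j. multilin dx j x"
  let ?R = "\<lambda>j. \<phi> (lat dx j) - \<phi> x - g x \<bullet> (lat dx j - x)"
  have L0: "0 \<le> L" using as norm_ge_zero order_trans by blast
  have w0: "0 \<le> ?w j" for j by (auto simp: multilin_def hat_bounds intro: prod_nonneg)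
  have "(\<Sum>\<^sub>\<infinity>j. \<phi> (lat dx j) * ?w j) = (\<Sum>\<^sub>\<infinity>j\<in>?J. \<phi> (lat dx j) * ?w j)"
    by (rule infsum_cong_neutral) (auto simp: multilin_zero)
  also have "\<dots> = (\<Sum>j\<in>?J. \<phi> (lat dx j) * ?w j)" by (simp add: finite_cell)
  also have "\<dots> = (\<Sum>j\<in>?J. ?w j * \<phi> x + ?w j * (g x \<bullet> (lat dx j - x)) + ?w j * ?R j)"
    by (simp add: algebra_simps)
  also have "\<dots> = \<phi> x + (\<Sum>j\<in>?J. ?w j * (g x \<bullet> (lat dx j - x))) + (\<Sum>j\<in>?J. ?w j * ?R j)"
    by (simp add: sum.distrib sum_distrib_right[symmetric] sum_multilin)
  also have "(\<Sum>j\<in>?J. ?w j * (g x \<bullet> (lat dx j - x)))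
      = (\<Sum>j\<in>?J. \<Sum>m\<in>UNIV. g x $ m * (?w j * (lat dx j $ m - x $ m)))"
    by (simp add: inner_vec_def sum_distrib_left mult_ac)
  also have "\<dots> = (\<Sum>m\<in>UNIV. g x $ m * (\<Sum>j\<in>?J. ?w j * (lat dx j $ m - x $ m)))"
    by (subst sum.swap) (simp add: sum_distrib_left)
  also have "\<dots> = 0" by (simp add: moment_multilin[OF assms])
  finally have "\<bar>(\<Sum>\<^sub>\<infinity>j. \<phi> (lat dx j) * ?w j) - \<phi> x\<bar> = \<bar>\<Sum>j\<in>?J. ?w j * ?R j\<bar>" by simp
  also have "\<dots> \<le> (\<Sum>j\<in>?J. \<bar>?w j * ?R j\<bar>)" by (rule sum_abs)
  also have "\<dots> \<le> (\<Sum>j\<in>?J. ?w j * (L * (?N * dx)\<^sup>2))"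
  proof (rule sum_mono)
    fix j
    show "\<bar>?w j * ?R j\<bar> \<le> ?w j * (L * (?N * dx)\<^sup>2)"
    proof (cases "?w j = 0")
      case False
      have "\<bar>?R j\<bar> \<le> L * (norm (lat dx j - x))\<^sup>2" using as by (intro taylor1) auto
      also have "\<dots> \<le> L * (?N * dx)\<^sup>2"
        using multilin_near[OF assms False] L0 by (intro mult_left_mono power_mono) auto
      finally show ?thesis by (simp add: abs_mult w0 mult_left_mono)
    qed simp
  qed
  also have "\<dots> = ?N\<^sup>2 * L * dx\<^sup>2"
    by (simp add: sum_distrib_right[symmetric] sum_multilin power_mult_distrib)
  finally show "\<bar>(\<Sum>\<^sub>\<infinity>j. \<phi> (lat dx j) * ?w j) - \<phi> x\<bar> \<le> ?N\<^sup>2 * L * dx\<^sup>2" .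
qed

section \<open>The scheme\<close>

definition b_tilde ::
  "('a, 'b, 'n::finite, 'm::finite) isaacs \<Rightarrow> real \<Rightarrow> 'a \<Rightarrow> 'b \<Rightarrow> real \<times> (real^'n) \<Rightarrow> real^'n" where
  "b_tilde P \<delta> \<alpha> \<beta> p = drift P \<alpha> \<beta> p - (LINT z:{z. norm z > \<delta>}|levy P. jump P \<alpha> \<beta> p z)"

definition D_h ::
  "('a, 'b, 'n::finite, 'm::finite) isaacs \<Rightarrow> real \<Rightarrow> real \<Rightarrow> 'a \<Rightarrow> 'b \<Rightarrow>
    (real \<times> (real^'n) \<Rightarrow> real) \<Rightarrow> real \<times> (real^'n) \<Rightarrow> real" where
  "D_h P \<delta> dx \<alpha> \<beta> w = (\<lambda>(t, x).
     \<Sum>i\<in>UNIV.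
       max (b_tilde P \<delta> \<alpha> \<beta> (t, x) $ i) 0 * ((w (t, x + dx *\<^sub>R axis i 1) - w (t, x)) / dx) +
       max (- b_tilde P \<delta> \<alpha> \<beta> (t, x) $ i) 0 * ((w (t, x - dx *\<^sub>R axis i 1) - w (t, x)) / dx))"

definition d_coeff ::
  "('a, 'b, 'n::finite, 'm::finite) isaacs \<Rightarrow> real \<Rightarrow> real \<Rightarrow> 'a \<Rightarrow> 'b \<Rightarrow>
    real \<times> (real^'n) \<Rightarrow> int^'n \<Rightarrow> real" where
  "d_coeff P \<delta> dx \<alpha> \<beta> p j =
     (\<Sum>i\<in>UNIV.
       (if j = axis i 1 then max (b_tilde P \<delta> \<alpha> \<beta> p $ i) 0 / dx else 0) +
       (if j = - axis i 1 then max (- b_tilde P \<delta> \<alpha> \<beta> p $ i) 0 / dx else 0))"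

lemma has_sum_if_single:
  fixes a :: real
  assumes "k \<in> S"
  shows "((\<lambda>j. (if j = k then a else 0) * F j) has_sum (a * F k)) S"
proof -
  have "((\<lambda>j. (if j = k then a else 0) * F j) has_sum (a * F k)) {k}"
    using has_sum_finite[of "{k}" "\<lambda>j. (if j = k then a else 0) * F j"] by simp
  then show ?thesis
    by (rule has_sum_cong_neutral[THEN iffD1, rotated -1]) (use assms in auto)
qed

lemma D_h_has_sum:
  fixes w :: "real \<times> (real^'n) \<Rightarrow> real"
  shows "((\<lambda>j. d_coeff P \<delta> dx \<alpha> \<beta> (t, x) j * (w (t, x + lat dx j) - w (t, x)))
           has_sum D_h P \<delta> dx \<alpha> \<beta> w (t, x)) (- {0})"
proof -
  define F where "F = (\<lambda>j. w (t, x + lat dx j) - w (t, x))"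
  define a where "a = (\<lambda>i. max (b_tilde P \<delta> \<alpha> \<beta> (t, x) $ i) 0 / dx)"
  define b where "b = (\<lambda>i. max (- b_tilde P \<delta> \<alpha> \<beta> (t, x) $ i) 0 / dx)"
  have nz: "axis i (1::int) \<in> - {0}" "- axis i (1::int) \<in> - {0}" for i :: 'n
    by (auto simp: vec_eq_iff axis_def)
  have l: "lat dx (axis i 1) = dx *\<^sub>R axis i 1" "lat dx (- axis i 1) = - (dx *\<^sub>R axis i 1)" for i :: 'n
    by (auto simp: lat_def vec_eq_iff axis_def)
  have single: "((\<lambda>j. (if j = axis i 1 then a i else 0) * F j + (if j = - axis i 1 then b i else 0) * F j)
      has_sum (a i * F (axis i 1) + b i * F (- axis i 1))) (- {0})" for i
    by (intro has_sum_add has_sum_if_single nz)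
  have "((\<lambda>j. \<Sum>i\<in>I. (if j = axis i 1 then a i else 0) * F j + (if j = - axis i 1 then b i else 0) * F j)
     has_sum (\<Sum>i\<in>I. a i * F (axis i 1) + b i * F (- axis i 1))) (- {0})" if "finite I" for I
    using that
  proof (induction I rule: finite_induct)
    case (insert i I)
    show ?case
      unfolding sum.insert[OF insert.hyps] by (rule has_sum_add[OF single insert.IH])
  qed simp
  from this[OF finite, of UNIV]
  have "((\<lambda>j. d_coeff P \<delta> dx \<alpha> \<beta> (t, x) j * F j)
      has_sum (\<Sum>i\<in>UNIV. a i * F (axis i 1) + b i * F (- axis i 1))) (- {0})"
    by (simp only: d_coeff_def a_def b_def sum_distrib_right distrib_right)
  then show ?thesis
    by (simp add: D_h_def F_def a_def b_def l)
qed

definition kap ::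
  "('a, 'b, 'n::finite, 'm::finite) isaacs \<Rightarrow> (int^'n \<Rightarrow> real^'n \<Rightarrow> real) \<Rightarrow> real \<Rightarrow> 'a \<Rightarrow> 'b \<Rightarrow>
    real \<times> (real^'n) \<Rightarrow> int^'n \<Rightarrow> real" where
  "kap P \<omega> \<delta> \<alpha> \<beta> p j = (LINT z:{z. norm z > \<delta>}|levy P. \<omega> j (jump P \<alpha> \<beta> p z))"

definition J_h ::
  "('a, 'b, 'n::finite, 'm::finite) isaacs \<Rightarrow> (int^'n \<Rightarrow> real^'n \<Rightarrow> real) \<Rightarrow> real \<Rightarrow> real \<Rightarrow> 'a \<Rightarrow> 'b \<Rightarrow>
    (real \<times> (real^'n) \<Rightarrow> real) \<Rightarrow> real \<times> (real^'n) \<Rightarrow> real" where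
  "J_h P \<omega> \<delta> dx \<alpha> \<beta> w = (\<lambda>(t, x).
     \<Sum>\<^sub>\<infinity>j. (w (t, x + lat dx j) - w (t, x)) * kap P \<omega> \<delta> \<alpha> \<beta> (t, x) j)"

text \<open>Only the values of \<open>U\<close> on the grid matter.\<close>

definition scheme_sol ::
  "('a, 'b, 'n::finite, 'm::finite) isaacs \<Rightarrow> (int^'n \<Rightarrow> real^'n \<Rightarrow> real) \<Rightarrow> real \<Rightarrow> real \<Rightarrow> real \<Rightarrow>
    real \<Rightarrow> real \<Rightarrow> nat \<Rightarrow> (real \<times> (real^'n) \<Rightarrow> real) \<Rightarrow> bool" where
  "scheme_sol P \<omega> \<delta> \<theta> \<theta>' dt dx MT U \<longleftrightarrow>
     (\<forall>j. \<forall>n\<in>{1..MT}. let x = lat dx j; t = tm dt n; s = tm dt (n - 1) in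
        U (t, x) = U (s, x) - dt *
          (INF \<alpha>\<in>ctrlA P. SUP \<beta>\<in>ctrlB P.
             - src P \<alpha> \<beta> (s, x) + zeroth P \<alpha> \<beta> (t, x) * U (s, x)
             - \<theta> * D_h P \<delta> dx \<alpha> \<beta> U (t, x) - (1 - \<theta>) * D_h P \<delta> dx \<alpha> \<beta> U (s, x)
             - \<theta>' * J_h P \<omega> \<delta> dx \<alpha> \<beta> U (t, x) - (1 - \<theta>') * J_h P \<omega> \<delta> dx \<alpha> \<beta> U (s, x)))"

definition CFL ::
  "('a, 'b, 'n::finite, 'm::finite) isaacs \<Rightarrow> (int^'n \<Rightarrow> real^'n \<Rightarrow> real) \<Rightarrow> real \<Rightarrow> real \<Rightarrow> real \<Rightarrow>
    real \<Rightarrow> real \<Rightarrow> nat \<Rightarrow> bool" where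
  "CFL P \<omega> \<delta> \<theta> \<theta>' dt dx MT \<longleftrightarrow>
     (\<forall>\<alpha>\<in>ctrlA P. \<forall>\<beta>\<in>ctrlB P. \<forall>i. \<forall>n\<in>{1..MT}.
        dt * ((1 - \<theta>) * (\<Sum>\<^sub>\<infinity>j\<in>- {0}. d_coeff P \<delta> dx \<alpha> \<beta> (tm dt (n - 1), lat dx i) j) +
              (1 - \<theta>') * (\<Sum>\<^sub>\<infinity>j\<in>- {0}. kap P \<omega> \<delta> \<alpha> \<beta> (tm dt (n - 1), lat dx i) j) +
              zeroth P \<alpha> \<beta> (tm dt n, lat dx i)) \<le> 1)"

end

theory Submission
  imports Defs
begin

text \<open>The argument doubles variables between the solution of the scheme on the grid and the viscosity
  solution. With \<open>s = \<plusminus>1\<close> one maximises, over grid points \<open>(t\<^sub>n, x\<^sub>j)\<close> and \<open>(t, y)\<close>,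
  \<open>s U(t\<^sub>n, x\<^sub>j) - s u(t, y) - exp(\<lambda>t) (|x\<^sub>j - y|\<^sup>2/\<epsilon> + (t\<^sub>n - t)\<^sup>2/\<epsilon>') - E t - \<gamma> (1 + |y|\<^sup>2)\<^sup>1\<^sup>/\<^sup>2\<close>.
  The factor \<open>exp(\<lambda>t)\<close> absorbs the Lipschitz errors of the coefficients, which are of the size of the
  penalty itself, so no regularity of \<open>u\<close> beyond continuity is used. If \<open>E\<close> dominates the consistency
  errors, the monotonicity of the scheme and the viscosity inequality exclude a positive interior
  maximum. Near the initial time both solutions are compared with barriers built from
  \<open>(r\<^sup>2 + |x - y|\<^sup>2)\<^sup>1\<^sup>/\<^sup>2\<close>, which costs \<open>r + t \<integral> min(|\<eta>|\<^sup>2/r, |\<eta>|) d\<nu>\<close>; a splitting into dyadic shells bounds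
  this integral through the density bound on \<open>\<nu>\<close>. Choosing \<open>\<epsilon>\<close>, \<open>\<epsilon>'\<close> and \<open>r\<close> gives the rates.\<close>

text \<open>The obstacle is the compensator. The upwind operator carries the drift
  \<open>b_tilde\<close>, whose jump part may be as large as
  \<open>hscale \<sigma> \<delta>\<close>; for \<sigma> \<ge> 1 this blows up as \<delta> tends to
  0, and its product with the gradient 2 (x - y) / \<epsilon> of the penalty could not be afforded.
  It has to cancel against the first order part of the interpolated jump operator. With \<theta>
  \<noteq> \<theta>' the two operators sit at different mixtures of the levels n - 1 and n, so a
  defect \<open>hscale \<sigma> \<delta> * dt\<close> times the gradient survives. Played against
  the penalty, it becomes (\<open>hscale \<sigma> \<delta> * dt\<close>)^2 / \<epsilon>. The Hessian
  1 / \<epsilon> also multiplies the upwind error \<open>hscale \<sigma> \<delta> * dx\<close>, the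
  interpolation error \<delta>^(-\<sigma>) dx^2 and the price \<delta>^(2 - \<sigma>) of the jumps
  that the scheme drops. Optimising \<epsilon> gives the square root of the sum of these four.

  One number A \<ge> 1 bounds all data, including T; this makes the Gronwall factor exp(\<lambda> T)
  a constant, and the bound T0 on T enters the final constant through it. Bounds for U and u given
  only qualitatively serve to find maximum points and to keep infima and suprema finite; the
  quantitative bound on u comes from its barrier.\<close>

section \<open>Moments of the Levy measure\<close>

text \<open>Up to constants, \<open>hscale \<sigma> r\<close> bounds the first moment of \<open>\<nu>\<close> outside the ball of radius \<open>r\<close> and
  \<open>\<integral> min(|z|\<^sup>2/r, |z|) d\<nu>\<close>.\<close>

definition hscale :: "real \<Rightarrow> real \<Rightarrow> real" where
  "hscale \<sigma> r = (if \<sigma> < 1 then 1 else if \<sigma> = 1 then 1 + max 0 (- ln r) else 1 + r powr (1 - \<sigma>))"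

lemma hscale_ge1: "1 \<le> hscale \<sigma> r"
  by (simp add: hscale_def)

lemma hscale_antimono:
  assumes "0 < r" "r \<le> s"
  shows "hscale \<sigma> s \<le> hscale \<sigma> r"
proof -
  have "s powr (1 - \<sigma>) \<le> r powr (1 - \<sigma>)" if "1 < \<sigma>"
    using assms that by (intro powr_mono2') auto
  moreover have "ln r \<le> ln s" using assms by simp
  ultimately show ?thesis by (auto simp: hscale_def)
qed

lemma powr_le_hscale:
  assumes "0 < r" "r \<le> 1"
  shows "r powr (1 - \<sigma>) \<le> hscale \<sigma> r"
  using powr_le1[of "1 - \<sigma>" r] assms by (auto simp: hscale_def)

definition is_levy :: "(real^'m) measure \<Rightarrow> bool" where
  "is_levy \<nu> \<longleftrightarrow> sets \<nu> = sets (restrict_space borel (- {0}))"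

lemma space_levy: "is_levy \<nu> \<Longrightarrow> space \<nu> = - {0}"
  using sets_eq_imp_space_eq[of \<nu> "restrict_space borel (-{0})"]
  by (simp add: is_levy_def space_restrict_space)

lemma borel_measurable_levy_continuous:
  assumes "is_levy (\<nu> :: (real^'m) measure)" "continuous_on (- {0}) f"
  shows "f \<in> borel_measurable \<nu>"
proof -
  have "f \<in> borel_measurable (restrict_space borel (-{0}))"
    using assms(2) by (intro borel_measurable_continuous_on_restrict)
  then show ?thesis using assms(1) measurable_cong_sets[of \<nu> "restrict_space borel (-{0})" borel borel]
    by (auto simp: is_levy_def)
qed

lemma norm_measurable_levy [measurable]:
  "is_levy (\<nu> :: (real^'m) measure) \<Longrightarrow> norm \<in> borel_measurable \<nu>"
  by (intro borel_measurable_levy_continuous continuous_intros)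

section \<open>Dyadic shells and the density bound\<close>

lemma ex_dyadic_below:
  fixes r x :: real
  assumes "0 < r" "0 < x" "x < 2 * r"
  shows "\<exists>k::nat. r / 2^k \<le> x \<and> x < 2 * (r / 2^k)"
proof -
  obtain n where "r / x < 2 ^ n" using real_arch_pow[of 2 "r / x"] by auto
  then have ex: "r \<le> 2 ^ n * x" using assms by (simp add: field_simps)
  define k where "k = (LEAST k. r \<le> 2 ^ k * x)"
  have 1: "r \<le> 2 ^ k * x" unfolding k_def by (rule LeastI[of _ n]) (rule ex)
  have "x < 2 * (r / 2^k)"
  proof (cases k)
    case (Suc l)
    have "\<not> r \<le> 2 ^ l * x" using not_less_Least[of l "\<lambda>k. r \<le> 2 ^ k * x"] Suc unfolding k_def by simp
    then show ?thesis using Suc by (simp add: field_simps)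
  qed (use assms in simp)
  with 1 show ?thesis by (intro exI[of _ k]) (simp add: field_simps)
qed

lemma ex_dyadic_above:
  fixes r x :: real
  assumes "0 < r" "r \<le> x"
  shows "\<exists>k::nat. r * 2^k \<le> x \<and> x < 2 * (r * 2^k)"
proof -
  obtain n where "x / r < 2 ^ n" using real_arch_pow[of 2 "x / r"] by auto
  then have ex: "x < 2 * (r * 2 ^ n)" using assms by (simp add: field_simps)
  define k where "k = (LEAST k. x < 2 * (r * 2 ^ k))"
  have 1: "x < 2 * (r * 2 ^ k)" unfolding k_def by (rule LeastI[of _ n]) (rule ex)
  have "r * 2 ^ k \<le> x"
  proof (cases k)
    case (Suc l)
    have "\<not> x < 2 * (r * 2 ^ l)" using not_less_Least[of l "\<lambda>k. x < 2 * (r * 2 ^ k)"] Suc unfolding k_def by simp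
    then show ?thesis using Suc by simp
  qed (use assms in simp)
  with 1 show ?thesis by (intro exI[of _ k]) simp
qed

text \<open>The clause \<open>norm z < 1\<close> confines the shell to the region where (A5) gives a
  density, so that a dyadic annulus may overhang the unit ball.\<close>

definition shell :: "real \<Rightarrow> (real^'m) set" where
  "shell s = {z. norm z < 1 \<and> s \<le> norm z \<and> norm z < 2 * s}"

lemma shell_borel [measurable]: "shell s \<in> sets borel"
  unfolding shell_def by measurable

definition shell_const :: "'m itself \<Rightarrow> real \<Rightarrow> real" where
  "shell_const TYPE('m) C = C * unit_ball_vol (real CARD('m)) * 2 ^ CARD('m)"

text \<open>On the shell the density is at most C s^(-m-\<sigma>), and the shell lies in a ball of
  radius 2 s, whose volume is of order s^m. The factor 2^m in \<open>shell_const\<close> comes from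
  this ball.\<close>

lemma emeasure_shell:
  fixes P :: "('a, 'b, 'n::finite, 'm::finite) isaacs"
  assumes A5: "A5 P \<sigma> C" and "C > 0" "0 < \<sigma>" "0 < s"
  shows "emeasure (levy P) (shell s) \<le> ennreal (shell_const TYPE('m) C * s powr (- \<sigma>))"
proof -
  obtain k where k: "k \<in> borel_measurable borel"
    "\<And>z. z \<noteq> 0 \<Longrightarrow> norm z < 1 \<Longrightarrow> 0 \<le> k z \<and> k z \<le> C * norm z powr (- real CARD('m) - \<sigma>)"
    "\<And>S. S\<in>sets borel \<Longrightarrow> S \<subseteq> {z. z \<noteq> 0 \<and> norm z < 1} \<Longrightarrow>
           emeasure (levy P) S = (\<integral>\<^sup>+z. ennreal (k z) * indicator S z \<partial>lborel)"
    using A5 unfolding A5_def by blast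
  let ?m = "real CARD('m)"
  have "emeasure (levy P) (shell s) = (\<integral>\<^sup>+z. ennreal (k z) * indicator (shell s) z \<partial>lborel)"
    using assms by (intro k(3)) (auto simp: shell_def)
  also have "\<dots> \<le> (\<integral>\<^sup>+(z::real^'m). ennreal (C * s powr (- ?m - \<sigma>)) * indicator (ball 0 (2 * s)) z \<partial>lborel)"
  proof (intro nn_integral_mono)
    fix z :: "real^'m"
    show "ennreal (k z) * indicator (shell s) z \<le> ennreal (C * s powr (- ?m - \<sigma>)) * indicator (ball 0 (2 * s)) z"
    proof (cases "z \<in> shell s")
      case True
      then have z: "z \<noteq> 0" "norm z < 1" "s \<le> norm z" "norm z < 2 * s" using assms by (auto simp: shell_def)
      have "k z \<le> C * norm z powr (- ?m - \<sigma>)" using k(2) z by blast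
      also have "\<dots> \<le> C * s powr (- ?m - \<sigma>)"
        using z assms by (intro mult_left_mono powr_mono2') auto
      finally show ?thesis using z by (auto simp: indicator_def intro: ennreal_leI)
    qed auto
  qed
  also have "\<dots> = ennreal (C * s powr (- ?m - \<sigma>)) * emeasure lborel (ball (0::real^'m) (2 * s))"
    by (simp add: nn_integral_cmult_indicator)
  also have "emeasure lborel (ball (0::real^'m) (2 * s)) = ennreal (unit_ball_vol ?m * (2 * s) ^ CARD('m))"
    using assms by (subst emeasure_ball) auto
  also have "ennreal (C * s powr (- ?m - \<sigma>)) * \<dots> = ennreal ((C * s powr (- ?m - \<sigma>)) * (unit_ball_vol ?m * (2 * s) ^ CARD('m)))"
    using assms by (simp add: ennreal_mult)
  also have "(C * s powr (- ?m - \<sigma>)) * (unit_ball_vol ?m * (2 * s) ^ CARD('m)) = shell_const TYPE('m) C * s powr (- \<sigma>)"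
  proof -
    have "s powr (- \<sigma>) = s powr (- ?m - \<sigma>) * s ^ CARD('m)"
      using assms by (simp add: powr_realpow[symmetric] powr_add[symmetric])
    then show ?thesis by (simp add: shell_const_def power_mult_distrib mult_ac)
  qed
  finally show ?thesis .
qed

lemma shell_const_nonneg: "C > 0 \<Longrightarrow> 0 \<le> shell_const TYPE('m::finite) C"
  by (simp add: shell_const_def)

text \<open>For each point a single shell that contains it, with g \<le> G there, is enough. The
  shells need not be disjoint, since further shells only enlarge the series.\<close>

lemma nn_integral_dyadic:
  fixes P :: "('a, 'b, 'n::finite, 'm::finite) isaacs"
  assumes lev: "is_levy (levy P)" and A5: "A5 P \<sigma> C" and C: "C > 0" "0 < \<sigma>"
    and s: "\<And>k::nat. 0 < s k" and G: "\<And>k. 0 \<le> G k"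
    and cover: "\<And>z. z \<in> D \<Longrightarrow> z \<noteq> 0 \<Longrightarrow> \<exists>k. z \<in> shell (s k) \<and> g z \<le> G k"
    and sums: "(\<lambda>k. G k * (s k) powr (- \<sigma>)) sums S"
  shows "(\<integral>\<^sup>+z. ennreal (g z) * indicator D z \<partial>levy P) \<le> ennreal (shell_const TYPE('m) C * S)"
proof -
  let ?c = "shell_const TYPE('m) C"
  have msets: "shell (s k) \<in> sets (levy P)" for k
  proof -
    have "0 \<notin> (shell (s k) :: (real^'m) set)" using s[of k] by (auto simp: shell_def)
    then show ?thesis using lev by (auto simp: is_levy_def sets_restrict_space image_iff intro!: bexI[of _ "shell (s k)"])
  qed
  have "(\<integral>\<^sup>+z. ennreal (g z) * indicator D z \<partial>levy P) \<le> (\<integral>\<^sup>+z. (\<Sum>k. ennreal (G k) * indicator (shell (s k)) z) \<partial>levy P)"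
  proof (intro nn_integral_mono)
    fix z assume z: "z \<in> space (levy P)"
    show "ennreal (g z) * indicator D z \<le> (\<Sum>k. ennreal (G k) * indicator (shell (s k)) z)"
    proof (cases "z \<in> D")
      case True
      then obtain k where k: "z \<in> shell (s k)" "g z \<le> G k" using cover z space_levy[OF lev] by auto
      have "ennreal (g z) * indicator D z \<le> ennreal (G k) * indicator (shell (s k)) z"
        using True k by (auto intro: ennreal_leI)
      also have "\<dots> = (\<Sum>i\<in>{k}. ennreal (G i) * indicator (shell (s i)) z)"
        by (subst sum.insert) auto
      also have "\<dots> \<le> (\<Sum>k. ennreal (G k) * indicator (shell (s k)) z)"
        by (intro sum_le_suminf) auto
      finally show ?thesis .
    qed simp
  qed
  also have "\<dots> = (\<Sum>k. \<integral>\<^sup>+z. ennreal (G k) * indicator (shell (s k)) z \<partial>levy P)"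
    using msets by (intro nn_integral_suminf) auto
  also have "\<dots> = (\<Sum>k. ennreal (G k) * emeasure (levy P) (shell (s k)))"
    using msets by (simp add: nn_integral_cmult_indicator)
  also have "\<dots> \<le> (\<Sum>k. ennreal (?c * (G k * (s k) powr (- \<sigma>))))"
  proof (intro suminf_le)
    fix k
    have "ennreal (G k) * emeasure (levy P) (shell (s k)) \<le> ennreal (G k) * ennreal (?c * s k powr (- \<sigma>))"
      using emeasure_shell[OF A5 C s] by (rule mult_left_mono) simp
    also have "\<dots> = ennreal (?c * (G k * (s k) powr (- \<sigma>)))"
      using G[of k] shell_const_nonneg[OF C(1), where 'm='m] by (simp add: ennreal_mult[symmetric] mult_ac)
    finally show "ennreal (G k) * emeasure (levy P) (shell (s k)) \<le> ennreal (?c * (G k * (s k) powr (- \<sigma>)))" .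
  qed auto
  also have "\<dots> = ennreal (?c * S)"
    using sums shell_const_nonneg[OF C(1), where 'm='m] G
    by (intro suminf_ennreal_eq sums_mult) auto
  finally show ?thesis .
qed

lemma geometric_sums_powr:
  fixes a b q :: real
  assumes "b < 1" "0 \<le> b"
  shows "(\<lambda>k. a * b ^ k) sums (a / (1 - b))"
  using sums_mult[OF geometric_sums, of b a] assms by simp

text \<open>The shell of radius r / 2^k contributes a multiple of (r / 2^k)^(2 - \<sigma>), and
  \<sigma> < 2 makes this a geometric series. The 4 is the square of the ratio of outer to inner
  radius.\<close>

lemma small_jumps_levy:
  fixes P :: "('a, 'b, 'n::finite, 'm::finite) isaacs"
  assumes lev: "is_levy (levy P)" and A5: "A5 P \<sigma> C" and C: "C > 0" "0 < \<sigma>" "\<sigma> < 2" and r: "0 < r"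
  shows "(\<integral>\<^sup>+z. ennreal ((norm z)\<^sup>2) * indicator {z. norm z < 1 \<and> norm z \<le> r} z \<partial>levy P)
    \<le> ennreal (shell_const TYPE('m) C * (4 / (1 - 2 powr (\<sigma> - 2))) * r powr (2 - \<sigma>))"
proof -
  have b: "2 powr (\<sigma> - 2) < (1::real)" using C by (simp add: powr_less_one)
  have "(2 * (r / 2 ^ k))\<^sup>2 * (r / 2 ^ k) powr (- \<sigma>) = (4 * r powr (2 - \<sigma>)) * (2 powr (\<sigma> - 2)) ^ k" for k :: nat
  proof -
    have "(2 * (r / 2 ^ k))\<^sup>2 * (r / 2 ^ k) powr (- \<sigma>) = 4 * ((r / 2 ^ k) powr 2 * (r / 2 ^ k) powr (- \<sigma>))"
      using r by (simp add: power_mult_distrib power_divide)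
    also have "\<dots> = 4 * (r / 2 ^ k) powr (2 - \<sigma>)" by (simp add: powr_add[symmetric])
    also have "(r / 2 ^ k) powr (2 - \<sigma>) = r powr (2 - \<sigma>) * (2 powr (- real k)) powr (2 - \<sigma>)"
      using r by (simp add: powr_mult[symmetric] powr_minus powr_realpow field_simps)
    also have "(2 powr (- real k)) powr (2 - \<sigma>) = (2 powr (\<sigma> - 2)) ^ k"
      by (simp add: powr_powr powr_realpow[symmetric] algebra_simps)
    finally show ?thesis by simp
  qed
  then have "(\<lambda>k. (2 * (r / 2 ^ k))\<^sup>2 * (r / 2 ^ k) powr (- \<sigma>)) sums (4 * r powr (2 - \<sigma>) / (1 - 2 powr (\<sigma> - 2)))"
    using geometric_sums_powr[OF b, of "4 * r powr (2 - \<sigma>)"] by simp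
  then have "(\<integral>\<^sup>+z. ennreal ((norm z)\<^sup>2) * indicator {z. norm z < 1 \<and> norm z \<le> r} z \<partial>levy P)
    \<le> ennreal (shell_const TYPE('m) C * (4 * r powr (2 - \<sigma>) / (1 - 2 powr (\<sigma> - 2))))"
  proof (rule nn_integral_dyadic[OF lev A5 C(1,2), rotated 3])
    fix z :: "real^'m" assume z: "z \<in> {z. norm z < 1 \<and> norm z \<le> r}" "z \<noteq> 0"
    obtain k :: nat where k: "r / 2^k \<le> norm z" "norm z < 2 * (r / 2^k)"
      using ex_dyadic_below[of r "norm z"] z r by auto
    then have "(norm z)\<^sup>2 \<le> (2 * (r / 2 ^ k))\<^sup>2" by (intro power_mono) auto
    then show "\<exists>k. z \<in> shell (r / 2 ^ k) \<and> (norm z)\<^sup>2 \<le> (2 * (r / 2 ^ k))\<^sup>2"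
      using k z by (auto simp: shell_def)
  qed (use r in auto)
  then show ?thesis by (simp add: mult_ac)
qed

text \<open>Here the shells grow outwards from r; their masses decay like 2^(-\<sigma> k), so the
  innermost one dominates.\<close>

lemma large_jumps_mass:
  fixes P :: "('a, 'b, 'n::finite, 'm::finite) isaacs"
  assumes lev: "is_levy (levy P)" and A5: "A5 P \<sigma> C" and C: "C > 0" "0 < \<sigma>" and r: "0 < r"
  shows "(\<integral>\<^sup>+z. ennreal 1 * indicator {z. norm z < 1 \<and> r < norm z} z \<partial>levy P)
    \<le> ennreal (shell_const TYPE('m) C * (1 / (1 - 2 powr (- \<sigma>))) * r powr (- \<sigma>))"
proof -
  have b: "2 powr (- \<sigma>) < (1::real)" using C by (simp add: powr_less_one)
  have "1 * (r * 2 ^ k) powr (- \<sigma>) = r powr (- \<sigma>) * (2 powr (- \<sigma>)) ^ k" for k :: nat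
    using r by (simp add: powr_mult powr_realpow[symmetric] powr_powr mult_ac)
  then have "(\<lambda>k. 1 * (r * 2 ^ k) powr (- \<sigma>)) sums (r powr (- \<sigma>) / (1 - 2 powr (- \<sigma>)))"
    using geometric_sums_powr[OF b, of "r powr (- \<sigma>)"] by simp
  then have "(\<integral>\<^sup>+z. ennreal 1 * indicator {z. norm z < 1 \<and> r < norm z} z \<partial>levy P)
    \<le> ennreal (shell_const TYPE('m) C * (r powr (- \<sigma>) / (1 - 2 powr (- \<sigma>))))"
  proof (rule nn_integral_dyadic[OF lev A5 C(1,2), rotated 3])
    fix z :: "real^'m" assume z: "z \<in> {z. norm z < 1 \<and> r < norm z}" "z \<noteq> 0"
    obtain k :: nat where k: "r * 2^k \<le> norm z" "norm z < 2 * (r * 2^k)"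
      using ex_dyadic_above[of r "norm z"] z r by auto
    then show "\<exists>k. z \<in> shell (r * 2 ^ k) \<and> (1::real) \<le> 1"
      using k z by (auto simp: shell_def)
  qed (use r in auto)
  then show ?thesis by (simp add: mult_ac)
qed

text \<open>For \<sigma> < 1 the shells next to the unit sphere dominate and the bound does not see
  r; for \<sigma> = 1 all shells contribute equally and their number is logarithmic in 1/r; for
  \<sigma> > 1 the shell at r dominates. One constant serves all regimes: at \<sigma> = 1 the
  quotient in it is 4 / 0 = 0, and the 6 takes care of that case.\<close>

lemma large_jumps_first_moment:
  fixes P :: "('a, 'b, 'n::finite, 'm::finite) isaacs"
  assumes lev: "is_levy (levy P)" and A5: "A5 P \<sigma> C" and C: "C > 0" "0 < \<sigma>" and r: "0 < r" "r \<le> 1"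
  shows "(\<integral>\<^sup>+z. ennreal (norm z) * indicator {z. norm z < 1 \<and> r < norm z} z \<partial>levy P)
    \<le> ennreal (shell_const TYPE('m) C * (6 + 4 / \<bar>1 - 2 powr (1 - \<sigma>)\<bar>) * hscale \<sigma> r)"
proof -
  let ?D = "{z :: real^'m. norm z < 1 \<and> r < norm z}"
  let ?I = "\<integral>\<^sup>+z. ennreal (norm z) * indicator ?D z \<partial>levy P"
  let ?c = "shell_const TYPE('m) C"
  have fin: "?thesis" if "S \<le> (6 + 4 / \<bar>1 - 2 powr (1 - \<sigma>)\<bar>) * hscale \<sigma> r" "?I \<le> ennreal (?c * S)" for S
  proof -
    have "?c * S \<le> ?c * ((6 + 4 / \<bar>1 - 2 powr (1 - \<sigma>)\<bar>) * hscale \<sigma> r)"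
      by (intro mult_left_mono that shell_const_nonneg C)
    then show ?thesis using order_trans[OF that(2) ennreal_leI] by (simp add: mult.assoc)
  qed
  consider "\<sigma> < 1" | "\<sigma> = 1" | "1 < \<sigma>" by linarith
  then show ?thesis
  proof cases
    case 1
    have b: "2 powr (\<sigma> - 1) < (1::real)" using 1 by (simp add: powr_less_one)
    have "(1 / 2 ^ k) * (1 / 2 / 2 ^ k) powr (- \<sigma>) = 2 powr \<sigma> * (2 powr (\<sigma> - 1)) ^ k" for k :: nat
    proof -
      have "(1 / 2 ^ k :: real) = 2 powr (- real k)" "(1 / 2 / 2 ^ k :: real) = 2 powr (- real k - 1)"
        by (simp_all add: powr_minus powr_diff powr_realpow field_simps)
      then show ?thesis by (simp add: powr_powr powr_add[symmetric] powr_realpow[symmetric] algebra_simps)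
    qed
    then have "(\<lambda>k. (1 / 2 ^ k) * (1 / 2 / 2 ^ k) powr (- \<sigma>)) sums (2 powr \<sigma> / (1 - 2 powr (\<sigma> - 1)))"
      using geometric_sums_powr[OF b, of "2 powr \<sigma>"] by simp
    then have "?I \<le> ennreal (?c * (2 powr \<sigma> / (1 - 2 powr (\<sigma> - 1))))"
    proof (rule nn_integral_dyadic[OF lev A5 C(1,2), rotated 3])
      fix z :: "real^'m" assume z: "z \<in> ?D" "z \<noteq> 0"
      obtain k :: nat where k: "1 / 2 / 2^k \<le> norm z" "norm z < 2 * (1 / 2 / 2^k)"
        using ex_dyadic_below[of "1/2" "norm z"] z r by auto
      then show "\<exists>k. z \<in> shell (1 / 2 / 2 ^ k) \<and> norm z \<le> 1 / 2 ^ k"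
        using k z by (intro exI[of _ k]) (auto simp: shell_def)
    qed (use r in auto)
    moreover have "2 powr \<sigma> / (1 - 2 powr (\<sigma> - 1)) \<le> (6 + 4 / \<bar>1 - 2 powr (1 - \<sigma>)\<bar>) * hscale \<sigma> r"
    proof -
      define q where "q = (2::real) powr (1 - \<sigma>)"
      have q: "1 < q" "q \<le> 2" using 1 C powr_mono[of "1-\<sigma>" 1 "2::real"] by (auto simp: q_def)
      have e: "2 powr \<sigma> = 2 / q" "2 powr (\<sigma> - 1) = 1 / q"
        by (simp_all add: q_def powr_diff)
      have "2 powr \<sigma> / (1 - 2 powr (\<sigma> - 1)) = 2 / (q - 1)"
        using q unfolding e by (simp add: field_simps)
      also have "\<dots> \<le> 4 / (q - 1)" using q by (intro divide_right_mono) auto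
      also have "\<dots> \<le> 6 + 4 / \<bar>1 - q\<bar>" using q by simp
      finally show ?thesis using 1 by (simp add: hscale_def q_def)
    qed
    ultimately show ?thesis by (rule fin[rotated])
  next
    case 2
    \<comment> \<open>The number of shells that meet the annulus: \<open>r * 2 ^ n\<close> lies
      between 1 and 2, so the shells with index at least n begin outside the unit ball and may be
      given weight 0.\<close>
    obtain n :: nat where n: "2 / r \<ge> 2 ^ n" "1 \<le> r * 2 ^ n"
    proof -
      obtain k :: nat where k: "1 * 2^k \<le> 2 / r" "2 / r < 2 * (1 * 2^k)"
        using ex_dyadic_above[of 1 "2/r"] r by auto
      then show ?thesis using r by (intro that[of k]) (auto simp: field_simps)
    qed
    have "2 * (r * 2 ^ k) * (r * 2 ^ k) powr (- \<sigma>) = 2" for k :: nat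
      using r 2 by (simp add: powr_minus_divide)
    then have "(\<lambda>k. (if k < n then 2 * (r * 2 ^ k) else 0) * (r * 2 ^ k) powr (- \<sigma>)) = (\<lambda>k. if k \<in> {..<n} then 2 else 0)"
      by auto
    moreover have "(\<lambda>k. if k \<in> {..<n} then 2 else 0 :: real) sums (\<Sum>k\<in>{..<n}. 2)"
      by (rule sums_If_finite_set) simp
    ultimately have "(\<lambda>k. (if k < n then 2 * (r * 2 ^ k) else 0) * (r * 2 ^ k) powr (- \<sigma>)) sums (2 * real n)"
      by (simp add: mult.commute)
    then have "?I \<le> ennreal (?c * (2 * real n))"
    proof (rule nn_integral_dyadic[OF lev A5 C(1,2), rotated 3])
      fix z :: "real^'m" assume z: "z \<in> ?D" "z \<noteq> 0"
      obtain k :: nat where k: "r * 2^k \<le> norm z" "norm z < 2 * (r * 2^k)"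
        using ex_dyadic_above[of r "norm z"] z r by auto
      have "r * 2 ^ k < r * 2 ^ n" using k z n by auto
      then have "k < n" using r by simp
      then show "\<exists>k. z \<in> shell (r * 2 ^ k) \<and> norm z \<le> (if k < n then 2 * (r * 2 ^ k) else 0)"
        using k z by (intro exI[of _ k]) (auto simp: shell_def)
    qed (use r in auto)
    moreover have "2 * real n \<le> (6 + 4 / \<bar>1 - 2 powr (1 - \<sigma>)\<bar>) * hscale \<sigma> r"
    proof -
      have "real n * ln 2 = ln (2 ^ n)" by (simp add: ln_realpow)
      also have "\<dots> \<le> ln (2 / r)" using n r by (subst ln_le_cancel_iff) auto
      also have "\<dots> = ln 2 - ln r" using r by (simp add: ln_div)
      finally have "real n * ln 2 \<le> ln 2 - ln r" .
      moreover have "real n * (1/2) \<le> real n * ln 2"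
        using ln_2_less_1 ln2_ge_two_thirds by (intro mult_left_mono) auto
      moreover have "ln r \<le> 0" using r by simp
      ultimately show ?thesis using 2 ln_2_less_1 by (simp add: hscale_def)
    qed
    ultimately show ?thesis by (rule fin[rotated])
  next
    case 3
    have b: "2 powr (1 - \<sigma>) < (1::real)" using 3 by (simp add: powr_less_one)
    have "(2 * (r * 2 ^ k)) * (r * 2 ^ k) powr (- \<sigma>) = (2 * r powr (1 - \<sigma>)) * (2 powr (1 - \<sigma>)) ^ k" for k :: nat
    proof -
      have "(r * 2 ^ k) * (r * 2 ^ k) powr (- \<sigma>) = (r * 2 ^ k) powr (1 - \<sigma>)"
        using r by (simp add: powr_diff powr_minus field_simps)
      also have "\<dots> = r powr (1 - \<sigma>) * (2 powr (1 - \<sigma>)) ^ k"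
        using r by (simp add: powr_mult powr_realpow[symmetric] powr_powr mult_ac)
      finally show ?thesis by simp
    qed
    then have "(\<lambda>k. (2 * (r * 2 ^ k)) * (r * 2 ^ k) powr (- \<sigma>)) sums (2 * r powr (1 - \<sigma>) / (1 - 2 powr (1 - \<sigma>)))"
      using geometric_sums_powr[OF b, of "2 * r powr (1 - \<sigma>)"] by (simp only: powr_ge_zero)
    then have "?I \<le> ennreal (?c * (2 * r powr (1 - \<sigma>) / (1 - 2 powr (1 - \<sigma>))))"
    proof (rule nn_integral_dyadic[OF lev A5 C(1,2), rotated 3])
      fix z :: "real^'m" assume z: "z \<in> ?D" "z \<noteq> 0"
      obtain k :: nat where k: "r * 2^k \<le> norm z" "norm z < 2 * (r * 2^k)"
        using ex_dyadic_above[of r "norm z"] z r by auto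
      then show "\<exists>k. z \<in> shell (r * 2 ^ k) \<and> norm z \<le> 2 * (r * 2 ^ k)"
        using k z by (intro exI[of _ k]) (auto simp: shell_def)
    qed (use r in auto)
    moreover have "2 * r powr (1 - \<sigma>) / (1 - 2 powr (1 - \<sigma>)) \<le> (6 + 4 / \<bar>1 - 2 powr (1 - \<sigma>)\<bar>) * hscale \<sigma> r"
    proof -
      have "2 * r powr (1 - \<sigma>) / (1 - 2 powr (1 - \<sigma>)) = (2 / \<bar>1 - 2 powr (1 - \<sigma>)\<bar>) * r powr (1 - \<sigma>)"
        using b by simp
      also have "\<dots> \<le> (6 + 4 / \<bar>1 - 2 powr (1 - \<sigma>)\<bar>) * hscale \<sigma> r"
      proof (intro mult_mono)
        have "2 / \<bar>1 - 2 powr (1 - \<sigma>)\<bar> \<le> 4 / \<bar>1 - 2 powr (1 - \<sigma>)\<bar>" by (intro divide_right_mono) auto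
        then show "2 / \<bar>1 - 2 powr (1 - \<sigma>)\<bar> \<le> 6 + 4 / \<bar>1 - 2 powr (1 - \<sigma>)\<bar>" by simp
      qed (use 3 in \<open>auto simp: hscale_def\<close>)
      finally show ?thesis .
    qed
    ultimately show ?thesis by (rule fin[rotated])
  qed
qed

section \<open>Moments of the majorant \<rho>\<close>

lemma integral_le_of_nn_integral:
  assumes "f \<in> borel_measurable M" "\<And>x. x \<in> space M \<Longrightarrow> 0 \<le> f x"
    "(\<integral>\<^sup>+x. ennreal (f x) \<partial>M) \<le> ennreal c" "0 \<le> c"
  shows "integrable M f" "integral\<^sup>L M f \<le> c"
proof -
  show i: "integrable M f"
    using assms by (intro integrableI_nonneg) (auto intro: le_less_trans)
  have "ennreal (integral\<^sup>L M f) = (\<integral>\<^sup>+x. ennreal (f x) \<partial>M)"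
    using i assms by (intro nn_integral_eq_integral[symmetric]) auto
  then show "integral\<^sup>L M f \<le> c" using assms by (metis ennreal_le_iff)
qed

text \<open>Everything is stated for \<rho>, which dominates the jumps, instead of |z|. The clauses
  serve, in this order: the Lipschitz dependence of the jumps on the base point, the small jumps
  missing in the scheme, the mass that multiplies the interpolation error, the compensator, and the
  barriers at the initial time.\<close>

definition levy_moments :: "real \<Rightarrow> real \<Rightarrow> (real^'m) measure \<Rightarrow> (real^'m \<Rightarrow> real) \<Rightarrow> bool" where
  "levy_moments A \<sigma> \<nu> \<rho> \<longleftrightarrow>
     integrable \<nu> (\<lambda>z. (\<rho> z)\<^sup>2) \<and> (LINT z|\<nu>. (\<rho> z)\<^sup>2) \<le> A \<and>
     (\<forall>r\<in>{0<..1}. (LINT z:{z. norm z \<le> r}|\<nu>. (\<rho> z)\<^sup>2) \<le> A * r powr (2 - \<sigma>)) \<and>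
     (\<forall>r\<in>{0<..1}. emeasure \<nu> {z \<in> space \<nu>. r < norm z} \<le> ennreal (A * r powr (- \<sigma>))) \<and>
     (\<forall>r\<in>{0<..1}. set_integrable \<nu> {z. r < norm z} \<rho> \<and> (LINT z:{z. r < norm z}|\<nu>. \<rho> z) \<le> A * hscale \<sigma> r) \<and>
     (\<forall>r>0. integrable \<nu> (\<lambda>z. min ((\<rho> z)\<^sup>2 / r) (2 * \<rho> z)) \<and>
        (LINT z|\<nu>. min ((\<rho> z)\<^sup>2 / r) (2 * \<rho> z)) \<le> A * hscale \<sigma> r)"

text \<open>All integrals are split at |z| = 1: inside, \<rho> \<le> K |z| reduces them to the
  dyadic bounds; outside, 1 \<le> \<rho> \<le> \<rho>^2 reduces them to (A4). The order of
  quantifiers makes A independent of the equation.\<close>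

lemma levy_moments_exist:
  fixes K \<Lambda> \<sigma> C :: real
  assumes K: "K > 0" and C: "C > 0" "0 < \<sigma>" "\<sigma> < 2"
  shows "\<exists>A\<ge>1. \<forall>(P :: ('a::metric_space, 'b::metric_space, 'n::finite, 'm::finite) isaacs) T \<rho>.
    A3 P T K \<rho> \<longrightarrow> A4 P \<rho> \<Lambda> \<longrightarrow> A5 P \<sigma> C \<longrightarrow> levy_moments A \<sigma> (levy P) \<rho>"
proof -
  \<comment> \<open>\<open>ennreal \<Lambda>\<close> is 0 for negative \<Lambda>; L is the
    nonnegative number with the same value.\<close>
  define L where "L = max \<Lambda> 0"
  define s where "s = shell_const TYPE('m) C"
  define q1 q2 q3 where "q1 = 4 / (1 - 2 powr (\<sigma> - 2))" and "q2 = 1 / (1 - 2 powr (- \<sigma>))" and "q3 = 6 + 4 / \<bar>1 - 2 powr (1 - \<sigma>)\<bar>"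
  \<comment> \<open>c1 bounds the total second moment, c2 the second moment near the origin, c3 and
    c4 the mass and the first moment away from it. The barrier integral combines c2 with twice c4
    because of the factor 2 in its minimum.\<close>
  define c1 where "c1 = (K\<^sup>2 + 1) * L"
  define c2 where "c2 = K\<^sup>2 * (s * q1) + c1"
  define c3 where "c3 = s * q2 + L"
  define c4 where "c4 = K * (s * q3) + L"
  define A where "A = 1 + c1 + c2 + c3 + (c2 + 2 * c4)"
  have "2 powr (\<sigma> - 2) < (1::real)" "2 powr (- \<sigma>) < (1::real)" using C by (simp_all add: powr_less_one)
  then have q: "0 \<le> q1" "0 \<le> q2" "0 \<le> q3" by (simp_all add: q1_def q2_def q3_def)
  have nn: "0 \<le> L" "0 \<le> s" "0 \<le> c1" "c1 \<le> c2" "0 \<le> c3" "0 \<le> c4"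
  proof -
    show Ls: "0 \<le> L" "0 \<le> s" using C by (auto simp: L_def s_def shell_const_nonneg)
    then show "0 \<le> c1" "0 \<le> c3" "0 \<le> c4" using K q
      unfolding c1_def c3_def c4_def by (intro add_nonneg_nonneg mult_nonneg_nonneg; simp)+
    show "c1 \<le> c2" unfolding c2_def using q(1) Ls by (intro add_increasing mult_nonneg_nonneg; simp)
  qed
  have cA: "1 \<le> A" "c1 \<le> A" "c2 \<le> A" "c3 \<le> A" "c4 \<le> A" "c2 + 2 * c4 \<le> A" using nn by (auto simp: A_def)
  have "levy_moments A \<sigma> (levy P) \<rho>"
    if A3: "A3 P T K \<rho>" and A4: "A4 P \<rho> \<Lambda>" and A5: "A5 P \<sigma> C" for P :: "('a, 'b, 'n, 'm) isaacs" and T \<rho>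
  proof -
    let ?\<nu> = "levy P"
    have lev: "is_levy ?\<nu>" using A4 by (simp add: A4_def is_levy_def)
    have [measurable]: "\<rho> \<in> borel_measurable ?\<nu>" using A4 by (simp add: A4_def)
    note [measurable] = norm_measurable_levy[OF lev]
    have sp: "z \<in> space ?\<nu> \<longleftrightarrow> z \<noteq> 0" for z using space_levy[OF lev] by auto
    have \<rho>0: "0 \<le> \<rho> z" if "z \<noteq> 0" for z using A3 that by (auto simp: A3_def)
    have \<rho>s: "\<rho> z \<le> K * norm z" if "z \<noteq> 0" "norm z < 1" for z using A3 that by (auto simp: A3_def)
    have \<rho>l: "1 \<le> \<rho> z \<and> \<rho> z \<le> (\<rho> z)\<^sup>2" if "1 \<le> norm z" for z
    proof -
      have "z \<in> - {0}" using that by auto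
      then show ?thesis using A3 that by (auto simp: A3_def)
    qed
    define NN where "NN = (\<lambda>f (D :: (real^'m) set). \<integral>\<^sup>+z. ennreal (f z) * indicator D z \<partial>?\<nu>)"
    \<comment> \<open>The splitting principle behind all five bounds: on D the integrand is
      dominated by a multiple of g on D1 or of h on D2. A coefficient 0 switches one of the two
      pieces off.\<close>
    have mono: "NN f D \<le> ennreal a * NN g D1 + ennreal b * NN h D2"
      if "\<And>z. z \<noteq> 0 \<Longrightarrow> z \<in> D \<Longrightarrow> z \<in> D1 \<and> f z \<le> a * g z \<or> z \<in> D2 \<and> f z \<le> b * h z" "0 \<le> a" "0 \<le> b"
        "g \<in> borel_measurable ?\<nu>" "h \<in> borel_measurable ?\<nu>"
        "D1 \<inter> space ?\<nu> \<in> sets ?\<nu>" "D2 \<inter> space ?\<nu> \<in> sets ?\<nu>"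
        "\<And>z. z \<noteq> 0 \<Longrightarrow> 0 \<le> g z" "\<And>z. z \<noteq> 0 \<Longrightarrow> 0 \<le> h z" for f g h a b D D1 D2
    proof -
      note [measurable] = that(4,5)
      have [measurable]: "(indicator D1 :: _ \<Rightarrow> ennreal) \<in> borel_measurable ?\<nu>" "(indicator D2 :: _ \<Rightarrow> ennreal) \<in> borel_measurable ?\<nu>"
        using that(6,7) by (simp_all add: borel_measurable_indicator_iff)
      have "NN f D \<le> (\<integral>\<^sup>+z. ennreal a * (ennreal (g z) * indicator D1 z) + ennreal b * (ennreal (h z) * indicator D2 z) \<partial>?\<nu>)"
        unfolding NN_def
      proof (intro nn_integral_mono)
        fix z assume "z \<in> space ?\<nu>"
        then have z: "z \<noteq> 0" using sp by auto
        show "ennreal (f z) * indicator D z \<le> ennreal a * (ennreal (g z) * indicator D1 z) + ennreal b * (ennreal (h z) * indicator D2 z)"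
        proof (cases "z \<in> D")
          case True
          from that(1)[OF z True] show ?thesis
          proof
            assume H: "z \<in> D1 \<and> f z \<le> a * g z"
            then have "ennreal (f z) \<le> ennreal a * ennreal (g z)"
              using that(2) that(8)[OF z] by (simp add: ennreal_mult[symmetric] ennreal_leI)
            then show ?thesis using True H by (auto intro: add_increasing2)
          next
            assume H: "z \<in> D2 \<and> f z \<le> b * h z"
            then have "ennreal (f z) \<le> ennreal b * ennreal (h z)"
              using that(3) that(9)[OF z] by (simp add: ennreal_mult[symmetric] ennreal_leI)
            then show ?thesis using True H by (auto intro: add_increasing)
          qed
        qed simp
      qed
      also have "\<dots> = ennreal a * NN g D1 + ennreal b * NN h D2"
        unfolding NN_def by (subst nn_integral_add) (auto simp: nn_integral_cmult)
      finally show ?thesis .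
    qed
    have comb: "ennreal a * x + ennreal b * y \<le> ennreal c"
      if "x \<le> ennreal x'" "y \<le> ennreal y'" "0 \<le> a" "0 \<le> b" "0 \<le> x'" "0 \<le> y'" "a * x' + b * y' \<le> c" for a b x' y' c :: real and x y
    proof -
      have "ennreal a * x + ennreal b * y \<le> ennreal a * ennreal x' + ennreal b * ennreal y'"
        using that by (intro add_mono mult_left_mono) auto
      also have "\<dots> = ennreal (a * x' + b * y')" using that by (simp add: ennreal_mult)
      also have "\<dots> \<le> ennreal c" using that by (intro ennreal_leI)
      finally show ?thesis .
    qed
    have sets: "{z. Q (norm z)} \<inter> space ?\<nu> \<in> sets ?\<nu>" if "{x. Q x} \<in> sets borel" for Q
      using measurable_sets[OF norm_measurable_levy[OF lev] that] by (simp add: vimage_def)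
    let ?S = "{z :: real^'m. norm z < 1}" and ?B = "{z :: real^'m. 1 \<le> norm z}"
    have SB: "?S \<inter> space ?\<nu> \<in> sets ?\<nu>" "?B \<inter> space ?\<nu> \<in> sets ?\<nu>"
      "\<And>r. {z. norm z < 1 \<and> norm z \<le> r} \<inter> space ?\<nu> \<in> sets ?\<nu>"
      "\<And>r. {z. norm z < 1 \<and> r < norm z} \<inter> space ?\<nu> \<in> sets ?\<nu>"
      "\<And>r. {z. norm z \<le> r} \<inter> space ?\<nu> \<in> sets ?\<nu>"
      "\<And>r. {z. r < norm z} \<inter> space ?\<nu> \<in> sets ?\<nu>"
      by (rule sets, measurable)+
    have "NN (\<lambda>z. (norm z)\<^sup>2) ?S + NN (\<lambda>z. (\<rho> z)\<^sup>2) ?B \<le> ennreal L"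
    proof -
      have "ennreal \<Lambda> = ennreal L" by (auto simp: L_def max_def ennreal_neg)
      then show ?thesis using A4 by (simp add: A4_def NN_def)
    qed
    then have N0: "NN (\<lambda>z. (norm z)\<^sup>2) ?S \<le> ennreal L" "NN (\<lambda>z. (\<rho> z)\<^sup>2) ?B \<le> ennreal L"
      by (auto intro: order_trans[rotated] add_increasing add_increasing2)
    have N1: "NN (\<lambda>z. (\<rho> z)\<^sup>2) UNIV \<le> ennreal c1"
    proof (rule order_trans[OF mono comb[OF N0]])
      fix z :: "real^'m" assume "z \<noteq> 0"
      have "(\<rho> z)\<^sup>2 \<le> (K * norm z)\<^sup>2" if "norm z < 1" using \<rho>0 \<rho>s \<open>z \<noteq> 0\<close> that by (intro power_mono) auto
      then show "z \<in> ?S \<and> (\<rho> z)\<^sup>2 \<le> K\<^sup>2 * (norm z)\<^sup>2 \<or> z \<in> ?B \<and> (\<rho> z)\<^sup>2 \<le> 1 * (\<rho> z)\<^sup>2"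
        by (cases "norm z < 1") (auto simp: power_mult_distrib)
    qed (use nn SB in \<open>auto simp: c1_def algebra_simps\<close>)
    have N2: "NN (\<lambda>z. (\<rho> z)\<^sup>2) {z. norm z \<le> r} \<le> ennreal (c2 * r powr (2 - \<sigma>))" if r: "0 < r" "r \<le> 1" for r
    proof (cases "r = 1")
      \<comment> \<open>The closed unit ball contains the unit sphere, where neither the density nor
        \<open>\<rho> z \<le> K * norm z\<close> is available; the total second moment takes over,
        and this is why c2 is defined to exceed c1.\<close>
      case True
      have "NN (\<lambda>z. (\<rho> z)\<^sup>2) {z. norm z \<le> r} \<le> NN (\<lambda>z. (\<rho> z)\<^sup>2) UNIV"
        unfolding NN_def by (intro nn_integral_mono) (auto simp: indicator_def)
      also have "\<dots> \<le> ennreal (c2 * r powr (2 - \<sigma>))"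
        using N1 nn True C by (intro order_trans[OF N1] ennreal_leI) auto
      finally show ?thesis .
    next
      case False
      have b: "NN (\<lambda>z. (norm z)\<^sup>2) {z. norm z < 1 \<and> norm z \<le> r} \<le> ennreal (s * q1 * r powr (2 - \<sigma>))"
        unfolding NN_def s_def q1_def by (rule small_jumps_levy[OF lev A5 C r(1)])
      have p: "0 \<le> s * q1"
        using nn q by (intro mult_nonneg_nonneg) auto
      show ?thesis
      proof (rule order_trans[OF mono comb[OF b N1]])
        fix z :: "real^'m" assume "z \<noteq> 0" "z \<in> {z. norm z \<le> r}"
        then have "(\<rho> z)\<^sup>2 \<le> (K * norm z)\<^sup>2" using \<rho>0 \<rho>s r False by (intro power_mono) auto
        then show "z \<in> {z. norm z < 1 \<and> norm z \<le> r} \<and> (\<rho> z)\<^sup>2 \<le> K\<^sup>2 * (norm z)\<^sup>2 \<or> z \<in> UNIV \<and> (\<rho> z)\<^sup>2 \<le> 0 * (\<rho> z)\<^sup>2"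
          using \<open>z \<in> _\<close> False r by (auto simp: power_mult_distrib)
      next
        show "K\<^sup>2 * (s * q1 * r powr (2 - \<sigma>)) + 0 * c1 \<le> c2 * r powr (2 - \<sigma>)"
          using nn by (simp add: c2_def algebra_simps)
      qed (use SB p r nn in \<open>auto\<close>)
    qed
    have N3: "NN (\<lambda>z. 1) {z. r < norm z} \<le> ennreal (c3 * r powr (- \<sigma>))" if r: "0 < r" "r \<le> 1" for r
    proof -
      have rr: "1 \<le> r powr (- \<sigma>)" using r C powr_mono2'[of "- \<sigma>" r 1] by simp
      have b: "NN (\<lambda>z. 1) {z. norm z < 1 \<and> r < norm z} \<le> ennreal (s * q2 * r powr (- \<sigma>))"
        unfolding NN_def s_def q2_def by (rule large_jumps_mass[OF lev A5 C(1,2) r(1)])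
      have p: "0 \<le> s * q2"
        using nn q by (intro mult_nonneg_nonneg) auto
      show ?thesis
      proof (rule order_trans[OF mono comb[OF b N0(2)]])
        fix z :: "real^'m" assume z: "z \<noteq> 0" "z \<in> {z. r < norm z}"
        have "1 \<le> (\<rho> z)\<^sup>2" if "1 \<le> norm z" using \<rho>l[OF that] by simp
        then show "z \<in> {z. norm z < 1 \<and> r < norm z} \<and> 1 \<le> 1 * (1::real) \<or> z \<in> ?B \<and> 1 \<le> 1 * (\<rho> z)\<^sup>2"
          using z by auto
      next
        have "L * 1 \<le> L * r powr (- \<sigma>)" using nn rr by (intro mult_left_mono) auto
        then show "1 * (s * q2 * r powr - \<sigma>) + 1 * L \<le> c3 * r powr - \<sigma>"
          using nn by (simp add: c3_def algebra_simps)
      qed (use SB p r nn in \<open>auto\<close>)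
    qed
    have N4: "NN \<rho> {z. r < norm z} \<le> ennreal (c4 * hscale \<sigma> r)" if r: "0 < r" "r \<le> 1" for r
    proof -
      have b: "NN norm {z. norm z < 1 \<and> r < norm z} \<le> ennreal (s * q3 * hscale \<sigma> r)"
        unfolding NN_def s_def q3_def by (rule large_jumps_first_moment[OF lev A5 C(1,2) r])
      have p: "0 \<le> s * q3 * hscale \<sigma> r"
        using nn q hscale_ge1[of \<sigma> r] by (intro mult_nonneg_nonneg) auto
      show ?thesis
      proof (rule order_trans[OF mono comb[OF b N0(2)]])
        fix z :: "real^'m" assume z: "z \<noteq> 0" "z \<in> {z. r < norm z}"
        then show "z \<in> {z. norm z < 1 \<and> r < norm z} \<and> \<rho> z \<le> K * norm z \<or> z \<in> ?B \<and> \<rho> z \<le> 1 * (\<rho> z)\<^sup>2"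
          using z \<rho>s \<rho>l by (cases "norm z < 1") auto
      next
        have "L * 1 \<le> L * hscale \<sigma> r" using nn hscale_ge1 by (intro mult_left_mono) auto
        then show "K * (s * q3 * hscale \<sigma> r) + 1 * L \<le> c4 * hscale \<sigma> r"
          by (simp add: c4_def algebra_simps)
      qed (use SB \<rho>0 p r nn K in \<open>auto\<close>)
    qed
    \<comment> \<open>For r \<le> 1 the quadratic entry of the minimum is used inside |z| = r, where
      it gives r^(1 - \<sigma>), and the linear entry outside. For larger r the total second moment
      suffices.\<close>
    have N5: "NN (\<lambda>z. min ((\<rho> z)\<^sup>2 / r) (2 * \<rho> z)) UNIV \<le> ennreal ((c2 + 2 * c4) * hscale \<sigma> r)" if r: "0 < r" for r
    proof (cases "r \<le> 1")
      case True
      have c20: "0 \<le> c2 * r powr (2 - \<sigma>)" "0 \<le> c4 * hscale \<sigma> r"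
        using nn hscale_ge1[of \<sigma> r] by (auto intro: mult_nonneg_nonneg)
      show ?thesis
      proof (rule order_trans[OF mono comb[OF N2[OF r True] N4[OF r True]]])
        fix z :: "real^'m" assume z: "z \<noteq> 0"
        show "z \<in> {z. norm z \<le> r} \<and> min ((\<rho> z)\<^sup>2 / r) (2 * \<rho> z) \<le> (1 / r) * (\<rho> z)\<^sup>2 \<or>
           z \<in> {z. r < norm z} \<and> min ((\<rho> z)\<^sup>2 / r) (2 * \<rho> z) \<le> 2 * \<rho> z"
          by auto
      next
        have "(1 / r) * (c2 * r powr (2 - \<sigma>)) = c2 * r powr (1 - \<sigma>)"
          using r by (simp add: powr_diff power2_eq_square)
        also have "\<dots> \<le> c2 * hscale \<sigma> r" using nn r True by (intro mult_left_mono powr_le_hscale) auto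
        finally show "(1 / r) * (c2 * r powr (2 - \<sigma>)) + 2 * (c4 * hscale \<sigma> r) \<le> (c2 + 2 * c4) * hscale \<sigma> r"
          by (simp add: algebra_simps)
      qed (use SB \<rho>0 r c20 in \<open>auto\<close>)
    next
      case False
      show ?thesis
      proof (rule order_trans[OF mono comb[OF N1 N1]])
        fix z :: "real^'m" assume z: "z \<noteq> 0"
        have "(\<rho> z)\<^sup>2 / r \<le> (\<rho> z)\<^sup>2" using False by (simp add: divide_le_eq mult_le_cancel_left1)
        then show "z \<in> UNIV \<and> min ((\<rho> z)\<^sup>2 / r) (2 * \<rho> z) \<le> 1 * (\<rho> z)\<^sup>2 \<or>
           z \<in> UNIV \<and> min ((\<rho> z)\<^sup>2 / r) (2 * \<rho> z) \<le> 0 * (\<rho> z)\<^sup>2"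
          by auto
      next
        have "c1 * 1 \<le> (c2 + 2 * c4) * hscale \<sigma> r"
          using nn hscale_ge1 by (intro mult_mono) auto
        then show "1 * c1 + 0 * c1 \<le> (c2 + 2 * c4) * hscale \<sigma> r" by simp
      qed (use nn in auto)
    qed
    have Ah: "c * x \<le> A * x" "0 \<le> A * x" if "c \<le> A" "0 \<le> x" for c x
      using that cA by (auto intro: mult_right_mono)
    have ind: "(\<integral>\<^sup>+z. ennreal (indicator D z *\<^sub>R f z) \<partial>?\<nu>) = NN f D" for f D
      unfolding NN_def by (intro nn_integral_cong) (auto simp: indicator_def)
    have UN: "NN f UNIV = (\<integral>\<^sup>+z. ennreal (f z) \<partial>?\<nu>)" for f by (simp add: NN_def)
    have r1: "integrable ?\<nu> (\<lambda>z. (\<rho> z)\<^sup>2)" "(LINT z|?\<nu>. (\<rho> z)\<^sup>2) \<le> A"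
      using integral_le_of_nn_integral[of "\<lambda>z. (\<rho> z)\<^sup>2" ?\<nu> c1] N1 nn cA unfolding UN by auto
    have r2: "(LINT z:{z. norm z \<le> r}|?\<nu>. (\<rho> z)\<^sup>2) \<le> A * r powr (2 - \<sigma>)" if "r \<in> {0<..1}" for r
    proof -
      have "(LINT z:{z. norm z \<le> r}|?\<nu>. (\<rho> z)\<^sup>2) \<le> c2 * r powr (2 - \<sigma>)"
        unfolding set_lebesgue_integral_def
      proof (rule integral_le_of_nn_integral(2))
        show "(\<integral>\<^sup>+z. ennreal (indicator {z. norm z \<le> r} z *\<^sub>R (\<rho> z)\<^sup>2) \<partial>?\<nu>) \<le> ennreal (c2 * r powr (2 - \<sigma>))"
          unfolding ind using that by (intro N2) auto
      qed (use nn in \<open>auto intro!: mult_nonneg_nonneg\<close>)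
      also have "\<dots> \<le> A * r powr (2 - \<sigma>)" by (intro Ah cA) simp
      finally show ?thesis .
    qed
    have r3: "emeasure ?\<nu> {z \<in> space ?\<nu>. r < norm z} \<le> ennreal (A * r powr (- \<sigma>))" if "r \<in> {0<..1}" for r
    proof -
      have "emeasure ?\<nu> {z \<in> space ?\<nu>. r < norm z} = (\<integral>\<^sup>+z. indicator {z \<in> space ?\<nu>. r < norm z} z \<partial>?\<nu>)"
        by simp
      also have "\<dots> = NN (\<lambda>z. 1) {z. r < norm z}" unfolding NN_def by (intro nn_integral_cong) (auto simp: indicator_def)
      also have "\<dots> \<le> ennreal (c3 * r powr (- \<sigma>))" using that by (intro N3) auto
      also have "\<dots> \<le> ennreal (A * r powr (- \<sigma>))" by (intro ennreal_leI Ah cA) simp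
      finally show ?thesis .
    qed
    have r4: "set_integrable ?\<nu> {z. r < norm z} \<rho> \<and> (LINT z:{z. r < norm z}|?\<nu>. \<rho> z) \<le> A * hscale \<sigma> r" if r: "r \<in> {0<..1}" for r
    proof -
      have "0 \<le> hscale \<sigma> r" using hscale_ge1[of \<sigma> r] by simp
      moreover have "(\<integral>\<^sup>+z. ennreal (indicator {z. r < norm z} z *\<^sub>R \<rho> z) \<partial>?\<nu>) \<le> ennreal (c4 * hscale \<sigma> r)"
          unfolding ind using r by (intro N4) auto
      ultimately show ?thesis
        unfolding set_lebesgue_integral_def set_integrable_def
        using integral_le_of_nn_integral[of "\<lambda>z. indicator {z. r < norm z} z *\<^sub>R \<rho> z" ?\<nu> "c4 * hscale \<sigma> r"] nn \<rho>0
         Ah(1)[OF cA(5), of "hscale \<sigma> r"]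
        by (auto simp: sp)
    qed
    have r5: "integrable ?\<nu> (\<lambda>z. min ((\<rho> z)\<^sup>2 / r) (2 * \<rho> z)) \<and>
        (LINT z|?\<nu>. min ((\<rho> z)\<^sup>2 / r) (2 * \<rho> z)) \<le> A * hscale \<sigma> r" if r: "r > 0" for r
    proof -
      have "0 \<le> hscale \<sigma> r" using hscale_ge1[of \<sigma> r] by simp
      then show ?thesis
        using integral_le_of_nn_integral[of "\<lambda>z. min ((\<rho> z)\<^sup>2 / r) (2 * \<rho> z)" ?\<nu> "(c2 + 2 * c4) * hscale \<sigma> r"] nn \<rho>0 N5[OF r]
         Ah(1)[OF cA(6), of "hscale \<sigma> r"] r unfolding UN
        by (auto simp: sp)
    qed
    show ?thesis unfolding levy_moments_def using r1 r2 r3 r4 r5 by blast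
  qed
  then show ?thesis using cA(1) by blast
qed

section \<open>Test functions\<close>

text \<open>Viscosity inequalities see a test function only through its values and gradient. Hiding
  the Hessian allows sums and products of test functions to be formed without carrying it
  along.\<close>

definition C2_grad :: "'v::euclidean_space set \<Rightarrow> ('v \<Rightarrow> real) \<Rightarrow> ('v \<Rightarrow> 'v) \<Rightarrow> bool" where
  "C2_grad S \<phi> g \<longleftrightarrow> (\<exists>H. C2_on S \<phi> g H)"

lemma C2_on_continuous:
  assumes "C2_on S \<phi> g H"
  shows "continuous_on S \<phi>" "continuous_on S g" "continuous_on S H"
  using assms unfolding C2_on_def by (auto intro!: has_derivative_continuous_on)

text \<open>The rank-one operator that appears in the Hessians of products and of
  \<open>soft_norm\<close>.\<close>

definition outer :: "'v::euclidean_space \<Rightarrow> 'v \<Rightarrow> 'v \<Rightarrow>\<^sub>L 'v" where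
  "outer a b = blinfun_scaleR_left a o\<^sub>L blinfun_inner_left b"

lemma outer_apply [simp]: "blinfun_apply (outer a b) v = (b \<bullet> v) *\<^sub>R a"
  by (simp add: outer_def blinfun_inner_left.rep_eq blinfun_scaleR_left.rep_eq inner_commute)

lemma norm_outer: "norm (outer a b) \<le> norm a * norm b"
proof (rule norm_blinfun_bound)
  fix v show "norm (blinfun_apply (outer a b) v) \<le> norm a * norm b * norm v"
    using mult_left_mono[OF Cauchy_Schwarz_ineq2[of b v], of "norm a"] by (simp add: mult_ac)
qed simp

lemma continuous_on_outer:
  fixes a b :: "'w::topological_space \<Rightarrow> 'v::euclidean_space"
  assumes "continuous_on S a" "continuous_on S b"
  shows "continuous_on S (\<lambda>x. outer (a x) (b x))"
  unfolding outer_def using assms by (intro continuous_intros)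

lemma C2_grad_const: "C2_grad S (\<lambda>_. c) (\<lambda>_. 0)"
  unfolding C2_grad_def C2_on_def by (intro exI[of _ "\<lambda>_. 0"]) (auto intro!: derivative_eq_intros)

lemma C2_grad_add:
  assumes "C2_grad S f1 g1" "C2_grad S f2 g2"
  shows "C2_grad S (\<lambda>p. f1 p + f2 p) (\<lambda>p. g1 p + g2 p)"
proof -
  obtain H1 H2 where "C2_on S f1 g1 H1" "C2_on S f2 g2 H2" using assms by (auto simp: C2_grad_def)
  then have "C2_on S (\<lambda>p. f1 p + f2 p) (\<lambda>p. g1 p + g2 p) (\<lambda>p. H1 p + H2 p)"
    unfolding C2_on_def by (auto intro!: derivative_eq_intros continuous_intros simp: inner_add_left blinfun.add_left)
  then show ?thesis by (auto simp: C2_grad_def)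
qed

lemma C2_grad_mult:
  assumes "C2_grad S f1 g1" "C2_grad S f2 g2"
  shows "C2_grad S (\<lambda>p. f1 p * f2 p) (\<lambda>p. f1 p *\<^sub>R g2 p + f2 p *\<^sub>R g1 p)"
proof -
  obtain H1 H2 where H: "C2_on S f1 g1 H1" "C2_on S f2 g2 H2" using assms by (auto simp: C2_grad_def)
  note c = C2_on_continuous[OF H(1)] C2_on_continuous[OF H(2)]
  have "C2_on S (\<lambda>p. f1 p * f2 p) (\<lambda>p. f1 p *\<^sub>R g2 p + f2 p *\<^sub>R g1 p)
     (\<lambda>p. (f1 p *\<^sub>R H2 p + outer (g2 p) (g1 p)) + (f2 p *\<^sub>R H1 p + outer (g1 p) (g2 p)))"
    unfolding C2_on_def
  proof (intro conjI ballI)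
    show "continuous_on S (\<lambda>p. (f1 p *\<^sub>R H2 p + outer (g2 p) (g1 p)) + (f2 p *\<^sub>R H1 p + outer (g1 p) (g2 p)))"
      by (intro continuous_intros continuous_on_outer c)
  next
    fix p assume "p \<in> S"
    then have d: "(f1 has_derivative (\<lambda>v. g1 p \<bullet> v)) (at p within S)" "(f2 has_derivative (\<lambda>v. g2 p \<bullet> v)) (at p within S)"
      "(g1 has_derivative blinfun_apply (H1 p)) (at p within S)" "(g2 has_derivative blinfun_apply (H2 p)) (at p within S)"
      using H by (auto simp: C2_on_def)
    show "((\<lambda>p. f1 p * f2 p) has_derivative (\<bullet>) (f1 p *\<^sub>R g2 p + f2 p *\<^sub>R g1 p)) (at p within S)"
      by (rule has_derivative_eq_rhs[OF has_derivative_mult[OF d(1,2)]]) (auto simp: inner_add_left)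
    show "((\<lambda>p. f1 p *\<^sub>R g2 p + f2 p *\<^sub>R g1 p) has_derivative
          blinfun_apply ((f1 p *\<^sub>R H2 p + outer (g2 p) (g1 p)) + (f2 p *\<^sub>R H1 p + outer (g1 p) (g2 p)))) (at p within S)"
      by (rule has_derivative_eq_rhs[OF has_derivative_add[OF has_derivative_scaleR[OF d(1,4)] has_derivative_scaleR[OF d(2,3)]]])
        (auto simp: blinfun.add_left blinfun.scaleR_left)
  qed
  then show ?thesis by (auto simp: C2_grad_def)
qed

lemma C2_grad_cmult:
  assumes "C2_grad S f g" shows "C2_grad S (\<lambda>p. c * f p) (\<lambda>p. c *\<^sub>R g p)"
  using C2_grad_mult[OF C2_grad_const[of S c] assms] by simp

text \<open>Embeddings and projections as bounded linear operators, from which the Hessians of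
  functions of time alone or of space alone are assembled.\<close>

definition fst_embed :: "real \<Rightarrow>\<^sub>L (real \<times> 'v::euclidean_space)" where
  "fst_embed = Blinfun (\<lambda>t. (t, 0))"

definition snd_embed :: "'v::euclidean_space \<Rightarrow>\<^sub>L (real \<times> 'v)" where
  "snd_embed = Blinfun (\<lambda>y. (0, y))"

definition fst_blin :: "(real \<times> 'v::euclidean_space) \<Rightarrow>\<^sub>L real" where
  "fst_blin = Blinfun fst"

definition snd_blin :: "(real \<times> 'v::euclidean_space) \<Rightarrow>\<^sub>L 'v" where
  "snd_blin = Blinfun snd"

lemma blin_apply [simp]:
  "blinfun_apply fst_embed t = (t, 0)" "blinfun_apply snd_embed y = (0, y)"
  "blinfun_apply fst_blin p = fst p" "blinfun_apply snd_blin p = snd p"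
  unfolding fst_embed_def snd_embed_def fst_blin_def snd_blin_def
  by (subst bounded_linear_Blinfun_apply; auto intro!: bounded_linear_Pair bounded_linear_zero bounded_linear_ident bounded_linear_fst bounded_linear_snd)+

lemma C2_grad_time:
  fixes \<tau> :: "real \<Rightarrow> real"
  assumes "\<And>s. (\<tau> has_real_derivative \<tau>' s) (at s)" "\<And>s. (\<tau>' has_real_derivative \<tau>'' s) (at s)" "continuous_on UNIV \<tau>''"
  shows "C2_grad (S :: (real \<times> 'v::euclidean_space) set) (\<lambda>p. \<tau> (fst p)) (\<lambda>p. (\<tau>' (fst p), 0))"
proof -
  have "C2_on S (\<lambda>p. \<tau> (fst p)) (\<lambda>p. (\<tau>' (fst p), 0 :: 'v)) (\<lambda>p. \<tau>'' (fst p) *\<^sub>R (fst_embed o\<^sub>L fst_blin))"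
    unfolding C2_on_def
  proof (intro conjI ballI)
    fix p :: "real \<times> 'v"
    have c: "((\<lambda>p. f (fst p)) has_derivative (\<lambda>v. f' * fst v)) (at p within S)" if "(f has_real_derivative f') (at (fst p))" for f f'
      using has_derivative_compose[OF has_derivative_fst[OF has_derivative_ident] that[unfolded has_field_derivative_def]] by simp
    show "((\<lambda>p. \<tau> (fst p)) has_derivative (\<bullet>) (\<tau>' (fst p), 0)) (at p within S)"
      by (rule has_derivative_eq_rhs[OF c[OF assms(1)]]) (auto simp: fun_eq_iff)
    show "((\<lambda>p. (\<tau>' (fst p), 0)) has_derivative blinfun_apply (\<tau>'' (fst p) *\<^sub>R (fst_embed o\<^sub>L fst_blin))) (at p within S)"
      by (rule has_derivative_eq_rhs[OF has_derivative_Pair[OF c[OF assms(2)] has_derivative_const]]) (auto simp: fun_eq_iff blinfun.scaleR_left)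
  next
    show "continuous_on S (\<lambda>p. \<tau>'' (fst p) *\<^sub>R (fst_embed o\<^sub>L fst_blin))"
      by (intro continuous_intros continuous_on_compose2[OF assms(3)]) auto
  qed
  then show ?thesis by (auto simp: C2_grad_def)
qed

lemma C2_grad_space:
  assumes "C2_grad UNIV f g"
  shows "C2_grad (S :: (real \<times> 'v::euclidean_space) set) (\<lambda>p. f (snd p)) (\<lambda>p. (0, g (snd p)))"
proof -
  obtain H where H: "C2_on UNIV f g H" using assms by (auto simp: C2_grad_def)
  have "C2_on S (\<lambda>p. f (snd p)) (\<lambda>p. (0, g (snd p))) (\<lambda>p. snd_embed o\<^sub>L (H (snd p) o\<^sub>L snd_blin))"
    unfolding C2_on_def
  proof (intro conjI ballI)
    fix p :: "real \<times> 'v"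
    have d: "(f has_derivative (\<lambda>v. g (snd p) \<bullet> v)) (at (snd p))" "(g has_derivative blinfun_apply (H (snd p))) (at (snd p))"
      using H by (auto simp: C2_on_def)
    show "((\<lambda>p. f (snd p)) has_derivative (\<bullet>) (0, g (snd p))) (at p within S)"
      by (rule has_derivative_eq_rhs[OF has_derivative_compose[OF has_derivative_snd[OF has_derivative_ident] d(1)]]) (auto simp: fun_eq_iff)
    show "((\<lambda>p. (0, g (snd p))) has_derivative blinfun_apply (snd_embed o\<^sub>L (H (snd p) o\<^sub>L snd_blin))) (at p within S)"
      by (rule has_derivative_eq_rhs[OF has_derivative_Pair[OF has_derivative_const has_derivative_compose[OF has_derivative_snd[OF has_derivative_ident] d(2)]]]) (auto simp: fun_eq_iff)
  next
    show "continuous_on S (\<lambda>p. snd_embed o\<^sub>L (H (snd p) o\<^sub>L snd_blin))"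
      by (intro continuous_intros continuous_on_compose2[OF C2_on_continuous(3)[OF H]]) auto
  qed
  then show ?thesis by (auto simp: C2_grad_def)
qed

lemma C2_on_shift:
  assumes H: "C2_on UNIV f g H"
  shows "C2_on UNIV (\<lambda>x. f (x - a)) (\<lambda>x. g (x - a)) (\<lambda>x. H (x - a))"
  unfolding C2_on_def
proof (intro conjI ballI)
  fix x
  have d: "(f has_derivative (\<lambda>v. g (x - a) \<bullet> v)) (at (x - a))" "(g has_derivative blinfun_apply (H (x - a))) (at (x - a))"
    using H by (auto simp: C2_on_def)
  have s: "((\<lambda>x. x - a) has_derivative (\<lambda>v. v)) (at x)" by (auto intro!: derivative_eq_intros)
  show "((\<lambda>x. f (x - a)) has_derivative (\<bullet>) (g (x - a))) (at x)"
    by (rule has_derivative_compose[OF s d(1)])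
  show "((\<lambda>x. g (x - a)) has_derivative blinfun_apply (H (x - a))) (at x)"
    by (rule has_derivative_compose[OF s d(2)])
next
  show "continuous_on UNIV (\<lambda>x. H (x - a))"
    by (intro continuous_intros continuous_on_compose2[OF C2_on_continuous(3)[OF H]]) auto
qed

lemma C2_on_square:
  "C2_on UNIV (\<lambda>q. k * (norm (q::'v::euclidean_space))\<^sup>2) (\<lambda>q. (2 * k) *\<^sub>R q) (\<lambda>q. (2 * k) *\<^sub>R id_blinfun)"
  unfolding C2_on_def power2_norm_eq_inner
  by (auto intro!: derivative_eq_intros simp: fun_eq_iff blinfun.scaleR_left inner_commute)

text \<open>A smooth convex substitute for the norm that exceeds it by at most r and has Hessian of
  order 1/r. This trade-off governs the barriers; with r = 1 the same function penalises growth in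
  y.\<close>

definition soft_norm :: "real \<Rightarrow> 'v::euclidean_space \<Rightarrow> real" where
  "soft_norm r q = sqrt (r\<^sup>2 + (norm q)\<^sup>2)"

lemma soft_norm_ge: "norm q \<le> soft_norm r q" "0 < r \<Longrightarrow> r \<le> soft_norm r q" "0 < r \<Longrightarrow> 0 < soft_norm r q"
proof -
  show "norm q \<le> soft_norm r q" by (simp add: soft_norm_def real_le_rsqrt)
  show "r \<le> soft_norm r q" by (simp add: soft_norm_def real_le_rsqrt)
  show "0 < r \<Longrightarrow> 0 < soft_norm r q" by (simp add: soft_norm_def add_pos_nonneg)
qed

lemma soft_norm_0 [simp]: "0 < r \<Longrightarrow> soft_norm r 0 = r"
  by (simp add: soft_norm_def)

lemma soft_norm_sq: "(soft_norm r q)\<^sup>2 = r\<^sup>2 + (norm q)\<^sup>2"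
  by (simp add: soft_norm_def)

definition soft_grad :: "real \<Rightarrow> 'v::euclidean_space \<Rightarrow> 'v" where
  "soft_grad r q = (1 / soft_norm r q) *\<^sub>R q"

lemma norm_soft_grad: "0 < r \<Longrightarrow> norm (soft_grad r q) \<le> 1"
  using soft_norm_ge[where r=r and q=q] by (simp add: soft_grad_def)

text \<open>With a and b the values at q and q + v, the second order increment is (a b - a^2 - v
  \<bullet> q) / a. Convexity is Cauchy-Schwarz, the quadratic bound is 2 a b \<le> a^2 + b^2, and
  the linear one is the Lipschitz bound on b - a together with |gradient| \<le> 1. The two upper
  bounds are meant for small and for large jumps.\<close>

lemma soft_norm_diff:
  assumes r: "0 < r"
  shows "0 \<le> soft_norm r (q + v) - soft_norm r q - v \<bullet> soft_grad r q"
    "soft_norm r (q + v) - soft_norm r q - v \<bullet> soft_grad r q \<le> min ((norm v)\<^sup>2 / r) (2 * norm v)"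
proof -
  define a b where "a = soft_norm r q" and "b = soft_norm r (q + v)"
  have ab: "r \<le> a" "r \<le> b" "0 < a" "0 < b" using r soft_norm_ge by (auto simp: a_def b_def)
  have a2: "a\<^sup>2 = r\<^sup>2 + (norm q)\<^sup>2" and b2: "b\<^sup>2 = r\<^sup>2 + (norm (q + v))\<^sup>2" by (auto simp: a_def b_def soft_norm_sq)
  have nq: "(norm (q + v))\<^sup>2 = (norm q)\<^sup>2 + 2 * (v \<bullet> q) + (norm v)\<^sup>2"
    by (simp add: power2_norm_eq_inner inner_add_left inner_add_right inner_commute)
  have vg: "v \<bullet> soft_grad r q = (v \<bullet> q) / a" by (simp add: soft_grad_def a_def)
  have e: "soft_norm r (q + v) - soft_norm r q - v \<bullet> soft_grad r q = (a * b - a\<^sup>2 - v \<bullet> q) / a"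
    using ab unfolding vg a_def[symmetric] b_def[symmetric] by (simp add: field_simps power2_eq_square)
  have "(a\<^sup>2 + v \<bullet> q)\<^sup>2 \<le> (a * b)\<^sup>2"
  proof -
    \<comment> \<open>In these variables the claim is (X + y)^2 \<le> X (X + 2 y + n), that is, y^2
      \<le> n X.\<close>
    define X y n where "X = a\<^sup>2" and "y = v \<bullet> q" and "n = (norm v)\<^sup>2"
    have "\<bar>y\<bar> \<le> norm v * norm q" unfolding y_def by (rule Cauchy_Schwarz_ineq2)
    then have "y\<^sup>2 \<le> (norm v * norm q)\<^sup>2" using power_mono[of "\<bar>y\<bar>" "norm v * norm q" 2] by simp
    also have "\<dots> = n * (norm q)\<^sup>2" unfolding n_def by (rule power_mult_distrib)
    also have "\<dots> \<le> n * X" unfolding X_def a2 by (intro mult_left_mono) (auto simp: n_def)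
    finally have "y\<^sup>2 \<le> n * X" .
    moreover have "(a * b)\<^sup>2 = X * (X + 2 * y + n)"
    proof -
      have "b\<^sup>2 = X + 2 * y + n" unfolding X_def y_def n_def b2 nq a2 by linarith
      then show ?thesis by (simp add: power_mult_distrib X_def)
    qed
    ultimately have "(X + y)\<^sup>2 \<le> (a * b)\<^sup>2" by (simp add: power2_eq_square algebra_simps)
    then show ?thesis by (simp add: X_def y_def)
  qed
  then have "a\<^sup>2 + v \<bullet> q \<le> a * b" by (rule power2_le_imp_le) (use ab in simp)
  then show "0 \<le> soft_norm r (q + v) - soft_norm r q - v \<bullet> soft_grad r q" unfolding e using ab by simp
  have "2 * (a * b) \<le> a\<^sup>2 + b\<^sup>2" using sum_squares_bound[of a b] by simp
  then have "2 * (a * b - a\<^sup>2 - v \<bullet> q) \<le> (norm v)\<^sup>2" using a2 b2 nq by simp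
  then have "(a * b - a\<^sup>2 - v \<bullet> q) / a \<le> ((norm v)\<^sup>2 / 2) / a" using ab by (intro divide_right_mono) auto
  also have "\<dots> \<le> ((norm v)\<^sup>2) / r" using ab r by (intro frac_le) auto
  finally have 1: "soft_norm r (q + v) - soft_norm r q - v \<bullet> soft_grad r q \<le> (norm v)\<^sup>2 / r" unfolding e .
  have "b \<le> a + norm v"
  proof -
    have "v \<bullet> q \<le> norm v * norm q" by (rule norm_cauchy_schwarz)
    also have "\<dots> \<le> norm v * a" using soft_norm_ge(1)[of q r] by (intro mult_left_mono) (auto simp: a_def)
    finally have "b\<^sup>2 \<le> (a + norm v)\<^sup>2" unfolding b2 nq power2_sum using a2 by (simp add: mult_ac)
    then show ?thesis by (rule power2_le_imp_le) (use ab in simp)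
  qed
  moreover have "\<bar>v \<bullet> soft_grad r q\<bar> \<le> norm v"
    using Cauchy_Schwarz_ineq2[of v "soft_grad r q"] norm_soft_grad[OF r, of q] mult_left_mono[of "norm (soft_grad r q)" 1 "norm v"] by simp
  ultimately have "soft_norm r (q + v) - soft_norm r q - v \<bullet> soft_grad r q \<le> 2 * norm v"
    unfolding a_def[symmetric] b_def[symmetric] by linarith
  with 1 show "soft_norm r (q + v) - soft_norm r q - v \<bullet> soft_grad r q \<le> min ((norm v)\<^sup>2 / r) (2 * norm v)" by (rule min.boundedI)
qed

lemma C2_on_soft_norm:
  fixes r :: real assumes r: "0 < r"
  obtains H :: "'v::euclidean_space \<Rightarrow> 'v \<Rightarrow>\<^sub>L 'v" where
    "C2_on UNIV (soft_norm r) (soft_grad r) H" "\<And>q. norm (H q) \<le> 2 / r"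
proof -
  \<comment> \<open>With a = \<open>soft_norm r q\<close>, this is I / a minus the outer square of q
    over a^3. Both summands have norm at most 1 / a, whence the 2 / r.\<close>
  define H where "H = (\<lambda>q::'v. (1 / soft_norm r q) *\<^sub>R id_blinfun + outer q ((- (1 / (soft_norm r q)^3)) *\<^sub>R q))"
  have pos: "0 < r\<^sup>2 + (norm q)\<^sup>2" for q :: 'v using r by (simp add: add_pos_nonneg)
  have nz: "soft_norm r q \<noteq> 0" for q :: 'v using soft_norm_ge(3)[OF r, of q] by simp
  have dw: "(soft_norm r has_derivative (\<lambda>v. soft_grad r q \<bullet> v)) (at q)" for q :: 'v
  proof -
    have 1: "((\<lambda>q::'v. r\<^sup>2 + q \<bullet> q) has_derivative (\<lambda>v. 2 * (q \<bullet> v))) (at q)"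
      by (rule has_derivative_eq_rhs[OF has_derivative_add[OF has_derivative_const has_derivative_inner[OF has_derivative_ident has_derivative_ident]]])
        (simp add: fun_eq_iff inner_commute)
    have 2: "(sqrt has_derivative (*) (inverse (sqrt (r\<^sup>2 + q \<bullet> q)) / 2)) (at (r\<^sup>2 + q \<bullet> q))"
      using DERIV_real_sqrt[OF pos[of q]] unfolding has_field_derivative_def power2_norm_eq_inner .
    have 3: "(\<lambda>v. inverse (sqrt (r\<^sup>2 + q \<bullet> q)) / 2 * (2 * (q \<bullet> v))) = (\<lambda>v. ((1 / sqrt (r\<^sup>2 + q \<bullet> q)) *\<^sub>R q) \<bullet> v)"
      unfolding inner_scaleR_left by (simp only: divide_inverse mult_ac) simp
    show ?thesis
      unfolding soft_grad_def soft_norm_def[abs_def] power2_norm_eq_inner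
      by (rule has_derivative_eq_rhs[OF has_derivative_compose[OF 1 2] 3])
  qed
  have dg: "(soft_grad r has_derivative blinfun_apply (H q)) (at q)" for q :: 'v
  proof -
    have 1: "((\<lambda>q. 1 / soft_norm r q) has_derivative (\<lambda>v. - (soft_grad r q \<bullet> v) / (soft_norm r q)\<^sup>2)) (at q)"
      by (rule has_derivative_eq_rhs[OF has_derivative_divide[OF has_derivative_const dw nz]])
        (simp add: fun_eq_iff nz power2_eq_square divide_inverse mult_ac)
    show ?thesis
      unfolding soft_grad_def[abs_def]
      by (rule has_derivative_eq_rhs[OF has_derivative_scaleR[OF 1 has_derivative_ident]])
        (simp add: fun_eq_iff H_def blinfun.add_left blinfun.scaleR_left soft_grad_def power3_eq_cube power2_eq_square)
  qed
  have cw: "continuous_on UNIV (soft_norm r :: 'v \<Rightarrow> real)" unfolding soft_norm_def[abs_def] by (intro continuous_intros)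
  have "continuous_on UNIV H" unfolding H_def
    by (intro continuous_intros continuous_on_outer cw) (use nz in auto)
  then have 1: "C2_on UNIV (soft_norm r) (soft_grad r) H" using dw dg by (auto simp: C2_on_def)
  have "norm (H q) \<le> 2 / r" for q
  proof -
    define a where "a = soft_norm r q"
    have a: "r \<le> a" "0 < a" "norm q \<le> a" using soft_norm_ge[where r=r and q=q] r by (auto simp: a_def)
    have "norm (H q) \<le> (1 / a) * norm (id_blinfun :: 'v \<Rightarrow>\<^sub>L 'v) + norm q * ((1 / a^3) * norm q)"
      unfolding H_def a_def[symmetric] using a
      by (intro order_trans[OF norm_triangle_ineq] add_mono order_trans[OF norm_outer]) (auto simp: abs_mult)
    also have "norm q * ((1 / a^3) * norm q) \<le> a * ((1 / a^3) * a)" using a by (intro mult_mono) auto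
    also have "a * ((1 / a^3) * a) = 1 / a" using a by (simp add: power3_eq_cube)
    also have "(1 / a) * norm (id_blinfun :: 'v \<Rightarrow>\<^sub>L 'v) \<le> (1 / a) * 1"
      using a by (intro mult_left_mono norm_blinfun_id_le) auto
    finally have "norm (H q) \<le> 2 / a" by simp
    also have "\<dots> \<le> 2 / r" using a r by (intro divide_left_mono) auto
    finally show ?thesis .
  qed
  with 1 show ?thesis by (rule that)
qed

section \<open>Interpolation and the inf-sup operation\<close>

text \<open>Infima and suprema of reals carry information only for bounded families. The bounds C
  and C' secure this and leave no trace in the conclusion, so any crude estimate may be supplied for
  them.\<close>

lemma INF_SUP_le_add:
  fixes F G :: "'a \<Rightarrow> 'b \<Rightarrow> real"
  assumes ne: "A \<noteq> {}" "B \<noteq> {}"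
    and F: "\<And>\<alpha> \<beta>. \<alpha> \<in> A \<Longrightarrow> \<beta> \<in> B \<Longrightarrow> \<bar>F \<alpha> \<beta>\<bar> \<le> C"
    and G: "\<And>\<alpha> \<beta>. \<alpha> \<in> A \<Longrightarrow> \<beta> \<in> B \<Longrightarrow> \<bar>G \<alpha> \<beta>\<bar> \<le> C'"
    and le: "\<And>\<alpha> \<beta>. \<alpha> \<in> A \<Longrightarrow> \<beta> \<in> B \<Longrightarrow> F \<alpha> \<beta> \<le> G \<alpha> \<beta> + e"
  shows "(INF \<alpha>\<in>A. SUP \<beta>\<in>B. F \<alpha> \<beta>) \<le> (INF \<alpha>\<in>A. SUP \<beta>\<in>B. G \<alpha> \<beta>) + e"
proof -
  have bF: "bdd_above (F \<alpha> ` B)" and bG: "bdd_above (G \<alpha> ` B)" if "\<alpha> \<in> A" for \<alpha>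
    using F[OF that] G[OF that] by (auto simp: abs_le_iff intro!: bdd_aboveI2)
  obtain \<beta>0 where \<beta>0: "\<beta>0 \<in> B" using ne by auto
  have low: "- C \<le> (SUP \<beta>\<in>B. F \<alpha> \<beta>)" if "\<alpha> \<in> A" for \<alpha>
    by (rule order_trans[OF _ cSUP_upper[OF \<beta>0 bF[OF that]]]) (use F[OF that \<beta>0] in \<open>auto simp: abs_le_iff\<close>)
  have "(INF \<alpha>\<in>A. SUP \<beta>\<in>B. F \<alpha> \<beta>) - e \<le> (INF \<alpha>\<in>A. SUP \<beta>\<in>B. G \<alpha> \<beta>)"
  proof (rule cINF_greatest[OF ne(1)])
    fix \<alpha> assume \<alpha>: "\<alpha> \<in> A"
    have "(INF \<alpha>\<in>A. SUP \<beta>\<in>B. F \<alpha> \<beta>) \<le> (SUP \<beta>\<in>B. F \<alpha> \<beta>)"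
      by (rule cINF_lower[OF _ \<alpha>]) (auto intro!: bdd_belowI2 low)
    also have "\<dots> \<le> (SUP \<beta>\<in>B. G \<alpha> \<beta>) + e"
    proof (rule cSUP_least[OF ne(2)])
      fix \<beta> assume \<beta>: "\<beta> \<in> B"
      show "F \<alpha> \<beta> \<le> (SUP \<beta>\<in>B. G \<alpha> \<beta>) + e"
        using le[OF \<alpha> \<beta>] cSUP_upper[OF \<beta> bG[OF \<alpha>]] by linarith
    qed
    finally show "(INF \<alpha>\<in>A. SUP \<beta>\<in>B. F \<alpha> \<beta>) - e \<le> (SUP \<beta>\<in>B. G \<alpha> \<beta>)" by simp
  qed
  then show ?thesis by simp
qed

text \<open>The sign \<open>\<tau> = \<plusminus>1\<close> treats the two one-sided estimates simultaneously.\<close>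

lemma INF_SUP_signed_mono:
  fixes F G :: "'a \<Rightarrow> 'b \<Rightarrow> real"
  assumes ne: "A \<noteq> {}" "B \<noteq> {}" and \<tau>: "\<tau> = 1 \<or> \<tau> = - 1"
    and F: "\<And>\<alpha> \<beta>. \<alpha> \<in> A \<Longrightarrow> \<beta> \<in> B \<Longrightarrow> \<bar>F \<alpha> \<beta>\<bar> \<le> C"
    and G: "\<And>\<alpha> \<beta>. \<alpha> \<in> A \<Longrightarrow> \<beta> \<in> B \<Longrightarrow> \<bar>G \<alpha> \<beta>\<bar> \<le> C'"
    and le: "\<And>\<alpha> \<beta>. \<alpha> \<in> A \<Longrightarrow> \<beta> \<in> B \<Longrightarrow> \<tau> * F \<alpha> \<beta> \<le> \<tau> * G \<alpha> \<beta> + e"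
  shows "\<tau> * (INF \<alpha>\<in>A. SUP \<beta>\<in>B. F \<alpha> \<beta>) \<le> \<tau> * (INF \<alpha>\<in>A. SUP \<beta>\<in>B. G \<alpha> \<beta>) + e"
  using \<tau>
proof
  assume "\<tau> = 1"
  then show ?thesis using INF_SUP_le_add[OF ne F G] le by simp
next
  assume t: "\<tau> = - 1"
  have "(INF \<alpha>\<in>A. SUP \<beta>\<in>B. G \<alpha> \<beta>) \<le> (INF \<alpha>\<in>A. SUP \<beta>\<in>B. F \<alpha> \<beta>) + e"
  proof (rule INF_SUP_le_add[OF ne G F])
    fix \<alpha> \<beta> assume "\<alpha> \<in> A" "\<beta> \<in> B"
    from le[OF this] t show "G \<alpha> \<beta> \<le> F \<alpha> \<beta> + e" by simp
  qed
  then show ?thesis using t by simp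
qed

text \<open>Summation and integration are exchanged along an enumeration of the index set, which is
  a bijection with the naturals because the set is infinite. The weights form a partition of unity,
  so all partial sums of absolute values are at most B, which is integrable on a finite measure
  space; absolute convergence then brings the result back to unordered sums.\<close>

lemma integral_has_sum_weights:
  fixes g :: "'i::countable \<Rightarrow> 'z \<Rightarrow> real" and a :: "'i \<Rightarrow> real"
  assumes inf: "infinite (UNIV :: 'i set)" and M: "finite_measure M"
    and meas: "\<And>j. g j \<in> borel_measurable M" and nonneg: "\<And>j z. 0 \<le> g j z"
    and one: "\<And>z. z \<in> space M \<Longrightarrow> ((\<lambda>j. g j z) has_sum 1) UNIV"
    and a: "\<And>j. \<bar>a j\<bar> \<le> B"
  shows "((\<lambda>j. a j * integral\<^sup>L M (g j)) has_sum (\<integral>z. (\<Sum>\<^sub>\<infinity>j. a j * g j z) \<partial>M)) UNIV"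
    and "integrable M (\<lambda>z. \<Sum>\<^sub>\<infinity>j. a j * g j z)"
    and "\<And>z. z \<in> space M \<Longrightarrow> (\<lambda>j. a j * g j z) summable_on UNIV"
proof -
  interpret finite_measure M by fact
  note [measurable] = meas
  define e where "e = from_nat_into (UNIV :: 'i set)"
  have e: "bij_betw e UNIV UNIV" unfolding e_def by (rule bij_betw_from_nat_into) (use inf in auto)
  have g1: "(\<lambda>n. g (e n) z) sums 1" if "z \<in> space M" for z
    by (intro has_sum_imp_sums has_sum_reindex_bij_betw[OF e, THEN iffD2] one that)
  have part: "(\<Sum>n<k. g (e n) z) \<le> 1" if "z \<in> space M" for z k
    using g1[OF that] nonneg sum_le_suminf[of "\<lambda>n. g (e n) z" "{..<k}"] by (auto simp: sums_iff)
  have gle: "g (e n) z \<le> 1" if "z \<in> space M" for z n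
  proof -
    have "g (e n) z \<le> (\<Sum>m<Suc n. g (e m) z)" using nonneg by (auto intro!: sum_nonneg simp: add_increasing)
    also note part[OF that, of "Suc n"]
    finally show ?thesis .
  qed
  have B0: "0 \<le> B" using a[of undefined] by linarith
  have intg: "integrable M (g (e n))" for n
    by (rule integrable_const_bound[of _ 1]) (use gle nonneg in auto)
  define f where "f = (\<lambda>n z. a (e n) * g (e n) z)"
  have i: "integrable M (f n)" for n unfolding f_def using intg by auto
  have nf: "norm (f n z) \<le> B * g (e n) z" for n z
    unfolding f_def using a[of "e n"] nonneg[of "e n" z] by (auto simp: abs_mult intro: mult_right_mono)
  have s1: "summable (\<lambda>n. norm (f n z))" if "z \<in> space M" for z
    by (rule summable_comparison_test'[OF summable_mult[of "\<lambda>n. g (e n) z" B]]) (use g1[OF that] nf in \<open>auto simp: sums_iff\<close>)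
  have s2: "summable (\<lambda>n. \<integral>z. norm (f n z) \<partial>M)"
  proof (rule summableI_nonneg_bounded)
    fix k
    have "(\<Sum>n<k. \<integral>z. norm (f n z) \<partial>M) = (\<integral>z. (\<Sum>n<k. norm (f n z)) \<partial>M)"
      by (rule Bochner_Integration.integral_sum[symmetric]) (use i in auto)
    also have "\<dots> \<le> (\<integral>z. B \<partial>M)"
    proof (rule integral_mono)
      fix z assume z: "z \<in> space M"
      have "(\<Sum>n<k. norm (f n z)) \<le> B * (\<Sum>n<k. g (e n) z)" unfolding sum_distrib_left by (intro sum_mono nf)
      also have "\<dots> \<le> B * 1" by (intro mult_left_mono part z B0)
      finally show "(\<Sum>n<k. norm (f n z)) \<le> B" by simp
    qed (intro Bochner_Integration.integrable_sum integrable_norm i integrable_const)+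
    finally show "(\<Sum>n<k. \<integral>z. norm (f n z) \<partial>M) \<le> (\<integral>z. B \<partial>M)" .
  qed simp
  have ae: "AE z in M. summable (\<lambda>n. norm (f n z))" by (rule AE_I2) (rule s1)
  have pt: "((\<lambda>j. a j * g j z) has_sum (\<Sum>n. f n z)) UNIV" if "z \<in> space M" for z
  proof -
    have "((\<lambda>n. f n z) has_sum (\<Sum>n. f n z)) UNIV"
      by (rule norm_summable_imp_has_sum[OF s1[OF that] summable_sums[OF summable_norm_cancel[OF s1[OF that]]]])
    then have "((\<lambda>n. a (e n) * g (e n) z) has_sum (\<Sum>n. f n z)) UNIV" by (simp only: f_def)
    then show ?thesis by (rule has_sum_reindex_bij_betw[OF e, of "\<lambda>j. a j * g j z", THEN iffD1])
  qed
  then show "\<And>z. z \<in> space M \<Longrightarrow> (\<lambda>j. a j * g j z) summable_on UNIV" by (auto simp: summable_on_def)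
  have eq: "(\<Sum>\<^sub>\<infinity>j. a j * g j z) = (\<Sum>n. f n z)" if "z \<in> space M" for z
    using pt[OF that] by (rule infsumI)
  show "integrable M (\<lambda>z. \<Sum>\<^sub>\<infinity>j. a j * g j z)"
    using integrable_suminf[OF i ae s2] by (subst Bochner_Integration.integrable_cong[OF refl eq])
  have "(\<lambda>n. integral\<^sup>L M (f n)) sums (\<integral>z. (\<Sum>n. f n z) \<partial>M)" by (rule sums_integral[OF i ae s2])
  moreover have "summable (\<lambda>n. norm (integral\<^sup>L M (f n)))"
    by (rule summable_comparison_test'[OF s2]) (auto intro: integral_norm_bound)
  ultimately have "((\<lambda>n. integral\<^sup>L M (f n)) has_sum (\<integral>z. (\<Sum>n. f n z) \<partial>M)) UNIV"
    by (rule norm_summable_imp_has_sum[rotated])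
  also have "(\<lambda>n. integral\<^sup>L M (f n)) = (\<lambda>n. a (e n) * integral\<^sup>L M (g (e n)))"
    by (simp add: f_def)
  also have "(\<integral>z. (\<Sum>n. f n z) \<partial>M) = (\<integral>z. (\<Sum>\<^sub>\<infinity>j. a j * g j z) \<partial>M)"
    by (rule Bochner_Integration.integral_cong[OF refl eq[symmetric]])
  finally show "((\<lambda>j. a j * integral\<^sup>L M (g j)) has_sum (\<integral>z. (\<Sum>\<^sub>\<infinity>j. a j * g j z) \<partial>M)) UNIV"
    by (rule has_sum_reindex_bij_betw[OF e, of "\<lambda>j. a j * integral\<^sup>L M (g j)", THEN iffD1])
qed

section \<open>The lattice and interpolation on it\<close>

lemma lat_add: "lat dx (i + j) = lat dx i + lat dx j"
  by (simp add: lat_def vec_eq_iff distrib_right)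

lemma lat_0 [simp]: "lat dx 0 = 0"
  by (simp add: lat_def vec_eq_iff)

lemma lat_axis: "lat dx (axis i 1) = dx *\<^sub>R axis i 1" "lat dx (- axis i 1) = - (dx *\<^sub>R axis i 1)"
  by (auto simp: lat_def vec_eq_iff axis_def)

text \<open>This makes every interpolation sum finite and lets grid functions attain their
  maxima.\<close>

lemma finite_lat_ball:
  fixes x :: "real^'n"
  assumes "0 < dx"
  shows "finite {j. norm (lat dx j - x) \<le> R}"
proof -
  define m where "m = \<lceil>(R + norm x) / dx\<rceil>"
  let ?S = "{- m..m}"
  have "finite ((\<lambda>f. \<chi> i. f i) ` (Pi\<^sub>E (UNIV :: 'n set) (\<lambda>_. ?S)))"
    by (intro finite_imageI finite_PiE) auto
  moreover have "{j. norm (lat dx j - x) \<le> R} \<subseteq> (\<lambda>f. \<chi> i. f i) ` (Pi\<^sub>E (UNIV :: 'n set) (\<lambda>_. ?S))"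
  proof
    fix j assume "j \<in> {j. norm (lat dx j - x) \<le> R}"
    then have "norm (lat dx j) \<le> R + norm x" using norm_triangle_sub[of "lat dx j" x] by simp
    have "j $ i \<in> ?S" for i
    proof -
      have "\<bar>lat dx j $ i\<bar> \<le> R + norm x" using component_le_norm_cart[of "lat dx j" i] \<open>norm (lat dx j) \<le> _\<close> by linarith
      then have "\<bar>real_of_int (j $ i)\<bar> * dx \<le> R + norm x" using assms by (simp add: lat_def abs_mult)
      then have "\<bar>real_of_int (j $ i)\<bar> \<le> (R + norm x) / dx" using assms by (simp add: field_simps)
      then have "\<bar>real_of_int (j $ i)\<bar> \<le> real_of_int m" unfolding m_def by linarith
      then show ?thesis by auto
    qed
    then have "j = (\<chi> i. (\<lambda>i. j $ i) i)" "(\<lambda>i. j $ i) \<in> Pi\<^sub>E UNIV (\<lambda>_. ?S)" by (auto simp: PiE_def)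
    then show "j \<in> (\<lambda>f. \<chi> i. f i) ` (Pi\<^sub>E (UNIV :: 'n set) (\<lambda>_. ?S))" by blast
  qed
  ultimately show ?thesis by (rule finite_subset[rotated])
qed

lemma tent_basis_finite:
  assumes t: "tent_basis cN C1 C2 dx \<omega>" and dx: "0 < dx"
  shows "finite {j. \<omega> j x \<noteq> 0}"
proof (rule finite_subset[OF _ finite_lat_ball[OF dx, of x "cN * dx"]])
  show "{j. \<omega> j x \<noteq> 0} \<subseteq> {j. norm (lat dx j - x) \<le> cN * dx}"
  proof safe
    fix j assume "\<omega> j x \<noteq> 0"
    then have "x \<in> closure {x. \<omega> j x \<noteq> 0}" using closure_subset[of "{x. \<omega> j x \<noteq> 0}"] by blast
    then have "x \<in> ball (lat dx j) (cN * dx)" using t unfolding tent_basis_def by blast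
    then show "norm (lat dx j - x) \<le> cN * dx" by (simp add: dist_norm)
  qed
qed

text \<open>Interpolation has nonnegative weights of sum 1, so it preserves one-sided bounds. Only
  the majorant \<phi> has to be smooth; b is arbitrary.\<close>

lemma interpolation_le:
  assumes t: "tent_basis cN C1 C2 dx \<omega>" and dx: "0 < dx"
    and C2: "C2_on UNIV \<phi> g H" "\<And>x. norm (H x) \<le> L"
    and b: "\<And>j. b j \<le> a + \<phi> (lat dx j)"
  shows "(\<Sum>\<^sub>\<infinity>j. b j * \<omega> j y) \<le> a + \<phi> y + C2 * L * dx\<^sup>2"
proof -
  have fs: "finite {j. c j * \<omega> j y \<noteq> 0}" for c
    by (rule finite_subset[OF _ tent_basis_finite[OF t dx, of y]]) auto
  have s: "(\<lambda>j. c j * \<omega> j y) summable_on UNIV" for c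
    by (rule finite_nonzero_values_imp_summable_on) (use fs[of c] in simp)
  have w: "0 \<le> \<omega> j y" "((\<lambda>j. \<omega> j y) has_sum 1) UNIV" for j using t by (auto simp: tent_basis_def)
  have "(\<Sum>\<^sub>\<infinity>j. b j * \<omega> j y) \<le> (\<Sum>\<^sub>\<infinity>j. (a + \<phi> (lat dx j)) * \<omega> j y)"
    by (intro infsum_mono s mult_right_mono b w)
  also have "\<dots> = (\<Sum>\<^sub>\<infinity>j. a * \<omega> j y) + (\<Sum>\<^sub>\<infinity>j. \<phi> (lat dx j) * \<omega> j y)"
    unfolding distrib_right by (intro infsum_add s)
  also have "(\<Sum>\<^sub>\<infinity>j. a * \<omega> j y) = a"
    using has_sum_cmult_right[OF w(2), of a] by (simp add: infsumI)
  also have "(\<Sum>\<^sub>\<infinity>j. \<phi> (lat dx j) * \<omega> j y) \<le> \<phi> y + C2 * L * dx\<^sup>2"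
  proof -
    have "\<bar>(\<Sum>\<^sub>\<infinity>j. \<phi> (lat dx j) * \<omega> j y) - \<phi> y\<bar> \<le> C2 * L * dx\<^sup>2"
      using t C2 unfolding tent_basis_def by blast
    then show ?thesis by linarith
  qed
  finally show ?thesis by simp
qed

lemma norm1_leD:
  assumes "norm1 T w \<le> ennreal K" "0 \<le> K"
  shows "p \<in> cyl T \<Longrightarrow> norm (w p) \<le> K"
    and "p \<in> cyl T \<Longrightarrow> q \<in> cyl T \<Longrightarrow> norm (w p - w q) \<le> K * pdist p q"
proof -
  have n0: "norm0 T w \<le> ennreal K" and nl: "(SUP (p, q)\<in>{(p, q). p \<in> cyl T \<and> q \<in> cyl T \<and> p \<noteq> q}. ennreal (norm (w p - w q) / pdist p q)) \<le> ennreal K"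
    using order_trans[OF add_increasing2[OF zero_le order_refl] assms(1)[unfolded norm1_def]]
      order_trans[OF add_increasing[OF zero_le order_refl] assms(1)[unfolded norm1_def]] by simp_all
  show "norm (w p) \<le> K" if "p \<in> cyl T"
  proof -
    have "ennreal (norm (w p)) \<le> norm0 T w" unfolding norm0_def by (rule SUP_upper[OF that])
    from order_trans[OF this n0] show ?thesis using assms(2) by (simp add: ennreal_le_iff)
  qed
  show "norm (w p - w q) \<le> K * pdist p q" if "p \<in> cyl T" "q \<in> cyl T"
  proof (cases "p = q")
    case False
    then have "0 < pdist p q" by (auto simp: pdist_def prod_eq_iff add_pos_nonneg add_nonneg_pos)
    moreover have "ennreal (norm (w p - w q) / pdist p q) \<le> ennreal K"
      using order_trans[OF SUP_upper[of "(p, q)" "{(p, q). p \<in> cyl T \<and> q \<in> cyl T \<and> p \<noteq> q}" "\<lambda>(p, q). ennreal (norm (w p - w q) / pdist p q)"] nl] that False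
      by simp
    then have "norm (w p - w q) / pdist p q \<le> K" by (rule ennreal_le_iff[OF assms(2), THEN iffD1])
    ultimately show ?thesis by (simp add: pos_divide_le_eq)
  qed (simp add: pdist_def)
qed

section \<open>The discrete operators\<close>

text \<open>The extended-real norms of (A1)-(A4) are unfolded here into pointwise bounds with one
  constant A. It also bounds T, so that exponentials in time stay bounded, and the dimension, since
  the upwind error is summed over the coordinates.\<close>

locale isaacs_bounds =
  fixes P :: "('a::metric_space, 'b::metric_space, 'n::finite, 'm::finite) isaacs"
    and T A \<sigma> :: real and \<rho> :: "real^'m \<Rightarrow> real" and u0 :: "real^'n \<Rightarrow> real"
  assumes T: "0 < T" "T \<le> A" and A: "1 \<le> A" and \<sigma>: "0 < \<sigma>" "\<sigma> < 2" and dim: "real CARD('n) \<le> A"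
    and ne: "ctrlA P \<noteq> {}" "ctrlB P \<noteq> {}"
    and src: "\<And>\<alpha> \<beta> p. \<alpha> \<in> ctrlA P \<Longrightarrow> \<beta> \<in> ctrlB P \<Longrightarrow> p \<in> cyl T \<Longrightarrow> \<bar>src P \<alpha> \<beta> p\<bar> \<le> A"
    and src_lip: "\<And>\<alpha> \<beta> p q. \<alpha> \<in> ctrlA P \<Longrightarrow> \<beta> \<in> ctrlB P \<Longrightarrow> p \<in> cyl T \<Longrightarrow> q \<in> cyl T \<Longrightarrow>
      \<bar>src P \<alpha> \<beta> p - src P \<alpha> \<beta> q\<bar> \<le> A * pdist p q"
    and zeroth: "\<And>\<alpha> \<beta> p. \<alpha> \<in> ctrlA P \<Longrightarrow> \<beta> \<in> ctrlB P \<Longrightarrow> p \<in> cyl T \<Longrightarrow> 0 \<le> zeroth P \<alpha> \<beta> p \<and> zeroth P \<alpha> \<beta> p \<le> A"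
    and zeroth_lip: "\<And>\<alpha> \<beta> p q. \<alpha> \<in> ctrlA P \<Longrightarrow> \<beta> \<in> ctrlB P \<Longrightarrow> p \<in> cyl T \<Longrightarrow> q \<in> cyl T \<Longrightarrow>
      \<bar>zeroth P \<alpha> \<beta> p - zeroth P \<alpha> \<beta> q\<bar> \<le> A * pdist p q"
    and drift: "\<And>\<alpha> \<beta> p. \<alpha> \<in> ctrlA P \<Longrightarrow> \<beta> \<in> ctrlB P \<Longrightarrow> p \<in> cyl T \<Longrightarrow> norm (drift P \<alpha> \<beta> p) \<le> A"
    and drift_lip: "\<And>\<alpha> \<beta> p q. \<alpha> \<in> ctrlA P \<Longrightarrow> \<beta> \<in> ctrlB P \<Longrightarrow> p \<in> cyl T \<Longrightarrow> q \<in> cyl T \<Longrightarrow>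
      norm (drift P \<alpha> \<beta> p - drift P \<alpha> \<beta> q) \<le> A * pdist p q"
    and u0: "\<And>x. \<bar>u0 x\<bar> \<le> A" and u0_lip: "\<And>x y. \<bar>u0 x - u0 y\<bar> \<le> A * norm (x - y)"
    and jump: "\<And>\<alpha> \<beta> p z. \<alpha> \<in> ctrlA P \<Longrightarrow> \<beta> \<in> ctrlB P \<Longrightarrow> p \<in> cyl T \<Longrightarrow> z \<noteq> 0 \<Longrightarrow> norm (jump P \<alpha> \<beta> p z) \<le> \<rho> z"
    and jump_lip: "\<And>\<alpha> \<beta> p q z. \<alpha> \<in> ctrlA P \<Longrightarrow> \<beta> \<in> ctrlB P \<Longrightarrow> p \<in> cyl T \<Longrightarrow> q \<in> cyl T \<Longrightarrow> z \<noteq> 0 \<Longrightarrow>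
      norm (jump P \<alpha> \<beta> p z - jump P \<alpha> \<beta> q z) \<le> \<rho> z * pdist p q"
    and jump_cont: "\<And>\<alpha> \<beta> p. \<alpha> \<in> ctrlA P \<Longrightarrow> \<beta> \<in> ctrlB P \<Longrightarrow> p \<in> cyl T \<Longrightarrow> continuous_on (- {0}) (jump P \<alpha> \<beta> p)"
    and \<rho>_nonneg: "\<And>z. z \<noteq> 0 \<Longrightarrow> 0 \<le> \<rho> z" and \<rho>_meas: "\<rho> \<in> borel_measurable (levy P)"
    and lev: "is_levy (levy P)" and mom: "levy_moments A \<sigma> (levy P) \<rho>"
begin

text \<open>As a measure space of its own, the part of \<nu> outside the \<delta>-ball is finite,
  and the set integrals of the scheme become ordinary integrals over it.\<close>

definition far :: "real \<Rightarrow> (real^'m) measure" where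
  "far \<delta> = restrict_space (levy P) {z. \<delta> < norm z}"

lemma space_levy_iff: "z \<in> space (levy P) \<longleftrightarrow> z \<noteq> 0"
  using space_levy[OF lev] by auto

lemma sets_levy_norm: "{x. Q x} \<in> sets borel \<Longrightarrow> {z. Q (norm z)} \<inter> space (levy P) \<in> sets (levy P)"
  using measurable_sets[OF norm_measurable_levy[OF lev], of "{x. Q x}"] by (simp add: vimage_def)

lemma sets_far: "{z. \<delta> < norm z} \<inter> space (levy P) \<in> sets (levy P)"
proof -
  have "{x. \<delta> < x} \<in> sets borel" by measurable
  then show ?thesis by (rule sets_levy_norm)
qed

lemma space_far: "0 < \<delta> \<Longrightarrow> space (far \<delta>) = {z. \<delta> < norm z}"
  unfolding far_def space_restrict_space space_levy[OF lev] by (auto simp: set_eq_iff)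

lemma set_integral_far: "(LINT z:{z. \<delta> < norm z}|levy P. f z) = integral\<^sup>L (far \<delta>) f"
  for f :: "_ \<Rightarrow> 'c::{banach, second_countable_topology}"
  unfolding far_def set_lebesgue_integral_def by (rule integral_restrict_space[OF sets_far, symmetric])

lemma set_integrable_far: "set_integrable (levy P) {z. \<delta> < norm z} f \<longleftrightarrow> integrable (far \<delta>) f"
  for f :: "_ \<Rightarrow> 'c::{banach, second_countable_topology}"
  unfolding far_def set_integrable_def by (rule integrable_restrict_space[OF sets_far, symmetric])

lemma measurable_far: "f \<in> borel_measurable (levy P) \<Longrightarrow> f \<in> borel_measurable (far \<delta>)"
  unfolding far_def by (rule measurable_restrict_space1)

lemma far_mass:
  assumes "0 < \<delta>" "\<delta> \<le> 1"
  shows "finite_measure (far \<delta>)" "measure (far \<delta>) (space (far \<delta>)) \<le> A * \<delta> powr (- \<sigma>)"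
proof -
  let ?S = "{z \<in> space (levy P). \<delta> < norm z}"
  have s: "space (far \<delta>) = ?S" by (auto simp: far_def space_restrict_space)
  have "emeasure (far \<delta>) ?S = emeasure (levy P) ?S"
    unfolding far_def by (rule emeasure_restrict_space[OF sets_far]) auto
  also have "\<dots> \<le> ennreal (A * \<delta> powr (- \<sigma>))"
    using mom assms by (auto simp: levy_moments_def)
  finally have le: "emeasure (far \<delta>) (space (far \<delta>)) \<le> ennreal (A * \<delta> powr (- \<sigma>))" unfolding s .
  show "finite_measure (far \<delta>)"
    by (rule finite_measureI) (use le in \<open>auto simp: top_unique\<close>)
  then interpret f: finite_measure "far \<delta>" .
  show "measure (far \<delta>) (space (far \<delta>)) \<le> A * \<delta> powr (- \<sigma>)"
    using le A by (simp add: f.emeasure_eq_measure ennreal_le_iff)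
qed

lemma far_\<rho>:
  assumes "0 < \<delta>" "\<delta> \<le> 1"
  shows "integrable (far \<delta>) \<rho>" "integral\<^sup>L (far \<delta>) \<rho> \<le> A * hscale \<sigma> \<delta>"
    "integrable (far \<delta>) (\<lambda>z. (\<rho> z)\<^sup>2)" "(\<integral>z. (\<rho> z)\<^sup>2 \<partial>far \<delta>) \<le> A"
proof -
  show "integrable (far \<delta>) \<rho>" "integral\<^sup>L (far \<delta>) \<rho> \<le> A * hscale \<sigma> \<delta>"
    using mom assms by (auto simp: levy_moments_def set_integral_far set_integrable_far)
  have i: "integrable (levy P) (\<lambda>z. (\<rho> z)\<^sup>2)" "(LINT z|levy P. (\<rho> z)\<^sup>2) \<le> A" using mom by (auto simp: levy_moments_def)
  have j: "integrable (levy P) (\<lambda>z. indicator {z. \<delta> < norm z} z *\<^sub>R (\<rho> z)\<^sup>2)"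
  proof (rule Bochner_Integration.integrable_bound[OF i(1)])
    have "(\<lambda>z. indicator ({z. \<delta> < norm z} \<inter> space (levy P)) z *\<^sub>R (\<rho> z)\<^sup>2) \<in> borel_measurable (levy P)"
      using sets_far \<rho>_meas by measurable
    then show "(\<lambda>z. indicator {z. \<delta> < norm z} z *\<^sub>R (\<rho> z)\<^sup>2) \<in> borel_measurable (levy P)"
      by (rule measurable_cong[THEN iffD1, rotated]) (auto simp: indicator_def)
  qed (auto simp: indicator_def)
  show "integrable (far \<delta>) (\<lambda>z. (\<rho> z)\<^sup>2)"
    unfolding set_integrable_far[symmetric] set_integrable_def by (rule j)
  have "(\<integral>z. (\<rho> z)\<^sup>2 \<partial>far \<delta>) = (LINT z|levy P. indicator {z. \<delta> < norm z} z *\<^sub>R (\<rho> z)\<^sup>2)"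
    unfolding set_integral_far[symmetric] set_lebesgue_integral_def ..
  also have "\<dots> \<le> (LINT z|levy P. (\<rho> z)\<^sup>2)"
    by (rule integral_mono[OF j i(1)]) (auto simp: indicator_def)
  finally show "(\<integral>z. (\<rho> z)\<^sup>2 \<partial>far \<delta>) \<le> A" using i(2) by linarith
qed

lemma integrable_far_bounded:
  fixes f :: "_ \<Rightarrow> 'c::{banach, second_countable_topology}"
  assumes "0 < \<delta>" "\<delta> \<le> 1" "f \<in> borel_measurable (levy P)" "\<And>z. z \<noteq> 0 \<Longrightarrow> norm (f z) \<le> B"
  shows "integrable (far \<delta>) f"
proof -
  interpret finite_measure "far \<delta>" using far_mass(1) assms by simp
  show ?thesis
  proof (rule integrable_const_bound)
    show "AE z in far \<delta>. norm (f z) \<le> B"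
    proof (rule AE_I2)
      fix z assume "z \<in> space (far \<delta>)"
      then have "z \<noteq> 0" using assms(1) by (auto simp: space_far)
      then show "norm (f z) \<le> B" by (rule assms(4))
    qed
  qed (rule measurable_far[OF assms(3)])
qed

lemma jump_measurable:
  "\<alpha> \<in> ctrlA P \<Longrightarrow> \<beta> \<in> ctrlB P \<Longrightarrow> p \<in> cyl T \<Longrightarrow> jump P \<alpha> \<beta> p \<in> borel_measurable (levy P)"
  by (rule borel_measurable_levy_continuous[OF lev jump_cont])

lemma jump_continuous_measurable:
  assumes "\<alpha> \<in> ctrlA P" "\<beta> \<in> ctrlB P" "p \<in> cyl T" "continuous_on UNIV (f :: real^'n \<Rightarrow> 'c::topological_space)"
  shows "(\<lambda>z. f (x + jump P \<alpha> \<beta> p z)) \<in> borel_measurable (levy P)"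
  by (intro borel_measurable_levy_continuous[OF lev] continuous_on_compose2[OF assms(4)] continuous_intros jump_cont assms) auto

text \<open>The compensator. It is kept apart from the drift because its bound degenerates with
  \<delta>: it must be cancelled, not estimated.\<close>

definition mean_jump :: "real \<Rightarrow> 'a \<Rightarrow> 'b \<Rightarrow> real \<times> (real^'n) \<Rightarrow> real^'n" where
  "mean_jump \<delta> \<alpha> \<beta> p = integral\<^sup>L (far \<delta>) (jump P \<alpha> \<beta> p)"

lemma b_tilde_eq: "b_tilde P \<delta> \<alpha> \<beta> p = drift P \<alpha> \<beta> p - mean_jump \<delta> \<alpha> \<beta> p"
  unfolding b_tilde_def mean_jump_def set_integral_far ..

lemma jump_integrable:
  assumes "0 < \<delta>" "\<delta> \<le> 1" "\<alpha> \<in> ctrlA P" "\<beta> \<in> ctrlB P" "p \<in> cyl T"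
  shows "integrable (far \<delta>) (jump P \<alpha> \<beta> p)"
proof (rule Bochner_Integration.integrable_bound[OF far_\<rho>(1)[OF assms(1,2)]])
  show "AE z in far \<delta>. norm (jump P \<alpha> \<beta> p z) \<le> norm (\<rho> z)"
  proof (rule AE_I2)
    fix z assume "z \<in> space (far \<delta>)"
    then have "z \<noteq> 0" using assms by (auto simp: space_far)
    then show "norm (jump P \<alpha> \<beta> p z) \<le> norm (\<rho> z)" using jump[of \<alpha> \<beta> p z] assms \<rho>_nonneg[of z] by simp
  qed
qed (rule measurable_far[OF jump_measurable[OF assms(3-5)]])

lemma mean_jump_bounds:
  assumes "0 < \<delta>" "\<delta> \<le> 1" "\<alpha> \<in> ctrlA P" "\<beta> \<in> ctrlB P" "p \<in> cyl T" "q \<in> cyl T"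
  shows "norm (mean_jump \<delta> \<alpha> \<beta> p) \<le> A * hscale \<sigma> \<delta>"
    "norm (mean_jump \<delta> \<alpha> \<beta> p - mean_jump \<delta> \<alpha> \<beta> q) \<le> A * hscale \<sigma> \<delta> * pdist p q"
proof -
  note ji = jump_integrable[OF assms(1-4)]
  have nz: "z \<noteq> 0" if "z \<in> space (far \<delta>)" for z using that assms by (auto simp: space_far)
  have "norm (mean_jump \<delta> \<alpha> \<beta> p) \<le> integral\<^sup>L (far \<delta>) \<rho>"
    unfolding mean_jump_def
    by (rule Bochner_Integration.integral_norm_bound_integral[OF ji far_\<rho>(1)]) (use assms jump nz in auto)
  also note far_\<rho>(2)[OF assms(1,2)]
  finally show "norm (mean_jump \<delta> \<alpha> \<beta> p) \<le> A * hscale \<sigma> \<delta>" .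
  have "mean_jump \<delta> \<alpha> \<beta> p - mean_jump \<delta> \<alpha> \<beta> q = (\<integral>z. jump P \<alpha> \<beta> p z - jump P \<alpha> \<beta> q z \<partial>far \<delta>)"
    unfolding mean_jump_def by (rule Bochner_Integration.integral_diff[symmetric]; intro ji assms)
  also have "norm \<dots> \<le> (\<integral>z. \<rho> z * pdist p q \<partial>far \<delta>)"
    by (rule Bochner_Integration.integral_norm_bound_integral)
      (use assms jump_lip nz ji far_\<rho>(1) in \<open>auto intro!: Bochner_Integration.integrable_diff\<close>)
  also have "\<dots> = integral\<^sup>L (far \<delta>) \<rho> * pdist p q" by simp
  also have "\<dots> \<le> A * hscale \<sigma> \<delta> * pdist p q"
    by (intro mult_right_mono far_\<rho> assms) (simp add: pdist_def)
  finally show "norm (mean_jump \<delta> \<alpha> \<beta> p - mean_jump \<delta> \<alpha> \<beta> q) \<le> A * hscale \<sigma> \<delta> * pdist p q" .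
qed

lemma norm_b_tilde:
  assumes "0 < \<delta>" "\<delta> \<le> 1" "\<alpha> \<in> ctrlA P" "\<beta> \<in> ctrlB P" "p \<in> cyl T"
  shows "norm (b_tilde P \<delta> \<alpha> \<beta> p) \<le> 2 * A * hscale \<sigma> \<delta>"
proof -
  have "norm (b_tilde P \<delta> \<alpha> \<beta> p) \<le> A + A * hscale \<sigma> \<delta>"
    unfolding b_tilde_eq using drift[OF assms(3-5)] mean_jump_bounds(1)[OF assms assms(5)]
    by (intro order_trans[OF norm_triangle_ineq4] add_mono)
  also have "A * 1 \<le> A * hscale \<sigma> \<delta>" using A hscale_ge1 by (intro mult_left_mono) auto
  then have "A + A * hscale \<sigma> \<delta> \<le> 2 * A * hscale \<sigma> \<delta>" by simp
  finally show ?thesis .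
qed

text \<open>The upwind coefficients are nonnegative, so w may be replaced by a majorant that touches
  it at x. The second order term of the majorant is multiplied by |b_i| dx in each coordinate;
  summing over the coordinates turns A into A^2.\<close>

lemma D_h_le:
  assumes d: "0 < \<delta>" "\<delta> \<le> 1" "\<alpha> \<in> ctrlA P" "\<beta> \<in> ctrlB P" "(t, x) \<in> cyl T" and dx: "0 < dx"
    and w: "w (t, x) = c + \<phi> x" "\<And>i. w (t, x + dx *\<^sub>R axis i 1) \<le> c + \<phi> (x + dx *\<^sub>R axis i 1)"
      "\<And>i. w (t, x - dx *\<^sub>R axis i 1) \<le> c + \<phi> (x - dx *\<^sub>R axis i 1)"
    and \<phi>: "\<And>v. \<phi> (x + v) \<le> \<phi> x + g \<bullet> v + L * (norm v)\<^sup>2" and L: "0 \<le> L"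
  shows "D_h P \<delta> dx \<alpha> \<beta> w (t, x) \<le> b_tilde P \<delta> \<alpha> \<beta> (t, x) \<bullet> g + L * (2 * A\<^sup>2 * hscale \<sigma> \<delta> * dx)"
proof -
  define b where "b = b_tilde P \<delta> \<alpha> \<beta> (t, x)"
  have "D_h P \<delta> dx \<alpha> \<beta> w (t, x) \<le> (\<Sum>i\<in>UNIV. b $ i * g $ i + L * (2 * A * hscale \<sigma> \<delta> * dx))"
    unfolding D_h_def prod.case b_def[symmetric]
  proof (rule sum_mono)
    fix i :: 'n
    have "w (t, x + dx *\<^sub>R axis i 1) - w (t, x) \<le> g $ i * dx + L * dx\<^sup>2"
      using w(1) w(2)[of i] \<phi>[of "dx *\<^sub>R axis i 1"] dx by (simp add: inner_axis mult_ac)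
    also have "\<dots> = (g $ i + L * dx) * dx" by (simp add: power2_eq_square algebra_simps)
    finally have 1: "(w (t, x + dx *\<^sub>R axis i 1) - w (t, x)) / dx \<le> g $ i + L * dx"
      by (simp only: pos_divide_le_eq[OF dx])
    have "w (t, x - dx *\<^sub>R axis i 1) - w (t, x) \<le> - (g $ i * dx) + L * dx\<^sup>2"
      using w(1) w(3)[of i] \<phi>[of "- (dx *\<^sub>R axis i 1)"] dx by (simp add: inner_axis mult_ac)
    also have "\<dots> = (- g $ i + L * dx) * dx" by (simp add: power2_eq_square algebra_simps)
    finally have 2: "(w (t, x - dx *\<^sub>R axis i 1) - w (t, x)) / dx \<le> - g $ i + L * dx"
      by (simp only: pos_divide_le_eq[OF dx])
    have "max (b $ i) 0 * ((w (t, x + dx *\<^sub>R axis i 1) - w (t, x)) / dx) +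
       max (- b $ i) 0 * ((w (t, x - dx *\<^sub>R axis i 1) - w (t, x)) / dx)
       \<le> max (b $ i) 0 * (g $ i + L * dx) + max (- b $ i) 0 * (- g $ i + L * dx)"
      by (intro add_mono mult_left_mono 1 2) auto
    also have "\<dots> = b $ i * g $ i + \<bar>b $ i\<bar> * (L * dx)" by (auto simp: max_def algebra_simps)
    also have "\<bar>b $ i\<bar> * (L * dx) \<le> (2 * A * hscale \<sigma> \<delta>) * (L * dx)"
      using component_le_norm_cart[of b i] norm_b_tilde[OF d] L dx by (intro mult_right_mono) (auto simp: b_def)
    finally show "max (b $ i) 0 * ((w (t, x + dx *\<^sub>R axis i 1) - w (t, x)) / dx) +
       max (- b $ i) 0 * ((w (t, x - dx *\<^sub>R axis i 1) - w (t, x)) / dx) \<le> b $ i * g $ i + L * (2 * A * hscale \<sigma> \<delta> * dx)"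
      by (simp add: mult_ac)
  qed
  also have "\<dots> = b \<bullet> g + real CARD('n) * (L * (2 * A * hscale \<sigma> \<delta> * dx))"
    by (simp add: sum.distrib inner_vec_def)
  also have "real CARD('n) * (L * (2 * A * hscale \<sigma> \<delta> * dx)) \<le> A * (L * (2 * A * hscale \<sigma> \<delta> * dx))"
    using dim L A dx hscale_ge1[of \<sigma> \<delta>] by (intro mult_right_mono) auto
  finally show ?thesis by (simp add: b_def power2_eq_square mult_ac)
qed

text \<open>The factor 1 / dx is harmless: this bound, like \<open>J_h_bounded\<close> below, only
  keeps the inf-sup of the scheme finite.\<close>

lemma D_h_bounded:
  assumes d: "0 < \<delta>" "\<delta> \<le> 1" "\<alpha> \<in> ctrlA P" "\<beta> \<in> ctrlB P" "(t, x) \<in> cyl T" and dx: "0 < dx"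
    and w: "\<bar>w (t, x)\<bar> \<le> B" "\<And>i. \<bar>w (t, x + dx *\<^sub>R axis i 1)\<bar> \<le> B" "\<And>i. \<bar>w (t, x - dx *\<^sub>R axis i 1)\<bar> \<le> B"
  shows "\<bar>D_h P \<delta> dx \<alpha> \<beta> w (t, x)\<bar> \<le> A * (2 * A * hscale \<sigma> \<delta> * (2 * B / dx))"
proof -
  define b where "b = b_tilde P \<delta> \<alpha> \<beta> (t, x)"
  have B: "0 \<le> B" using w(1) by linarith
  have "\<bar>D_h P \<delta> dx \<alpha> \<beta> w (t, x)\<bar> \<le> (\<Sum>i\<in>(UNIV :: 'n set). 2 * A * hscale \<sigma> \<delta> * (2 * B / dx))"
    unfolding D_h_def prod.case b_def[symmetric]
  proof (rule order_trans[OF sum_abs sum_mono])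
    fix i :: 'n
    have q: "\<bar>(w (t, y) - w (t, x)) / dx\<bar> \<le> 2 * B / dx" if "\<bar>w (t, y)\<bar> \<le> B" for y
      using that w(1) dx unfolding abs_divide by (simp add: divide_right_mono)
    have q': "\<bar>c * ((w (t, y) - w (t, x)) / dx)\<bar> \<le> c * (2 * B / dx)" if "\<bar>w (t, y)\<bar> \<le> B" "0 \<le> c" for y c
      unfolding abs_mult abs_of_nonneg[OF that(2)] by (rule mult_left_mono[OF q[OF that(1)] that(2)])
    have "\<bar>max (b $ i) 0 * ((w (t, x + dx *\<^sub>R axis i 1) - w (t, x)) / dx) +
       max (- b $ i) 0 * ((w (t, x - dx *\<^sub>R axis i 1) - w (t, x)) / dx)\<bar>
       \<le> max (b $ i) 0 * (2 * B / dx) + max (- b $ i) 0 * (2 * B / dx)"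
      by (rule order_trans[OF abs_triangle_ineq], rule add_mono; rule q') (auto simp: w)
    also have "\<dots> = \<bar>b $ i\<bar> * (2 * B / dx)" by (auto simp: max_def)
    also have "\<dots> \<le> 2 * A * hscale \<sigma> \<delta> * (2 * B / dx)"
      using component_le_norm_cart[of b i] norm_b_tilde[OF d] B dx by (intro mult_right_mono) (auto simp: b_def)
    finally show "\<bar>max (b $ i) 0 * ((w (t, x + dx *\<^sub>R axis i 1) - w (t, x)) / dx) +
       max (- b $ i) 0 * ((w (t, x - dx *\<^sub>R axis i 1) - w (t, x)) / dx)\<bar> \<le> 2 * A * hscale \<sigma> \<delta> * (2 * B / dx)" .
  qed
  also have "\<dots> = real CARD('n) * (2 * A * hscale \<sigma> \<delta> * (2 * B / dx))" by simp
  also have "\<dots> \<le> A * (2 * A * hscale \<sigma> \<delta> * (2 * B / dx))"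
    using dim A B dx hscale_ge1[of \<sigma> \<delta>] by (intro mult_right_mono) auto
  finally show ?thesis .
qed

lemma infinite_lattice: "infinite (UNIV :: (int^'n) set)"
proof -
  have "inj (\<lambda>k::int. (\<chi> i. k) :: int^'n)" by (auto simp: inj_def vec_eq_iff)
  then show ?thesis using finite_subset[of "range (\<lambda>k::int. (\<chi> i. k) :: int^'n)" UNIV] finite_imageD infinite_UNIV_int by blast
qed

text \<open>This turns lattice weights into an integral over jumps of interpolated increments, the
  form in which discrete and continuous operators can be compared jump by jump.\<close>

lemma J_h_integral:
  assumes d: "0 < \<delta>" "\<delta> \<le> 1" "\<alpha> \<in> ctrlA P" "\<beta> \<in> ctrlB P" "(t, x) \<in> cyl T" and dx: "0 < dx"
    and tent: "tent_basis cN C1 C2 dx \<omega>" and w: "\<And>j. \<bar>w (t, x + lat dx j)\<bar> \<le> B"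
  shows "((\<lambda>j. (w (t, x + lat dx j) - w (t, x)) * kap P \<omega> \<delta> \<alpha> \<beta> (t, x) j) has_sum J_h P \<omega> \<delta> dx \<alpha> \<beta> w (t, x)) UNIV"
    "J_h P \<omega> \<delta> dx \<alpha> \<beta> w (t, x) = (\<integral>z. (\<Sum>\<^sub>\<infinity>j. (w (t, x + lat dx j) - w (t, x)) * \<omega> j (jump P \<alpha> \<beta> (t, x) z)) \<partial>far \<delta>)"
    "integrable (far \<delta>) (\<lambda>z. \<Sum>\<^sub>\<infinity>j. (w (t, x + lat dx j) - w (t, x)) * \<omega> j (jump P \<alpha> \<beta> (t, x) z))"
    "(kap P \<omega> \<delta> \<alpha> \<beta> (t, x)) summable_on UNIV"
proof -
  have k: "kap P \<omega> \<delta> \<alpha> \<beta> (t, x) j = (\<integral>z. \<omega> j (jump P \<alpha> \<beta> (t, x) z) \<partial>far \<delta>)" for j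
    unfolding kap_def set_integral_far ..
  have m: "(\<lambda>z. \<omega> j (jump P \<alpha> \<beta> (t, x) z)) \<in> borel_measurable (far \<delta>)" for j
  proof -
    have "continuous_on UNIV (\<omega> j)" using tent lipschitz_on_continuous_on unfolding tent_basis_def by blast
    from jump_continuous_measurable[OF d(3-5) this, of 0] show ?thesis by (simp add: measurable_far)
  qed
  have w0: "\<bar>w (t, x)\<bar> \<le> B" using w[of 0] by simp
  have a: "\<bar>w (t, x + lat dx j) - w (t, x)\<bar> \<le> 2 * B" for j using w[of j] w0 by linarith
  have nn: "0 \<le> \<omega> j y" "((\<lambda>j. \<omega> j y) has_sum 1) UNIV" for j y using tent unfolding tent_basis_def by blast+
  note R = integral_has_sum_weights[OF infinite_lattice far_mass(1)[OF d(1,2)] m nn(1) nn(2)]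
  have hs: "((\<lambda>j. (w (t, x + lat dx j) - w (t, x)) * kap P \<omega> \<delta> \<alpha> \<beta> (t, x) j) has_sum
    (\<integral>z. (\<Sum>\<^sub>\<infinity>j. (w (t, x + lat dx j) - w (t, x)) * \<omega> j (jump P \<alpha> \<beta> (t, x) z)) \<partial>far \<delta>)) UNIV"
    unfolding k by (rule R(1)[OF a])
  then show 2: "J_h P \<omega> \<delta> dx \<alpha> \<beta> w (t, x) = (\<integral>z. (\<Sum>\<^sub>\<infinity>j. (w (t, x + lat dx j) - w (t, x)) * \<omega> j (jump P \<alpha> \<beta> (t, x) z)) \<partial>far \<delta>)"
    unfolding J_h_def prod.case by (rule infsumI)
  show "((\<lambda>j. (w (t, x + lat dx j) - w (t, x)) * kap P \<omega> \<delta> \<alpha> \<beta> (t, x) j) has_sum J_h P \<omega> \<delta> dx \<alpha> \<beta> w (t, x)) UNIV"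
    unfolding 2 by (rule hs)
  show "integrable (far \<delta>) (\<lambda>z. \<Sum>\<^sub>\<infinity>j. (w (t, x + lat dx j) - w (t, x)) * \<omega> j (jump P \<alpha> \<beta> (t, x) z))"
    by (rule R(2)[OF a])
  have "((\<lambda>j. 1 * kap P \<omega> \<delta> \<alpha> \<beta> (t, x) j) has_sum (\<integral>z. (\<Sum>\<^sub>\<infinity>j. 1 * \<omega> j (jump P \<alpha> \<beta> (t, x) z)) \<partial>far \<delta>)) UNIV"
    unfolding k by (rule R(1)[of "\<lambda>_. 1" 1]) simp
  then show "(kap P \<omega> \<delta> \<alpha> \<beta> (t, x)) summable_on UNIV" by (auto simp: summable_on_def)
qed

text \<open>Height and centre of the majorant may depend on the jump z. In the doubling argument the
  centre follows the jump of the second variable, so that the penalty sees only the difference of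
  the two jumps. The interpolation error L dx^2 is paid on the whole mass outside \<delta>, which
  gives the factor \<delta>^(-\<sigma>).\<close>

lemma J_h_le:
  assumes d: "0 < \<delta>" "\<delta> \<le> 1" "\<alpha> \<in> ctrlA P" "\<beta> \<in> ctrlB P" "(t, x) \<in> cyl T" and dx: "0 < dx"
    and tent: "tent_basis cN C1 C2 dx \<omega>" and C2A: "C2 \<le> A" and w: "\<And>j. \<bar>w (t, x + lat dx j)\<bar> \<le> B"
    and C2: "C2_on UNIV \<phi> g H" "\<And>x. norm (H x) \<le> L"
    and le: "\<And>z j. \<delta> < norm z \<Longrightarrow> w (t, x + lat dx j) \<le> a z + \<phi> (x + lat dx j - \<zeta> z)"
    and int: "integrable (far \<delta>) (\<lambda>z. a z + \<phi> (x + jump P \<alpha> \<beta> (t, x) z - \<zeta> z) - w (t, x))"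
  shows "J_h P \<omega> \<delta> dx \<alpha> \<beta> w (t, x) \<le> (\<integral>z. a z + \<phi> (x + jump P \<alpha> \<beta> (t, x) z - \<zeta> z) - w (t, x) \<partial>far \<delta>) + L * (A\<^sup>2 * \<delta> powr (- \<sigma>) * dx\<^sup>2)"
proof -
  interpret finite_measure "far \<delta>" by (rule far_mass[OF d(1,2)])
  note J = J_h_integral[OF d dx tent, where w = w and B = B, OF w]
  have L: "0 \<le> L" using C2(2)[of 0] norm_ge_zero order_trans by blast
  let ?e = "A * L * dx\<^sup>2"
  have "J_h P \<omega> \<delta> dx \<alpha> \<beta> w (t, x) \<le> (\<integral>z. (a z + \<phi> (x + jump P \<alpha> \<beta> (t, x) z - \<zeta> z) - w (t, x)) + ?e \<partial>far \<delta>)"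
    unfolding J(2)
  proof (rule integral_mono[OF J(3)])
    show "integrable (far \<delta>) (\<lambda>z. (a z + \<phi> (x + jump P \<alpha> \<beta> (t, x) z - \<zeta> z) - w (t, x)) + ?e)"
      by (intro Bochner_Integration.integrable_add int integrable_const)
    fix z assume "z \<in> space (far \<delta>)"
    then have z: "\<delta> < norm z" using d by (simp add: space_far)
    let ?y = "jump P \<alpha> \<beta> (t, x) z"
    have "(\<Sum>\<^sub>\<infinity>j. (w (t, x + lat dx j) - w (t, x)) * \<omega> j ?y) \<le> (a z - w (t, x)) + \<phi> (?y - (\<zeta> z - x)) + C2 * L * dx\<^sup>2"
    proof (rule interpolation_le[OF tent dx C2_on_shift[OF C2(1)] C2(2)])
      fix j show "w (t, x + lat dx j) - w (t, x) \<le> (a z - w (t, x)) + \<phi> (lat dx j - (\<zeta> z - x))"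
        using le[OF z, of j] by (simp add: algebra_simps)
    qed
    also have "C2 * L * dx\<^sup>2 \<le> ?e" using C2A L by (intro mult_right_mono) auto
    finally show "(\<Sum>\<^sub>\<infinity>j. (w (t, x + lat dx j) - w (t, x)) * \<omega> j ?y) \<le> (a z + \<phi> (x + ?y - \<zeta> z) - w (t, x)) + ?e"
      by (simp add: algebra_simps)
  qed
  also have "\<dots> = (\<integral>z. a z + \<phi> (x + jump P \<alpha> \<beta> (t, x) z - \<zeta> z) - w (t, x) \<partial>far \<delta>) + ?e * measure (far \<delta>) (space (far \<delta>))"
    by (subst Bochner_Integration.integral_add[OF int integrable_const]) simp
  also have "?e * measure (far \<delta>) (space (far \<delta>)) \<le> ?e * (A * \<delta> powr (- \<sigma>))"
    using A L by (intro mult_left_mono far_mass d) auto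
  finally show ?thesis by (simp add: power2_eq_square mult_ac)
qed

lemma J_h_bounded:
  assumes d: "0 < \<delta>" "\<delta> \<le> 1" "\<alpha> \<in> ctrlA P" "\<beta> \<in> ctrlB P" "(t, x) \<in> cyl T" and dx: "0 < dx"
    and tent: "tent_basis cN C1 C2 dx \<omega>" and w: "\<And>j. \<bar>w (t, x + lat dx j)\<bar> \<le> B"
  shows "\<bar>J_h P \<omega> \<delta> dx \<alpha> \<beta> w (t, x)\<bar> \<le> 2 * B * (A * \<delta> powr (- \<sigma>))"
proof -
  interpret finite_measure "far \<delta>" by (rule far_mass[OF d(1,2)])
  have w0: "\<bar>w (t, x)\<bar> \<le> B" using w[of 0] by simp
  then have B: "0 \<le> B" by linarith
  note J = J_h_integral[OF d dx tent, where w = w and B = B, OF w]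
  have "\<bar>J_h P \<omega> \<delta> dx \<alpha> \<beta> w (t, x)\<bar> \<le> (\<integral>z. 2 * B \<partial>far \<delta>)"
    unfolding J(2) real_norm_def[symmetric]
  proof (rule Bochner_Integration.integral_norm_bound_integral[OF J(3) integrable_const])
    fix z
    let ?y = "jump P \<alpha> \<beta> (t, x) z"
    have one: "((\<lambda>j. \<omega> j ?y) has_sum 1) UNIV" and nn: "\<And>j. 0 \<le> \<omega> j ?y" using tent unfolding tent_basis_def by blast+
    have s: "(\<lambda>j. (w (t, x + lat dx j) - w (t, x)) * \<omega> j ?y) summable_on UNIV"
      by (rule finite_nonzero_values_imp_summable_on, rule finite_subset[OF _ tent_basis_finite[OF tent dx, of ?y]]) auto
    have hs: "((\<lambda>j. c * \<omega> j ?y) has_sum c) UNIV" for c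
      using has_sum_cmult_right[OF one, of c] by simp
    have bd: "w (t, x + lat dx j) - w (t, x) \<le> 2 * B" "- (2 * B) \<le> w (t, x + lat dx j) - w (t, x)" for j
      using w[of j] w0 by linarith+
    have "(\<Sum>\<^sub>\<infinity>j. (w (t, x + lat dx j) - w (t, x)) * \<omega> j ?y) \<le> 2 * B"
      by (rule has_sum_mono[OF has_sum_infsum[OF s] hs]) (intro mult_right_mono bd nn)
    moreover have "- (2 * B) \<le> (\<Sum>\<^sub>\<infinity>j. (w (t, x + lat dx j) - w (t, x)) * \<omega> j ?y)"
      by (rule has_sum_mono[OF hs has_sum_infsum[OF s]]) (intro mult_right_mono bd nn)
    ultimately show "norm (\<Sum>\<^sub>\<infinity>j. (w (t, x + lat dx j) - w (t, x)) * \<omega> j ?y) \<le> 2 * B"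
      by (simp add: abs_le_iff)
  qed
  also have "\<dots> = 2 * B * measure (far \<delta>) (space (far \<delta>))" by simp
  also have "\<dots> \<le> 2 * B * (A * \<delta> powr (- \<sigma>))" using B by (intro mult_left_mono far_mass d) auto
  finally show ?thesis .
qed

lemma lat_eq_0_iff: "0 < dx \<Longrightarrow> lat dx j = 0 \<longleftrightarrow> j = 0"
  by (auto simp: lat_def vec_eq_iff)

text \<open>Changing w at the centre shifts all increments by the same amount, so the operator
  changes by this amount times the sum of its coefficients, the very sum in the CFL condition. The
  same holds for \<open>J_h\<close> below.\<close>

lemma D_h_update:
  assumes "0 < dx"
  shows "D_h P \<delta> dx \<alpha> \<beta> (w((t, x) := V)) (t, x) = D_h P \<delta> dx \<alpha> \<beta> w (t, x) - (V - w (t, x)) * (\<Sum>\<^sub>\<infinity>j\<in>- {0}. d_coeff P \<delta> dx \<alpha> \<beta> (t, x) j)"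
proof -
  let ?d = "d_coeff P \<delta> dx \<alpha> \<beta> (t, x)"
  \<comment> \<open>Applied to the function that vanishes at x and is 1 elsewhere, the operator
    returns the sum of its coefficients; in particular they are summable.\<close>
  have "(?d has_sum D_h P \<delta> dx \<alpha> \<beta> (\<lambda>p. if snd p = x then 0 else 1) (t, x)) (- {0})"
    using D_h_has_sum[of P \<delta> dx \<alpha> \<beta> t x "\<lambda>p. if snd p = x then 0 else 1"]
    by (rule has_sum_cong[THEN iffD1, rotated]) (use assms in \<open>auto simp: lat_eq_0_iff\<close>)
  then have d: "(?d has_sum infsum ?d (- {0})) (- {0})" by (intro has_sum_infsum) (auto simp: summable_on_def)
  have "((\<lambda>j. ?d j * (w (t, x + lat dx j) - w (t, x)) + (- (V - w (t, x))) * ?d j) has_sum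
     (D_h P \<delta> dx \<alpha> \<beta> w (t, x) + (- (V - w (t, x))) * infsum ?d (- {0}))) (- {0})"
    by (intro has_sum_add D_h_has_sum has_sum_cmult_right d)
  moreover have "?d j * (w (t, x + lat dx j) - w (t, x)) + (- (V - w (t, x))) * ?d j
     = ?d j * ((w((t, x) := V)) (t, x + lat dx j) - (w((t, x) := V)) (t, x))" if "j \<in> - {0}" for j
    using that assms by (auto simp: lat_eq_0_iff algebra_simps)
  ultimately have "((\<lambda>j. ?d j * ((w((t, x) := V)) (t, x + lat dx j) - (w((t, x) := V)) (t, x))) has_sum
     (D_h P \<delta> dx \<alpha> \<beta> w (t, x) + (- (V - w (t, x))) * infsum ?d (- {0}))) (- {0})"
    by (rule has_sum_cong[THEN iffD1, rotated])
  from has_sum_unique[OF D_h_has_sum this] show ?thesis by (simp only: mult_minus_left add_uminus_conv_diff)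
qed

lemma J_h_update:
  assumes d: "0 < \<delta>" "\<delta> \<le> 1" "\<alpha> \<in> ctrlA P" "\<beta> \<in> ctrlB P" "(t, x) \<in> cyl T" and dx: "0 < dx"
    and tent: "tent_basis cN C1 C2 dx \<omega>" and w: "\<And>j. \<bar>w (t, x + lat dx j)\<bar> \<le> B"
  shows "J_h P \<omega> \<delta> dx \<alpha> \<beta> (w((t, x) := V)) (t, x) = J_h P \<omega> \<delta> dx \<alpha> \<beta> w (t, x) - (V - w (t, x)) * (\<Sum>\<^sub>\<infinity>j\<in>- {0}. kap P \<omega> \<delta> \<alpha> \<beta> (t, x) j)"
proof -
  let ?k = "kap P \<omega> \<delta> \<alpha> \<beta> (t, x)"
  note J = J_h_integral[OF d dx tent, where w = w and B = B, OF w]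
  have k: "(?k has_sum infsum ?k (- {0})) (- {0})"
    by (intro has_sum_infsum summable_on_subset_banach[OF J(4)]) auto
  have "((\<lambda>j. (w (t, x + lat dx j) - w (t, x)) * ?k j) has_sum J_h P \<omega> \<delta> dx \<alpha> \<beta> w (t, x)) (- {0})"
    using J(1) by (rule has_sum_cong_neutral[THEN iffD1, rotated -1]) auto
  from has_sum_add[OF this has_sum_cmult_right[OF k, of "- (V - w (t, x))"]]
  have "((\<lambda>j. ((w((t, x) := V)) (t, x + lat dx j) - (w((t, x) := V)) (t, x)) * ?k j) has_sum
     (J_h P \<omega> \<delta> dx \<alpha> \<beta> w (t, x) + (- (V - w (t, x))) * infsum ?k (- {0}))) UNIV"
    by (rule has_sum_cong_neutral[THEN iffD1, rotated -1]) (use dx in \<open>auto simp: lat_eq_0_iff algebra_simps\<close>)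
  then have "J_h P \<omega> \<delta> dx \<alpha> \<beta> (w((t, x) := V)) (t, x) = J_h P \<omega> \<delta> dx \<alpha> \<beta> w (t, x) + (- (V - w (t, x))) * infsum ?k (- {0})"
    unfolding J_h_def prod.case by (rule infsumI)
  then show ?thesis by (simp only: mult_minus_left add_uminus_conv_diff)
qed

end

section \<open>One step of the scheme\<close>

text \<open>The bound B on U is qualitative: it confines maxima and keeps expressions finite but
  enters none of the final constants.\<close>

locale scheme_bounds = isaacs_bounds P T A \<sigma> \<rho> u0
  for P :: "('a::metric_space, 'b::metric_space, 'n::finite, 'm::finite) isaacs" and T A \<sigma> \<rho> u0 +
  fixes \<omega> :: "int^'n \<Rightarrow> real^'n \<Rightarrow> real" and cN C1 C2 \<delta> \<theta> \<theta>' dt dx :: real and MT :: nat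
    and U :: "real \<times> (real^'n) \<Rightarrow> real" and B :: real
  assumes tent: "tent_basis cN C1 C2 dx \<omega>" and C2A: "C2 \<le> A"
    and dx: "0 < dx" "dx \<le> \<delta>" and \<delta>1: "\<delta> \<le> 1" and \<theta>: "0 \<le> \<theta>" "\<theta> \<le> 1" "0 \<le> \<theta>'" "\<theta>' \<le> 1"
    and MT: "0 < MT" and dt_eq: "dt = T / real MT" and cfl: "CFL P \<omega> \<delta> \<theta> \<theta>' dt dx MT"
    and sch: "scheme_sol P \<omega> \<delta> \<theta> \<theta>' dt dx MT U"
    and UB: "\<And>n j. n \<le> MT \<Longrightarrow> \<bar>U (tm dt n, lat dx j)\<bar> \<le> B" and U0: "\<And>j. U (0, lat dx j) = u0 (lat dx j)"
begin

lemma \<delta>: "0 < \<delta>" "\<delta> \<le> 1"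
  using dx \<delta>1 by auto

lemma dt: "0 < dt" "dt \<le> T"
proof -
  show "0 < dt" using T MT by (simp add: dt_eq)
  have "1 \<le> real MT" using MT by simp
  then show "dt \<le> T" unfolding dt_eq using T divide_left_mono[of 1 "real MT" T] by simp
qed

lemma tm_bounds: "n \<le> MT \<Longrightarrow> 0 \<le> tm dt n \<and> tm dt n \<le> T"
  using dt T MT mult_right_mono[of "real n" "real MT" dt] by (simp add: tm_def dt_eq)

lemma tm_cyl: "n \<le> MT \<Longrightarrow> (tm dt n, x) \<in> cyl T"
  using tm_bounds by (simp add: cyl_def)

lemma tm_diff: "1 \<le> n \<Longrightarrow> tm dt n = tm dt (n - 1) + dt"
  by (simp add: tm_def of_nat_diff algebra_simps)

text \<open>The source is left out to make this homogeneous in V, so that the sign s can be pulled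
  through.\<close>

definition scheme_lin :: "'a \<Rightarrow> 'b \<Rightarrow> nat \<Rightarrow> int^'n \<Rightarrow> (real \<times> (real^'n) \<Rightarrow> real) \<Rightarrow> real" where
  "scheme_lin \<alpha> \<beta> n i V =
     zeroth P \<alpha> \<beta> (tm dt n, lat dx i) * V (tm dt (n - 1), lat dx i)
     - \<theta> * D_h P \<delta> dx \<alpha> \<beta> V (tm dt n, lat dx i) - (1 - \<theta>) * D_h P \<delta> dx \<alpha> \<beta> V (tm dt (n - 1), lat dx i)
     - \<theta>' * J_h P \<omega> \<delta> dx \<alpha> \<beta> V (tm dt n, lat dx i) - (1 - \<theta>') * J_h P \<omega> \<delta> dx \<alpha> \<beta> V (tm dt (n - 1), lat dx i)"

lemma D_h_cmult: "D_h P \<delta> dx \<alpha> \<beta> (\<lambda>p. c * V p) p = c * D_h P \<delta> dx \<alpha> \<beta> V p"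
  by (cases p) (simp add: D_h_def sum_distrib_left right_diff_distrib[symmetric] distrib_left mult_ac)

lemma J_h_cmult: "J_h P \<omega> \<delta> dx \<alpha> \<beta> (\<lambda>p. c * V p) p = c * J_h P \<omega> \<delta> dx \<alpha> \<beta> V p"
  by (cases p) (simp add: J_h_def right_diff_distrib[symmetric] mult.assoc infsum_cmult_right')

lemma scheme_lin_cmult: "scheme_lin \<alpha> \<beta> n i (\<lambda>p. c * V p) = c * scheme_lin \<alpha> \<beta> n i V"
  unfolding scheme_lin_def D_h_cmult J_h_cmult by (simp add: algebra_simps)

text \<open>Under the CFL condition the scheme is monotone in the value at the previous time level, which may
  therefore be raised to the value of the test function before the operators are estimated.\<close>

lemma discrete_ge:
  assumes n: "1 \<le> n" "n \<le> MT" and ab: "\<alpha> \<in> ctrlA P" "\<beta> \<in> ctrlB P"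
    and VB: "\<And>k j. k \<le> MT \<Longrightarrow> \<bar>V (tm dt k, lat dx j)\<bar> \<le> B'"
    and ub: "\<And>k z j. k \<in> {n - 1, n} \<Longrightarrow> \<delta> < norm z \<Longrightarrow> V (tm dt k, lat dx j) \<le> a z + \<tau> k + \<phi> (lat dx j - \<zeta> z)"
    and ub0: "\<And>k j. k \<in> {n - 1, n} \<Longrightarrow> V (tm dt k, lat dx j) \<le> a0 + \<tau> k + \<phi> (lat dx j - \<zeta>0)"
    and eq: "V (tm dt n, lat dx i) = a0 + \<tau> n + \<phi> (lat dx i - \<zeta>0)"
    and C2: "C2_on UNIV \<phi> g H" "\<And>x. norm (H x) \<le> L"
    and int: "\<And>k. k \<in> {n - 1, n} \<Longrightarrow> integrable (far \<delta>)
      (\<lambda>z. a z - a0 + \<phi> (lat dx i + jump P \<alpha> \<beta> (tm dt k, lat dx i) z - \<zeta> z) - \<phi> (lat dx i - \<zeta>0))"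
    and G: "\<And>k. G k = (\<integral>z. a z - a0 + \<phi> (lat dx i + jump P \<alpha> \<beta> (tm dt k, lat dx i) z - \<zeta> z) - \<phi> (lat dx i - \<zeta>0) \<partial>far \<delta>)"
    and b: "\<And>k. b k = b_tilde P \<delta> \<alpha> \<beta> (tm dt k, lat dx i) \<bullet> g (lat dx i - \<zeta>0)"
  shows "\<tau> n - \<tau> (n - 1) + dt * (zeroth P \<alpha> \<beta> (tm dt n, lat dx i) * (a0 + \<tau> (n - 1) + \<phi> (lat dx i - \<zeta>0))
      - (\<theta> * b n + (1 - \<theta>) * b (n - 1)) - (\<theta>' * G n + (1 - \<theta>') * G (n - 1))
      - L * (2 * A\<^sup>2 * hscale \<sigma> \<delta> * dx + A\<^sup>2 * \<delta> powr (- \<sigma>) * dx\<^sup>2))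
    \<le> V (tm dt n, lat dx i) - V (tm dt (n - 1), lat dx i) + dt * scheme_lin \<alpha> \<beta> n i V"
proof -
  define x s t where "x = lat dx i" and "s = tm dt (n - 1)" and "t = tm dt n"
  have st: "t = s + dt" unfolding s_def t_def using n by (intro tm_diff)
  then have nst: "s \<noteq> t" using dt by simp
  have cyl: "(s, x) \<in> cyl T" "(t, x) \<in> cyl T" unfolding s_def t_def using n by (auto intro: tm_cyl)
  define Vs where "Vs = a0 + \<tau> (n - 1) + \<phi> (x - \<zeta>0)"
  define V' where "V' = V((s, x) := Vs)"
  define e1 e2 where "e1 = 2 * A\<^sup>2 * hscale \<sigma> \<delta> * dx" and "e2 = A\<^sup>2 * \<delta> powr (- \<sigma>) * dx\<^sup>2"
  have L: "0 \<le> L" using C2(2)[of 0] norm_ge_zero order_trans by blast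
  have xl: "x + lat dx j = lat dx (i + j)" for j by (simp add: x_def lat_add)
  have xax: "x + dx *\<^sub>R axis k 1 = lat dx (i + axis k 1)" "x - dx *\<^sub>R axis k 1 = lat dx (i + - axis k 1)" for k
    unfolding lat_add lat_axis x_def by auto
  have eqt: "V (t, x) = a0 + \<tau> n + \<phi> (x - \<zeta>0)" using eq by (simp add: t_def x_def)
  have VBt: "\<bar>V (t, x + lat dx j)\<bar> \<le> B'" "\<bar>V (s, x + lat dx j)\<bar> \<le> B'" for j
    unfolding xl t_def s_def using n by (auto intro: VB)
  have tayl: "\<phi> (x + v - \<zeta>0) \<le> \<phi> (x - \<zeta>0) + g (x - \<zeta>0) \<bullet> v + L * (norm v)\<^sup>2" for v
    using taylor1[OF C2, of "x + v - \<zeta>0" "x - \<zeta>0"] by simp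
  have V'0: "V' (s, lat dx j) \<le> a0 + \<tau> (n - 1) + \<phi> (lat dx j - \<zeta>0)" for j
    using ub0[of "n - 1" j] by (simp add: V'_def Vs_def s_def)
  \<comment> \<open>At x itself the bound is imported from level n: there V touches its majorant
    centred at \<open>\<zeta>0\<close>, hence this majorant lies below the one belonging to z, and
    the difference of the two does not involve \<tau>.\<close>
  have V'z: "V' (s, lat dx j) \<le> a z + \<tau> (n - 1) + \<phi> (lat dx j - \<zeta> z)" if z: "\<delta> < norm z" for z j
  proof (cases "lat dx j = x")
    case True
    then show ?thesis using ub[OF _ z, of n i] eqt by (simp add: V'_def Vs_def x_def t_def)
  next
    case False
    then show ?thesis using ub[OF _ z, of "n - 1" j] by (simp add: V'_def s_def)
  qed
  have gap: "0 \<le> Vs - V (s, x)" using ub0[of "n - 1" i] by (simp add: Vs_def s_def x_def)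
  have Dt: "D_h P \<delta> dx \<alpha> \<beta> V (t, x) \<le> b n + L * e1"
    unfolding b t_def[symmetric] x_def[symmetric] e1_def
    by (rule D_h_le[OF \<delta> ab cyl(2) dx(1), where c = "a0 + \<tau> n" and \<phi> = "\<lambda>y. \<phi> (y - \<zeta>0)"])
      (use eqt ub0[of n] L tayl in \<open>auto simp: xax t_def\<close>)
  have Ds: "D_h P \<delta> dx \<alpha> \<beta> V' (s, x) \<le> b (n - 1) + L * e1"
    unfolding b s_def[symmetric] x_def[symmetric] e1_def
    by (rule D_h_le[OF \<delta> ab cyl(1) dx(1), where c = "a0 + \<tau> (n - 1)" and \<phi> = "\<lambda>y. \<phi> (y - \<zeta>0)"])
      (use V'0 L tayl in \<open>auto simp: xax V'_def Vs_def\<close>)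
  have Jt: "J_h P \<omega> \<delta> dx \<alpha> \<beta> V (t, x) \<le> G n + L * e2"
  proof -
    have e: "(\<lambda>z. (a z + \<tau> n) + \<phi> (x + jump P \<alpha> \<beta> (t, x) z - \<zeta> z) - V (t, x))
      = (\<lambda>z. a z - a0 + \<phi> (x + jump P \<alpha> \<beta> (t, x) z - \<zeta> z) - \<phi> (x - \<zeta>0))"
      unfolding eqt by (auto simp: fun_eq_iff)
    have "J_h P \<omega> \<delta> dx \<alpha> \<beta> V (t, x) \<le> (\<integral>z. (a z + \<tau> n) + \<phi> (x + jump P \<alpha> \<beta> (t, x) z - \<zeta> z) - V (t, x) \<partial>far \<delta>) + L * (A\<^sup>2 * \<delta> powr (- \<sigma>) * dx\<^sup>2)"
    proof (rule J_h_le[OF \<delta> ab cyl(2) dx(1) tent C2A, where w = V and B = B' and \<phi> = \<phi> and g = g and H = H and L = L and a = "\<lambda>z. a z + \<tau> n" and \<zeta> = \<zeta>, OF VBt(1) C2])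
      show "V (t, x + lat dx j) \<le> a z + \<tau> n + \<phi> (x + lat dx j - \<zeta> z)" if "\<delta> < norm z" for z j
        unfolding xl t_def using that by (intro ub) auto
      show "integrable (far \<delta>) (\<lambda>z. (a z + \<tau> n) + \<phi> (x + jump P \<alpha> \<beta> (t, x) z - \<zeta> z) - V (t, x))"
        unfolding e using int[of n] by (simp add: t_def x_def)
    qed
    then show ?thesis unfolding e unfolding G e2_def t_def x_def .
  qed
  have V'B: "\<bar>V' (s, x + lat dx j)\<bar> \<le> max B' \<bar>Vs\<bar>" for j
    using VBt(2)[of j] by (auto simp: V'_def)
  have Js: "J_h P \<omega> \<delta> dx \<alpha> \<beta> V' (s, x) \<le> G (n - 1) + L * e2"
  proof -
    have e: "(\<lambda>z. (a z + \<tau> (n - 1)) + \<phi> (x + jump P \<alpha> \<beta> (s, x) z - \<zeta> z) - V' (s, x))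
      = (\<lambda>z. a z - a0 + \<phi> (x + jump P \<alpha> \<beta> (s, x) z - \<zeta> z) - \<phi> (x - \<zeta>0))"
      by (auto simp: fun_eq_iff V'_def Vs_def)
    have "J_h P \<omega> \<delta> dx \<alpha> \<beta> V' (s, x) \<le> (\<integral>z. (a z + \<tau> (n - 1)) + \<phi> (x + jump P \<alpha> \<beta> (s, x) z - \<zeta> z) - V' (s, x) \<partial>far \<delta>) + L * (A\<^sup>2 * \<delta> powr (- \<sigma>) * dx\<^sup>2)"
    proof (rule J_h_le[OF \<delta> ab cyl(1) dx(1) tent C2A, where w = V' and B = "max B' \<bar>Vs\<bar>" and \<phi> = \<phi> and g = g and H = H and L = L and a = "\<lambda>z. a z + \<tau> (n - 1)" and \<zeta> = \<zeta>, OF V'B C2])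
      show "V' (s, x + lat dx j) \<le> a z + \<tau> (n - 1) + \<phi> (x + lat dx j - \<zeta> z)" if "\<delta> < norm z" for z j
        unfolding xl using that by (rule V'z)
      show "integrable (far \<delta>) (\<lambda>z. (a z + \<tau> (n - 1)) + \<phi> (x + jump P \<alpha> \<beta> (s, x) z - \<zeta> z) - V' (s, x))"
        unfolding e using int[of "n - 1"] by (simp add: s_def x_def)
    qed
    then show ?thesis unfolding e unfolding G e2_def s_def x_def .
  qed
  define Sd Sk c where "Sd = (\<Sum>\<^sub>\<infinity>j\<in>- {0}. d_coeff P \<delta> dx \<alpha> \<beta> (s, x) j)" and "Sk = (\<Sum>\<^sub>\<infinity>j\<in>- {0}. kap P \<omega> \<delta> \<alpha> \<beta> (s, x) j)"
    and "c = zeroth P \<alpha> \<beta> (t, x)"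
  have Du: "D_h P \<delta> dx \<alpha> \<beta> V' (s, x) = D_h P \<delta> dx \<alpha> \<beta> V (s, x) - (Vs - V (s, x)) * Sd"
    unfolding V'_def Sd_def by (rule D_h_update[OF dx(1)])
  have Ju: "J_h P \<omega> \<delta> dx \<alpha> \<beta> V' (s, x) = J_h P \<omega> \<delta> dx \<alpha> \<beta> V (s, x) - (Vs - V (s, x)) * Sk"
    unfolding V'_def Sk_def by (rule J_h_update[OF \<delta> ab cyl(1) dx(1) tent, where w = V and B = B', OF VBt(2)])
  have cf: "dt * ((1 - \<theta>) * Sd + (1 - \<theta>') * Sk + c) \<le> 1"
    using cfl ab n unfolding CFL_def Sd_def Sk_def c_def s_def t_def x_def by auto
  define Dt' Ds' Jt' Js' gp where "Dt' = D_h P \<delta> dx \<alpha> \<beta> V (t, x)" and "Ds' = D_h P \<delta> dx \<alpha> \<beta> V' (s, x)"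
    and "Jt' = J_h P \<omega> \<delta> dx \<alpha> \<beta> V (t, x)" and "Js' = J_h P \<omega> \<delta> dx \<alpha> \<beta> V' (s, x)" and "gp = Vs - V (s, x)"
  have Dsv: "D_h P \<delta> dx \<alpha> \<beta> V (s, x) = Ds' + gp * Sd" and Jsv: "J_h P \<omega> \<delta> dx \<alpha> \<beta> V (s, x) = Js' + gp * Sk"
    and Vsv: "V (s, x) = Vs - gp" using Du Ju by (auto simp: Ds'_def Js'_def gp_def)
  \<comment> \<open>The coefficient of \<open>gp\<close> is the slack in the CFL condition, hence
    nonnegative, as is \<open>gp\<close> itself. Raising the old value therefore costs
    nothing.\<close>
  have "V (t, x) - V (s, x) + dt * scheme_lin \<alpha> \<beta> n i V
     = \<tau> n - \<tau> (n - 1) + gp * (1 - dt * ((1 - \<theta>) * Sd + (1 - \<theta>') * Sk + c))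
       + dt * (c * Vs - (\<theta> * Dt' + (1 - \<theta>) * Ds') - (\<theta>' * Jt' + (1 - \<theta>') * Js'))"
    unfolding scheme_lin_def t_def[symmetric] s_def[symmetric] x_def[symmetric] Dsv Jsv Vsv c_def[symmetric] Dt'_def[symmetric] Jt'_def[symmetric] eqt
    unfolding Vs_def by (simp add: algebra_simps)
  moreover have "0 \<le> gp * (1 - dt * ((1 - \<theta>) * Sd + (1 - \<theta>') * Sk + c))"
    using gap cf by (auto simp: gp_def)
  moreover have "dt * (c * Vs - (\<theta> * b n + (1 - \<theta>) * b (n - 1)) - (\<theta>' * G n + (1 - \<theta>') * G (n - 1)) - L * (e1 + e2))
    \<le> dt * (c * Vs - (\<theta> * Dt' + (1 - \<theta>) * Ds') - (\<theta>' * Jt' + (1 - \<theta>') * Js'))"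
  proof (rule mult_left_mono)
    have 1: "\<theta> * Dt' + (1 - \<theta>) * Ds' \<le> \<theta> * (b n + L * e1) + (1 - \<theta>) * (b (n - 1) + L * e1)"
      by (intro add_mono mult_left_mono Dt[folded Dt'_def] Ds[folded Ds'_def]) (use \<theta> in auto)
    have 2: "\<theta>' * Jt' + (1 - \<theta>') * Js' \<le> \<theta>' * (G n + L * e2) + (1 - \<theta>') * (G (n - 1) + L * e2)"
      by (intro add_mono mult_left_mono Jt[folded Jt'_def] Js[folded Js'_def]) (use \<theta> in auto)
    show "c * Vs - (\<theta> * b n + (1 - \<theta>) * b (n - 1)) - (\<theta>' * G n + (1 - \<theta>') * G (n - 1)) - L * (e1 + e2)
      \<le> c * Vs - (\<theta> * Dt' + (1 - \<theta>) * Ds') - (\<theta>' * Jt' + (1 - \<theta>') * Js')"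
      using 1 2 by (simp add: algebra_simps)
  qed (use dt in simp)
  ultimately have "\<tau> n - \<tau> (n - 1) + dt * (c * Vs - (\<theta> * b n + (1 - \<theta>) * b (n - 1)) - (\<theta>' * G n + (1 - \<theta>') * G (n - 1)) - L * (e1 + e2))
    \<le> V (t, x) - V (s, x) + dt * scheme_lin \<alpha> \<beta> n i V" by linarith
  then show ?thesis unfolding c_def Vs_def e1_def e2_def t_def s_def x_def .
qed

lemma scheme_lin_bounded:
  assumes n: "1 \<le> n" "n \<le> MT"
  shows "\<exists>C. \<forall>\<alpha>\<in>ctrlA P. \<forall>\<beta>\<in>ctrlB P. \<bar>scheme_lin \<alpha> \<beta> n i U\<bar> \<le> C"
proof -
  let ?C = "A * (2 * A * hscale \<sigma> \<delta> * (2 * B / dx))" and ?D = "2 * B * (A * \<delta> powr (- \<sigma>))"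
  have "\<bar>scheme_lin \<alpha> \<beta> n i U\<bar> \<le> A * B + ?C + ?C + ?D + ?D" if ab: "\<alpha> \<in> ctrlA P" "\<beta> \<in> ctrlB P" for \<alpha> \<beta>
  proof -
    have xax: "lat dx i + dx *\<^sub>R axis k 1 = lat dx (i + axis k 1)" "lat dx i - dx *\<^sub>R axis k 1 = lat dx (i + - axis k 1)" for k
      unfolding lat_add lat_axis by auto
    have D: "\<bar>D_h P \<delta> dx \<alpha> \<beta> U (tm dt k, lat dx i)\<bar> \<le> ?C" if "k \<le> MT" for k
      by (rule D_h_bounded[OF \<delta> ab tm_cyl[OF that] dx(1)]) (auto simp: xax intro!: UB that)
    have J: "\<bar>J_h P \<omega> \<delta> dx \<alpha> \<beta> U (tm dt k, lat dx i)\<bar> \<le> ?D" if "k \<le> MT" for k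
      by (rule J_h_bounded[OF \<delta> ab tm_cyl[OF that] dx(1) tent]) (auto simp: lat_add[symmetric] intro!: UB that)
    have q: "\<bar>r * X\<bar> \<le> M" if "0 \<le> r" "r \<le> 1" "\<bar>X\<bar> \<le> M" for r X M :: real
    proof -
      have "\<bar>r * X\<bar> \<le> 1 * M" unfolding abs_mult using that by (intro mult_mono) auto
      then show ?thesis by simp
    qed
    have "\<bar>zeroth P \<alpha> \<beta> (tm dt n, lat dx i) * U (tm dt (n - 1), lat dx i)\<bar> \<le> A * B"
      unfolding abs_mult using zeroth[OF ab tm_cyl[OF n(2)], of "lat dx i"] UB[of "n - 1" i] n A by (intro mult_mono) auto
    moreover have "\<bar>\<theta> * D_h P \<delta> dx \<alpha> \<beta> U (tm dt n, lat dx i)\<bar> \<le> ?C" "\<bar>(1 - \<theta>) * D_h P \<delta> dx \<alpha> \<beta> U (tm dt (n - 1), lat dx i)\<bar> \<le> ?C"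
      "\<bar>\<theta>' * J_h P \<omega> \<delta> dx \<alpha> \<beta> U (tm dt n, lat dx i)\<bar> \<le> ?D" "\<bar>(1 - \<theta>') * J_h P \<omega> \<delta> dx \<alpha> \<beta> U (tm dt (n - 1), lat dx i)\<bar> \<le> ?D"
      by (intro q D J; use \<theta> n in simp)+
    moreover have "\<bar>a1 - a2 - a3 - a4 - a5\<bar> \<le> c1 + c2 + c3 + c4 + c5"
      if "\<bar>a1\<bar> \<le> c1" "\<bar>a2\<bar> \<le> c2" "\<bar>a3\<bar> \<le> c3" "\<bar>a4\<bar> \<le> c4" "\<bar>a5\<bar> \<le> c5" for a1 a2 a3 a4 a5 c1 c2 c3 c4 c5 :: real
      using that by linarith
    ultimately show ?thesis unfolding scheme_lin_def by blast
  qed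
  then show ?thesis by blast
qed

text \<open>The difference quotient in time does not depend on the controls, so it may be moved
  through the inf-sup; in this way a bound for each pair of controls becomes an inequality for the
  inf-sup that the scheme prescribes.\<close>

lemma scheme_step:
  assumes n: "1 \<le> n" "n \<le> MT" and s: "s = 1 \<or> s = - 1"
    and le: "\<And>\<alpha> \<beta>. \<alpha> \<in> ctrlA P \<Longrightarrow> \<beta> \<in> ctrlB P \<Longrightarrow>
      dt * R \<alpha> \<beta> \<le> s * U (tm dt n, lat dx i) - s * U (tm dt (n - 1), lat dx i) + dt * scheme_lin \<alpha> \<beta> n i (\<lambda>p. s * U p)"
    and R: "\<And>\<alpha> \<beta>. \<alpha> \<in> ctrlA P \<Longrightarrow> \<beta> \<in> ctrlB P \<Longrightarrow> \<bar>R \<alpha> \<beta>\<bar> \<le> C"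
  shows "s * (INF \<alpha>\<in>ctrlA P. SUP \<beta>\<in>ctrlB P. - src P \<alpha> \<beta> (tm dt (n - 1), lat dx i) + s * R \<alpha> \<beta>) \<le> 0"
proof -
  define D where "D = U (tm dt n, lat dx i) - U (tm dt (n - 1), lat dx i)"
  let ?F = "\<lambda>\<alpha> \<beta>. - src P \<alpha> \<beta> (tm dt (n - 1), lat dx i) + scheme_lin \<alpha> \<beta> n i U"
  have "n \<in> {1..MT}" using n by simp
  with sch have "U (tm dt n, lat dx i) = U (tm dt (n - 1), lat dx i) - dt *
      (INF \<alpha>\<in>ctrlA P. SUP \<beta>\<in>ctrlB P. ?F \<alpha> \<beta>)"
    unfolding scheme_sol_def Let_def scheme_lin_def by (simp add: add_diff_eq)
  then have I: "(INF \<alpha>\<in>ctrlA P. SUP \<beta>\<in>ctrlB P. ?F \<alpha> \<beta>) = - D / dt" using dt by (simp add: D_def field_simps)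
  obtain C' where C': "\<And>\<alpha> \<beta>. \<alpha> \<in> ctrlA P \<Longrightarrow> \<beta> \<in> ctrlB P \<Longrightarrow> \<bar>scheme_lin \<alpha> \<beta> n i U\<bar> \<le> C'"
    using scheme_lin_bounded[OF n] by blast
  have cyl: "(tm dt (n - 1), lat dx i) \<in> cyl T" using n by (intro tm_cyl) simp
  have ss: "s * s = 1" "\<bar>s\<bar> = 1" using s by auto
  have "s * (INF \<alpha>\<in>ctrlA P. SUP \<beta>\<in>ctrlB P. - src P \<alpha> \<beta> (tm dt (n - 1), lat dx i) + s * R \<alpha> \<beta>)
    \<le> s * (INF \<alpha>\<in>ctrlA P. SUP \<beta>\<in>ctrlB P. ?F \<alpha> \<beta>) + s * D / dt"
  proof (rule INF_SUP_signed_mono[OF ne s])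
    fix \<alpha> \<beta> assume ab: "\<alpha> \<in> ctrlA P" "\<beta> \<in> ctrlB P"
    show "\<bar>- src P \<alpha> \<beta> (tm dt (n - 1), lat dx i) + s * R \<alpha> \<beta>\<bar> \<le> A + C"
      using src[OF ab cyl] R[OF ab] ss by (intro order_trans[OF abs_triangle_ineq] add_mono) (auto simp: abs_mult)
    show "\<bar>?F \<alpha> \<beta>\<bar> \<le> A + C'"
      using src[OF ab cyl] C'[OF ab] by (intro order_trans[OF abs_triangle_ineq] add_mono) auto
    have "dt * R \<alpha> \<beta> \<le> s * D + dt * (s * scheme_lin \<alpha> \<beta> n i U)"
      using le[OF ab] by (simp add: scheme_lin_cmult D_def right_diff_distrib)
    then have "dt * R \<alpha> \<beta> \<le> dt * (s * D / dt + s * scheme_lin \<alpha> \<beta> n i U)"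
      using dt by (simp add: distrib_left)
    then have "R \<alpha> \<beta> \<le> s * D / dt + s * scheme_lin \<alpha> \<beta> n i U" using dt by (simp only: mult_le_cancel_left_pos)
    moreover have "s * (s * R \<alpha> \<beta>) = R \<alpha> \<beta>" using ss by (simp add: mult.assoc[symmetric])
    ultimately show "s * (- src P \<alpha> \<beta> (tm dt (n - 1), lat dx i) + s * R \<alpha> \<beta>) \<le> s * ?F \<alpha> \<beta> + s * D / dt"
      unfolding distrib_left by linarith
  qed
  then show ?thesis unfolding I by simp
qed

end

section \<open>Nonlocal operators at a touching point\<close>

context isaacs_bounds
begin

text \<open>\<nu> lives on the punctured space, so the set has to be cut down to it before its
  indicator is measurable.\<close>

lemma indicator_norm_measurable:
  fixes f :: "_ \<Rightarrow> real"
  assumes "{x. Q x} \<in> sets borel" "f \<in> borel_measurable (levy P)"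
  shows "(\<lambda>z. indicator {z. Q (norm z)} z *\<^sub>R f z) \<in> borel_measurable (levy P)"
proof -
  have "(\<lambda>z. indicator ({z. Q (norm z)} \<inter> space (levy P)) z *\<^sub>R f z) \<in> borel_measurable (levy P)"
    using sets_levy_norm[OF assms(1)] assms(2) by measurable
  then show ?thesis by (rule measurable_cong[THEN iffD1, rotated]) (auto simp: indicator_def)
qed

lemma integrable_increment:
  assumes \<delta>: "0 < \<delta>" "\<delta> \<le> 1" and ab: "\<alpha> \<in> ctrlA P" "\<beta> \<in> ctrlB P" and p: "p \<in> cyl T"
    and V: "continuous_on UNIV v" "\<And>y. \<bar>v y\<bar> \<le> Bv"
  shows "integrable (far \<delta>) (\<lambda>z. v (y + jump P \<alpha> \<beta> p z) - v y)"
    "integrable (far \<delta>) (\<lambda>z. jump P \<alpha> \<beta> p z \<bullet> d)"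
    "(\<integral>z. v (y + jump P \<alpha> \<beta> p z) - v y - jump P \<alpha> \<beta> p z \<bullet> d \<partial>far \<delta>)
      = (\<integral>z. v (y + jump P \<alpha> \<beta> p z) - v y \<partial>far \<delta>) - mean_jump \<delta> \<alpha> \<beta> p \<bullet> d"
    "\<bar>\<integral>z. v (y + jump P \<alpha> \<beta> p z) - v y \<partial>far \<delta>\<bar> \<le> 2 * Bv * (A * \<delta> powr (- \<sigma>))"
proof -
  interpret finite_measure "far \<delta>" by (rule far_mass[OF \<delta>])
  have bd: "norm (v (y + jump P \<alpha> \<beta> p z) - v y) \<le> 2 * Bv" for z
    using V(2)[of "y + jump P \<alpha> \<beta> p z"] V(2)[of y] by (simp add: abs_le_iff)
  show 1: "integrable (far \<delta>) (\<lambda>z. v (y + jump P \<alpha> \<beta> p z) - v y)"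
    using jump_continuous_measurable[OF ab p V(1), of y] bd by (intro integrable_far_bounded[OF \<delta>, where B = "2 * Bv"]) auto
  show 2: "integrable (far \<delta>) (\<lambda>z. jump P \<alpha> \<beta> p z \<bullet> d)"
    by (intro integrable_inner_left jump_integrable \<delta> ab p)
  show "(\<integral>z. v (y + jump P \<alpha> \<beta> p z) - v y - jump P \<alpha> \<beta> p z \<bullet> d \<partial>far \<delta>)
      = (\<integral>z. v (y + jump P \<alpha> \<beta> p z) - v y \<partial>far \<delta>) - mean_jump \<delta> \<alpha> \<beta> p \<bullet> d"
    unfolding Bochner_Integration.integral_diff[OF 1 2] mean_jump_def
    by (simp add: integral_inner_left jump_integrable[OF \<delta> ab p])
  have Bv: "0 \<le> Bv" using V(2)[of y] by linarith
  have "\<bar>\<integral>z. v (y + jump P \<alpha> \<beta> p z) - v y \<partial>far \<delta>\<bar> \<le> (\<integral>z. 2 * Bv \<partial>far \<delta>)"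
    unfolding real_norm_def[symmetric]
    by (rule Bochner_Integration.integral_norm_bound_integral[OF 1 integrable_const bd])
  also have "\<dots> = 2 * Bv * measure (far \<delta>) (space (far \<delta>))" by simp
  also have "\<dots> \<le> 2 * Bv * (A * \<delta> powr (- \<sigma>))" using Bv by (intro mult_left_mono far_mass \<delta>) auto
  finally show "\<bar>\<integral>z. v (y + jump P \<alpha> \<beta> p z) - v y \<partial>far \<delta>\<bar> \<le> 2 * Bv * (A * \<delta> powr (- \<sigma>))" .
qed

text \<open>At a minimum of V - \<xi> the increments of V dominate those of \<xi>, so replacing V by
  \<xi> on any range of jumps only lowers the integral. Doing it everywhere gives the first bound,
  made for barriers; doing it inside \<delta> only gives the second, made for doubling, where the
  jumps of V outside \<delta> reappear in the scheme. The third is for finiteness of the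
  inf-sup.\<close>

lemma nonlocal_ge:
  assumes ab: "\<alpha> \<in> ctrlA P" "\<beta> \<in> ctrlB P" and p: "(t, y) \<in> cyl T" and \<kappa>: "0 < \<kappa>" "\<kappa> < 1"
    and V: "continuous_on UNIV (\<lambda>y. V (t, y))" "\<And>y. \<bar>V (t, y)\<bar> \<le> Bv" and \<xi>: "continuous_on UNIV (\<lambda>y. \<xi> (t, y))"
    and min: "\<And>y'. V (t, y) - \<xi> (t, y) \<le> V (t, y') - \<xi> (t, y')"
    and m: "integrable (levy P) m"
      "\<And>z. z \<noteq> 0 \<Longrightarrow> \<bar>\<xi> (t, y + jump P \<alpha> \<beta> (t, y) z) - \<xi> (t, y) - jump P \<alpha> \<beta> (t, y) z \<bullet> d\<bar> \<le> m z"
  shows "- (LINT z|levy P. m z) \<le> I_near P \<kappa> \<xi> d \<alpha> \<beta> (t, y) + I_far P \<kappa> V d \<alpha> \<beta> (t, y)"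
    and "\<kappa> \<le> \<delta> \<Longrightarrow> \<delta> \<le> 1 \<Longrightarrow>
      (\<integral>z. V (t, y + jump P \<alpha> \<beta> (t, y) z) - V (t, y) - jump P \<alpha> \<beta> (t, y) z \<bullet> d \<partial>far \<delta>) - (LINT z:{z. norm z \<le> \<delta>}|levy P. m z)
        \<le> I_near P \<kappa> \<xi> d \<alpha> \<beta> (t, y) + I_far P \<kappa> V d \<alpha> \<beta> (t, y)"
    and "\<bar>I_near P \<kappa> \<xi> d \<alpha> \<beta> (t, y) + I_far P \<kappa> V d \<alpha> \<beta> (t, y)\<bar>
      \<le> (LINT z|levy P. m z) + (2 * Bv * (A * (\<kappa> / 2) powr (- \<sigma>)) + norm d * (A * hscale \<sigma> (\<kappa> / 2)))"
proof -
  let ?\<eta> = "jump P \<alpha> \<beta> (t, y)"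
  define f1 f2 where "f1 = (\<lambda>z. \<xi> (t, y + ?\<eta> z) - \<xi> (t, y) - ?\<eta> z \<bullet> d)" and "f2 = (\<lambda>z. V (t, y + ?\<eta> z) - V (t, y) - ?\<eta> z \<bullet> d)"
  \<comment> \<open>The far operator includes the sphere |z| = \<kappa>, whereas \<open>far\<close>
    is cut off by a strict inequality; halving the radius catches the sphere.\<close>
  have k2: "0 < \<kappa> / 2" "\<kappa> / 2 \<le> 1" using \<kappa> by auto
  interpret fm: finite_measure "far (\<kappa> / 2)" by (rule far_mass[OF k2])
  have im: "(\<lambda>z. ?\<eta> z \<bullet> d) \<in> borel_measurable (levy P)"
    using jump_measurable[OF ab p] by measurable
  have f1m: "f1 \<in> borel_measurable (levy P)" and f2m: "f2 \<in> borel_measurable (levy P)"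
    unfolding f1_def f2_def
    using jump_continuous_measurable[OF ab p \<xi>, of y] jump_continuous_measurable[OF ab p V(1), of y] im by measurable
  have f12: "f1 z \<le> f2 z" for z using min[of "y + ?\<eta> z"] by (simp add: f1_def f2_def)
  have f1b: "\<bar>f1 z\<bar> \<le> m z" if "z \<noteq> 0" for z using m(2)[OF that] by (simp add: f1_def)
  have m0: "0 \<le> m z" if "z \<noteq> 0" for z using f1b[OF that] by linarith
  let ?N = "{z :: real^'m. norm z < \<kappa>}" and ?F = "{z :: real^'m. \<kappa> \<le> norm z}"
  define W1 W2 where "W1 = (\<lambda>z. indicator ?N z *\<^sub>R f1 z)" and "W2 = (\<lambda>z. indicator ?F z *\<^sub>R f2 z)"
  have near: "I_near P \<kappa> \<xi> d \<alpha> \<beta> (t, y) = integral\<^sup>L (levy P) W1"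
    unfolding I_near_def prod.case set_lebesgue_integral_def W1_def f1_def ..
  have farI: "I_far P \<kappa> V d \<alpha> \<beta> (t, y) = integral\<^sup>L (levy P) W2"
    unfolding I_far_def prod.case set_lebesgue_integral_def W2_def f2_def ..
  have W1m: "W1 \<in> borel_measurable (levy P)" and W2m: "W2 \<in> borel_measurable (levy P)"
    unfolding W1_def W2_def by (rule indicator_norm_measurable, measurable, rule f1m f2m)+
  have W1i: "integrable (levy P) W1"
    by (rule Bochner_Integration.integrable_bound[OF m(1) W1m], rule AE_I2)
      (use f1b m0 in \<open>auto simp: space_levy_iff W1_def indicator_def\<close>)
  define dom where "dom = (\<lambda>z. 2 * Bv + norm d * \<rho> z)"
  have domi: "integrable (far (\<kappa> / 2)) dom"
    unfolding dom_def by (intro Bochner_Integration.integrable_add fm.integrable_const Bochner_Integration.integrable_mult_right far_\<rho>(1) k2)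
  have domI: "integral\<^sup>L (far (\<kappa> / 2)) dom \<le> 2 * Bv * (A * (\<kappa> / 2) powr (- \<sigma>)) + norm d * (A * hscale \<sigma> (\<kappa> / 2))"
  proof -
    have Bv: "0 \<le> Bv" using V(2)[of y] by linarith
    have "integral\<^sup>L (far (\<kappa> / 2)) dom = 2 * Bv * measure (far (\<kappa> / 2)) (space (far (\<kappa> / 2))) + norm d * integral\<^sup>L (far (\<kappa> / 2)) \<rho>"
      unfolding dom_def
      by (subst Bochner_Integration.integral_add[OF fm.integrable_const Bochner_Integration.integrable_mult_right[OF far_\<rho>(1)[OF k2]]]) simp
    also have "\<dots> \<le> 2 * Bv * (A * (\<kappa> / 2) powr (- \<sigma>)) + norm d * (A * hscale \<sigma> (\<kappa> / 2))"
      using Bv by (intro add_mono mult_left_mono far_mass far_\<rho> k2) auto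
    finally show ?thesis .
  qed
  have domi': "integrable (levy P) (\<lambda>z. indicator {z. \<kappa> / 2 < norm z} z *\<^sub>R dom z)"
    using domi unfolding set_integrable_far[symmetric] set_integrable_def .
  have f2b: "\<bar>f2 z\<bar> \<le> dom z" if "z \<noteq> 0" for z
  proof -
    have "\<bar>?\<eta> z \<bullet> d\<bar> \<le> norm (?\<eta> z) * norm d" by (rule Cauchy_Schwarz_ineq2)
    also have "\<dots> \<le> \<rho> z * norm d" using jump[OF ab p that] by (intro mult_right_mono) auto
    finally have "\<bar>?\<eta> z \<bullet> d\<bar> \<le> norm d * \<rho> z" by (simp add: mult.commute)
    then show ?thesis using V(2)[of "y + ?\<eta> z"] V(2)[of y] unfolding f2_def dom_def by linarith
  qed
  have W2b: "norm (W2 z) \<le> indicator {z. \<kappa> / 2 < norm z} z *\<^sub>R dom z" if "z \<noteq> 0" for z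
  proof (cases "\<kappa> \<le> norm z")
    case True
    then show ?thesis using f2b[OF that] \<kappa> by (simp add: W2_def indicator_def)
  next
    case False
    have "0 \<le> dom z" using f2b[OF that] by linarith
    then show ?thesis using False by (simp add: W2_def indicator_def)
  qed
  have W2i: "integrable (levy P) W2"
  proof (rule Bochner_Integration.integrable_bound[OF domi' W2m], rule AE_I2)
    fix z assume "z \<in> space (levy P)"
    then have "norm (W2 z) \<le> indicator {z. \<kappa> / 2 < norm z} z *\<^sub>R dom z" using W2b space_levy_iff by auto
    then show "norm (W2 z) \<le> norm (indicator {z. \<kappa> / 2 < norm z} z *\<^sub>R dom z)" by simp
  qed
  have sum: "I_near P \<kappa> \<xi> d \<alpha> \<beta> (t, y) + I_far P \<kappa> V d \<alpha> \<beta> (t, y) = (LINT z|levy P. W1 z + W2 z)"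
    unfolding near farI by (rule Bochner_Integration.integral_add[symmetric, OF W1i W2i])
  have Wge: "f1 z \<le> W1 z + W2 z" for z using f12[of z] by (auto simp: W1_def W2_def indicator_def)
  have "(LINT z|levy P. - m z) \<le> (LINT z|levy P. W1 z + W2 z)"
  proof (rule integral_mono)
    fix z assume "z \<in> space (levy P)"
    then have "\<bar>f1 z\<bar> \<le> m z" using f1b space_levy_iff by auto
    then show "- m z \<le> W1 z + W2 z" using Wge[of z] by linarith
  qed (intro Bochner_Integration.integrable_add Bochner_Integration.integrable_minus m W1i W2i)+
  then show "- (LINT z|levy P. m z) \<le> I_near P \<kappa> \<xi> d \<alpha> \<beta> (t, y) + I_far P \<kappa> V d \<alpha> \<beta> (t, y)"
    unfolding sum by simp
  have "\<bar>integral\<^sup>L (levy P) W1\<bar> \<le> (LINT z|levy P. m z)"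
    unfolding real_norm_def[symmetric]
    by (rule Bochner_Integration.integral_norm_bound_integral[OF W1i m(1)])
      (use f1b m0 in \<open>auto simp: space_levy_iff W1_def indicator_def\<close>)
  moreover have "\<bar>integral\<^sup>L (levy P) W2\<bar> \<le> integral\<^sup>L (far (\<kappa> / 2)) dom"
    unfolding set_integral_far[symmetric] set_lebesgue_integral_def unfolding real_norm_def[symmetric]
    by (rule Bochner_Integration.integral_norm_bound_integral[OF W2i domi' W2b]) (simp add: space_levy_iff)
  ultimately show "\<bar>I_near P \<kappa> \<xi> d \<alpha> \<beta> (t, y) + I_far P \<kappa> V d \<alpha> \<beta> (t, y)\<bar>
      \<le> (LINT z|levy P. m z) + (2 * Bv * (A * (\<kappa> / 2) powr (- \<sigma>)) + norm d * (A * hscale \<sigma> (\<kappa> / 2)))"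
    unfolding near farI using domI by linarith
  show "(\<integral>z. V (t, y + ?\<eta> z) - V (t, y) - ?\<eta> z \<bullet> d \<partial>far \<delta>) - (LINT z:{z. norm z \<le> \<delta>}|levy P. m z)
        \<le> I_near P \<kappa> \<xi> d \<alpha> \<beta> (t, y) + I_far P \<kappa> V d \<alpha> \<beta> (t, y)" if \<delta>: "\<kappa> \<le> \<delta>" "\<delta> \<le> 1"
  proof -
    have d0: "0 < \<delta>" using \<delta> \<kappa> by simp
    have 1: "integrable (levy P) (\<lambda>z. indicator {z. \<delta> < norm z} z *\<^sub>R f2 z)"
      unfolding set_integrable_def[symmetric] set_integrable_far f2_def
      by (intro Bochner_Integration.integrable_diff integrable_increment[OF d0 \<delta>(2) ab p V])
    have 2: "integrable (levy P) (\<lambda>z. indicator {z. norm z \<le> \<delta>} z *\<^sub>R m z)"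
    proof (rule Bochner_Integration.integrable_bound[OF m(1)])
      show "(\<lambda>z. indicator {z. norm z \<le> \<delta>} z *\<^sub>R m z) \<in> borel_measurable (levy P)"
        by (rule indicator_norm_measurable) (use m(1) in \<open>auto\<close>)
    qed (auto simp: indicator_def)
    have "(\<integral>z. V (t, y + ?\<eta> z) - V (t, y) - ?\<eta> z \<bullet> d \<partial>far \<delta>) - (LINT z:{z. norm z \<le> \<delta>}|levy P. m z)
      = (LINT z|levy P. indicator {z. \<delta> < norm z} z *\<^sub>R f2 z - indicator {z. norm z \<le> \<delta>} z *\<^sub>R m z)"
      using Bochner_Integration.integral_diff[OF 1 2, symmetric]
      unfolding f2_def set_integral_far[symmetric] set_lebesgue_integral_def .
    also have "\<dots> \<le> (LINT z|levy P. W1 z + W2 z)"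
    proof (rule integral_mono)
      fix z assume "z \<in> space (levy P)"
      then have f: "\<bar>f1 z\<bar> \<le> m z" using f1b space_levy_iff by auto
      show "indicator {z. \<delta> < norm z} z *\<^sub>R f2 z - indicator {z. norm z \<le> \<delta>} z *\<^sub>R m z \<le> W1 z + W2 z"
      proof (cases "\<delta> < norm z")
        case True
        then show ?thesis using \<delta> by (simp add: W1_def W2_def indicator_def)
      next
        case False
        then show ?thesis using f Wge[of z] by (simp add: indicator_def)
      qed
    qed (intro Bochner_Integration.integrable_add Bochner_Integration.integrable_diff 1 2 W1i W2i)+
    finally show ?thesis unfolding sum .
  qed
qed

end

section \<open>The viscosity inequality\<close>

locale visc_bounds = isaacs_bounds P T A \<sigma> \<rho> u0
  for P :: "('a::metric_space, 'b::metric_space, 'n::finite, 'm::finite) isaacs" and T A \<sigma> \<rho> u0 +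
  fixes u :: "real \<times> (real^'n) \<Rightarrow> real"
  assumes sol: "visc_sol_ivp P T u0 u"
begin

lemma u_bounded: "\<exists>B. \<forall>q\<in>cyl T. \<bar>u q\<bar> \<le> B"
  using sol by (auto simp: visc_sol_ivp_def bounded_iff)

lemma u_cont: "continuous_on (cyl T) u"
  using sol by (simp add: visc_sol_ivp_def)

lemma u_init: "u (0, x) = u0 x"
  using sol by (simp add: visc_sol_ivp_def)

lemma u_section_cont: "t \<in> {0..T} \<Longrightarrow> continuous_on UNIV (\<lambda>y. s * u (t, y))"
  by (intro continuous_intros continuous_on_compose2[OF u_cont]) (auto simp: cyl_def)

lemma QT_cyl: "q \<in> QT T \<Longrightarrow> q \<in> cyl T"
  by (auto simp: QT_def cyl_def)

lemma I_near_cmult: "I_near P \<kappa> (\<lambda>p. c * \<xi> p) (c *\<^sub>R d) \<alpha> \<beta> p = c * I_near P \<kappa> \<xi> d \<alpha> \<beta> p"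
  by (cases p) (simp add: I_near_def set_lebesgue_integral_def right_diff_distrib[symmetric] mult.left_commute[of _ c])

lemma I_far_cmult: "I_far P \<kappa> (\<lambda>p. c * \<xi> p) (c *\<^sub>R d) \<alpha> \<beta> p = c * I_far P \<kappa> \<xi> d \<alpha> \<beta> p"
  by (cases p) (simp add: I_far_def set_lebesgue_integral_def right_diff_distrib[symmetric] mult.left_commute[of _ c])

text \<open>For s = 1 this rests on the supersolution inequality, for s = -1 on the subsolution
  inequality with test function -\<xi>. The inf-sup is not odd, so the sign is carried to
  \<open>s * Q\<close> inside it and the roles of the controls stay as they are. For each pair of
  controls Q may dominate either of two quantities: with all jumps given up to \<xi>, or only those
  inside \<delta>.\<close>

lemma visc_step:
  assumes s: "s = 1 \<or> s = - 1" and \<delta>: "0 < \<delta>" "\<delta> \<le> 1" and C2: "C2_grad (QT T) \<xi> g" and p: "(t, y) \<in> QT T"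
    and min: "\<And>q. q \<in> QT T \<Longrightarrow> s * u (t, y) - \<xi> (t, y) \<le> s * u q - \<xi> q"
    and d: "d = snd (g (t, y))" and m: "integrable (levy P) m"
      "\<And>\<alpha> \<beta> z. \<alpha> \<in> ctrlA P \<Longrightarrow> \<beta> \<in> ctrlB P \<Longrightarrow> z \<noteq> 0 \<Longrightarrow>
        \<bar>\<xi> (t, y + jump P \<alpha> \<beta> (t, y) z) - \<xi> (t, y) - jump P \<alpha> \<beta> (t, y) z \<bullet> d\<bar> \<le> m z"
    and Q: "\<And>\<alpha> \<beta>. \<alpha> \<in> ctrlA P \<Longrightarrow> \<beta> \<in> ctrlB P \<Longrightarrow>
        zeroth P \<alpha> \<beta> (t, y) * (s * u (t, y)) - drift P \<alpha> \<beta> (t, y) \<bullet> d + (LINT z|levy P. m z) \<le> Q \<alpha> \<beta> \<or>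
        zeroth P \<alpha> \<beta> (t, y) * (s * u (t, y)) - drift P \<alpha> \<beta> (t, y) \<bullet> d
         - ((\<integral>z. s * u (t, y + jump P \<alpha> \<beta> (t, y) z) - s * u (t, y) \<partial>far \<delta>) - mean_jump \<delta> \<alpha> \<beta> (t, y) \<bullet> d)
         + (LINT z:{z. norm z \<le> \<delta>}|levy P. m z) \<le> Q \<alpha> \<beta>"
    and QB: "\<And>\<alpha> \<beta>. \<alpha> \<in> ctrlA P \<Longrightarrow> \<beta> \<in> ctrlB P \<Longrightarrow> \<bar>Q \<alpha> \<beta>\<bar> \<le> CQ"
  shows "0 \<le> fst (g (t, y)) + s * (INF \<alpha>\<in>ctrlA P. SUP \<beta>\<in>ctrlB P. - src P \<alpha> \<beta> (t, y) + s * Q \<alpha> \<beta>)"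
proof -
  \<comment> \<open>The inequality needs a radius below 1 that does not exceed \<delta>; half of
    \<delta> qualifies even for \<delta> = 1.\<close>
  define \<kappa> where "\<kappa> = \<delta> / 2"
  have \<kappa>: "0 < \<kappa>" "\<kappa> < 1" "\<kappa> \<le> \<delta>" using \<delta> by (auto simp: \<kappa>_def)
  have pc: "(t, y) \<in> cyl T" and tT: "t \<in> {0..T}" using p by (auto simp: QT_def cyl_def)
  have ss: "s * s = 1" "\<bar>s\<bar> = 1" using s by auto
  obtain Bu where Bu: "\<And>q. q \<in> cyl T \<Longrightarrow> \<bar>u q\<bar> \<le> Bu" using u_bounded by blast
  have Vb: "\<bar>s * u (t, y)\<bar> \<le> Bu" for y using Bu[of "(t, y)"] tT ss by (simp add: abs_mult cyl_def)
  obtain H where H: "C2_on (QT T) \<xi> g H" using C2 by (auto simp: C2_grad_def)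
  have \<xi>c: "continuous_on UNIV (\<lambda>y. \<xi> (t, y))"
    by (intro continuous_on_compose2[OF C2_on_continuous(1)[OF H]] continuous_intros) (use p in \<open>auto simp: QT_def\<close>)
  have min': "s * u (t, y) - \<xi> (t, y) \<le> s * u (t, y') - \<xi> (t, y')" for y'
    using p by (intro min) (auto simp: QT_def)
  define N where "N = (\<lambda>\<alpha> \<beta>. I_near P \<kappa> \<xi> d \<alpha> \<beta> (t, y) + I_far P \<kappa> (\<lambda>p. s * u p) d \<alpha> \<beta> (t, y))"
  have NL: "- (LINT z|levy P. m z) \<le> N \<alpha> \<beta>"
    "((\<integral>z. s * u (t, y + jump P \<alpha> \<beta> (t, y) z) - s * u (t, y) \<partial>far \<delta>) - mean_jump \<delta> \<alpha> \<beta> (t, y) \<bullet> d)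
         - (LINT z:{z. norm z \<le> \<delta>}|levy P. m z) \<le> N \<alpha> \<beta>"
    "\<bar>N \<alpha> \<beta>\<bar> \<le> (LINT z|levy P. m z) + (2 * Bu * (A * (\<kappa> / 2) powr (- \<sigma>)) + norm d * (A * hscale \<sigma> (\<kappa> / 2)))"
    if ab: "\<alpha> \<in> ctrlA P" "\<beta> \<in> ctrlB P" for \<alpha> \<beta>
  proof -
    note R = nonlocal_ge[OF ab pc \<kappa>(1,2), where V = "\<lambda>p. s * u p" and Bv = Bu and \<xi> = \<xi> and m = m and d = d, OF u_section_cont[OF tT] Vb \<xi>c min' m(1) m(2)[OF ab]]
    show "- (LINT z|levy P. m z) \<le> N \<alpha> \<beta>" unfolding N_def by (rule R(1))
    show "((\<integral>z. s * u (t, y + jump P \<alpha> \<beta> (t, y) z) - s * u (t, y) \<partial>far \<delta>) - mean_jump \<delta> \<alpha> \<beta> (t, y) \<bullet> d)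
         - (LINT z:{z. norm z \<le> \<delta>}|levy P. m z) \<le> N \<alpha> \<beta>"
      using R(2)[OF _ \<kappa>(3) \<delta>(2)] unfolding N_def integrable_increment(3)[OF \<delta> ab pc u_section_cont[OF tT] Vb] by simp
    show "\<bar>N \<alpha> \<beta>\<bar> \<le> (LINT z|levy P. m z) + (2 * Bu * (A * (\<kappa> / 2) powr (- \<sigma>)) + norm d * (A * hscale \<sigma> (\<kappa> / 2)))"
      unfolding N_def by (rule R(3))
  qed
  define X where "X = (\<lambda>\<alpha> \<beta>. zeroth P \<alpha> \<beta> (t, y) * (s * u (t, y)) - drift P \<alpha> \<beta> (t, y) \<bullet> d - N \<alpha> \<beta>)"
  obtain CN where CN: "\<And>\<alpha> \<beta>. \<alpha> \<in> ctrlA P \<Longrightarrow> \<beta> \<in> ctrlB P \<Longrightarrow> \<bar>N \<alpha> \<beta>\<bar> \<le> CN"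
    using NL(3) by blast
  have XB: "\<bar>X \<alpha> \<beta>\<bar> \<le> A * Bu + A * norm d + CN" if ab: "\<alpha> \<in> ctrlA P" "\<beta> \<in> ctrlB P" for \<alpha> \<beta>
  proof -
    have "\<bar>zeroth P \<alpha> \<beta> (t, y) * (s * u (t, y))\<bar> \<le> A * Bu"
      unfolding abs_mult[of "zeroth P \<alpha> \<beta> (t, y)"] using zeroth[OF ab pc] Vb[of y] A by (intro mult_mono) auto
    moreover have "\<bar>drift P \<alpha> \<beta> (t, y) \<bullet> d\<bar> \<le> A * norm d"
      by (rule order_trans[OF Cauchy_Schwarz_ineq2 mult_right_mono[OF drift[OF ab pc]]]) simp
    ultimately show ?thesis unfolding X_def using CN[OF ab] by linarith
  qed
  have XQ: "X \<alpha> \<beta> \<le> Q \<alpha> \<beta>" if ab: "\<alpha> \<in> ctrlA P" "\<beta> \<in> ctrlB P" for \<alpha> \<beta>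
    using Q[OF ab]
  proof
    assume "zeroth P \<alpha> \<beta> (t, y) * (s * u (t, y)) - drift P \<alpha> \<beta> (t, y) \<bullet> d + (LINT z|levy P. m z) \<le> Q \<alpha> \<beta>"
    then show ?thesis using NL(1)[OF ab] unfolding X_def by linarith
  next
    assume "zeroth P \<alpha> \<beta> (t, y) * (s * u (t, y)) - drift P \<alpha> \<beta> (t, y) \<bullet> d
         - ((\<integral>z. s * u (t, y + jump P \<alpha> \<beta> (t, y) z) - s * u (t, y) \<partial>far \<delta>) - mean_jump \<delta> \<alpha> \<beta> (t, y) \<bullet> d)
         + (LINT z:{z. norm z \<le> \<delta>}|levy P. m z) \<le> Q \<alpha> \<beta>"
    then show ?thesis using NL(2)[OF ab] unfolding X_def by linarith
  qed
  have op: "visc_op P \<kappa> u (\<lambda>p. s * \<xi> p) (\<lambda>p. s *\<^sub>R g p) (t, y)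
    = s * fst (g (t, y)) + (INF \<alpha>\<in>ctrlA P. SUP \<beta>\<in>ctrlB P. - src P \<alpha> \<beta> (t, y) + s * X \<alpha> \<beta>)"
  proof -
    have "- src P \<alpha> \<beta> (t, y) + zeroth P \<alpha> \<beta> (t, y) * u (t, y) - drift P \<alpha> \<beta> (t, y) \<bullet> snd (s *\<^sub>R g (t, y))
        - I_near P \<kappa> (\<lambda>p. s * \<xi> p) (snd (s *\<^sub>R g (t, y))) \<alpha> \<beta> (t, y) - I_far P \<kappa> u (snd (s *\<^sub>R g (t, y))) \<alpha> \<beta> (t, y)
      = - src P \<alpha> \<beta> (t, y) + s * X \<alpha> \<beta>" for \<alpha> \<beta>
    proof -
      have 1: "I_far P \<kappa> u (s *\<^sub>R d) \<alpha> \<beta> (t, y) = s * I_far P \<kappa> (\<lambda>p. s * u p) d \<alpha> \<beta> (t, y)"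
        using I_far_cmult[of \<kappa> s "\<lambda>p. s * u p" d \<alpha> \<beta> "(t, y)"] ss by (simp add: mult.assoc[symmetric])
      have 2: "s * (zeroth P \<alpha> \<beta> (t, y) * (s * u (t, y))) = zeroth P \<alpha> \<beta> (t, y) * u (t, y)"
        using s by auto
      show ?thesis
        unfolding X_def N_def right_diff_distrib distrib_left 2 snd_scaleR d[symmetric] I_near_cmult 1 inner_scaleR_right by linarith
    qed
    then show ?thesis unfolding visc_op_def by (simp only: fst_scaleR real_scaleR_def)
  qed
  have C2s: "\<exists>H. C2_on (QT T) (\<lambda>p. s * \<xi> p) (\<lambda>p. s *\<^sub>R g p) H" using C2_grad_cmult[OF C2, of s] by (simp add: C2_grad_def)
  have "0 \<le> s * visc_op P \<kappa> u (\<lambda>p. s * \<xi> p) (\<lambda>p. s *\<^sub>R g p) (t, y)"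
    using s
  proof
    assume s1: "s = 1"
    have "\<forall>q\<in>QT T. u (t, y) - s * \<xi> (t, y) \<le> u q - s * \<xi> q" using min s1 by auto
    then show ?thesis using sol C2s \<kappa> p s1 unfolding visc_sol_ivp_def visc_supersol_def by auto
  next
    assume s1: "s = - 1"
    have "\<forall>q\<in>QT T. u q - s * \<xi> q \<le> u (t, y) - s * \<xi> (t, y)" using min s1 by fastforce
    then have "visc_op P \<kappa> u (\<lambda>p. s * \<xi> p) (\<lambda>p. s *\<^sub>R g p) (t, y) \<le> 0"
      using sol C2s \<kappa> p unfolding visc_sol_ivp_def visc_subsol_def by auto
    then show ?thesis using s1 by simp
  qed
  then have "0 \<le> s * s * fst (g (t, y)) + s * (INF \<alpha>\<in>ctrlA P. SUP \<beta>\<in>ctrlB P. - src P \<alpha> \<beta> (t, y) + s * X \<alpha> \<beta>)"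
    unfolding op by (simp add: distrib_left)
  also have "s * (INF \<alpha>\<in>ctrlA P. SUP \<beta>\<in>ctrlB P. - src P \<alpha> \<beta> (t, y) + s * X \<alpha> \<beta>)
    \<le> s * (INF \<alpha>\<in>ctrlA P. SUP \<beta>\<in>ctrlB P. - src P \<alpha> \<beta> (t, y) + s * Q \<alpha> \<beta>) + 0"
  proof (rule INF_SUP_signed_mono[OF ne s])
    fix \<alpha> \<beta> assume ab: "\<alpha> \<in> ctrlA P" "\<beta> \<in> ctrlB P"
    show "\<bar>- src P \<alpha> \<beta> (t, y) + s * X \<alpha> \<beta>\<bar> \<le> A + (A * Bu + A * norm d + CN)"
      using src[OF ab pc] XB[OF ab] ss by (intro order_trans[OF abs_triangle_ineq] add_mono) (auto simp: abs_mult)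
    show "\<bar>- src P \<alpha> \<beta> (t, y) + s * Q \<alpha> \<beta>\<bar> \<le> A + CQ"
      using src[OF ab pc] QB[OF ab] ss by (intro order_trans[OF abs_triangle_ineq] add_mono) (auto simp: abs_mult)
    have "s * (s * X \<alpha> \<beta>) \<le> s * (s * Q \<alpha> \<beta>)" using XQ[OF ab] ss by (simp add: mult.assoc[symmetric])
    then show "s * (- src P \<alpha> \<beta> (t, y) + s * X \<alpha> \<beta>) \<le> s * (- src P \<alpha> \<beta> (t, y) + s * Q \<alpha> \<beta>) + 0"
      unfolding distrib_left by linarith
  qed
  finally show ?thesis using ss by simp
qed

end

section \<open>Barriers at the initial time\<close>

lemma signed_one_abs:
  fixes s :: real
  assumes "s = 1 \<or> s = - 1"
  shows "s * s = 1" "\<bar>s\<bar> = 1" "\<bar>s * x\<bar> = \<bar>x\<bar>"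
  using assms by auto

lemma soft_norm_increment:
  assumes "0 < r"
  shows "\<bar>soft_norm r (q + v) - soft_norm r q\<bar> \<le> 3 * norm v"
proof -
  have "\<bar>v \<bullet> soft_grad r q\<bar> \<le> norm v * 1"
    by (rule order_trans[OF Cauchy_Schwarz_ineq2 mult_left_mono[OF norm_soft_grad[OF assms]]]) simp
  then show ?thesis using soft_norm_diff[OF assms, of q v] by (simp add: min_le_iff_disj) linarith
qed

context isaacs_bounds
begin

lemma A_le: "A \<le> A\<^sup>2" "A\<^sup>2 \<le> A^3" "1 \<le> A\<^sup>2" "1 \<le> A^3"
  using A power_increasing[of 1 2 A] power_increasing[of 2 3 A] power_increasing[of 0 2 A] power_increasing[of 0 3 A] by auto

lemma far_le_levy:
  fixes f :: "_ \<Rightarrow> real"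
  assumes f: "integrable (levy P) f" "\<And>z. z \<noteq> 0 \<Longrightarrow> 0 \<le> f z"
  shows "integrable (far \<delta>) f" "integral\<^sup>L (far \<delta>) f \<le> (LINT z|levy P. f z)"
proof -
  have j: "integrable (levy P) (\<lambda>z. indicator {z. \<delta> < norm z} z *\<^sub>R f z)"
  proof (rule Bochner_Integration.integrable_bound[OF f(1)])
    show "(\<lambda>z. indicator {z. \<delta> < norm z} z *\<^sub>R f z) \<in> borel_measurable (levy P)"
      by (rule indicator_norm_measurable[where Q = "\<lambda>x. \<delta> < x"]) (use f(1) in auto)
  qed (auto simp: indicator_def)
  then show "integrable (far \<delta>) f" unfolding set_integrable_far[symmetric] set_integrable_def .
  have "(LINT z|levy P. indicator {z. \<delta> < norm z} z *\<^sub>R f z) \<le> (LINT z|levy P. f z)"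
    by (rule integral_mono[OF j f(1)]) (use f(2) in \<open>auto simp: indicator_def space_levy_iff\<close>)
  then show "integral\<^sup>L (far \<delta>) f \<le> (LINT z|levy P. f z)"
    unfolding set_integral_far[symmetric] set_lebesgue_integral_def .
qed

text \<open>A bound for the second order increments of \<open>soft_norm r\<close> that is uniform in
  the controls and in the base point.\<close>

definition soft_majorant :: "real \<Rightarrow> real^'m \<Rightarrow> real" where
  "soft_majorant r z = min ((\<rho> z)\<^sup>2 / r) (2 * \<rho> z)"

lemma soft_majorant:
  assumes "0 < r"
  shows "integrable (levy P) (soft_majorant r)" "(LINT z|levy P. soft_majorant r z) \<le> A * hscale \<sigma> r"
    "z \<noteq> 0 \<Longrightarrow> 0 \<le> soft_majorant r z"
  using mom assms \<rho>_nonneg[of z] unfolding levy_moments_def soft_majorant_def[abs_def] by auto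

lemma soft_jump_pointwise:
  assumes r: "0 < r" and ab: "\<alpha> \<in> ctrlA P" "\<beta> \<in> ctrlB P" and p: "p \<in> cyl T" and z: "z \<noteq> 0"
  shows "0 \<le> soft_norm r (q + jump P \<alpha> \<beta> p z) - soft_norm r q - jump P \<alpha> \<beta> p z \<bullet> soft_grad r q"
    "soft_norm r (q + jump P \<alpha> \<beta> p z) - soft_norm r q - jump P \<alpha> \<beta> p z \<bullet> soft_grad r q \<le> soft_majorant r z"
proof -
  let ?v = "jump P \<alpha> \<beta> p z"
  note J = jump[OF ab p z]
  show "0 \<le> soft_norm r (q + ?v) - soft_norm r q - ?v \<bullet> soft_grad r q" by (rule soft_norm_diff(1)[OF r])
  have "min ((norm ?v)\<^sup>2 / r) (2 * norm ?v) \<le> soft_majorant r z"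
    unfolding soft_majorant_def using J r by (intro min.mono divide_right_mono power_mono) auto
  then show "soft_norm r (q + ?v) - soft_norm r q - ?v \<bullet> soft_grad r q \<le> soft_majorant r z"
    using soft_norm_diff(2)[OF r, of q ?v] by linarith
qed

text \<open>Only the second order remainder is estimated. The compensator is left standing because
  \<open>b_tilde\<close> contains it with the opposite sign.\<close>

lemma soft_jump_integral:
  assumes r: "0 < r" and \<delta>: "0 < \<delta>" "\<delta> \<le> 1" and ab: "\<alpha> \<in> ctrlA P" "\<beta> \<in> ctrlB P" and p: "p \<in> cyl T"
  shows "integrable (far \<delta>) (\<lambda>z. soft_norm r (q + jump P \<alpha> \<beta> p z) - soft_norm r q)" (is "integrable _ ?w")
    "(\<integral>z. soft_norm r (q + jump P \<alpha> \<beta> p z) - soft_norm r q \<partial>far \<delta>) \<le> mean_jump \<delta> \<alpha> \<beta> p \<bullet> soft_grad r q + A * hscale \<sigma> r"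
proof -
  let ?\<eta> = "jump P \<alpha> \<beta> p"
  obtain H :: "real^'n \<Rightarrow> _" where "C2_on UNIV (soft_norm r) (soft_grad r) H" using C2_on_soft_norm[OF r] by blast
  from C2_on_continuous(1)[OF this] have c: "continuous_on UNIV (soft_norm r :: real^'n \<Rightarrow> real)" .
  show i: "integrable (far \<delta>) ?w"
  proof (rule Bochner_Integration.integrable_bound[OF Bochner_Integration.integrable_mult_right[OF far_\<rho>(1)[OF \<delta>], of 3]])
    show "?w \<in> borel_measurable (far \<delta>)"
      by (rule measurable_far) (use jump_continuous_measurable[OF ab p c, of q] in measurable)
    show "AE z in far \<delta>. norm (?w z) \<le> norm (3 * \<rho> z)"
    proof (rule AE_I2)
      fix z assume "z \<in> space (far \<delta>)"
      then have z: "z \<noteq> 0" using \<delta> by (auto simp: space_far)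
      show "norm (?w z) \<le> norm (3 * \<rho> z)"
        using soft_norm_increment[OF r, of q "?\<eta> z"] jump[OF ab p z] \<rho>_nonneg[OF z] by simp
    qed
  qed
  have j: "integrable (far \<delta>) (\<lambda>z. ?\<eta> z \<bullet> soft_grad r q)" by (intro integrable_inner_left jump_integrable \<delta> ab p)
  have M: "integrable (far \<delta>) (soft_majorant r)" "integral\<^sup>L (far \<delta>) (soft_majorant r) \<le> (LINT z|levy P. soft_majorant r z)"
    using far_le_levy[OF soft_majorant(1)[OF r], of \<delta>] soft_majorant(3)[OF r] by blast+
  have "(\<integral>z. ?w z \<partial>far \<delta>) - mean_jump \<delta> \<alpha> \<beta> p \<bullet> soft_grad r q = (\<integral>z. ?w z - ?\<eta> z \<bullet> soft_grad r q \<partial>far \<delta>)"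
    unfolding Bochner_Integration.integral_diff[OF i j] mean_jump_def
    by (simp add: integral_inner_left jump_integrable[OF \<delta> ab p])
  also have "\<dots> \<le> integral\<^sup>L (far \<delta>) (soft_majorant r)"
  proof (rule integral_mono[OF Bochner_Integration.integrable_diff[OF i j]])
    show "integrable (far \<delta>) (soft_majorant r)" by (rule M(1))
    fix z assume "z \<in> space (far \<delta>)"
    then have z: "z \<noteq> 0" using \<delta> by (auto simp: space_far)
    show "?w z - ?\<eta> z \<bullet> soft_grad r q \<le> soft_majorant r z" by (rule soft_jump_pointwise(2)[OF r ab p z])
  qed
  also have "\<dots> \<le> A * hscale \<sigma> r" using M(2) soft_majorant(2)[OF r] by linarith
  finally show "(\<integral>z. ?w z \<partial>far \<delta>) \<le> mean_jump \<delta> \<alpha> \<beta> p \<bullet> soft_grad r q + A * hscale \<sigma> r" by simp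
qed

text \<open>Comparison with the zero family: a quantity R independent of the controls leaves the
  inf-sup at the price of the source bound A.\<close>

lemma signed_INF_SUP_const_bounds:
  assumes s: "s = 1 \<or> s = - 1" and p: "p \<in> cyl T"
  shows "s * (INF \<alpha>\<in>ctrlA P. SUP \<beta>\<in>ctrlB P. - src P \<alpha> \<beta> p + s * R) \<le> A + R"
    "R - A \<le> s * (INF \<alpha>\<in>ctrlA P. SUP \<beta>\<in>ctrlB P. - src P \<alpha> \<beta> p + s * R)"
proof -
  have z: "(INF \<alpha>\<in>ctrlA P. SUP \<beta>\<in>ctrlB P. (0::real)) = 0" using ne by simp
  note S = signed_one_abs[OF s]
  have B: "\<bar>- src P \<alpha> \<beta> p + s * R\<bar> \<le> A + \<bar>R\<bar>" if "\<alpha> \<in> ctrlA P" "\<beta> \<in> ctrlB P" for \<alpha> \<beta>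
    using src[OF that p] S(3)[of R] by linarith
  have e: "s * (- src P \<alpha> \<beta> p + s * R) = R - s * src P \<alpha> \<beta> p" for \<alpha> \<beta>
    using s by (auto simp: algebra_simps)
  have sb: "\<bar>s * src P \<alpha> \<beta> p\<bar> \<le> A" if "\<alpha> \<in> ctrlA P" "\<beta> \<in> ctrlB P" for \<alpha> \<beta>
    using src[OF that p] S(3) by simp
  have "s * (INF \<alpha>\<in>ctrlA P. SUP \<beta>\<in>ctrlB P. - src P \<alpha> \<beta> p + s * R) \<le> s * (INF \<alpha>\<in>ctrlA P. SUP \<beta>\<in>ctrlB P. 0) + (A + R)"
  proof (rule INF_SUP_signed_mono[OF ne s B, where C' = 0])
    fix \<alpha> \<beta> assume ab: "\<alpha> \<in> ctrlA P" "\<beta> \<in> ctrlB P"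
    show "s * (- src P \<alpha> \<beta> p + s * R) \<le> s * 0 + (A + R)" unfolding e using sb[OF ab] by linarith
  qed auto
  then show "s * (INF \<alpha>\<in>ctrlA P. SUP \<beta>\<in>ctrlB P. - src P \<alpha> \<beta> p + s * R) \<le> A + R" unfolding z by simp
  have "s * (INF \<alpha>\<in>ctrlA P. SUP \<beta>\<in>ctrlB P. 0) \<le> s * (INF \<alpha>\<in>ctrlA P. SUP \<beta>\<in>ctrlB P. - src P \<alpha> \<beta> p + s * R) + (A - R)"
  proof (rule INF_SUP_signed_mono[OF ne s, where C = 0, rotated])
    fix \<alpha> \<beta> assume ab: "\<alpha> \<in> ctrlA P" "\<beta> \<in> ctrlB P"
    show "\<bar>- src P \<alpha> \<beta> p + s * R\<bar> \<le> A + \<bar>R\<bar>" by (rule B[OF ab])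
    show "s * 0 \<le> s * (- src P \<alpha> \<beta> p + s * R) + (A - R)" unfolding e using sb[OF ab] by linarith
  qed auto
  then show "R - A \<le> s * (INF \<alpha>\<in>ctrlA P. SUP \<beta>\<in>ctrlB P. - src P \<alpha> \<beta> p + s * R)" unfolding z by simp
qed

end

section \<open>The barrier for the viscosity solution\<close>

context visc_bounds
begin

text \<open>The barrier starts below the initial data by their Lipschitz bound and then sinks at
  speed E. At a negative minimum of the difference, \<open>s * u\<close> lies below the barrier and
  hence below A, so the zeroth order term is at most A^2 although no quantitative bound for u is
  known yet.\<close>

lemma u_initial:
  assumes s: "s = 1 \<or> s = - 1" and r: "0 < r" and q1: "(t1, y0) \<in> cyl T"
  shows "s * u0 y0 - A * r - 10 * A\<^sup>2 * hscale \<sigma> r * t1 \<le> s * u (t1, y0)"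
proof -
  \<comment> \<open>Source, zeroth order term, drift and jumps each contribute at most
    \<open>A\<^sup>2 * hscale \<sigma> r\<close>; any factor above 4 makes the contradiction
    strict.\<close>
  define E where "E = 10 * A\<^sup>2 * hscale \<sigma> r"
  have h1: "1 \<le> hscale \<sigma> r" by (rule hscale_ge1)
  have E0: "0 \<le> E" using h1 by (simp add: E_def)
  define \<xi> where "\<xi> = (\<lambda>q :: real \<times> (real^'n). (s * u0 y0 + (- E) * fst q) + (- A) * soft_norm r (snd q - y0))"
  define g where "g = (\<lambda>q :: real \<times> (real^'n). (- E, 0) + (- A) *\<^sub>R (0, soft_grad r (snd q - y0)))"
  define f where "f = (\<lambda>q. s * u q - \<xi> q)"
  note S = signed_one_abs[OF s]
  obtain H :: "real^'n \<Rightarrow> (real^'n) \<Rightarrow>\<^sub>L (real^'n)" where H: "C2_on UNIV (soft_norm r) (soft_grad r) H" using C2_on_soft_norm[OF r] by blast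
  have C2w: "C2_grad UNIV (\<lambda>y. soft_norm r (y - y0)) (\<lambda>y. soft_grad r (y - y0))"
    using C2_on_shift[OF H] by (auto simp: C2_grad_def)
  have C2: "C2_grad S' \<xi> g" for S'
  proof -
    have "C2_grad S' (\<lambda>q :: real \<times> (real^'n). s * u0 y0 + (- E) * fst q) (\<lambda>q. (- E, 0))"
      by (rule C2_grad_time[where \<tau>'' = "\<lambda>_. 0"]) (auto intro!: derivative_eq_intros)
    from C2_grad_add[OF this C2_grad_cmult[OF C2_grad_space[OF C2w], of S' "- A"]]
    show ?thesis unfolding \<xi>_def g_def .
  qed
  obtain Bu where Bu: "\<And>q. q \<in> cyl T \<Longrightarrow> \<bar>u q\<bar> \<le> Bu" using u_bounded by blast
  have "0 \<le> f q0" if q0: "q0 \<in> cyl T" for q0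
  proof (rule ccontr)
    assume "\<not> 0 \<le> f q0"
    then have neg: "f q0 < 0" by simp
    \<comment> \<open>Where the difference is negative, A |y - y0| is at most Bu + A. So the infimum
      over the unbounded cylinder is attained on this compact set.\<close>
    define K where "K = {0..T} \<times> cball y0 (Bu + A)"
    have out: "q \<in> K" if q: "q \<in> cyl T" "f q < 0" for q
    proof -
      obtain t y where ty: "q = (t, y)" by fastforce
      have t: "0 \<le> t" "t \<le> T" using q ty by (auto simp: cyl_def)
      have "0 \<le> E * t" using E0 t by simp
      have "norm (y - y0) * 1 \<le> norm (y - y0) * A" using A by (intro mult_left_mono) auto
      also have "\<dots> \<le> A * soft_norm r (y - y0)" using soft_norm_ge(1)[of "y - y0" r] A by (simp add: mult.commute mult_left_mono)
      also have "\<dots> \<le> Bu + A"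
        using q(2) S(3)[of "u q"] S(3)[of "u0 y0"] Bu[OF q(1)] u0[of y0] \<open>0 \<le> E * t\<close> unfolding f_def \<xi>_def ty by simp
      finally have "norm (y - y0) \<le> Bu + A" by simp
      then show ?thesis using t by (simp add: K_def ty dist_norm norm_minus_commute)
    qed
    have Kc: "K \<subseteq> cyl T" by (auto simp: K_def cyl_def)
    have fc: "continuous_on K f"
      unfolding f_def
    proof (intro continuous_intros)
      show "continuous_on K u" by (rule continuous_on_subset[OF u_cont Kc])
      obtain H' where "C2_on K \<xi> g H'" using C2[of K] by (auto simp: C2_grad_def)
      then show "continuous_on K \<xi>" by (rule C2_on_continuous(1))
    qed
    have "compact K" "K \<noteq> {}" using out[OF q0 neg] by (auto simp: K_def intro: compact_Times)
    from continuous_attains_inf[OF this fc] obtain p where p: "p \<in> K" "\<And>q. q \<in> K \<Longrightarrow> f p \<le> f q" by auto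
    have fp: "f p < 0" using p(2)[OF out[OF q0 neg]] neg by linarith
    have pmin: "f p \<le> f q" if "q \<in> cyl T" for q
      using p(2) out[OF that] fp by (cases "f q < 0") auto
    obtain t y where ty: "p = (t, y)" by fastforce
    have pc: "(t, y) \<in> cyl T" using p Kc ty by auto
    have t0: "t \<noteq> 0"
    proof
      assume "t = 0"
      then have "f p = s * u0 y - s * u0 y0 + A * soft_norm r (y - y0)" by (simp add: f_def \<xi>_def ty u_init)
      moreover have "s * u0 y - s * u0 y0 \<ge> - (A * norm (y - y0))"
        using S(3)[of "u0 y - u0 y0"] u0_lip[of y y0] by (simp add: right_diff_distrib)
      moreover have "A * norm (y - y0) \<le> A * soft_norm r (y - y0)" using A soft_norm_ge(1) by (intro mult_left_mono) auto
      ultimately show False using fp by linarith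
    qed
    have pQ: "(t, y) \<in> QT T" using pc t0 by (auto simp: QT_def cyl_def)
    define d where "d = (- A) *\<^sub>R soft_grad r (y - y0)"
    have nd: "norm d \<le> A" using norm_soft_grad[OF r, of "y - y0"] A mult_left_le[of "norm (soft_grad r (y - y0))" A] by (simp add: d_def)
    have R: "0 \<le> fst (g (t, y)) + s * (INF \<alpha>\<in>ctrlA P. SUP \<beta>\<in>ctrlB P. - src P \<alpha> \<beta> (t, y) + s * (3 * A\<^sup>2 * hscale \<sigma> r))"
    \<comment> \<open>All jumps are given up to the barrier, through the first alternative for Q, so
      the choice \<delta> = 1 is arbitrary.\<close>
    proof (rule visc_step[OF s _ _ C2 pQ, where \<delta> = 1 and m = "\<lambda>z. A * soft_majorant r z" and d = d and CQ = "\<bar>3 * A\<^sup>2 * hscale \<sigma> r\<bar>"])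
      fix q :: "real \<times> (real^'n)" assume "q \<in> QT T"
      then show "s * u (t, y) - \<xi> (t, y) \<le> s * u q - \<xi> q" using pmin[OF QT_cyl] by (simp add: f_def ty)
    next
      show "d = snd (g (t, y))" by (simp add: d_def g_def)
      show "integrable (levy P) (\<lambda>z. A * soft_majorant r z)" using soft_majorant(1)[OF r] by simp
    next
      fix \<alpha> \<beta> and z :: "real^'m" assume ab: "\<alpha> \<in> ctrlA P" "\<beta> \<in> ctrlB P" and z: "z \<noteq> 0"
      let ?v = "jump P \<alpha> \<beta> (t, y) z" and ?q = "y - y0"
      define D where "D = soft_norm r (?q + ?v) - soft_norm r ?q - ?v \<bullet> soft_grad r ?q"
      have "\<xi> (t, y + ?v) - \<xi> (t, y) - ?v \<bullet> d = - (A * D)"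
        unfolding \<xi>_def d_def D_def by (simp add: algebra_simps)
      moreover have "0 \<le> D" "D \<le> soft_majorant r z" unfolding D_def by (rule soft_jump_pointwise[OF r ab pc z])+
      ultimately show "\<bar>\<xi> (t, y + ?v) - \<xi> (t, y) - ?v \<bullet> d\<bar> \<le> A * soft_majorant r z"
        using A by (simp add: abs_mult)
    next
      fix \<alpha> \<beta> assume ab: "\<alpha> \<in> ctrlA P" "\<beta> \<in> ctrlB P"
      have t: "0 \<le> t" using pc by (auto simp: cyl_def)
      have "0 \<le> E * t" "0 \<le> A * soft_norm r (y - y0)"
        using E0 t A soft_norm_ge(3)[OF r, of "y - y0"] by auto
      then have "\<xi> p \<le> A" using S(3)[of "u0 y0"] u0[of y0] unfolding \<xi>_def ty by simp
      then have "s * u (t, y) \<le> A" using fp by (simp add: f_def ty)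
      then have "zeroth P \<alpha> \<beta> (t, y) * (s * u (t, y)) \<le> zeroth P \<alpha> \<beta> (t, y) * A" using zeroth[OF ab pc] by (intro mult_left_mono) auto
      also have "\<dots> \<le> A * A" using zeroth[OF ab pc] A by (intro mult_right_mono) auto
      finally have 1: "zeroth P \<alpha> \<beta> (t, y) * (s * u (t, y)) \<le> A\<^sup>2" by (simp add: power2_eq_square)
      have "\<bar>drift P \<alpha> \<beta> (t, y) \<bullet> d\<bar> \<le> A * A"
        using Cauchy_Schwarz_ineq2[of "drift P \<alpha> \<beta> (t, y)" d] mult_mono[OF drift[OF ab pc] nd] A by simp
      then have 2: "- (drift P \<alpha> \<beta> (t, y) \<bullet> d) \<le> A\<^sup>2" by (simp add: power2_eq_square)
      have "(LINT z|levy P. A * soft_majorant r z) = A * (LINT z|levy P. soft_majorant r z)" by simp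
      also have "\<dots> \<le> A * (A * hscale \<sigma> r)" using soft_majorant(2)[OF r] A by (intro mult_left_mono) auto
      finally have 3: "(LINT z|levy P. A * soft_majorant r z) \<le> A\<^sup>2 * hscale \<sigma> r" by (simp add: power2_eq_square mult_ac)
      have "A\<^sup>2 * 1 \<le> A\<^sup>2 * hscale \<sigma> r" using h1 by (intro mult_left_mono) auto
      then show "zeroth P \<alpha> \<beta> (t, y) * (s * u (t, y)) - drift P \<alpha> \<beta> (t, y) \<bullet> d + (LINT z|levy P. A * soft_majorant r z) \<le> 3 * A\<^sup>2 * hscale \<sigma> r \<or>
        zeroth P \<alpha> \<beta> (t, y) * (s * u (t, y)) - drift P \<alpha> \<beta> (t, y) \<bullet> d
         - ((\<integral>z. s * u (t, y + jump P \<alpha> \<beta> (t, y) z) - s * u (t, y) \<partial>far 1) - mean_jump 1 \<alpha> \<beta> (t, y) \<bullet> d)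
         + (LINT z:{z. norm z \<le> 1}|levy P. A * soft_majorant r z) \<le> 3 * A\<^sup>2 * hscale \<sigma> r"
        using 1 2 3 by (intro disjI1) linarith
    qed auto
    have "E \<le> A + 3 * A\<^sup>2 * hscale \<sigma> r"
      using R signed_INF_SUP_const_bounds(1)[OF s pc, of "3 * A\<^sup>2 * hscale \<sigma> r"] by (simp add: g_def)
    moreover have "A \<le> A\<^sup>2 * hscale \<sigma> r" using A_le(1) mult_mono[of "A\<^sup>2" "A\<^sup>2" 1 "hscale \<sigma> r"] h1 by simp
    moreover have "0 < A\<^sup>2 * hscale \<sigma> r" using A h1 by simp
    ultimately show False unfolding E_def by linarith
  qed
  from this[OF q1] show ?thesis using r by (simp add: f_def \<xi>_def E_def)
qed

text \<open>The barrier with r = 1: since \<open>hscale \<sigma> 1\<close> \<le> 2 and t \<le> A,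
  the slope costs 20 A^3, and the initial value and the offset A r cost A each.\<close>

lemma u_le: "q \<in> cyl T \<Longrightarrow> \<bar>u q\<bar> \<le> 22 * A^3"
proof -
  assume q: "q \<in> cyl T"
  obtain t y where ty: "q = (t, y)" by fastforce
  have t: "0 \<le> t" "t \<le> A" using q ty T by (auto simp: cyl_def)
  have h: "hscale \<sigma> 1 \<le> 2" by (simp add: hscale_def)
  define X where "X = 10 * A\<^sup>2 * hscale \<sigma> 1 * t"
  have "X \<le> 10 * A\<^sup>2 * 2 * A" unfolding X_def using h t hscale_ge1[of \<sigma> 1] A by (intro mult_mono) auto
  also have "\<dots> = 20 * A^3" by (simp add: power3_eq_cube power2_eq_square)
  finally have "X \<le> 20 * A^3" .
  moreover have "A \<le> A^3" using A_le by linarith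
  moreover have "u0 y - A - X \<le> u (t, y)" "- u0 y - A - X \<le> - u (t, y)"
    using u_initial[of 1 1 t y] u_initial[of "- 1" 1 t y] q unfolding ty X_def by simp_all
  ultimately show ?thesis using u0[of y] unfolding ty by linarith
qed

end

section \<open>The barrier for the scheme\<close>

context scheme_bounds
begin

text \<open>The discrete counterpart of \<open>u_initial\<close>, with two further costs: the time
  mismatch \<open>hscale \<sigma> \<delta> * dt\<close> of the compensator, and the upwind and
  interpolation errors multiplied by the Hessian of the barrier, which is of order A / r. At a
  positive maximum the majorant is at least -A, so the zeroth order term is at least -A^2.\<close>

lemma U_initial:
  assumes s: "s = 1 \<or> s = - 1" and r: "0 < r" and n1: "n1 \<le> MT"
  shows "s * U (tm dt n1, lat dx i0) \<le> s * u0 (lat dx i0) + A * r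
    + 10 * A^3 * (hscale \<sigma> r + hscale \<sigma> \<delta> * dt + (hscale \<sigma> \<delta> * dx + \<delta> powr (- \<sigma>) * dx\<^sup>2) / r) * tm dt n1"
proof -
  define y0 where "y0 = lat dx i0"
  define X1 where "X1 = (hscale \<sigma> \<delta> * dx + \<delta> powr (- \<sigma>) * dx\<^sup>2) / r"
  define E where "E = 10 * A^3 * (hscale \<sigma> r + hscale \<sigma> \<delta> * dt + X1)"
  have h1: "1 \<le> hscale \<sigma> r" "1 \<le> hscale \<sigma> \<delta>" by (rule hscale_ge1)+
  have X10: "0 \<le> X1" using h1 dx r by (simp add: X1_def)
  have E0: "0 \<le> E" using h1 X10 A dt by (simp add: E_def)
  note S = signed_one_abs[OF s]
  define V where "V = (\<lambda>p. s * U p)"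
  define f where "f = (\<lambda>(n, j). V (tm dt n, lat dx j) - s * u0 y0 - A * soft_norm r (lat dx j - y0) - E * tm dt n)"
  have VB: "\<bar>V (tm dt k, lat dx j)\<bar> \<le> B" if "k \<le> MT" for k j using UB[OF that, of j] S(3) by (simp add: V_def)
  have "f (n1, i0) \<le> 0"
  proof (rule ccontr)
    assume pos0: "\<not> f (n1, i0) \<le> 0"
    \<comment> \<open>A positive value confines the grid point to a ball and leaves finitely many
      candidates, so a maximum exists.\<close>
    define K where "K = {..MT} \<times> {j. norm (lat dx j - y0) \<le> B + A}"
    have out: "(n, j) \<in> K" if n: "n \<le> MT" "0 < f (n, j)" for n j
    proof -
      have "0 \<le> E * tm dt n" using E0 tm_bounds[OF n(1)] by simp
      have "norm (lat dx j - y0) * 1 \<le> norm (lat dx j - y0) * A" using A by (intro mult_left_mono) auto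
      also have "\<dots> \<le> A * soft_norm r (lat dx j - y0)" using soft_norm_ge(1)[of "lat dx j - y0" r] A by (simp add: mult.commute mult_left_mono)
      also have "\<dots> \<le> B + A"
        using n(2) VB[OF n(1), of j] S(3)[of "u0 y0"] u0[of y0] \<open>0 \<le> E * tm dt n\<close> unfolding f_def prod.case by linarith
      finally show ?thesis using n by (simp add: K_def)
    qed
    have nK: "(n1, i0) \<in> K" using out[OF n1, of i0] pos0 by (simp add: not_le)
    have finK: "finite K" unfolding K_def using finite_lat_ball[OF dx(1)] by (intro finite_cartesian_product) auto
    then have "Max (f ` K) \<in> f ` K" using nK by (intro Max_in) auto
    then obtain p where p0: "p \<in> K" "f p = Max (f ` K)" by auto
    have p: "p \<in> K" "\<And>q. q \<in> K \<Longrightarrow> f q \<le> f p"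
      using p0 finK by auto
    obtain n i where ni: "p = (n, i)" by fastforce
    have nMT: "n \<le> MT" using p ni by (simp add: K_def)
    define S0 where "S0 = f (n, i)"
    have S0: "0 < S0" using p(2)[OF nK] pos0 by (simp add: S0_def ni)
    have pmax: "f (k, j) \<le> S0" if "k \<le> MT" for k j
      using p(2) out[OF that, of j] S0 ni by (cases "0 < f (k, j)") (auto simp: S0_def)
    have n0: "n \<noteq> 0"
    proof
      assume "n = 0"
      then have "S0 = s * u0 (lat dx i) - s * u0 y0 - A * soft_norm r (lat dx i - y0)"
        by (simp add: S0_def f_def V_def tm_def U0)
      moreover have "s * u0 (lat dx i) - s * u0 y0 \<le> A * norm (lat dx i - y0)"
        using S(3)[of "u0 (lat dx i) - u0 y0"] u0_lip[of "lat dx i" y0] by (simp add: right_diff_distrib)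
      moreover have "A * norm (lat dx i - y0) \<le> A * soft_norm r (lat dx i - y0)" using A soft_norm_ge(1) by (intro mult_left_mono) auto
      ultimately show False using S0 by linarith
    qed
    then have n: "1 \<le> n" "n \<le> MT" using nMT by auto
    let ?x = "lat dx i" and ?q = "lat dx i - y0"
    define a0 where "a0 = s * u0 y0 + S0"
    obtain H :: "real^'n \<Rightarrow> (real^'n) \<Rightarrow>\<^sub>L (real^'n)" where H: "C2_on UNIV (soft_norm r) (soft_grad r) H" "\<And>q. norm (H q) \<le> 2 / r"
      using C2_on_soft_norm[OF r] by blast
    have C2: "C2_on UNIV (\<lambda>q. A * soft_norm r q) (\<lambda>q :: real^'n. A *\<^sub>R soft_grad r q) (\<lambda>q. A *\<^sub>R H q)"
      using H(1) unfolding C2_on_def by (auto intro!: derivative_eq_intros continuous_intros simp: blinfun.scaleR_left inner_commute)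
    have HL: "norm (A *\<^sub>R H q) \<le> A * (2 / r)" for q using mult_left_mono[OF H(2)[of q], of A] A by simp
    \<comment> \<open>The slope of the barrier minus all consistency errors. The scheme forces R
      \<le> A, which the choice of E violates.\<close>
    define R where "R = E - (3 * A\<^sup>2 + A\<^sup>2 * hscale \<sigma> r + A\<^sup>2 * hscale \<sigma> \<delta> * dt
       + A * (2 / r) * (2 * A\<^sup>2 * hscale \<sigma> \<delta> * dx + A\<^sup>2 * \<delta> powr (- \<sigma>) * dx\<^sup>2))"
    have step: "dt * R \<le> s * U (tm dt n, ?x) - s * U (tm dt (n - 1), ?x) + dt * scheme_lin \<alpha> \<beta> n i (\<lambda>p. s * U p)"
      if ab: "\<alpha> \<in> ctrlA P" "\<beta> \<in> ctrlB P" for \<alpha> \<beta>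
    proof -
      define G where "G = (\<lambda>k. \<integral>z. a0 - a0 + A * soft_norm r (?x + jump P \<alpha> \<beta> (tm dt k, ?x) z - y0) - A * soft_norm r ?q \<partial>far \<delta>)"
      define b where "b = (\<lambda>k. b_tilde P \<delta> \<alpha> \<beta> (tm dt k, ?x) \<bullet> (A *\<^sub>R soft_grad r ?q))"
      define c where "c = zeroth P \<alpha> \<beta> (tm dt n, ?x)"
      have cyl: "(tm dt k, ?x) \<in> cyl T" if "k \<in> {n - 1, n}" for k using that n by (auto intro: tm_cyl)
      have ge: "(\<lambda>z. a0 - a0 + A * soft_norm r (?x + jump P \<alpha> \<beta> (tm dt k, ?x) z - y0) - A * soft_norm r ?q)
        = (\<lambda>z. A * (soft_norm r (?q + jump P \<alpha> \<beta> (tm dt k, ?x) z) - soft_norm r ?q))" for k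
      proof -
        have e: "?x + v - y0 = ?q + v" for v by simp
        show ?thesis unfolding e by (simp only: right_diff_distrib diff_self add_0)
      qed
      have D: "E * tm dt n - E * tm dt (n - 1) + dt * (c * (a0 + E * tm dt (n - 1) + A * soft_norm r ?q)
        - (\<theta> * b n + (1 - \<theta>) * b (n - 1)) - (\<theta>' * G n + (1 - \<theta>') * G (n - 1))
        - A * (2 / r) * (2 * A\<^sup>2 * hscale \<sigma> \<delta> * dx + A\<^sup>2 * \<delta> powr (- \<sigma>) * dx\<^sup>2))
        \<le> V (tm dt n, ?x) - V (tm dt (n - 1), ?x) + dt * scheme_lin \<alpha> \<beta> n i V"
        unfolding c_def
      proof (rule discrete_ge[OF n ab, where V = V and G = G and b = b and i = i and B' = B and a = "\<lambda>_. a0" and \<zeta> = "\<lambda>_. y0" and \<tau> = "\<lambda>k. E * tm dt k" and \<phi> = "\<lambda>q. A * soft_norm r q", OF VB _ _ _ C2 HL])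
        have ub: "V (tm dt k, lat dx j) \<le> a0 + E * tm dt k + A * soft_norm r (lat dx j - y0)" if "k \<in> {n - 1, n}" for k j
        proof -
          have "k \<le> MT" using that n by auto
          from pmax[OF this, of j] show ?thesis unfolding f_def prod.case a0_def by linarith
        qed
        then show "\<And>k j. k \<in> {n - 1, n} \<Longrightarrow> V (tm dt k, lat dx j) \<le> a0 + E * tm dt k + A * soft_norm r (lat dx j - y0)"
          "\<And>k (z :: real^'m) j. k \<in> {n - 1, n} \<Longrightarrow> \<delta> < norm z \<Longrightarrow> V (tm dt k, lat dx j) \<le> a0 + E * tm dt k + A * soft_norm r (lat dx j - y0)"
          by auto
        show "V (tm dt n, ?x) = a0 + E * tm dt n + A * soft_norm r ?q" by (simp add: a0_def S0_def f_def)
        show "integrable (far \<delta>) (\<lambda>z. a0 - a0 + A * soft_norm r (?x + jump P \<alpha> \<beta> (tm dt k, ?x) z - y0) - A * soft_norm r ?q)"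
          if "k \<in> {n - 1, n}" for k
          unfolding ge by (intro Bochner_Integration.integrable_mult_right soft_jump_integral(1)[OF r \<delta> ab cyl[OF that]])
      qed (simp_all add: G_def b_def)
      define mj where "mj = (\<lambda>k. mean_jump \<delta> \<alpha> \<beta> (tm dt k, ?x) \<bullet> soft_grad r ?q)"
      have Gle: "G k \<le> A * mj k + A\<^sup>2 * hscale \<sigma> r" if "k \<in> {n - 1, n}" for k
      proof -
        have "G k = A * (\<integral>z. soft_norm r (?q + jump P \<alpha> \<beta> (tm dt k, ?x) z) - soft_norm r ?q \<partial>far \<delta>)"
          unfolding G_def ge by simp
        also have "\<dots> \<le> A * (mj k + A * hscale \<sigma> r)"
          unfolding mj_def using A by (intro mult_left_mono soft_jump_integral(2)[OF r \<delta> ab cyl[OF that]]) auto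
        finally show ?thesis by (simp add: power2_eq_square algebra_simps)
      qed
      have ble: "b k \<le> A\<^sup>2 - A * mj k" if "k \<in> {n - 1, n}" for k
      proof -
        have "\<bar>drift P \<alpha> \<beta> (tm dt k, ?x) \<bullet> soft_grad r ?q\<bar> \<le> A * 1"
          using Cauchy_Schwarz_ineq2[of "drift P \<alpha> \<beta> (tm dt k, ?x)" "soft_grad r ?q"] mult_mono[OF drift[OF ab cyl[OF that]] norm_soft_grad[OF r, of ?q]] A by simp
        then have "A * (drift P \<alpha> \<beta> (tm dt k, ?x) \<bullet> soft_grad r ?q) \<le> A * A" using A by (intro mult_left_mono) auto
        moreover have "b k = A * (drift P \<alpha> \<beta> (tm dt k, ?x) \<bullet> soft_grad r ?q) - A * mj k"
          by (simp add: b_def mj_def b_tilde_eq inner_diff_left right_diff_distrib)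
        ultimately show ?thesis by (simp add: power2_eq_square)
      qed
      have mjd: "\<bar>mj n - mj (n - 1)\<bar> \<le> A * hscale \<sigma> \<delta> * dt"
      proof -
        have "pdist (tm dt n, ?x) (tm dt (n - 1), ?x) = dt" using tm_diff[OF n(1)] dt by (simp add: pdist_def)
        then have N: "norm (mean_jump \<delta> \<alpha> \<beta> (tm dt n, ?x) - mean_jump \<delta> \<alpha> \<beta> (tm dt (n - 1), ?x)) \<le> A * hscale \<sigma> \<delta> * dt"
          using mean_jump_bounds(2)[OF \<delta> ab cyl[of n] cyl[of "n - 1"]] by simp
        show ?thesis
          using Cauchy_Schwarz_ineq2[of "mean_jump \<delta> \<alpha> \<beta> (tm dt n, ?x) - mean_jump \<delta> \<alpha> \<beta> (tm dt (n - 1), ?x)" "soft_grad r ?q"]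
            mult_mono[OF N norm_soft_grad[OF r, of ?q]] A h1 dt by (simp add: mj_def inner_diff_left)
      qed
      \<comment> \<open>The compensator enters \<open>b\<close> and \<open>G\<close> with opposite
        signs, but weighted by \<theta> and \<theta>'. What is left is (\<theta>' - \<theta>) times
        its change over one time step.\<close>
      have mix: "\<theta> * b n + (1 - \<theta>) * b (n - 1) + (\<theta>' * G n + (1 - \<theta>') * G (n - 1)) \<le> A\<^sup>2 + A\<^sup>2 * hscale \<sigma> r + A\<^sup>2 * hscale \<sigma> \<delta> * dt"
      proof -
        have "\<theta> * b n + (1 - \<theta>) * b (n - 1) \<le> \<theta> * (A\<^sup>2 - A * mj n) + (1 - \<theta>) * (A\<^sup>2 - A * mj (n - 1))"
          using \<theta> by (intro add_mono mult_left_mono ble) auto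
        moreover have "\<theta>' * G n + (1 - \<theta>') * G (n - 1) \<le> \<theta>' * (A * mj n + A\<^sup>2 * hscale \<sigma> r) + (1 - \<theta>') * (A * mj (n - 1) + A\<^sup>2 * hscale \<sigma> r)"
          using \<theta> by (intro add_mono mult_left_mono Gle) auto
        moreover have "\<theta> * (A\<^sup>2 - A * mj n) + (1 - \<theta>) * (A\<^sup>2 - A * mj (n - 1)) + (\<theta>' * (A * mj n + A\<^sup>2 * hscale \<sigma> r) + (1 - \<theta>') * (A * mj (n - 1) + A\<^sup>2 * hscale \<sigma> r))
          = A\<^sup>2 + A\<^sup>2 * hscale \<sigma> r + A * ((\<theta>' - \<theta>) * (mj n - mj (n - 1)))" by (simp add: algebra_simps)
        moreover have "(\<theta>' - \<theta>) * (mj n - mj (n - 1)) \<le> A * hscale \<sigma> \<delta> * dt"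
        proof -
          have "\<bar>(\<theta>' - \<theta>) * (mj n - mj (n - 1))\<bar> \<le> 1 * (A * hscale \<sigma> \<delta> * dt)"
            unfolding abs_mult using \<theta> by (intro mult_mono mjd) auto
          then show ?thesis by simp
        qed
        then have "A * ((\<theta>' - \<theta>) * (mj n - mj (n - 1))) \<le> A * (A * hscale \<sigma> \<delta> * dt)" using A by (intro mult_left_mono) auto
        ultimately show ?thesis by (simp add: power2_eq_square mult_ac)
      qed
      have "- A \<le> a0 + E * tm dt (n - 1) + A * soft_norm r ?q"
      proof -
        have "0 \<le> E * tm dt (n - 1)" "0 \<le> A * soft_norm r ?q" using E0 tm_bounds[of "n - 1"] n A soft_norm_ge(3)[OF r, of ?q] by auto
        then show ?thesis using S0 S(3)[of "u0 y0"] u0[of y0] unfolding a0_def by linarith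
      qed
      moreover have c: "0 \<le> c" "c \<le> A" unfolding c_def using zeroth[OF ab cyl[of n]] by auto
      ultimately have "c * (- A) \<le> c * (a0 + E * tm dt (n - 1) + A * soft_norm r ?q)" by (intro mult_left_mono) auto
      moreover have "c * A \<le> A * A" using c A by (intro mult_right_mono) auto
      ultimately have cle: "- A\<^sup>2 \<le> c * (a0 + E * tm dt (n - 1) + A * soft_norm r ?q)" by (simp add: power2_eq_square)
      have Et: "E * tm dt n - E * tm dt (n - 1) = dt * E" using tm_diff[OF n(1)] by (simp add: algebra_simps)
      have "dt * (R - E) \<le> dt * (c * (a0 + E * tm dt (n - 1) + A * soft_norm r ?q)
        - (\<theta> * b n + (1 - \<theta>) * b (n - 1)) - (\<theta>' * G n + (1 - \<theta>') * G (n - 1))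
        - A * (2 / r) * (2 * A\<^sup>2 * hscale \<sigma> \<delta> * dx + A\<^sup>2 * \<delta> powr (- \<sigma>) * dx\<^sup>2))"
      proof (rule mult_left_mono)
        show "R - E \<le> c * (a0 + E * tm dt (n - 1) + A * soft_norm r ?q)
          - (\<theta> * b n + (1 - \<theta>) * b (n - 1)) - (\<theta>' * G n + (1 - \<theta>') * G (n - 1))
          - A * (2 / r) * (2 * A\<^sup>2 * hscale \<sigma> \<delta> * dx + A\<^sup>2 * \<delta> powr (- \<sigma>) * dx\<^sup>2)"
          unfolding R_def using mix cle zero_le_power2[of A] by linarith
      qed (use dt in simp)
      then show ?thesis using D unfolding Et V_def right_diff_distrib[of dt R E] by linarith
    qed
    have cyl: "(tm dt (n - 1), ?x) \<in> cyl T" using n by (intro tm_cyl) simp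
    have "s * (INF \<alpha>\<in>ctrlA P. SUP \<beta>\<in>ctrlB P. - src P \<alpha> \<beta> (tm dt (n - 1), ?x) + s * R) \<le> 0"
      by (rule scheme_step[OF n s step, where C = "\<bar>R\<bar>"]) auto
    with signed_INF_SUP_const_bounds(2)[OF s cyl, of R] have "R \<le> A" by linarith
    moreover have "A * (2 / r) * (2 * A\<^sup>2 * hscale \<sigma> \<delta> * dx + A\<^sup>2 * \<delta> powr (- \<sigma>) * dx\<^sup>2) \<le> 4 * A^3 * X1"
    proof -
      have "2 * A\<^sup>2 * hscale \<sigma> \<delta> * dx + A\<^sup>2 * \<delta> powr (- \<sigma>) * dx\<^sup>2 \<le> 2 * A\<^sup>2 * (hscale \<sigma> \<delta> * dx + \<delta> powr (- \<sigma>) * dx\<^sup>2)"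
        by (simp add: algebra_simps)
      then have "A * (2 / r) * (2 * A\<^sup>2 * hscale \<sigma> \<delta> * dx + A\<^sup>2 * \<delta> powr (- \<sigma>) * dx\<^sup>2) \<le> A * (2 / r) * (2 * A\<^sup>2 * (hscale \<sigma> \<delta> * dx + \<delta> powr (- \<sigma>) * dx\<^sup>2))"
        using A r by (intro mult_left_mono) auto
      also have "\<dots> = 4 * A^3 * X1" by (simp add: X1_def power3_eq_cube power2_eq_square)
      finally show ?thesis .
    qed
    moreover have "A\<^sup>2 * hscale \<sigma> r \<le> A^3 * hscale \<sigma> r" "A\<^sup>2 * hscale \<sigma> \<delta> * dt \<le> A^3 * (hscale \<sigma> \<delta> * dt)"
      using A_le h1 dt by (auto intro!: mult_right_mono)
    moreover have "A \<le> A^3 * hscale \<sigma> r" "3 * A\<^sup>2 \<le> 3 * (A^3 * hscale \<sigma> r)" "0 < A^3 * hscale \<sigma> r"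
    proof -
      have "A^3 * 1 \<le> A^3 * hscale \<sigma> r" using h1 A by (intro mult_left_mono) auto
      then show "A \<le> A^3 * hscale \<sigma> r" "3 * A\<^sup>2 \<le> 3 * (A^3 * hscale \<sigma> r)" "0 < A^3 * hscale \<sigma> r" using A_le by auto
    qed
    moreover have "0 \<le> A^3 * X1" "0 \<le> A^3 * (hscale \<sigma> \<delta> * dt)" using X10 A h1 dt by auto
    moreover have "E = 10 * (A^3 * hscale \<sigma> r) + 10 * (A^3 * (hscale \<sigma> \<delta> * dt)) + 10 * (A^3 * X1)"
      by (simp add: E_def algebra_simps)
    ultimately show False unfolding R_def by linarith
  qed
  then show ?thesis using r by (simp add: f_def V_def y0_def E_def X1_def)
qed

end

section \<open>Doubling of variables\<close>

locale error_bounds =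
  scheme_bounds P T A \<sigma> \<rho> u0 \<omega> cN C1 C2 \<delta> \<theta> \<theta>' dt dx MT U B + visc_bounds P T A \<sigma> \<rho> u0 u
  for P :: "('a::metric_space, 'b::metric_space, 'n::finite, 'm::finite) isaacs" and T A \<sigma> \<rho> u0 \<omega> cN C1 C2 \<delta> \<theta> \<theta>' dt dx MT U B u
begin

text \<open>\<open>Y\<close> collects what the scheme has in common with the viscosity inequality at
  (t, y), \<open>e1\<close> the price of the replacement. The terms of \<open>e1\<close> are, in
  this order: the zeroth order coefficient times the bound on u, the drift against the gradient g,
  the growth penalty, the squared difference of the jumps, the time mismatch of the compensator, and
  the upwind and interpolation errors times the Hessian 2 k.\<close>

lemma doubling_discrete:
  fixes S w0 \<gamma> k t :: real and y :: "real^'n" and \<tau> :: "nat \<Rightarrow> real"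
  assumes n: "1 \<le> n" "n \<le> MT" and ab: "\<alpha> \<in> ctrlA P" "\<beta> \<in> ctrlB P" and s: "s = 1 \<or> s = - 1"
    and p: "(t, y) \<in> cyl T" and nonneg: "0 \<le> S" "0 \<le> w0" "0 \<le> \<gamma>" "0 \<le> k" "0 \<le> \<tau> (n - 1)"
    and q: "q = lat dx i - y" and g: "g = (2 * k) *\<^sub>R q" and D: "D = norm q + \<bar>tm dt n - t\<bar> + dt"
    and ub: "\<And>l j y'. l \<in> {n - 1, n} \<Longrightarrow> s * U (tm dt l, lat dx j)
      \<le> S + s * u (t, y') + w0 + \<gamma> * soft_norm 1 y' + \<tau> l + k * (norm (lat dx j - y'))\<^sup>2"
    and eq: "s * U (tm dt n, lat dx i) = S + s * u (t, y) + w0 + \<gamma> * soft_norm 1 y + \<tau> n + k * (norm q)\<^sup>2"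
    and Y: "Y = zeroth P \<alpha> \<beta> (t, y) * (s * u (t, y)) - drift P \<alpha> \<beta> (t, y) \<bullet> g
      - (\<integral>z. s * u (t, y + jump P \<alpha> \<beta> (t, y) z) - s * u (t, y) \<partial>far \<delta>)
      + mean_jump \<delta> \<alpha> \<beta> (t, y) \<bullet> g - \<gamma> * (mean_jump \<delta> \<alpha> \<beta> (t, y) \<bullet> soft_grad 1 y)"
    and e1: "e1 = A * D * (22 * A^3) + A * D * norm g + 2 * A * \<gamma> + k * A * D\<^sup>2 + A * hscale \<sigma> \<delta> * dt * norm g
      + 2 * k * (2 * A\<^sup>2 * hscale \<sigma> \<delta> * dx + A\<^sup>2 * \<delta> powr (- \<sigma>) * dx\<^sup>2)"
  shows "\<tau> n - \<tau> (n - 1) + dt * (Y - e1)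
    \<le> s * U (tm dt n, lat dx i) - s * U (tm dt (n - 1), lat dx i) + dt * scheme_lin \<alpha> \<beta> n i (\<lambda>p. s * U p)"
proof -
  let ?x = "lat dx i" and ?\<eta> = "jump P \<alpha> \<beta> (t, y)"
  define \<eta> where "\<eta> = (\<lambda>l. jump P \<alpha> \<beta> (tm dt l, ?x))"
  define v where "v = (\<lambda>y. s * u (t, y))"
  note SS = signed_one_abs[OF s]
  have tT: "t \<in> {0..T}" using p by (simp add: cyl_def)
  have vc: "continuous_on UNIV v" unfolding v_def by (rule u_section_cont[OF tT])
  have vb: "\<bar>v y'\<bar> \<le> 22 * A^3" for y' unfolding v_def SS(3) by (rule u_le) (use tT in \<open>simp add: cyl_def\<close>)
  have cyl: "(tm dt l, ?x) \<in> cyl T" if "l \<in> {n - 1, n}" for l using that n by (intro tm_cyl) auto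
  have D0: "0 \<le> D" using dt by (simp add: D)
  have pd: "pdist (tm dt l, ?x) (t, y) \<le> D" if "l \<in> {n - 1, n}" for l
    using that tm_diff[OF n(1)] dt by (auto simp: pdist_def D q)
  \<comment> \<open>The maximum property is used at y' = y + \<eta>(t, y; z): u jumps along, which
    reproduces the nonlocal term of the viscosity inequality.\<close>
  define a where "a = (\<lambda>z. S + v (y + ?\<eta> z) + w0 + \<gamma> * soft_norm 1 (y + ?\<eta> z))"
  define a0 where "a0 = S + v y + w0 + \<gamma> * soft_norm 1 y"
  define W where "W = (\<lambda>l z. a z - a0 + k * (norm (?x + \<eta> l z - (y + ?\<eta> z)))\<^sup>2 - k * (norm (?x - y))\<^sup>2)"
  define G where "G = (\<lambda>l. \<integral>z. W l z \<partial>far \<delta>)"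
  define b where "b = (\<lambda>l. b_tilde P \<delta> \<alpha> \<beta> (tm dt l, ?x) \<bullet> ((2 * k) *\<^sub>R (?x - y)))"
  define c where "c = zeroth P \<alpha> \<beta> (tm dt n, ?x)"
  define m2 where "m2 = mean_jump \<delta> \<alpha> \<beta> (t, y)"
  define m where "m = (\<lambda>l. mean_jump \<delta> \<alpha> \<beta> (tm dt l, ?x))"
  define Iv where "Iv = (\<integral>z. v (y + ?\<eta> z) - v y \<partial>far \<delta>)"
  define I\<psi> where "I\<psi> = (\<integral>z. soft_norm 1 (y + ?\<eta> z) - soft_norm 1 y \<partial>far \<delta>)"
  define sq where "sq = (\<lambda>l z. (norm (\<eta> l z - ?\<eta> z))\<^sup>2)"
  have nz: "z \<noteq> 0" if "z \<in> space (far \<delta>)" for z using that \<delta> by (auto simp: space_far)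
  have iv: "integrable (far \<delta>) (\<lambda>z. v (y + ?\<eta> z) - v y)" by (rule integrable_increment(1)[OF \<delta> ab p vc vb])
  have i\<psi>: "integrable (far \<delta>) (\<lambda>z. soft_norm 1 (y + ?\<eta> z) - soft_norm 1 y)"
    by (rule soft_jump_integral(1)[OF _ \<delta> ab p]) simp
  have ij: "integrable (far \<delta>) (\<lambda>z. \<eta> l z - ?\<eta> z)" if "l \<in> {n - 1, n}" for l
    unfolding \<eta>_def by (intro Bochner_Integration.integrable_diff jump_integrable \<delta> ab p cyl[OF that])
  have sqb: "sq l z \<le> D\<^sup>2 * (\<rho> z)\<^sup>2" if "z \<noteq> 0" "l \<in> {n - 1, n}" for l z
  proof -
    have "norm (\<eta> l z - ?\<eta> z) \<le> \<rho> z * pdist (tm dt l, ?x) (t, y)"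
      unfolding \<eta>_def by (rule jump_lip[OF ab cyl[OF that(2)] p that(1)])
    also have "\<dots> \<le> \<rho> z * D" using pd[OF that(2)] \<rho>_nonneg[OF that(1)] by (intro mult_left_mono) auto
    finally have "sq l z \<le> (\<rho> z * D)\<^sup>2" unfolding sq_def by (intro power_mono) auto
    then show ?thesis by (simp add: power_mult_distrib mult.commute)
  qed
  have isq: "integrable (far \<delta>) (sq l)" "(\<integral>z. sq l z \<partial>far \<delta>) \<le> A * D\<^sup>2" if l: "l \<in> {n - 1, n}" for l
  proof -
    have i2: "integrable (far \<delta>) (\<lambda>z. D\<^sup>2 * (\<rho> z)\<^sup>2)" using far_\<rho>(3)[OF \<delta>] by simp
    show i: "integrable (far \<delta>) (sq l)"
    proof (rule Bochner_Integration.integrable_bound[OF i2])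
      have "(\<lambda>z. \<eta> l z - ?\<eta> z) \<in> borel_measurable (far \<delta>)" using ij[OF l] by (rule borel_measurable_integrable)
      then show "sq l \<in> borel_measurable (far \<delta>)" unfolding sq_def by measurable
      show "AE z in far \<delta>. norm (sq l z) \<le> norm (D\<^sup>2 * (\<rho> z)\<^sup>2)"
      proof (rule AE_I2)
        fix z assume "z \<in> space (far \<delta>)"
        from sqb[OF nz[OF this] l] show "norm (sq l z) \<le> norm (D\<^sup>2 * (\<rho> z)\<^sup>2)" by (simp add: sq_def)
      qed
    qed
    have "(\<integral>z. sq l z \<partial>far \<delta>) \<le> (\<integral>z. D\<^sup>2 * (\<rho> z)\<^sup>2 \<partial>far \<delta>)"
      by (rule integral_mono[OF i i2]) (use sqb[OF nz l] in auto)
    also have "\<dots> = D\<^sup>2 * (\<integral>z. (\<rho> z)\<^sup>2 \<partial>far \<delta>)" by simp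
    also have "\<dots> \<le> D\<^sup>2 * A" using far_\<rho>(4)[OF \<delta>] by (intro mult_left_mono) auto
    finally show "(\<integral>z. sq l z \<partial>far \<delta>) \<le> A * D\<^sup>2" by (simp add: mult.commute)
  qed
  \<comment> \<open>Expanding the square: the cross term integrates to the difference of the
    compensators times g, and the square of the jump difference is controlled by D^2 and the second
    moment.\<close>
  have We: "W l = (\<lambda>z. (v (y + ?\<eta> z) - v y) + \<gamma> * (soft_norm 1 (y + ?\<eta> z) - soft_norm 1 y) + (\<eta> l z - ?\<eta> z) \<bullet> g + k * sq l z)" for l
  proof
    fix z
    have "(norm (?x + \<eta> l z - (y + ?\<eta> z)))\<^sup>2 = (norm (q + (\<eta> l z - ?\<eta> z)))\<^sup>2" by (simp add: q algebra_simps)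
    also have "\<dots> = (norm q)\<^sup>2 + 2 * ((\<eta> l z - ?\<eta> z) \<bullet> q) + sq l z"
      unfolding sq_def power2_norm_eq_inner by (simp only: inner_add_left inner_add_right inner_commute)
    finally have N: "(norm (?x + \<eta> l z - (y + ?\<eta> z)))\<^sup>2 = (norm q)\<^sup>2 + 2 * ((\<eta> l z - ?\<eta> z) \<bullet> q) + sq l z" .
    show "W l z = (v (y + ?\<eta> z) - v y) + \<gamma> * (soft_norm 1 (y + ?\<eta> z) - soft_norm 1 y) + (\<eta> l z - ?\<eta> z) \<bullet> g + k * sq l z"
      unfolding W_def N a_def a0_def g q[symmetric] inner_scaleR_right by (simp add: algebra_simps)
  qed
  have iW: "integrable (far \<delta>) (W l)" if "l \<in> {n - 1, n}" for l
    unfolding We by (intro Bochner_Integration.integrable_add Bochner_Integration.integrable_mult_right iv i\<psi> isq(1) integrable_inner_left ij that)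
  have Geq: "G l = Iv + \<gamma> * I\<psi> + (m l - m2) \<bullet> g + k * (\<integral>z. sq l z \<partial>far \<delta>)" if l: "l \<in> {n - 1, n}" for l
  proof -
    have e: "(\<integral>z. (\<eta> l z - ?\<eta> z) \<bullet> g \<partial>far \<delta>) = (m l - m2) \<bullet> g"
    proof -
      have "(\<integral>z. (\<eta> l z - ?\<eta> z) \<bullet> g \<partial>far \<delta>) = (\<integral>z. \<eta> l z - ?\<eta> z \<partial>far \<delta>) \<bullet> g"
        by (rule integral_inner_left) (rule ij[OF l])
      also have "(\<integral>z. \<eta> l z - ?\<eta> z \<partial>far \<delta>) = m l - m2"
        unfolding m_def m2_def mean_jump_def \<eta>_def
        by (rule Bochner_Integration.integral_diff; intro jump_integrable \<delta> ab p cyl[OF l])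
      finally show ?thesis .
    qed
    note i1 = iv Bochner_Integration.integrable_mult_right[OF i\<psi>, of \<gamma>] integrable_inner_left[OF ij[OF l], of g] Bochner_Integration.integrable_mult_right[OF isq(1)[OF l], of k]
    show ?thesis
      unfolding G_def We
      by (subst Bochner_Integration.integral_add[OF Bochner_Integration.integrable_add[OF Bochner_Integration.integrable_add[OF i1(1,2)] i1(3)] i1(4)],
          subst Bochner_Integration.integral_add[OF Bochner_Integration.integrable_add[OF i1(1,2)] i1(3)],
          subst Bochner_Integration.integral_add[OF i1(1,2)]) (simp add: e Iv_def I\<psi>_def)
  qed
  have h1: "hscale \<sigma> 1 \<le> 2" by (simp add: hscale_def)
  have I\<psi>: "\<gamma> * I\<psi> \<le> \<gamma> * (m2 \<bullet> soft_grad 1 y) + 2 * A * \<gamma>"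
  proof -
    have "I\<psi> \<le> m2 \<bullet> soft_grad 1 y + A * hscale \<sigma> 1"
      unfolding I\<psi>_def m2_def by (rule soft_jump_integral(2)[OF _ \<delta> ab p]) simp
    also have "A * hscale \<sigma> 1 \<le> A * 2" using h1 A by (intro mult_left_mono) auto
    finally have "\<gamma> * I\<psi> \<le> \<gamma> * (m2 \<bullet> soft_grad 1 y + A * 2)" using nonneg by (intro mult_left_mono) auto
    then show ?thesis by (simp add: algebra_simps)
  qed
  have Gle: "G l \<le> Iv + \<gamma> * (m2 \<bullet> soft_grad 1 y) + 2 * A * \<gamma> + (m l - m2) \<bullet> g + k * A * D\<^sup>2" if l: "l \<in> {n - 1, n}" for l
  proof -
    have "k * (\<integral>z. sq l z \<partial>far \<delta>) \<le> k * (A * D\<^sup>2)" using isq(2)[OF l] nonneg by (intro mult_left_mono) auto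
    then show ?thesis unfolding Geq[OF l] using I\<psi> by simp
  qed
  have ble: "b l \<le> drift P \<alpha> \<beta> (t, y) \<bullet> g + A * D * norm g - m l \<bullet> g" if l: "l \<in> {n - 1, n}" for l
  proof -
    have "norm (drift P \<alpha> \<beta> (tm dt l, ?x) - drift P \<alpha> \<beta> (t, y)) \<le> A * D"
      using drift_lip[OF ab cyl[OF l] p] mult_left_mono[OF pd[OF l], of A] A by linarith
    then have "(drift P \<alpha> \<beta> (tm dt l, ?x) - drift P \<alpha> \<beta> (t, y)) \<bullet> g \<le> A * D * norm g"
      by (meson norm_cauchy_schwarz norm_ge_zero mult_right_mono order_trans)
    then show ?thesis by (simp add: b_def b_tilde_eq m_def q[symmetric] g[symmetric] inner_diff_left)
  qed
  have md: "\<bar>(m n - m (n - 1)) \<bullet> g\<bar> \<le> A * hscale \<sigma> \<delta> * dt * norm g"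
  proof -
    have "pdist (tm dt n, ?x) (tm dt (n - 1), ?x) = dt" using tm_diff[OF n(1)] dt by (simp add: pdist_def)
    then have N: "norm (m n - m (n - 1)) \<le> A * hscale \<sigma> \<delta> * dt"
      using mean_jump_bounds(2)[OF \<delta> ab cyl[of n] cyl[of "n - 1"]] by (simp add: m_def)
    then show ?thesis by (meson Cauchy_Schwarz_ineq2 norm_ge_zero mult_right_mono order_trans)
  qed
  \<comment> \<open>The compensator at the grid point cancels between \<open>b\<close> and
    \<open>G\<close> up to the time mismatch; the one at (t, y) stays and becomes part of
    \<open>Y\<close>.\<close>
  have mix: "\<theta> * b n + (1 - \<theta>) * b (n - 1) + (\<theta>' * G n + (1 - \<theta>') * G (n - 1))
    \<le> drift P \<alpha> \<beta> (t, y) \<bullet> g + A * D * norm g + Iv + \<gamma> * (m2 \<bullet> soft_grad 1 y) + 2 * A * \<gamma> - m2 \<bullet> g + k * A * D\<^sup>2 + A * hscale \<sigma> \<delta> * dt * norm g"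
  proof -
    define X1 X2 M1 M0 where "X1 = drift P \<alpha> \<beta> (t, y) \<bullet> g + A * D * norm g"
      and "X2 = Iv + \<gamma> * (m2 \<bullet> soft_grad 1 y) + 2 * A * \<gamma> - m2 \<bullet> g + k * A * D\<^sup>2" and "M1 = m n \<bullet> g" and "M0 = m (n - 1) \<bullet> g"
    have "\<theta> * b n + (1 - \<theta>) * b (n - 1) \<le> \<theta> * (X1 - M1) + (1 - \<theta>) * (X1 - M0)"
      unfolding X1_def M1_def M0_def using \<theta> by (intro add_mono mult_left_mono ble) auto
    moreover have "\<theta>' * G n + (1 - \<theta>') * G (n - 1) \<le> \<theta>' * (X2 + M1) + (1 - \<theta>') * (X2 + M0)"
      using Gle[of n] Gle[of "n - 1"] \<theta> by (intro add_mono mult_left_mono) (auto simp: X2_def M1_def M0_def inner_diff_left)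
    moreover have "\<theta> * (X1 - M1) + (1 - \<theta>) * (X1 - M0) + (\<theta>' * (X2 + M1) + (1 - \<theta>') * (X2 + M0)) = X1 + X2 + (\<theta>' - \<theta>) * (M1 - M0)"
      by (simp add: algebra_simps)
    moreover have "(\<theta>' - \<theta>) * (M1 - M0) \<le> A * hscale \<sigma> \<delta> * dt * norm g"
    proof -
      have "\<bar>(\<theta>' - \<theta>) * (M1 - M0)\<bar> \<le> 1 * (A * hscale \<sigma> \<delta> * dt * norm g)"
        unfolding abs_mult using \<theta> md by (intro mult_mono) (auto simp: M1_def M0_def inner_diff_left)
      then show ?thesis by simp
    qed
    ultimately show ?thesis unfolding X1_def X2_def by linarith
  qed
  \<comment> \<open>The zeroth order coefficient is nonnegative and the majorant exceeds
    \<open>v y\<close> by nonnegative terms, which may be dropped; then the coefficient is moved to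
    (t, y) at the cost of its Lipschitz bound times the bound on u.\<close>
  have cle: "zeroth P \<alpha> \<beta> (t, y) * v y - A * D * (22 * A^3) \<le> c * (a0 + \<tau> (n - 1) + k * (norm (?x - y))\<^sup>2)"
  proof -
    have c: "0 \<le> c" unfolding c_def using zeroth[OF ab cyl[of n]] by auto
    have "\<bar>zeroth P \<alpha> \<beta> (t, y) - c\<bar> \<le> A * D"
    proof -
      have "A * pdist (tm dt n, ?x) (t, y) \<le> A * D" by (rule mult_left_mono[OF pd]) (use A in auto)
      moreover have "\<bar>c - zeroth P \<alpha> \<beta> (t, y)\<bar> \<le> A * pdist (tm dt n, ?x) (t, y)"
        unfolding c_def by (rule zeroth_lip[OF ab cyl p]) simp
      ultimately show ?thesis by linarith
    qed
    then have "\<bar>(zeroth P \<alpha> \<beta> (t, y) - c) * v y\<bar> \<le> (A * D) * (22 * A^3)"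
      unfolding abs_mult using vb[of y] by (intro mult_mono) auto
    then have "zeroth P \<alpha> \<beta> (t, y) * v y - A * D * (22 * A^3) \<le> c * v y" by (simp add: left_diff_distrib)
    also have "\<dots> \<le> c * (a0 + \<tau> (n - 1) + k * (norm (?x - y))\<^sup>2)"
      using c nonneg soft_norm_ge(3)[of 1 y] by (intro mult_left_mono) (auto simp: a0_def intro!: add_nonneg_nonneg)
    finally show ?thesis .
  qed
  have main: "\<tau> n - \<tau> (n - 1) + dt * (c * (a0 + \<tau> (n - 1) + k * (norm (?x - y))\<^sup>2)
      - (\<theta> * b n + (1 - \<theta>) * b (n - 1)) - (\<theta>' * G n + (1 - \<theta>') * G (n - 1))
      - 2 * k * (2 * A\<^sup>2 * hscale \<sigma> \<delta> * dx + A\<^sup>2 * \<delta> powr (- \<sigma>) * dx\<^sup>2))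
    \<le> s * U (tm dt n, ?x) - s * U (tm dt (n - 1), ?x) + dt * scheme_lin \<alpha> \<beta> n i (\<lambda>p. s * U p)"
    unfolding c_def
  proof (rule discrete_ge[OF n ab, where V = "\<lambda>p. s * U p" and G = G and b = b and i = i and B' = B and a = a and \<zeta> = "\<lambda>z. y + ?\<eta> z" and \<tau> = \<tau> and \<phi> = "\<lambda>q. k * (norm q)\<^sup>2", OF _ _ _ _ C2_on_square])
    show "\<bar>s * U (tm dt l, lat dx j)\<bar> \<le> B" if "l \<le> MT" for l j unfolding SS(3) by (rule UB[OF that])
    show "s * U (tm dt l, lat dx j) \<le> a z + \<tau> l + k * (norm (lat dx j - (y + ?\<eta> z)))\<^sup>2" if "l \<in> {n - 1, n}" for l z j
      unfolding a_def v_def by (rule ub[OF that])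
    show "s * U (tm dt l, lat dx j) \<le> a0 + \<tau> l + k * (norm (lat dx j - y))\<^sup>2" if "l \<in> {n - 1, n}" for l j
      unfolding a0_def v_def by (rule ub[OF that])
    show "s * U (tm dt n, ?x) = a0 + \<tau> n + k * (norm (?x - y))\<^sup>2"
      unfolding a0_def v_def using eq by (simp only: q)
    show "norm ((2 * k) *\<^sub>R id_blinfun :: (real^'n) \<Rightarrow>\<^sub>L (real^'n)) \<le> 2 * k"
      using mult_left_mono[OF norm_blinfun_id_le, of "2 * k"] nonneg by simp
    show "integrable (far \<delta>) (\<lambda>z. a z - a0 + k * (norm (?x + jump P \<alpha> \<beta> (tm dt l, ?x) z - (y + ?\<eta> z)))\<^sup>2 - k * (norm (?x - y))\<^sup>2)"
      if "l \<in> {n - 1, n}" for l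
      using iW[OF that] unfolding W_def \<eta>_def .
  qed (simp_all add: G_def W_def \<eta>_def b_def)
  have "dt * (Y - e1) \<le> dt * (c * (a0 + \<tau> (n - 1) + k * (norm (?x - y))\<^sup>2)
      - (\<theta> * b n + (1 - \<theta>) * b (n - 1)) - (\<theta>' * G n + (1 - \<theta>') * G (n - 1))
      - 2 * k * (2 * A\<^sup>2 * hscale \<sigma> \<delta> * dx + A\<^sup>2 * \<delta> powr (- \<sigma>) * dx\<^sup>2))"
  proof (rule mult_left_mono)
    have Y': "Y = zeroth P \<alpha> \<beta> (t, y) * v y - drift P \<alpha> \<beta> (t, y) \<bullet> g - Iv + m2 \<bullet> g - \<gamma> * (m2 \<bullet> soft_grad 1 y)"
      unfolding Y v_def Iv_def m2_def ..
    show "Y - e1 \<le> c * (a0 + \<tau> (n - 1) + k * (norm (?x - y))\<^sup>2)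
      - (\<theta> * b n + (1 - \<theta>) * b (n - 1)) - (\<theta>' * G n + (1 - \<theta>') * G (n - 1))
      - 2 * k * (2 * A\<^sup>2 * hscale \<sigma> \<delta> * dx + A\<^sup>2 * \<delta> powr (- \<sigma>) * dx\<^sup>2)"
      unfolding Y' e1 using mix cle by linarith
  qed (use dt in simp)
  with main show ?thesis by linarith
qed

end

text \<open>Every error is either constant or a multiple of the penalty Q. Linear terms obey D \<le>
  \<epsilon> + k D^2, because k \<ge> 1 / \<epsilon>, and k D^2 \<le> 3 Q + 3 k dt^2. K is the total
  coefficient of k D^2: A (1 + 22 A^3) from source and zeroth order term, 2 A from the drift, A from
  the jumps. The further A Q comes from the time mismatch of the compensator. At most 4 A \<gamma>
  is spent of the 6 A \<gamma>, which makes the inequality strict.\<close>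

lemma doubling_arith:
  fixes A e d \<theta> dt h \<epsilon> \<epsilon>' \<gamma> X w \<Gamma> :: real
  assumes A: "1 \<le> A" and e: "1 \<le> e" "e \<le> \<Gamma>" and nn: "0 \<le> d" "0 \<le> \<theta>" "0 < dt" "1 \<le> h" "0 < \<epsilon>'" "\<epsilon>' \<le> \<epsilon>" "0 < \<gamma>" "0 \<le> X" "0 \<le> w" "w \<le> 1"
    and k: "k = e / \<epsilon>" and D: "D = d + \<theta> + dt" and K: "K = A * (1 + 22 * A^3) + 3 * A"
  shows "A * D + (A * D * (22 * A^3) + A * D * (2 * k * d) + 2 * A * \<gamma> + k * A * D\<^sup>2 + A * h * dt * (2 * k * d) + 2 * k * (2 * A\<^sup>2 * X))
     + (\<gamma> * A + (k + \<gamma>) * A * w) + e * dt / \<epsilon>'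
   < (6 * A * \<gamma> + K * \<epsilon> + \<Gamma> * ((3 * K + 4 * A\<^sup>2 + A) * (h\<^sup>2 * dt\<^sup>2 + X + w) / \<epsilon>) + \<Gamma> * dt / \<epsilon>') + (3 * K + A) * (e * (d\<^sup>2 / \<epsilon> + \<theta>\<^sup>2 / \<epsilon>'))"
proof -
  have \<epsilon>: "0 < \<epsilon>" using nn by linarith
  have k0: "0 < k" using e \<epsilon> by (simp add: k)
  have A3: "0 \<le> A * (1 + 22 * A^3)" using A by simp
  then have K0: "0 \<le> K" using A by (simp add: K)
  have D0: "0 \<le> D" "d \<le> D" using nn by (auto simp: D)
  define Q where "Q = e * (d\<^sup>2 / \<epsilon> + \<theta>\<^sup>2 / \<epsilon>')"
  have kd: "k * d\<^sup>2 \<le> Q" using e \<epsilon> nn by (simp add: Q_def k distrib_left)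
  \<comment> \<open>Here \<epsilon>' \<le> \<epsilon> enters: Lipschitz errors in time are weighted
    by 1 / \<epsilon> and must be covered by the time penalty.\<close>
  have k\<theta>: "k * \<theta>\<^sup>2 \<le> e * (\<theta>\<^sup>2 / \<epsilon>')"
  proof -
    have "\<theta>\<^sup>2 / \<epsilon> \<le> \<theta>\<^sup>2 / \<epsilon>'" using nn by (intro divide_left_mono) auto
    then have "e * (\<theta>\<^sup>2 / \<epsilon>) \<le> e * (\<theta>\<^sup>2 / \<epsilon>')" using e by (intro mult_left_mono) auto
    then show ?thesis by (simp add: k)
  qed
  have D2: "D\<^sup>2 \<le> 3 * (d\<^sup>2 + \<theta>\<^sup>2 + dt\<^sup>2)"
  proof -
    have "3 * (d\<^sup>2 + \<theta>\<^sup>2 + dt\<^sup>2) - D\<^sup>2 = (d - \<theta>)\<^sup>2 + (d - dt)\<^sup>2 + (\<theta> - dt)\<^sup>2" by (simp add: D power2_eq_square algebra_simps)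
    moreover have "0 \<le> (d - \<theta>)\<^sup>2 + (d - dt)\<^sup>2 + (\<theta> - dt)\<^sup>2" by simp
    ultimately show ?thesis by linarith
  qed
  have kD: "k * D\<^sup>2 \<le> 3 * Q + 3 * (k * dt\<^sup>2)"
  proof -
    have "k * D\<^sup>2 \<le> k * (3 * (d\<^sup>2 + \<theta>\<^sup>2 + dt\<^sup>2))" using D2 k0 by (intro mult_left_mono) auto
    also have "\<dots> = 3 * (k * d\<^sup>2 + k * \<theta>\<^sup>2) + 3 * (k * dt\<^sup>2)" by (simp add: algebra_simps)
    also have "k * d\<^sup>2 + k * \<theta>\<^sup>2 \<le> Q" using k\<theta> by (simp add: Q_def k distrib_left)
    finally show ?thesis by simp
  qed
  have Dk: "D \<le> \<epsilon> + k * D\<^sup>2"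
  proof -
    have "0 \<le> D * \<epsilon>" using D0 \<epsilon> by simp
    then have "D * \<epsilon> \<le> \<epsilon>\<^sup>2 + D\<^sup>2" using sum_squares_bound[of D \<epsilon>] by linarith
    then have "D \<le> (\<epsilon>\<^sup>2 + D\<^sup>2) / \<epsilon>" by (simp only: pos_le_divide_eq[OF \<epsilon>])
    also have "\<dots> = \<epsilon> + D\<^sup>2 / \<epsilon>" using \<epsilon> by (simp add: add_divide_distrib power2_eq_square)
    finally have "D \<le> \<epsilon> + D\<^sup>2 / \<epsilon>" .
    also have "D\<^sup>2 / \<epsilon> \<le> k * D\<^sup>2" using e \<epsilon> mult_right_mono[of 1 e "D\<^sup>2 / \<epsilon>"] by (simp add: k)
    finally show ?thesis by simp
  qed
  have 1: "A * D + A * D * (22 * A^3) \<le> A * (1 + 22 * A^3) * (\<epsilon> + k * D\<^sup>2)"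
    using mult_left_mono[OF Dk A3] by (simp add: algebra_simps)
  have 2: "A * D * (2 * k * d) \<le> 2 * A * (k * D\<^sup>2)"
  proof -
    have "2 * A * k * D * d \<le> 2 * A * k * D * D" using A k0 D0 by (intro mult_left_mono) auto
    then show ?thesis by (simp add: power2_eq_square mult_ac)
  qed
  have 3: "A * h * dt * (2 * k * d) \<le> A * Q + A * (k * (h\<^sup>2 * dt\<^sup>2))"
  proof -
    have "2 * d * (h * dt) \<le> d\<^sup>2 + (h * dt)\<^sup>2" by (rule sum_squares_bound)
    then have "A * k * (2 * d * (h * dt)) \<le> A * k * (d\<^sup>2 + (h * dt)\<^sup>2)" using A k0 by (intro mult_left_mono) auto
    also have "\<dots> = A * (k * d\<^sup>2) + A * (k * (h\<^sup>2 * dt\<^sup>2))" by (simp add: power_mult_distrib algebra_simps)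
    also have "A * (k * d\<^sup>2) \<le> A * Q" using kd A by (intro mult_left_mono) auto
    finally show ?thesis by (simp add: mult_ac)
  qed
  have 4: "K * (k * D\<^sup>2) \<le> 3 * K * Q + 3 * K * (k * (h\<^sup>2 * dt\<^sup>2))"
  proof -
    have "1 \<le> h\<^sup>2" using nn by simp
    then have "1 * dt\<^sup>2 \<le> h\<^sup>2 * dt\<^sup>2" by (intro mult_right_mono) auto
    then have "k * dt\<^sup>2 \<le> k * (h\<^sup>2 * dt\<^sup>2)" using k0 by simp
    then have "K * (k * D\<^sup>2) \<le> K * (3 * Q + 3 * (k * (h\<^sup>2 * dt\<^sup>2)))" using kD K0 by (intro mult_left_mono) auto
    then show ?thesis by (simp add: algebra_simps)
  qed
  have 5: "A * w * \<gamma> \<le> A * \<gamma>" using nn A by (simp add: mult_le_cancel_right1 mult_le_cancel_right2)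
  have 6: "A * (1 + 22 * A^3) * \<epsilon> \<le> K * \<epsilon>" using A \<epsilon> by (intro mult_right_mono) (auto simp: K)
  have 7: "e * dt / \<epsilon>' \<le> \<Gamma> * dt / \<epsilon>'" using e nn by (intro divide_right_mono mult_right_mono) auto
  define M Z where "M = 3 * K + 4 * A\<^sup>2 + A" and "Z = h\<^sup>2 * dt\<^sup>2 + X + w"
  have Z: "0 \<le> Z" "0 \<le> h\<^sup>2 * dt\<^sup>2" using nn by (auto simp: Z_def)
  have 8: "3 * K * (k * (h\<^sup>2 * dt\<^sup>2)) + A * (k * (h\<^sup>2 * dt\<^sup>2)) + 4 * A\<^sup>2 * (k * X) + A * (k * w) \<le> \<Gamma> * (M * Z / \<epsilon>)"
  proof -
    have "(3 * K + A) * (h\<^sup>2 * dt\<^sup>2) \<le> M * (h\<^sup>2 * dt\<^sup>2)" "4 * A\<^sup>2 * X \<le> M * X" "A * w \<le> M * w"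
      using A K0 nn by (intro mult_right_mono; simp add: M_def)+
    then have "(3 * K + A) * (h\<^sup>2 * dt\<^sup>2) + 4 * A\<^sup>2 * X + A * w \<le> M * Z" unfolding Z_def distrib_left by linarith
    then have "k * ((3 * K + A) * (h\<^sup>2 * dt\<^sup>2) + 4 * A\<^sup>2 * X + A * w) \<le> k * (M * Z)" using k0 by (intro mult_left_mono) auto
    also have "\<dots> = e * (M * Z / \<epsilon>)" by (simp add: k)
    also have "\<dots> \<le> \<Gamma> * (M * Z / \<epsilon>)" using e Z A K0 \<epsilon> by (intro mult_right_mono) (auto simp: M_def)
    finally show ?thesis by (simp add: algebra_simps)
  qed
  have 9: "A * (1 + 22 * A^3) * (\<epsilon> + k * D\<^sup>2) + 2 * A * (k * D\<^sup>2) + k * A * D\<^sup>2 = A * (1 + 22 * A^3) * \<epsilon> + K * (k * D\<^sup>2)"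
    unfolding K by (simp add: algebra_simps)
  have 10: "2 * k * (2 * A\<^sup>2 * X) = 4 * A\<^sup>2 * (k * X)" "(k + \<gamma>) * A * w = A * (k * w) + A * w * \<gamma>" "(3 * K + A) * Q = 3 * K * Q + A * Q"
    "\<gamma> * A = A * \<gamma>" "6 * A * \<gamma> = 6 * (A * \<gamma>)" "2 * A * \<gamma> = 2 * (A * \<gamma>)"
    by (simp_all add: algebra_simps)
  have "0 < A * \<gamma>" using A nn by simp
  then show ?thesis
    unfolding Q_def[symmetric] M_def[symmetric] Z_def[symmetric] 10
    using 1 2 3 4 5 6 7 8 9 by linarith
qed

section \<open>The doubled function and its maximum\<close>

context error_bounds
begin

text \<open>\<open>\<kappa>1\<close> is the K of \<open>doubling_arith\<close> and
  \<open>lam\<close> the coefficient of the penalty there, which is exactly what differentiating the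
  weight exp(\<open>lam\<close> t) produces. \<open>X1\<close> is, up to powers of A, the upwind and
  interpolation error per unit of the Hessian.\<close>

definition \<kappa>1 :: real where "\<kappa>1 = A * (1 + 22 * A^3) + 3 * A"
definition lam :: real where "lam = 3 * \<kappa>1 + A"
definition X1 :: real where "X1 = hscale \<sigma> \<delta> * dx + \<delta> powr (- \<sigma>) * dx\<^sup>2"

lemma lam_pos: "0 \<le> lam" "0 \<le> \<kappa>1"
  using A by (auto simp: lam_def \<kappa>1_def)

text \<open>The exponential weight and the slope E depend on the continuous time only. For the
  scheme they are constants, and only the plain square of the time difference is affected by its
  time step.\<close>

definition \<Phi> :: "real \<Rightarrow> real \<Rightarrow> real \<Rightarrow> real \<Rightarrow> real \<Rightarrow> nat \<Rightarrow> int^'n \<Rightarrow> real \<times> (real^'n) \<Rightarrow> real" where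
  "\<Phi> s \<epsilon> \<epsilon>' \<gamma> E n j q = s * U (tm dt n, lat dx j) - s * u q
     - (exp (lam * fst q) * ((1 / \<epsilon>) * (norm (lat dx j - snd q))\<^sup>2 + (tm dt n - fst q)\<^sup>2 / \<epsilon>') + E * fst q + \<gamma> * soft_norm 1 (snd q))"

text \<open>A positive value bounds all penalties by b. The growth penalty then confines y, and the
  quadratic one confines the grid point. Thus the maximum is one over finitely many indices and a
  compact set.\<close>

lemma doubling_max:
  assumes s: "s = 1 \<or> s = - 1" and pos: "0 < \<epsilon>" "0 < \<epsilon>'" "0 < \<gamma>" "0 \<le> E"
    and start: "n0 \<le> MT" "q0 \<in> cyl T" "0 < \<Phi> s \<epsilon> \<epsilon>' \<gamma> E n0 j0 q0"
  obtains n i p where "n \<le> MT" "p \<in> cyl T" "\<And>l j q. l \<le> MT \<Longrightarrow> q \<in> cyl T \<Longrightarrow> \<Phi> s \<epsilon> \<epsilon>' \<gamma> E l j q \<le> \<Phi> s \<epsilon> \<epsilon>' \<gamma> E n i p"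
proof -
  note SS = signed_one_abs[OF s]
  let ?f = "\<Phi> s \<epsilon> \<epsilon>' \<gamma> E"
  define b where "b = B + 22 * A^3"
  define J where "J = {..MT} \<times> {j :: int^'n. norm (lat dx j - 0) \<le> b / \<gamma> + (1 + \<epsilon> * b)}"
  define K where "K = {0..T} \<times> cball (0 :: real^'n) (b / \<gamma>)"
  have Kc: "K \<subseteq> cyl T" by (auto simp: K_def cyl_def)
  have inJK: "(n, j) \<in> J \<and> q \<in> K" if h: "n \<le> MT" "q \<in> cyl T" "0 < ?f n j q" for n j q
  proof -
    obtain t y where ty: "q = (t, y)" by fastforce
    have t: "0 \<le> t" "t \<le> T" using h ty by (auto simp: cyl_def)
    have e1: "1 \<le> exp (lam * t)" using lam_pos t by simp
    let ?N = "(1 / \<epsilon>) * (norm (lat dx j - y))\<^sup>2"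
    have N0: "0 \<le> ?N" "0 \<le> (tm dt n - t)\<^sup>2 / \<epsilon>'" "0 \<le> E * t" "0 < soft_norm 1 y" using pos t soft_norm_ge(3)[of 1 y] by auto
    have "s * U (tm dt n, lat dx j) - s * u q \<le> b"
      using SS(3)[of "U (tm dt n, lat dx j)"] SS(3)[of "u q"] UB[OF h(1), of j] u_le[OF h(2)] unfolding b_def by linarith
    then have le: "exp (lam * t) * (?N + (tm dt n - t)\<^sup>2 / \<epsilon>') + E * t + \<gamma> * soft_norm 1 y \<le> b"
      using h(3) unfolding \<Phi>_def ty by simp
    have G0: "0 \<le> \<gamma> * soft_norm 1 y" using N0 pos by simp
    have X0: "0 \<le> exp (lam * t) * (?N + (tm dt n - t)\<^sup>2 / \<epsilon>')" by (rule mult_nonneg_nonneg[OF _ add_nonneg_nonneg[OF N0(1,2)]]) simp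
    have "1 * ?N \<le> exp (lam * t) * (?N + (tm dt n - t)\<^sup>2 / \<epsilon>')" using e1 N0 by (intro mult_mono) auto
    then have N1: "?N \<le> b" and N2: "\<gamma> * soft_norm 1 y \<le> b"
      using le N0(3) G0 X0 by linarith+
    have ny: "norm y \<le> b / \<gamma>"
    proof -
      have "\<gamma> * norm y \<le> \<gamma> * soft_norm 1 y" using soft_norm_ge(1)[of y 1] pos by (intro mult_left_mono) auto
      then have "norm y * \<gamma> \<le> b" using N2 by (simp add: mult.commute)
      then show ?thesis by (simp only: pos_le_divide_eq[OF pos(3)])
    qed
    have "(norm (lat dx j - y))\<^sup>2 \<le> \<epsilon> * b" using N1 pos by (simp add: pos_divide_le_eq mult.commute)
    moreover have "norm (lat dx j - y) \<le> 1 + (norm (lat dx j - y))\<^sup>2"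
    proof -
      have "2 * norm (lat dx j - y) \<le> (norm (lat dx j - y))\<^sup>2 + 1" using sum_squares_bound[of "norm (lat dx j - y)" 1] by simp
      then show ?thesis using norm_ge_zero[of "lat dx j - y"] by linarith
    qed
    ultimately have "norm (lat dx j - y) \<le> 1 + \<epsilon> * b" by linarith
    then have "norm (lat dx j) \<le> b / \<gamma> + (1 + \<epsilon> * b)" using ny norm_triangle_sub[of "lat dx j" y] by linarith
    then show ?thesis using h t ny by (auto simp: J_def K_def ty)
  qed
  have finJ: "finite J" unfolding J_def by (intro finite_cartesian_product finite_lat_ball dx(1)) simp
  have st: "(n0, j0) \<in> J" "q0 \<in> K" using inJK[OF start] by auto
  have cK: "compact K" "K \<noteq> {}"
  proof -
    show "compact K" unfolding K_def by (intro compact_Times compact_Icc compact_cball)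
    show "K \<noteq> {}" using st(2) by blast
  qed
  have "\<exists>p\<in>K. \<forall>q\<in>K. ?f n j q \<le> ?f n j p" for n j
  proof (rule continuous_attains_sup[OF cK])
    obtain H :: "real^'n \<Rightarrow> _" where "C2_on UNIV (soft_norm 1) (soft_grad 1) H" using C2_on_soft_norm[OF zero_less_one] by blast
    from C2_on_continuous(1)[OF this] have c: "continuous_on UNIV (soft_norm 1 :: real^'n \<Rightarrow> real)" .
    have c1: "continuous_on K (\<lambda>q. soft_norm 1 (snd q))" by (intro continuous_on_compose2[OF c] continuous_intros) auto
    have c2: "continuous_on K u" by (rule continuous_on_subset[OF u_cont Kc])
    show "continuous_on K (?f n j)" unfolding \<Phi>_def[abs_def] using pos by (intro continuous_intros c1 c2) auto
  qed
  then obtain p where p: "\<And>n j. p n j \<in> K" "\<And>n j q. q \<in> K \<Longrightarrow> ?f n j q \<le> ?f n j (p n j)" by metis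
  let ?g = "\<lambda>(n, j). ?f n j (p n j)"
  have "Max (?g ` J) \<in> ?g ` J" using finJ st by (intro Max_in) auto
  then obtain n i where ni: "(n, i) \<in> J" "?g (n, i) = Max (?g ` J)" by auto
  have mx: "?f l j (p l j) \<le> ?f n i (p n i)" if "(l, j) \<in> J" for l j
  proof -
    have "?g (l, j) \<le> Max (?g ` J)" using that finJ by (intro Max_ge) auto
    then show ?thesis using ni by simp
  qed
  have pos': "0 < ?f n i (p n i)" using mx[OF st(1)] p(2)[OF st(2), of n0 j0] start(3) by linarith
  show ?thesis
  proof (rule that[of n "p n i" i])
    show "n \<le> MT" using ni by (simp add: J_def)
    show "p n i \<in> cyl T" using p(1) Kc by auto
    fix l j and q :: "real \<times> (real^'n)" assume h: "l \<le> MT" "q \<in> cyl T"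
    show "?f l j q \<le> ?f n i (p n i)"
    proof (cases "0 < ?f l j q")
      case True
      from inJK[OF h True] have "(l, j) \<in> J" "q \<in> K" by auto
      then show ?thesis using mx[of l j] p(2)[of q l j] by linarith
    qed (use pos' in linarith)
  qed
qed

end

section \<open>Exclusion of an interior maximum\<close>

context error_bounds
begin

text \<open>At a positive interior maximum the viscosity inequality bounds an inf-sup at (t, y) from
  below and the scheme bounds nearly the same inf-sup at the grid point of level n - 1 from above.
  Subtracting them leaves E and \<open>lam\<close> times the penalty against the consistency errors,
  and E is the rest of the right-hand side of \<open>doubling_arith\<close>.\<close>

lemma doubling_interior:
  fixes y :: "real^'n"
  assumes s: "s = 1 \<or> s = - 1" and pos: "0 < \<epsilon>'" "\<epsilon>' \<le> \<epsilon>" "0 < \<gamma>"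
    and E: "E = 6 * A * \<gamma> + \<kappa>1 * \<epsilon> + exp (lam * A) * ((3 * \<kappa>1 + 4 * A\<^sup>2 + A) * ((hscale \<sigma> \<delta>)\<^sup>2 * dt\<^sup>2 + X1 + \<delta> powr (2 - \<sigma>)) / \<epsilon>)
      + exp (lam * A) * dt / \<epsilon>'"
    and n: "1 \<le> n" "n \<le> MT" and p: "(t, y) \<in> QT T"
    and max: "\<And>l j q. l \<le> MT \<Longrightarrow> q \<in> cyl T \<Longrightarrow> \<Phi> s \<epsilon> \<epsilon>' \<gamma> E l j q \<le> \<Phi> s \<epsilon> \<epsilon>' \<gamma> E n i (t, y)"
  shows "\<Phi> s \<epsilon> \<epsilon>' \<gamma> E n i (t, y) \<le> 0"
proof (rule ccontr)
  assume "\<not> \<Phi> s \<epsilon> \<epsilon>' \<gamma> E n i (t, y) \<le> 0"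
  define S where "S = \<Phi> s \<epsilon> \<epsilon>' \<gamma> E n i (t, y)"
  have S0: "0 \<le> S" using \<open>\<not> _\<close> by (simp add: S_def)
  have \<epsilon>: "0 < \<epsilon>" using pos by linarith
  have pc: "(t, y) \<in> cyl T" by (rule QT_cyl[OF p])
  have t: "0 < t" "t \<le> T" "t \<in> {0..T}" using p by (auto simp: QT_def)
  note SS = signed_one_abs[OF s]
  define x where "x = lat dx i"
  define tn where "tn = tm dt n"
  define e where "e = exp (lam * t)"
  have lt: "lam * t \<le> lam * A" using lam_pos t T by (intro mult_left_mono) auto
  have e: "1 \<le> e" "e \<le> exp (lam * A)" using lam_pos t lt by (simp_all add: e_def)
  define k where "k = e / \<epsilon>"
  have k0: "0 < k" using e \<epsilon> by (simp add: k_def)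
  define q where "q = x - y"
  define g where "g = (2 * k) *\<^sub>R q"
  \<comment> \<open>The time penalty as seen by the scheme, with the weight frozen at t. Its
    backward difference quotient will meet the derivative in t from the viscosity
    inequality.\<close>
  define \<tau> where "\<tau> = (\<lambda>l. e * ((tm dt l - t)\<^sup>2 / \<epsilon>'))"
  define D where "D = norm q + \<bar>tm dt n - t\<bar> + dt"
  define w where "w = \<delta> powr (2 - \<sigma>)"
  have w: "0 \<le> w" "w \<le> 1" using \<delta> \<sigma> by (auto simp: w_def powr_le1)
  have X10: "0 \<le> X1" using dx hscale_ge1[of \<sigma> \<delta>] by (simp add: X1_def)
  have E0: "0 \<le> E" using A pos \<epsilon> lam_pos X10 dt by (auto simp: E intro!: add_nonneg_nonneg mult_nonneg_nonneg divide_nonneg_nonneg)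
  define v where "v = (\<lambda>y. s * u (t, y))"
  have vc: "continuous_on UNIV v" unfolding v_def by (rule u_section_cont[OF t(3)])
  have vb: "\<bar>v y'\<bar> \<le> 22 * A^3" for y' unfolding v_def SS(3) by (rule u_le) (use t in \<open>simp add: cyl_def\<close>)
  define Y where "Y = (\<lambda>\<alpha> \<beta>. zeroth P \<alpha> \<beta> (t, y) * (s * u (t, y)) - drift P \<alpha> \<beta> (t, y) \<bullet> g
      - (\<integral>z. s * u (t, y + jump P \<alpha> \<beta> (t, y) z) - s * u (t, y) \<partial>far \<delta>)
      + mean_jump \<delta> \<alpha> \<beta> (t, y) \<bullet> g - \<gamma> * (mean_jump \<delta> \<alpha> \<beta> (t, y) \<bullet> soft_grad 1 y))"
  define e1 where "e1 = A * D * (22 * A^3) + A * D * norm g + 2 * A * \<gamma> + k * A * D\<^sup>2 + A * hscale \<sigma> \<delta> * dt * norm g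
      + 2 * k * (2 * A\<^sup>2 * hscale \<sigma> \<delta> * dx + A\<^sup>2 * \<delta> powr (- \<sigma>) * dx\<^sup>2)"
  define e2 where "e2 = \<gamma> * A + (k + \<gamma>) * A * w"
  have hs1: "0 \<le> hscale \<sigma> \<delta>" using hscale_ge1[of \<sigma> \<delta>] by simp
  have ub: "s * U (tm dt l, lat dx j) \<le> S + s * u (t, y') + E * t + \<gamma> * soft_norm 1 y' + \<tau> l + k * (norm (lat dx j - y'))\<^sup>2"
    if "l \<in> {n - 1, n}" for l j y'
  proof -
    have "l \<le> MT" using that n by auto
    moreover have "(t, y') \<in> cyl T" using t by (simp add: cyl_def)
    ultimately have "\<Phi> s \<epsilon> \<epsilon>' \<gamma> E l j (t, y') \<le> S" unfolding S_def by (rule max)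
    then show ?thesis by (simp add: \<Phi>_def \<tau>_def k_def e_def distrib_left algebra_simps)
  qed
  have eq: "s * U (tm dt n, lat dx i) = S + s * u (t, y) + E * t + \<gamma> * soft_norm 1 y + \<tau> n + k * (norm q)\<^sup>2"
    by (simp add: S_def \<Phi>_def \<tau>_def k_def e_def q_def x_def distrib_left algebra_simps)
  have disc: "\<tau> n - \<tau> (n - 1) + dt * (Y \<alpha> \<beta> - e1)
    \<le> s * U (tm dt n, lat dx i) - s * U (tm dt (n - 1), lat dx i) + dt * scheme_lin \<alpha> \<beta> n i (\<lambda>p. s * U p)"
    if ab: "\<alpha> \<in> ctrlA P" "\<beta> \<in> ctrlB P" for \<alpha> \<beta>
  proof (rule doubling_discrete[OF n ab s pc S0, where k = k and \<tau> = \<tau> and \<gamma> = \<gamma> and q = q and g = g and D = D and ?w0.0 = "E * t" and Y = "Y \<alpha> \<beta>" and ?e1.0 = e1])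
    show "0 \<le> \<tau> (n - 1)" using e pos by (simp add: \<tau>_def)
  qed (use E0 t pos k0 ub eq in \<open>simp_all add: q_def x_def g_def D_def Y_def e1_def\<close>)
  have mj: "norm (mean_jump \<delta> \<alpha> \<beta> (t, y)) \<le> A * hscale \<sigma> \<delta>" if ab: "\<alpha> \<in> ctrlA P" "\<beta> \<in> ctrlB P" for \<alpha> \<beta>
    by (rule mean_jump_bounds(1)[OF \<delta> ab pc pc])
  define CY where "CY = A * (22 * A^3) + A * norm g + 2 * (22 * A^3) * (A * \<delta> powr (- \<sigma>)) + A * hscale \<sigma> \<delta> * norm g + \<gamma> * (A * hscale \<sigma> \<delta> * 1)"
  have YB: "\<bar>Y \<alpha> \<beta>\<bar> \<le> CY" if ab: "\<alpha> \<in> ctrlA P" "\<beta> \<in> ctrlB P" for \<alpha> \<beta>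
  proof -
    have 1: "\<bar>zeroth P \<alpha> \<beta> (t, y) * v y\<bar> \<le> A * (22 * A^3)"
      unfolding abs_mult[of "zeroth P \<alpha> \<beta> (t, y)"] using zeroth[OF ab pc] vb[of y] A by (intro mult_mono) auto
    have 2: "\<bar>drift P \<alpha> \<beta> (t, y) \<bullet> g\<bar> \<le> A * norm g"
      by (rule order_trans[OF Cauchy_Schwarz_ineq2 mult_right_mono[OF drift[OF ab pc]]]) simp
    have 3: "\<bar>mean_jump \<delta> \<alpha> \<beta> (t, y) \<bullet> g\<bar> \<le> A * hscale \<sigma> \<delta> * norm g"
      by (rule order_trans[OF Cauchy_Schwarz_ineq2 mult_right_mono[OF mj[OF ab]]]) simp
    have "\<bar>mean_jump \<delta> \<alpha> \<beta> (t, y) \<bullet> soft_grad 1 y\<bar> \<le> A * hscale \<sigma> \<delta> * 1"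
      by (rule order_trans[OF Cauchy_Schwarz_ineq2 mult_mono[OF mj[OF ab] norm_soft_grad]]) (use A hs1 in auto)
    then have 4: "\<bar>\<gamma> * (mean_jump \<delta> \<alpha> \<beta> (t, y) \<bullet> soft_grad 1 y)\<bar> \<le> \<gamma> * (A * hscale \<sigma> \<delta> * 1)"
      unfolding abs_mult[of \<gamma>] using pos by (intro mult_mono) auto
    have 5: "\<bar>\<integral>z. v (y + jump P \<alpha> \<beta> (t, y) z) - v y \<partial>far \<delta>\<bar> \<le> 2 * (22 * A^3) * (A * \<delta> powr (- \<sigma>))"
      by (rule integrable_increment(4)[OF \<delta> ab pc vc vb])
    show ?thesis using 1 2 3 4 5 unfolding Y_def CY_def v_def by linarith
  qed
  \<comment> \<open>Minus the penalty as a function of (t, y) is the test function for u. It is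
    split into a product of a time and a space factor, a pure time part \<open>a3\<close> with
    derivatives \<open>b3\<close> and \<open>c3\<close>, and the growth penalty, to match the
    calculus rules.\<close>
  define f2 where "f2 = (\<lambda>z. (1 / \<epsilon>) * (norm (z - x))\<^sup>2)"
  define a3 where "a3 = (\<lambda>r. exp (lam * r) * ((tn - r)\<^sup>2 / \<epsilon>') + E * r)"
  define b3 where "b3 = (\<lambda>r. lam * exp (lam * r) * ((tn - r)\<^sup>2 / \<epsilon>') - exp (lam * r) * (2 * (tn - r) / \<epsilon>') + E)"
  define c3 where "c3 = (\<lambda>r. lam * (lam * exp (lam * r)) * ((tn - r)\<^sup>2 / \<epsilon>') - 2 * (lam * exp (lam * r) * (2 * (tn - r) / \<epsilon>')) + exp (lam * r) * (2 / \<epsilon>'))"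
  define \<xi> where "\<xi> = (\<lambda>z :: real \<times> (real^'n). - 1 * (exp (lam * fst z) * f2 (snd z) + a3 (fst z) + \<gamma> * soft_norm 1 (snd z)))"
  define G where "G = (\<lambda>z :: real \<times> (real^'n). - 1 *\<^sub>R ((exp (lam * fst z) *\<^sub>R (0, (2 * (1 / \<epsilon>)) *\<^sub>R (snd z - x)) + f2 (snd z) *\<^sub>R (lam * exp (lam * fst z), 0))
     + (b3 (fst z), 0) + \<gamma> *\<^sub>R (0, soft_grad 1 (snd z))))"
  have C2\<xi>: "C2_grad (QT T) \<xi> G"
  proof -
    have c1: "C2_grad (QT T) (\<lambda>z :: real \<times> (real^'n). exp (lam * fst z)) (\<lambda>z. (lam * exp (lam * fst z), 0))"
      by (rule C2_grad_time[where \<tau>'' = "\<lambda>r. lam * (lam * exp (lam * r))"]) (auto intro!: derivative_eq_intros continuous_intros)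
    have "C2_grad UNIV f2 (\<lambda>z. (2 * (1 / \<epsilon>)) *\<^sub>R (z - x))"
      unfolding f2_def C2_grad_def using C2_on_shift[OF C2_on_square[of "1 / \<epsilon>"], of x] by blast
    then have c2: "C2_grad (QT T) (\<lambda>z :: real \<times> (real^'n). f2 (snd z)) (\<lambda>z. (0, (2 * (1 / \<epsilon>)) *\<^sub>R (snd z - x)))"
      by (rule C2_grad_space)
    have c3: "C2_grad (QT T) (\<lambda>z :: real \<times> (real^'n). a3 (fst z)) (\<lambda>z. (b3 (fst z), 0))"
    proof (rule C2_grad_time[where \<tau>'' = c3])
      define ci where "ci = inverse \<epsilon>'"
      show "(a3 has_real_derivative b3 r) (at r)" for r unfolding a3_def b3_def divide_inverse ci_def[symmetric]
        by (auto intro!: derivative_eq_intros simp: algebra_simps)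
      show "(b3 has_real_derivative c3 r) (at r)" for r unfolding b3_def c3_def divide_inverse ci_def[symmetric]
        by (auto intro!: derivative_eq_intros simp: algebra_simps)
      show "continuous_on UNIV c3" unfolding c3_def using pos by (intro continuous_intros) auto
    qed
    have "C2_grad UNIV (soft_norm 1 :: real^'n \<Rightarrow> real) (soft_grad 1)"
      using C2_on_soft_norm[OF zero_less_one] unfolding C2_grad_def by blast
    then have c4: "C2_grad (QT T) (\<lambda>z :: real \<times> (real^'n). \<gamma> * soft_norm 1 (snd z)) (\<lambda>z. \<gamma> *\<^sub>R (0, soft_grad 1 (snd z)))"
      by (intro C2_grad_cmult C2_grad_space)
    show ?thesis unfolding \<xi>_def G_def
      by (rule C2_grad_cmult[OF C2_grad_add[OF C2_grad_add[OF C2_grad_mult[OF c1 c2] c3] c4]])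
  qed
  \<comment> \<open>The gradient of \<open>\<xi>\<close> in y. Its main part g is also the gradient
    of the quadratic penalty in the grid variable, so both inequalities contain the same first order
    term.\<close>
  define d where "d = g - \<gamma> *\<^sub>R soft_grad 1 y"
  have kq: "k * r = e * ((1 / \<epsilon>) * r)" for r by (simp add: k_def)
  have Gd: "d = snd (G (t, y))"
    by (simp add: d_def G_def g_def q_def k_def e_def algebra_simps)
  have Gt: "fst (G (t, y)) = - (lam * (e * ((norm q)\<^sup>2 / \<epsilon> + (tn - t)\<^sup>2 / \<epsilon>')) - e * (2 * (tn - t) / \<epsilon>') + E)"
    by (simp add: G_def f2_def b3_def e_def q_def norm_minus_commute divide_inverse algebra_simps)
  have sqi: "integrable (levy P) (\<lambda>z. (\<rho> z)\<^sup>2)" using mom by (simp add: levy_moments_def)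
  have INFv: "0 \<le> fst (G (t, y)) + s * (INF \<alpha>\<in>ctrlA P. SUP \<beta>\<in>ctrlB P. - src P \<alpha> \<beta> (t, y) + s * (Y \<alpha> \<beta> + e2))"
  proof (rule visc_step[OF s \<delta> C2\<xi> p _ Gd, where m = "\<lambda>z. (k + \<gamma>) * (\<rho> z)\<^sup>2" and CQ = "CY + \<bar>e2\<bar>"])
    fix q' :: "real \<times> (real^'n)" assume "q' \<in> QT T"
    then have "\<Phi> s \<epsilon> \<epsilon>' \<gamma> E n i q' \<le> \<Phi> s \<epsilon> \<epsilon>' \<gamma> E n i (t, y)" using n by (intro max QT_cyl) auto
    moreover have "\<Phi> s \<epsilon> \<epsilon>' \<gamma> E n i z = s * U (tm dt n, x) - s * u z + \<xi> z" for z
      unfolding \<Phi>_def \<xi>_def f2_def a3_def x_def tn_def by (simp add: norm_minus_commute distrib_left)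
    ultimately show "s * u (t, y) - \<xi> (t, y) \<le> s * u q' - \<xi> q'" by simp
  next
    show "integrable (levy P) (\<lambda>z. (k + \<gamma>) * (\<rho> z)\<^sup>2)" using sqi by simp
  next
    fix \<alpha> \<beta> and z :: "real^'m" assume ab: "\<alpha> \<in> ctrlA P" "\<beta> \<in> ctrlB P" and z: "z \<noteq> 0"
    define \<eta> where "\<eta> = jump P \<alpha> \<beta> (t, y) z"
    define W where "W = soft_norm 1 (y + \<eta>) - soft_norm 1 y - \<eta> \<bullet> soft_grad 1 y"
    have W: "0 \<le> W" "W \<le> (\<rho> z)\<^sup>2"
      using soft_jump_pointwise[OF _ ab pc z, of 1 y] unfolding W_def \<eta>_def soft_majorant_def by auto
    have \<eta>2: "(norm \<eta>)\<^sup>2 \<le> (\<rho> z)\<^sup>2" using jump[OF ab pc z] by (intro power_mono) (auto simp: \<eta>_def)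
    have nx: "(norm (y + \<eta> - x))\<^sup>2 = (norm (y - x))\<^sup>2 - 2 * (\<eta> \<bullet> q) + (norm \<eta>)\<^sup>2"
      unfolding q_def power2_norm_eq_inner by (simp add: inner_add_left inner_add_right inner_diff_left inner_diff_right inner_commute)
    have "\<xi> (t, y + \<eta>) - \<xi> (t, y) - \<eta> \<bullet> d = - (k * ((norm (y + \<eta> - x))\<^sup>2 - (norm (y - x))\<^sup>2) + \<gamma> * (soft_norm 1 (y + \<eta>) - soft_norm 1 y)) - \<eta> \<bullet> d"
      unfolding \<xi>_def f2_def kq by (simp add: e_def algebra_simps)
    also have "\<dots> = - (k * (norm \<eta>)\<^sup>2 + \<gamma> * W)"
      unfolding nx W_def d_def g_def by (simp add: inner_diff_right algebra_simps)
    finally have xe: "\<xi> (t, y + \<eta>) - \<xi> (t, y) - \<eta> \<bullet> d = - (k * (norm \<eta>)\<^sup>2 + \<gamma> * W)" .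
    have "0 \<le> k * (norm \<eta>)\<^sup>2 + \<gamma> * W" using k0 pos W by (intro add_nonneg_nonneg mult_nonneg_nonneg) auto
    then have "\<bar>\<xi> (t, y + \<eta>) - \<xi> (t, y) - \<eta> \<bullet> d\<bar> = k * (norm \<eta>)\<^sup>2 + \<gamma> * W" unfolding xe abs_minus_cancel by (rule abs_of_nonneg)
    also have "\<dots> \<le> k * (\<rho> z)\<^sup>2 + \<gamma> * (\<rho> z)\<^sup>2" using k0 pos W \<eta>2 by (intro add_mono mult_left_mono) auto
    finally show "\<bar>\<xi> (t, y + jump P \<alpha> \<beta> (t, y) z) - \<xi> (t, y) - jump P \<alpha> \<beta> (t, y) z \<bullet> d\<bar> \<le> (k + \<gamma>) * (\<rho> z)\<^sup>2"
      by (simp add: \<eta>_def distrib_right)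
  next
    fix \<alpha> \<beta> assume ab: "\<alpha> \<in> ctrlA P" "\<beta> \<in> ctrlB P"
    have "(LINT z:{z. norm z \<le> \<delta>}|levy P. (k + \<gamma>) * (\<rho> z)\<^sup>2) = (k + \<gamma>) * (LINT z:{z. norm z \<le> \<delta>}|levy P. (\<rho> z)\<^sup>2)"
      by simp
    also have "\<dots> \<le> (k + \<gamma>) * (A * w)" using mom k0 pos \<delta> by (intro mult_left_mono) (auto simp: levy_moments_def w_def)
    finally have 1: "(LINT z:{z. norm z \<le> \<delta>}|levy P. (k + \<gamma>) * (\<rho> z)\<^sup>2) \<le> (k + \<gamma>) * A * w" by (simp add: mult.assoc)
    have "drift P \<alpha> \<beta> (t, y) \<bullet> soft_grad 1 y \<le> A * 1"
      by (rule order_trans[OF norm_cauchy_schwarz mult_mono[OF drift[OF ab pc] norm_soft_grad]]) (use A in auto)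
    then have 2: "\<gamma> * (drift P \<alpha> \<beta> (t, y) \<bullet> soft_grad 1 y) \<le> \<gamma> * A" using pos by (intro mult_left_mono) auto
    have 3: "r \<bullet> d = r \<bullet> g - \<gamma> * (r \<bullet> soft_grad 1 y)" for r by (simp add: d_def inner_diff_right)
    \<comment> \<open>The second alternative is taken: the jumps of u outside \<delta> stay, since
      they also occur in the scheme, and those inside cost the Hessian times \<delta>^(2 -
      \<sigma>).\<close>
    show "zeroth P \<alpha> \<beta> (t, y) * (s * u (t, y)) - drift P \<alpha> \<beta> (t, y) \<bullet> d + (LINT z|levy P. (k + \<gamma>) * (\<rho> z)\<^sup>2) \<le> Y \<alpha> \<beta> + e2 \<or>
        zeroth P \<alpha> \<beta> (t, y) * (s * u (t, y)) - drift P \<alpha> \<beta> (t, y) \<bullet> d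
         - ((\<integral>z. s * u (t, y + jump P \<alpha> \<beta> (t, y) z) - s * u (t, y) \<partial>far \<delta>) - mean_jump \<delta> \<alpha> \<beta> (t, y) \<bullet> d)
         + (LINT z:{z. norm z \<le> \<delta>}|levy P. (k + \<gamma>) * (\<rho> z)\<^sup>2) \<le> Y \<alpha> \<beta> + e2"
      using 1 2 unfolding 3 Y_def e2_def by (intro disjI2) linarith
    show "\<bar>Y \<alpha> \<beta> + e2\<bar> \<le> CY + \<bar>e2\<bar>" using YB[OF ab] by linarith
  qed
  define R where "R = (\<lambda>\<alpha> \<beta>. Y \<alpha> \<beta> - e1 + (\<tau> n - \<tau> (n - 1)) / dt)"
  have INFd: "s * (INF \<alpha>\<in>ctrlA P. SUP \<beta>\<in>ctrlB P. - src P \<alpha> \<beta> (tm dt (n - 1), lat dx i) + s * R \<alpha> \<beta>) \<le> 0"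
  proof (rule scheme_step[OF n s, where C = "CY + \<bar>e1\<bar> + \<bar>(\<tau> n - \<tau> (n - 1)) / dt\<bar>"])
    fix \<alpha> \<beta> assume ab: "\<alpha> \<in> ctrlA P" "\<beta> \<in> ctrlB P"
    have "dt * R \<alpha> \<beta> = \<tau> n - \<tau> (n - 1) + dt * (Y \<alpha> \<beta> - e1)" using dt by (simp add: R_def distrib_left)
    then show "dt * R \<alpha> \<beta> \<le> s * U (tm dt n, lat dx i) - s * U (tm dt (n - 1), lat dx i) + dt * scheme_lin \<alpha> \<beta> n i (\<lambda>p. s * U p)"
      using disc[OF ab] by simp
    show "\<bar>R \<alpha> \<beta>\<bar> \<le> CY + \<bar>e1\<bar> + \<bar>(\<tau> n - \<tau> (n - 1)) / dt\<bar>" using YB[OF ab] unfolding R_def by linarith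
  qed
  \<comment> \<open>All discrepancies between the two inf-sups; \<open>A * D\<close> is the
    Lipschitz error of the source, which the scheme evaluates at level n - 1.\<close>
  define e3 where "e3 = A * D + e1 + e2 - (\<tau> n - \<tau> (n - 1)) / dt"
  have cyl1: "(tm dt (n - 1), lat dx i) \<in> cyl T" using n by (intro tm_cyl) simp
  have "s * (INF \<alpha>\<in>ctrlA P. SUP \<beta>\<in>ctrlB P. - src P \<alpha> \<beta> (t, y) + s * (Y \<alpha> \<beta> + e2))
    \<le> s * (INF \<alpha>\<in>ctrlA P. SUP \<beta>\<in>ctrlB P. - src P \<alpha> \<beta> (tm dt (n - 1), lat dx i) + s * R \<alpha> \<beta>) + e3"
  proof (rule INF_SUP_signed_mono[OF ne s, where C = "A + (CY + \<bar>e2\<bar>)" and C' = "A + (CY + \<bar>e1\<bar> + \<bar>(\<tau> n - \<tau> (n - 1)) / dt\<bar>)"])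
    fix \<alpha> \<beta> assume ab: "\<alpha> \<in> ctrlA P" "\<beta> \<in> ctrlB P"
    show "\<bar>- src P \<alpha> \<beta> (t, y) + s * (Y \<alpha> \<beta> + e2)\<bar> \<le> A + (CY + \<bar>e2\<bar>)"
      using src[OF ab pc] YB[OF ab] SS(3)[of "Y \<alpha> \<beta> + e2"] by linarith
    show "\<bar>- src P \<alpha> \<beta> (tm dt (n - 1), lat dx i) + s * R \<alpha> \<beta>\<bar> \<le> A + (CY + \<bar>e1\<bar> + \<bar>(\<tau> n - \<tau> (n - 1)) / dt\<bar>)"
    proof -
      have "\<bar>R \<alpha> \<beta>\<bar> \<le> CY + \<bar>e1\<bar> + \<bar>(\<tau> n - \<tau> (n - 1)) / dt\<bar>" using YB[OF ab] unfolding R_def by linarith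
      then show ?thesis using src[OF ab cyl1] SS(3)[of "R \<alpha> \<beta>"] by linarith
    qed
    have pd: "pdist (tm dt (n - 1), lat dx i) (t, y) \<le> D"
      using tm_diff[OF n(1)] dt by (auto simp: pdist_def D_def q_def x_def)
    have "\<bar>src P \<alpha> \<beta> (tm dt (n - 1), lat dx i) - src P \<alpha> \<beta> (t, y)\<bar> \<le> A * D"
      by (rule order_trans[OF src_lip[OF ab cyl1 pc] mult_left_mono[OF pd]]) (use A in simp)
    then have "s * src P \<alpha> \<beta> (tm dt (n - 1), lat dx i) - s * src P \<alpha> \<beta> (t, y) \<le> A * D"
      using SS(3)[of "src P \<alpha> \<beta> (tm dt (n - 1), lat dx i) - src P \<alpha> \<beta> (t, y)"] by (simp add: right_diff_distrib)
    moreover have ss: "s * (- r' + s * r) = - (s * r') + r" for r r' :: real using s by auto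
    moreover have "Y \<alpha> \<beta> + e2 + A * D = R \<alpha> \<beta> + e3" unfolding R_def e3_def by simp
    ultimately show "s * (- src P \<alpha> \<beta> (t, y) + s * (Y \<alpha> \<beta> + e2)) \<le> s * (- src P \<alpha> \<beta> (tm dt (n - 1), lat dx i) + s * R \<alpha> \<beta>) + e3"
      unfolding ss by linarith
  qed
  then have "0 \<le> fst (G (t, y)) + e3" using INFv INFd by linarith
  \<comment> \<open>The backward difference of the parabola is its derivative at \<open>tn\<close>
    minus one step; the derivative cancels with the one in t, which leaves the error e dt /
    \<epsilon>'.\<close>
  moreover have "(\<tau> n - \<tau> (n - 1)) / dt = e * (2 * (tn - t) / \<epsilon>') - e * dt / \<epsilon>'"
  proof -
    have tn1: "tm dt (n - 1) = tn - dt" using tm_diff[OF n(1)] by (simp add: tn_def)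
    have "\<tau> n - \<tau> (n - 1) = e * (((tn - t)\<^sup>2 - (tn - dt - t)\<^sup>2) / \<epsilon>')"
      unfolding \<tau>_def tn1 by (simp add: tn_def diff_divide_distrib right_diff_distrib)
    also have "(tn - t)\<^sup>2 - (tn - dt - t)\<^sup>2 = (2 * (tn - t) - dt) * dt" by (simp add: power2_eq_square algebra_simps)
    finally show ?thesis using dt by (simp add: diff_divide_distrib right_diff_distrib)
  qed
  ultimately have "E + lam * (e * ((norm q)\<^sup>2 / \<epsilon> + (tn - t)\<^sup>2 / \<epsilon>')) \<le> A * D + e1 + e2 + e * dt / \<epsilon>'"
    unfolding Gt e3_def by linarith
  moreover have "A * D + e1 + e2 + e * dt / \<epsilon>' < E + lam * (e * ((norm q)\<^sup>2 / \<epsilon> + (tn - t)\<^sup>2 / \<epsilon>'))"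
  proof -
    have ng: "norm g = 2 * k * norm q" using k0 by (simp add: g_def)
    have "2 * A\<^sup>2 * hscale \<sigma> \<delta> * dx + A\<^sup>2 * \<delta> powr (- \<sigma>) * dx\<^sup>2 \<le> 2 * A\<^sup>2 * X1" by (simp add: X1_def algebra_simps)
    then have "2 * k * (2 * A\<^sup>2 * hscale \<sigma> \<delta> * dx + A\<^sup>2 * \<delta> powr (- \<sigma>) * dx\<^sup>2) \<le> 2 * k * (2 * A\<^sup>2 * X1)" using k0 by (intro mult_left_mono) auto
    then have e1le: "e1 \<le> A * D * (22 * A^3) + A * D * (2 * k * norm q) + 2 * A * \<gamma> + k * A * D\<^sup>2 + A * hscale \<sigma> \<delta> * dt * (2 * k * norm q) + 2 * k * (2 * A\<^sup>2 * X1)"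
      unfolding e1_def ng by linarith
    have "A * D + (A * D * (22 * A^3) + A * D * (2 * k * norm q) + 2 * A * \<gamma> + k * A * D\<^sup>2 + A * hscale \<sigma> \<delta> * dt * (2 * k * norm q) + 2 * k * (2 * A\<^sup>2 * X1))
       + (\<gamma> * A + (k + \<gamma>) * A * w) + e * dt / \<epsilon>'
     < (6 * A * \<gamma> + \<kappa>1 * \<epsilon> + exp (lam * A) * ((3 * \<kappa>1 + 4 * A\<^sup>2 + A) * ((hscale \<sigma> \<delta>)\<^sup>2 * dt\<^sup>2 + X1 + w) / \<epsilon>) + exp (lam * A) * dt / \<epsilon>')
       + (3 * \<kappa>1 + A) * (e * ((norm q)\<^sup>2 / \<epsilon> + \<bar>tn - t\<bar>\<^sup>2 / \<epsilon>'))"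
      by (rule doubling_arith[OF A e _ _ dt(1) hscale_ge1 pos X10 w k_def _ \<kappa>1_def]) (auto simp: D_def tn_def)
    then show ?thesis using e1le unfolding E lam_def[symmetric] e2_def w_def power2_abs by linarith
  qed
  ultimately show False by linarith
qed

end

section \<open>Choice of the parameters\<close>

lemma weighted_am_gm:
  fixes a b \<epsilon> :: real
  assumes "0 \<le> a" "0 \<le> b" "0 < \<epsilon>"
  shows "a * b \<le> a\<^sup>2 * \<epsilon> + b\<^sup>2 / \<epsilon>"
proof -
  have "2 * (a * \<epsilon>) * b \<le> (a * \<epsilon>)\<^sup>2 + b\<^sup>2" by (rule sum_squares_bound)
  moreover have "0 \<le> a * \<epsilon> * b" using assms by simp
  ultimately have "a * b * \<epsilon> \<le> a\<^sup>2 * \<epsilon>\<^sup>2 + b\<^sup>2" by (simp add: power_mult_distrib mult_ac)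
  then have "a * b \<le> (a\<^sup>2 * \<epsilon>\<^sup>2 + b\<^sup>2) / \<epsilon>" by (simp only: pos_le_divide_eq[OF assms(3)])
  also have "\<dots> = a\<^sup>2 * \<epsilon> + b\<^sup>2 / \<epsilon>" using assms by (simp add: add_divide_distrib power2_eq_square)
  finally show ?thesis .
qed

context error_bounds
begin

text \<open>\<open>S0\<close> collects the errors made at \<open>t\<^sub>n = 0\<close> or \<open>t = 0\<close>, \<open>E0\<close> the consistency errors per unit of time; the
  remaining part \<open>6 A \<gamma>\<close> of \<open>E\<close> disappears as \<open>\<gamma> \<rightarrow> 0\<close>.\<close>

definition E0 :: "real \<Rightarrow> real \<Rightarrow> real" where
  "E0 \<epsilon> \<epsilon>' = \<kappa>1 * \<epsilon> + exp (lam * A) * ((3 * \<kappa>1 + 4 * A\<^sup>2 + A) * ((hscale \<sigma> \<delta>)\<^sup>2 * dt\<^sup>2 + X1 + \<delta> powr (2 - \<sigma>)) / \<epsilon>)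
      + exp (lam * A) * dt / \<epsilon>'"

definition S0 :: "real \<Rightarrow> real \<Rightarrow> real \<Rightarrow> real" where
  "S0 \<epsilon> \<epsilon>' r = A\<^sup>2 * \<epsilon> + A * r + 100 * A^6 * (hscale \<sigma> r)\<^sup>2 * \<epsilon>' + 10 * A^3 * (hscale \<sigma> \<delta> * dt + X1 / r) * T"

lemma X1_nonneg: "0 \<le> X1"
  using dx hscale_ge1[of \<sigma> \<delta>] by (simp add: X1_def)

text \<open>If the maximum has n = 0 or t = 0, one of the barriers applies. Its loss, linear in the
  other time, is absorbed by the time penalty at a cost proportional to \<epsilon>', and the
  Lipschitz error of \<open>u0\<close> by the quadratic penalty at the cost A^2 \<epsilon>.
  Evaluating the doubled function on the diagonal yields the error up to the terms in E and
  \<gamma>.\<close>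

lemma doubling_estimate:
  assumes s: "s = 1 \<or> s = - 1" and pos: "0 < \<epsilon>'" "\<epsilon>' \<le> \<epsilon>" "0 < r" and n1: "n1 \<le> MT"
  shows "s * U (tm dt n1, lat dx i1) - s * u (tm dt n1, lat dx i1) \<le> S0 \<epsilon> \<epsilon>' r + E0 \<epsilon> \<epsilon>' * T"
proof -
  have \<epsilon>: "0 < \<epsilon>" using pos by linarith
  note SS = signed_one_abs[OF s]
  let ?x1 = "lat dx i1" and ?t1 = "tm dt n1"
  have hr: "1 \<le> hscale \<sigma> r" "1 \<le> hscale \<sigma> \<delta>" by (rule hscale_ge1)+
  have X1r: "0 \<le> hscale \<sigma> \<delta> * dt + X1 / r" using hr X1_nonneg dt pos by simp
  have S00: "0 \<le> S0 \<epsilon> \<epsilon>' r" unfolding S0_def using A \<epsilon> pos hr X1_nonneg dt T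
    by (intro add_nonneg_nonneg mult_nonneg_nonneg) auto
  \<comment> \<open>The 100 A^6 in \<open>S0\<close> is the square of the slope 10 A^3 from the
    barrier of the scheme; the barrier of u would give only 100 A^4.\<close>
  have A46: "A^4 \<le> A^6" using A by (intro power_increasing) auto
  have g: "s * U (?t1, ?x1) - s * u (?t1, ?x1) \<le> (S0 \<epsilon> \<epsilon>' r + E0 \<epsilon> \<epsilon>' * T) + \<gamma> * (6 * A * T + soft_norm 1 ?x1)" if \<gamma>: "0 < \<gamma>" for \<gamma>
  proof -
    define E where "E = 6 * A * \<gamma> + E0 \<epsilon> \<epsilon>'"
    have E0': "0 \<le> E" unfolding E_def E0_def using A \<gamma> lam_pos X1_nonneg dt \<epsilon> pos
      by (intro add_nonneg_nonneg mult_nonneg_nonneg divide_nonneg_nonneg) auto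
    have Eeq: "E = 6 * A * \<gamma> + \<kappa>1 * \<epsilon> + exp (lam * A) * ((3 * \<kappa>1 + 4 * A\<^sup>2 + A) * ((hscale \<sigma> \<delta>)\<^sup>2 * dt\<^sup>2 + X1 + \<delta> powr (2 - \<sigma>)) / \<epsilon>)
      + exp (lam * A) * dt / \<epsilon>'" unfolding E_def E0_def by simp
    have "\<Phi> s \<epsilon> \<epsilon>' \<gamma> E n1 i1 (?t1, ?x1) \<le> S0 \<epsilon> \<epsilon>' r"
    proof (rule ccontr)
      assume neg: "\<not> ?thesis"
      then have start: "0 < \<Phi> s \<epsilon> \<epsilon>' \<gamma> E n1 i1 (?t1, ?x1)" using S00 by linarith
      obtain n p i where mx: "n \<le> MT" "p \<in> cyl T" "\<And>l j q. l \<le> MT \<Longrightarrow> q \<in> cyl T \<Longrightarrow> \<Phi> s \<epsilon> \<epsilon>' \<gamma> E l j q \<le> \<Phi> s \<epsilon> \<epsilon>' \<gamma> E n i p"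
        by (rule doubling_max[OF s \<epsilon> pos(1) \<gamma> E0' n1 tm_cyl[OF n1] start], rule that)
      obtain t y where ty: "p = (t, y)" by fastforce
      have t: "0 \<le> t" "t \<le> T" using mx(2) ty by (auto simp: cyl_def)
      have big: "S0 \<epsilon> \<epsilon>' r < \<Phi> s \<epsilon> \<epsilon>' \<gamma> E n i (t, y)" using mx(3)[OF n1 tm_cyl[OF n1], of i1 ?x1] neg unfolding ty by linarith
      define x where "x = lat dx i"
      define d where "d = norm (x - y)"
      have d0: "0 \<le> d" by (simp add: d_def)
      have Ad: "A * d \<le> A\<^sup>2 * \<epsilon> + d\<^sup>2 / \<epsilon>" using A d0 \<epsilon> by (intro weighted_am_gm) auto
      have lip: "s * u0 x - s * u0 y \<le> A * d"
        using SS(3)[of "u0 x - u0 y"] u0_lip[of x y] by (simp add: right_diff_distrib d_def)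
      have \<psi>: "0 \<le> \<gamma> * soft_norm 1 y" using \<gamma> soft_norm_ge(3)[of 1 y] by simp
      consider "n = 0" | "t = 0" | "1 \<le> n" "0 < t" using t by linarith
      then show False
      proof cases
        case 1
        have e1: "1 \<le> exp (lam * t)" using lam_pos t by simp
        define W where "W = exp (lam * t) * ((1 / \<epsilon>) * d\<^sup>2 + (tm dt n - t)\<^sup>2 / \<epsilon>')"
        have "1 * ((1 / \<epsilon>) * d\<^sup>2 + (tm dt n - t)\<^sup>2 / \<epsilon>') \<le> W"
          unfolding W_def using e1 \<epsilon> pos by (intro mult_right_mono add_nonneg_nonneg) auto
        then have "d\<^sup>2 / \<epsilon> + t\<^sup>2 / \<epsilon>' \<le> W" using 1 by (simp add: tm_def)
        moreover have "\<Phi> s \<epsilon> \<epsilon>' \<gamma> E n i (t, y) = s * u0 x - s * u (t, y) - (W + E * t + \<gamma> * soft_norm 1 y)"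
          using 1 by (simp add: \<Phi>_def W_def x_def d_def tm_def U0)
        moreover have "0 \<le> E * t" using E0' t by simp
        moreover note u_initial[OF s pos(3) mx(2)[unfolded ty]]
        moreover have "10 * A\<^sup>2 * hscale \<sigma> r * t \<le> (10 * A\<^sup>2 * hscale \<sigma> r)\<^sup>2 * \<epsilon>' + t\<^sup>2 / \<epsilon>'"
          using hr t pos by (intro weighted_am_gm) auto
        moreover have "(10 * A\<^sup>2 * hscale \<sigma> r)\<^sup>2 * \<epsilon>' \<le> 100 * A^6 * (hscale \<sigma> r)\<^sup>2 * \<epsilon>'"
        proof -
          have "(10 * A\<^sup>2 * hscale \<sigma> r)\<^sup>2 * \<epsilon>' = 100 * A^4 * ((hscale \<sigma> r)\<^sup>2 * \<epsilon>')" by (simp add: power_mult_distrib)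
          also have "\<dots> \<le> 100 * A^6 * ((hscale \<sigma> r)\<^sup>2 * \<epsilon>')" using A46 pos by (intro mult_right_mono) auto
          finally show ?thesis by (simp add: mult_ac)
        qed
        moreover have "0 \<le> 10 * A^3 * (hscale \<sigma> \<delta> * dt + X1 / r) * T" using A X1r T by (intro mult_nonneg_nonneg) auto
        ultimately have "\<Phi> s \<epsilon> \<epsilon>' \<gamma> E n i (t, y) \<le> S0 \<epsilon> \<epsilon>' r"
          using Ad lip \<psi> unfolding S0_def by linarith
        then show False using big by linarith
      next
        case 2
        let ?tn = "tm dt n"
        have tn: "0 \<le> ?tn" "?tn \<le> T" using tm_bounds[OF mx(1)] by auto
        have "s * U (?tn, lat dx i) \<le> s * u0 x + A * r + 10 * A^3 * (hscale \<sigma> r + hscale \<sigma> \<delta> * dt + X1 / r) * ?tn"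
          using U_initial[OF s pos(3) mx(1), of i] by (simp add: x_def X1_def)
        also have "10 * A^3 * (hscale \<sigma> r + hscale \<sigma> \<delta> * dt + X1 / r) * ?tn = 10 * A^3 * hscale \<sigma> r * ?tn + 10 * A^3 * (hscale \<sigma> \<delta> * dt + X1 / r) * ?tn"
          by (simp add: algebra_simps)
        also have "10 * A^3 * hscale \<sigma> r * ?tn \<le> (10 * A^3 * hscale \<sigma> r)\<^sup>2 * \<epsilon>' + ?tn\<^sup>2 / \<epsilon>'"
          using hr tn pos A by (intro weighted_am_gm) auto
        also have "(10 * A^3 * hscale \<sigma> r)\<^sup>2 * \<epsilon>' = 100 * A^6 * (hscale \<sigma> r)\<^sup>2 * \<epsilon>'" by (simp add: power_mult_distrib)
        also have "10 * A^3 * (hscale \<sigma> \<delta> * dt + X1 / r) * ?tn \<le> 10 * A^3 * (hscale \<sigma> \<delta> * dt + X1 / r) * T"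
          using tn A X1r by (intro mult_left_mono mult_nonneg_nonneg) auto
        finally have "s * U (?tn, lat dx i) \<le> s * u0 x + A * r + (100 * A^6 * (hscale \<sigma> r)\<^sup>2 * \<epsilon>' + ?tn\<^sup>2 / \<epsilon>' + 10 * A^3 * (hscale \<sigma> \<delta> * dt + X1 / r) * T)" by simp
        moreover have "\<Phi> s \<epsilon> \<epsilon>' \<gamma> E n i (t, y) = s * U (?tn, lat dx i) - s * u0 y - (d\<^sup>2 / \<epsilon> + ?tn\<^sup>2 / \<epsilon>' + \<gamma> * soft_norm 1 y)"
          using 2 by (simp add: \<Phi>_def x_def d_def u_init)
        ultimately have "\<Phi> s \<epsilon> \<epsilon>' \<gamma> E n i (t, y) \<le> S0 \<epsilon> \<epsilon>' r"
          using Ad lip \<psi> unfolding S0_def by linarith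
        then show False using big by linarith
      next
        case 3
        have "(t, y) \<in> QT T" using 3 t by (simp add: QT_def)
        from doubling_interior[OF s pos(1,2) \<gamma> Eeq 3(1) mx(1) this] mx(3)[unfolded ty]
        have "\<Phi> s \<epsilon> \<epsilon>' \<gamma> E n i (t, y) \<le> 0" by blast
        then show False using big S00 by linarith
      qed
    qed
    moreover have "E * ?t1 \<le> E * T" using E0' tm_bounds[OF n1] by (intro mult_left_mono) auto
    ultimately show ?thesis by (simp add: \<Phi>_def E_def algebra_simps)
  qed
  \<comment> \<open>For a fixed grid point the remaining terms are linear in \<gamma>, so \<gamma>
    may be sent to 0.\<close>
  have c: "0 < 6 * A * T + soft_norm 1 ?x1" using A T soft_norm_ge(3)[of 1 ?x1] by (simp add: add_pos_pos)
  show ?thesis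
  proof (rule field_le_epsilon)
    fix e :: real assume "0 < e"
    then have "0 < e / (6 * A * T + soft_norm 1 ?x1)" using c by simp
    from g[OF this] c show "s * U (?t1, ?x1) - s * u (?t1, ?x1) \<le> S0 \<epsilon> \<epsilon>' r + E0 \<epsilon> \<epsilon>' * T + e" by simp
  qed
qed

end

text \<open>The sum of the coefficients that arise in \<open>error_estimate\<close>, with
  \<open>\<kappa>1\<close> and \<open>exp (lam * A)\<close> written out. Stated outside the locale,
  it visibly depends on A alone.\<close>

definition final_const :: "real \<Rightarrow> real" where
  "final_const A = (let \<kappa> = A * (1 + 22 * A^3) + 3 * A; \<Gamma> = exp ((3 * \<kappa> + A) * A) in
     A\<^sup>2 + A + 100 * A^6 + 10 * A^4 + 10 * A^3 + A * \<kappa> + \<Gamma> * (3 * \<kappa> + 4 * A\<^sup>2 + A) + \<Gamma>)"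

lemma final_const_pos: "1 \<le> A \<Longrightarrow> 0 < final_const A"
  unfolding final_const_def Let_def by (intro add_pos_pos add_nonneg_pos mult_pos_pos) (auto intro!: add_pos_nonneg)

context error_bounds
begin

text \<open>\<open>r0\<close> is left free because its best value, a balance of \<open>r0\<close>
  and \<open>hscale \<sigma> r0 * sqrt (T * dt)\<close>, depends on the regime of \<sigma>.\<close>

lemma error_estimate:
  assumes r0: "0 < r0" and n: "n \<le> MT"
  shows "\<bar>U (tm dt n, lat dx i) - u (tm dt n, lat dx i)\<bar> \<le> final_const A *
    (r0 + hscale \<sigma> r0 * sqrt (T * dt) + sqrt (T * ((hscale \<sigma> \<delta>)\<^sup>2 * dt\<^sup>2 + X1 + \<delta> powr (2 - \<sigma>))))"
proof -
  define X where "X = (hscale \<sigma> \<delta>)\<^sup>2 * dt\<^sup>2 + X1 + \<delta> powr (2 - \<sigma>)"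
  define a1 where "a1 = sqrt (T * dt)"
  define a2 where "a2 = sqrt (T * X)"
  define h where "h = hscale \<sigma> r0"
  \<comment> \<open>\<epsilon>' balances h^2 \<epsilon>' against T dt / \<epsilon>'. The part a2 of
    \<epsilon> balances \<epsilon> against T X / \<epsilon>, and a1 is added to keep \<epsilon>'
    \<le> \<epsilon>. Likewise r exceeds \<open>r0\<close> by a2 so that X1 T / r is at most
    a2.\<close>
  define \<epsilon>' \<epsilon> r where "\<epsilon>' = a1 / h" and "\<epsilon> = a1 + a2" and "r = r0 + a2"
  have h1: "1 \<le> h" by (simp add: h_def hscale_ge1)
  have X: "0 < X" using X1_nonneg \<delta> by (simp add: X_def add_nonneg_pos)
  have a: "0 < a1" "0 < a2" "a1 * a1 = T * dt" "a2 * a2 = T * X" using T dt X by (auto simp: a1_def a2_def)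
  have \<epsilon>': "0 < \<epsilon>'" "\<epsilon>' \<le> \<epsilon>" "0 < r" "0 < \<epsilon>"
  proof -
    have "a1 / h \<le> a1 / 1" using h1 a by (intro divide_left_mono) auto
    then show "0 < \<epsilon>'" "\<epsilon>' \<le> \<epsilon>" "0 < r" "0 < \<epsilon>" using a h1 r0 by (auto simp: \<epsilon>'_def \<epsilon>_def r_def)
  qed
  define \<Gamma> M where "\<Gamma> = exp (lam * A)" and "M = 3 * \<kappa>1 + 4 * A\<^sup>2 + A"
  have M0: "0 \<le> M" "0 < \<Gamma>" using lam_pos A by (auto simp: M_def \<Gamma>_def)
  have a1h: "a1 \<le> h * a1" using h1 a by simp
  have t1: "A\<^sup>2 * \<epsilon> \<le> A\<^sup>2 * (r0 + h * a1 + a2)" "A * r \<le> A * (r0 + h * a1 + a2)" "A * \<kappa>1 * \<epsilon> \<le> A * \<kappa>1 * (r0 + h * a1 + a2)"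
  proof -
    have "\<epsilon> \<le> r0 + h * a1 + a2" "r \<le> r0 + h * a1 + a2" using a1h r0 a unfolding \<epsilon>_def r_def by linarith+
    then show "A\<^sup>2 * \<epsilon> \<le> A\<^sup>2 * (r0 + h * a1 + a2)" "A * r \<le> A * (r0 + h * a1 + a2)" "A * \<kappa>1 * \<epsilon> \<le> A * \<kappa>1 * (r0 + h * a1 + a2)"
      using A lam_pos by (intro mult_left_mono; simp)+
  qed
  have t2: "100 * A^6 * (hscale \<sigma> r)\<^sup>2 * \<epsilon>' \<le> 100 * A^6 * (r0 + h * a1 + a2)"
  proof -
    have "hscale \<sigma> r \<le> h" unfolding h_def r_def using r0 a by (intro hscale_antimono) auto
    then have "(hscale \<sigma> r)\<^sup>2 \<le> h\<^sup>2" using hscale_ge1[of \<sigma> r] by (intro power_mono) auto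
    then have "(hscale \<sigma> r)\<^sup>2 * \<epsilon>' \<le> h\<^sup>2 * \<epsilon>'" using \<epsilon>' by (intro mult_right_mono) auto
    also have "\<dots> = h * a1" using h1 by (simp add: \<epsilon>'_def power2_eq_square)
    also have "\<dots> \<le> r0 + h * a1 + a2" using r0 a(2) by simp
    finally have "100 * A^6 * ((hscale \<sigma> r)\<^sup>2 * \<epsilon>') \<le> 100 * A^6 * (r0 + h * a1 + a2)" using A by (intro mult_left_mono) auto
    then show ?thesis by (simp add: mult.assoc)
  qed
  have a2le: "a2 \<le> r0 + h * a1 + a2" using r0 a h1 by simp
  have t3: "10 * A^3 * (hscale \<sigma> \<delta> * dt + X1 / r) * T \<le> (10 * A^4 + 10 * A^3) * (r0 + h * a1 + a2)"
  proof -
    \<comment> \<open>The square of \<open>hscale \<sigma> \<delta> * dt\<close> is one of the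
      summands of X, hence covered by a2.\<close>
    have "(T * (hscale \<sigma> \<delta> * dt))\<^sup>2 \<le> (A * a2)\<^sup>2"
    proof -
      have "(hscale \<sigma> \<delta>)\<^sup>2 * dt\<^sup>2 \<le> X" using X1_nonneg by (simp add: X_def)
      then have "T\<^sup>2 * ((hscale \<sigma> \<delta>)\<^sup>2 * dt\<^sup>2) \<le> T\<^sup>2 * X" by (intro mult_left_mono) auto
      also have "\<dots> = T * (a2 * a2)" unfolding a(4) by (simp add: power2_eq_square)
      also have "\<dots> \<le> A * (a2 * a2)" using T by (intro mult_right_mono) auto
      also have "\<dots> \<le> A\<^sup>2 * (a2 * a2)" using A_le by (intro mult_right_mono) auto
      finally show ?thesis by (simp add: power_mult_distrib power2_eq_square[of a2])
    qed
    then have 1: "T * (hscale \<sigma> \<delta> * dt) \<le> A * a2" by (rule power2_le_imp_le) (use A a in simp)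
    have "X1 \<le> X" by (simp add: X_def)
    then have "X1 / r * T \<le> X / a2 * T" using X1_nonneg X a r0 T by (intro mult_right_mono frac_le) (auto simp: r_def)
    also have "\<dots> = (a2 * a2) / a2" unfolding a(4) by simp
    also have "\<dots> = a2" using a(2) by simp
    finally have 2: "X1 / r * T \<le> a2" .
    have "10 * A^3 * (hscale \<sigma> \<delta> * dt + X1 / r) * T = 10 * A^3 * (T * (hscale \<sigma> \<delta> * dt) + X1 / r * T)" by (simp add: algebra_simps)
    also have "\<dots> \<le> 10 * A^3 * (A * a2 + a2)" using 1 2 A by (intro mult_left_mono add_mono) auto
    also have "\<dots> = (10 * A^4 + 10 * A^3) * a2" by (simp add: algebra_simps eval_nat_numeral)
    also have "\<dots> \<le> (10 * A^4 + 10 * A^3) * (r0 + h * a1 + a2)" using a2le A by (intro mult_left_mono) auto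
    finally show ?thesis .
  qed
  have t4: "\<Gamma> * (M * X / \<epsilon>) * T \<le> \<Gamma> * M * (r0 + h * a1 + a2)"
  proof -
    have "X / \<epsilon> * T \<le> X / a2 * T" using X a T by (intro mult_right_mono divide_left_mono) (auto simp: \<epsilon>_def)
    also have "\<dots> = (a2 * a2) / a2" unfolding a(4) by simp
    also have "\<dots> = a2" using a(2) by simp
    also have "\<dots> \<le> r0 + h * a1 + a2" by (rule a2le)
    finally have "\<Gamma> * M * (X / \<epsilon> * T) \<le> \<Gamma> * M * (r0 + h * a1 + a2)" using M0 by (intro mult_left_mono) auto
    then show ?thesis by (simp add: mult_ac)
  qed
  have t5: "\<Gamma> * dt / \<epsilon>' * T \<le> \<Gamma> * (r0 + h * a1 + a2)"
  proof -
    have "dt / \<epsilon>' * T = (T * dt) * h / a1" by (simp add: \<epsilon>'_def)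
    also have "\<dots> = h * a1" unfolding a(3)[symmetric] using a(1) by simp
    also have "\<dots> \<le> r0 + h * a1 + a2" using r0 a(2) by simp
    finally have "\<Gamma> * (dt / \<epsilon>' * T) \<le> \<Gamma> * (r0 + h * a1 + a2)" using M0 by (intro mult_left_mono) auto
    then show ?thesis by simp
  qed
  have t6: "\<kappa>1 * \<epsilon> * T \<le> A * \<kappa>1 * \<epsilon>"
    using mult_left_mono[OF T(2), of "\<kappa>1 * \<epsilon>"] lam_pos \<epsilon>' by (simp add: mult_ac)
  have fc: "final_const A = A\<^sup>2 + A + 100 * A^6 + (10 * A^4 + 10 * A^3) + A * \<kappa>1 + \<Gamma> * M + \<Gamma>"
    unfolding final_const_def Let_def \<Gamma>_def M_def lam_def \<kappa>1_def by simp
  have "S0 \<epsilon> \<epsilon>' r + E0 \<epsilon> \<epsilon>' * T \<le> final_const A * (r0 + h * a1 + a2)"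
    unfolding S0_def E0_def fc X_def[symmetric] \<Gamma>_def[symmetric] M_def[symmetric] distrib_right[of _ _ T] distrib_right[of _ _ "r0 + h * a1 + a2"]
    using t1 t2 t3[unfolded distrib_right[of _ _ "r0 + h * a1 + a2"]] t4 t5 t6 by linarith
  moreover have "s * U (tm dt n, lat dx i) - s * u (tm dt n, lat dx i) \<le> S0 \<epsilon> \<epsilon>' r + E0 \<epsilon> \<epsilon>' * T" if "s = 1 \<or> s = - 1" for s
    by (rule doubling_estimate[OF that \<epsilon>'(1,2,3) n])
  from this[of 1] this[of "- 1"]
  have "U (tm dt n, lat dx i) - u (tm dt n, lat dx i) \<le> S0 \<epsilon> \<epsilon>' r + E0 \<epsilon> \<epsilon>' * T"
    "- (U (tm dt n, lat dx i) - u (tm dt n, lat dx i)) \<le> S0 \<epsilon> \<epsilon>' r + E0 \<epsilon> \<epsilon>' * T" by simp_all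
  ultimately have "\<bar>U (tm dt n, lat dx i) - u (tm dt n, lat dx i)\<bar> \<le> final_const A * (r0 + h * a1 + a2)" by linarith
  then show ?thesis by (simp add: h_def a1_def a2_def X_def)
qed

end

text \<open>Each summand is bounded by a square: dt \<le> A sqrt dt lowers the order in dt to the
  one in the rate, h \<le> h^2 completes the square in dx, and dx \<le> \<delta> turns
  \<delta>^(-\<sigma>) dx^2 into a second copy of \<delta>^(2 - \<sigma>), whence the factor
  2.\<close>

lemma sqrt_consistency_le:
  fixes A T dt dx \<delta> \<sigma> :: real
  assumes A: "1 \<le> A" and T: "0 < T" "T \<le> A" and dt: "0 < dt" "dt \<le> T" and dx: "0 < dx" "dx \<le> \<delta>" and \<delta>: "\<delta> \<le> 1"
  shows "sqrt (T * ((hscale \<sigma> \<delta>)\<^sup>2 * dt\<^sup>2 + (hscale \<sigma> \<delta> * dx + \<delta> powr (- \<sigma>) * dx\<^sup>2) + \<delta> powr (2 - \<sigma>)))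
    \<le> sqrt T * (hscale \<sigma> \<delta> * (A * sqrt dt) + hscale \<sigma> \<delta> * sqrt dx + 2 * \<delta> powr (1 - \<sigma> / 2))"
proof -
  define h where "h = hscale \<sigma> \<delta>"
  define c where "c = \<delta> powr (1 - \<sigma> / 2)"
  have h: "1 \<le> h" by (simp add: h_def hscale_ge1)
  have \<delta>0: "0 < \<delta>" using dx by linarith
  have c2: "c\<^sup>2 = \<delta> powr (2 - \<sigma>)" using \<delta>0 by (simp add: c_def power2_eq_square powr_add[symmetric])
  have c0: "0 \<le> c" by (simp add: c_def)
  have sA: "sqrt dt \<le> A"
  proof -
    have "dt \<le> A\<^sup>2" using dt T A power_increasing[of 1 2 A] by simp
    then have "sqrt dt \<le> sqrt (A\<^sup>2)" by (rule real_sqrt_le_mono)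
    then show ?thesis using A by simp
  qed
  have dtle: "dt \<le> A * sqrt dt"
  proof -
    have "dt = sqrt dt * sqrt dt" using dt by simp
    also have "\<dots> \<le> A * sqrt dt" using sA dt by (intro mult_right_mono) auto
    finally show ?thesis .
  qed
  define z1 z2 where "z1 = h * (A * sqrt dt)" and "z2 = h * sqrt dx"
  have z: "0 \<le> z1" "0 \<le> z2" using h A dt dx by (auto simp: z1_def z2_def)
  have "(h * dt)\<^sup>2 \<le> z1\<^sup>2" unfolding z1_def using h dt dtle by (intro power_mono mult_left_mono) auto
  moreover have "h * dx \<le> z2\<^sup>2"
  proof -
    have "h * 1 \<le> h * h" using h by (intro mult_left_mono) auto
    then have "(h * 1) * dx \<le> (h * h) * dx" using dx by (intro mult_right_mono) auto
    then have "h * dx \<le> h\<^sup>2 * dx" by (simp add: power2_eq_square)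
    then show ?thesis using dx by (simp add: z2_def power_mult_distrib)
  qed
  moreover have "\<delta> powr (- \<sigma>) * dx\<^sup>2 \<le> c\<^sup>2"
  proof -
    have "\<delta> powr (- \<sigma>) * dx\<^sup>2 \<le> \<delta> powr (- \<sigma>) * \<delta>\<^sup>2" using dx by (intro mult_left_mono power_mono) auto
    also have "\<dots> = \<delta> powr (- \<sigma>) * \<delta> powr 2" using \<delta>0 by simp
    also have "\<dots> = c\<^sup>2" unfolding c2 powr_add[symmetric] by (simp add: add.commute)
    finally show ?thesis .
  qed
  moreover have c4: "(2 * c)\<^sup>2 = 4 * c\<^sup>2" by (simp add: power_mult_distrib)
  ultimately have "h\<^sup>2 * dt\<^sup>2 + (h * dx + \<delta> powr (- \<sigma>) * dx\<^sup>2) + \<delta> powr (2 - \<sigma>) \<le> z1\<^sup>2 + z2\<^sup>2 + (2 * c)\<^sup>2"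
    unfolding c2[symmetric] power_mult_distrib[of h dt] using zero_le_power2[of c] by linarith
  also have "\<dots> \<le> (z1 + z2 + 2 * c)\<^sup>2"
  proof -
    have e: "(z1 + z2 + 2 * c)\<^sup>2 = z1\<^sup>2 + z2\<^sup>2 + (2 * c)\<^sup>2 + 2 * (z1 * z2 + z1 * (2 * c) + z2 * (2 * c))" by (simp add: power2_eq_square algebra_simps)
    have "0 \<le> 2 * (z1 * z2 + z1 * (2 * c) + z2 * (2 * c))" using z c0 by simp
    then show ?thesis unfolding e le_add_same_cancel1 .
  qed
  finally have le: "h\<^sup>2 * dt\<^sup>2 + (h * dx + \<delta> powr (- \<sigma>) * dx\<^sup>2) + \<delta> powr (2 - \<sigma>) \<le> (z1 + z2 + 2 * c)\<^sup>2" .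
  have "sqrt (h\<^sup>2 * dt\<^sup>2 + (h * dx + \<delta> powr (- \<sigma>) * dx\<^sup>2) + \<delta> powr (2 - \<sigma>)) \<le> z1 + z2 + 2 * c"
    by (rule real_le_lsqrt) (use z c0 le in auto)
  then have "sqrt T * sqrt (h\<^sup>2 * dt\<^sup>2 + (h * dx + \<delta> powr (- \<sigma>) * dx\<^sup>2) + \<delta> powr (2 - \<sigma>)) \<le> sqrt T * (z1 + z2 + 2 * c)"
    using T by (intro mult_left_mono) auto
  then show ?thesis unfolding real_sqrt_mult h_def z1_def z2_def c_def .
qed

text \<open>For \<sigma> \<le> 1 the choice is r0 = sqrt (T dt). For \<sigma> > 1 it is (T dt)^(1/(2
  \<sigma>)), the solution of r0 = r0^(1 - \<sigma>) sqrt (T dt), which accounts for the separate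
  first term of the rate. T is replaced by min T 1 at the cost of a power of A, since T \<le>
  A.\<close>

lemma rate_bound:
  fixes A T dt dx \<delta> \<sigma> :: real
  assumes A: "1 \<le> A" and T: "0 < T" "T \<le> A" and dt: "0 < dt" "dt \<le> T" and dx: "0 < dx" "dx \<le> \<delta>" and \<delta>: "\<delta> \<le> 1"
    and \<sigma>: "0 < \<sigma>" "\<sigma> < 2"
  shows "\<exists>r0>0. r0 + hscale \<sigma> r0 * sqrt (T * dt)
      + sqrt (T * ((hscale \<sigma> \<delta>)\<^sup>2 * dt\<^sup>2 + (hscale \<sigma> \<delta> * dx + \<delta> powr (- \<sigma>) * dx\<^sup>2) + \<delta> powr (2 - \<sigma>)))
    \<le> 20 * A^3 *
       (if \<sigma> < 1 then
          (min T 1) powr (1/2) * (dt powr (1/2) + dx powr (1/2) + \<delta> powr (1 - \<sigma>/2))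
        else if \<sigma> = 1 then
          (min T 1) powr (1/2) *
            (dt powr (1/2) * \<bar>ln dt\<bar> + dt powr (1/2) * \<bar>ln \<delta>\<bar> + dx powr (1/2) * \<bar>ln \<delta>\<bar> + \<delta> powr (1/2))
        else
          (min T 1) powr (1/(2*\<sigma>)) * dt powr (1/(2*\<sigma>)) +
          (min T 1) powr (1/2) *
            (dt powr (1/2) * \<delta> powr (1 - \<sigma>) + dx powr (1/2) * \<delta> powr (1 - \<sigma>) + \<delta> powr (1 - \<sigma>/2)))"
proof -
  define R m a b c where "R = sqrt T" and "m = (min T 1) powr (1/2)" and "a = sqrt dt" and "b = sqrt dx" and "c = \<delta> powr (1 - \<sigma>/2)"
  define h where "h = hscale \<sigma> \<delta>"
  define L where "L = sqrt (T * ((hscale \<sigma> \<delta>)\<^sup>2 * dt\<^sup>2 + (hscale \<sigma> \<delta> * dx + \<delta> powr (- \<sigma>) * dx\<^sup>2) + \<delta> powr (2 - \<sigma>)))"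
  have L: "L \<le> R * (h * (A * a) + h * b + 2 * c)"
    unfolding L_def R_def h_def a_def b_def c_def by (rule sqrt_consistency_le[OF A T dt dx \<delta>])
  have \<delta>0: "0 < \<delta>" using dx by linarith
  have pos: "0 < R" "0 < a" "0 < b" "0 < c" "0 < m" using T dt dx \<delta>0 by (auto simp: R_def a_def b_def c_def m_def)
  have half: "dt powr (1/2) = a" "dx powr (1/2) = b" using dt dx by (auto simp: a_def b_def powr_half_sqrt)
  have TA: "T \<le> A * min T 1"
    using A T by (cases "T \<le> 1") (auto simp: min_def mult_le_cancel_right1)
  have Rm: "R \<le> A * m"
  proof -
    have "R \<le> sqrt (A * min T 1)" unfolding R_def using TA by (rule real_sqrt_le_mono)
    also have "\<dots> = sqrt A * m" using T by (simp add: real_sqrt_mult m_def powr_half_sqrt)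
    also have "sqrt A \<le> A" using A real_sqrt_le_mono[of A "A\<^sup>2"] power_increasing[of 1 2 A] by simp
    then have "sqrt A * m \<le> A * m" using pos by (intro mult_right_mono) auto
    finally show ?thesis .
  qed
  have Ra: "sqrt (T * dt) = R * a" by (simp add: R_def a_def real_sqrt_mult)
  have A13: "A \<le> A\<^sup>2" "A\<^sup>2 \<le> A^3" "A \<le> A^3" using A power_increasing[of 1 2 A] power_increasing[of 2 3 A] power_increasing[of 1 3 A] by auto
  have scale: "R * (q * Z) \<le> 20 * A^3 * (m * Z)" if "0 \<le> q" "q \<le> 20 * A\<^sup>2" "0 \<le> Z" for q Z
  proof -
    have "R * (q * Z) \<le> (A * m) * ((20 * A\<^sup>2) * Z)" using Rm that pos A by (intro mult_mono) auto
    also have "\<dots> = 20 * A^3 * (m * Z)" by (simp add: power2_eq_square power3_eq_cube)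
    finally show ?thesis .
  qed
  consider "\<sigma> < 1" | "\<sigma> = 1" | "1 < \<sigma>" by linarith
  then show ?thesis
  proof cases
    case 1
    have h1: "h = 1" "hscale \<sigma> (R * a) = 1" using 1 by (auto simp: h_def hscale_def)
    have "R * a + 1 * (R * a) + L \<le> R * ((A + 2) * (a + b + c))"
    proof -
      have "0 \<le> A * b" "0 \<le> A * c" "0 \<le> b" using A pos by auto
      then have "2 * a + (A * a + b + 2 * c) \<le> (A + 2) * (a + b + c)" by (simp add: algebra_simps)
      then have "R * (2 * a + (A * a + b + 2 * c)) \<le> R * ((A + 2) * (a + b + c))" using pos by (intro mult_left_mono) auto
      then show ?thesis using L unfolding h1 by (simp add: algebra_simps)
    qed
    also have "\<dots> \<le> 20 * A^3 * (m * (a + b + c))" using A A13 pos by (intro scale) auto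
    finally have "R * a + 1 * (R * a) + L \<le> 20 * A^3 * (m * (a + b + c))" .
    then show ?thesis unfolding Ra L_def[symmetric] half m_def[symmetric] c_def[symmetric]
      using 1 pos h1 by (intro exI[of _ "R * a"]) simp
  next
    case 2
    define l k where "l = \<bar>ln dt\<bar>" and "k = \<bar>ln \<delta>\<bar>"
    have lk: "0 \<le> l" "0 \<le> k" by (auto simp: l_def k_def)
    have ln\<delta>: "ln \<delta> \<le> 0" using \<delta> \<delta>0 by simp
    have hk: "h = 1 + k" using 2 ln\<delta> by (simp add: h_def hscale_def k_def)
    \<comment> \<open>The logarithm of T is harmless because dt \<le> T: if T \<le> 1, then |ln T|
      \<le> |ln dt|, and otherwise its sign is favourable.\<close>
    have hr: "hscale \<sigma> (R * a) \<le> 1 + A + l"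
    proof -
      have lnRa: "ln (R * a) = (ln T + ln dt) / 2" using T dt by (simp add: Ra[symmetric] ln_sqrt ln_mult)
      have lnT: "- ln T \<le> l + A"
      proof (cases "T \<le> 1")
        case True
        have "ln dt \<le> ln T" using dt T by simp
        moreover have "ln dt \<le> 0" using dt True by simp
        ultimately show ?thesis using A by (simp add: l_def)
      next
        case False
        then have "0 \<le> ln T" by simp
        then show ?thesis using lk A by simp
      qed
      have lndt: "- ln dt \<le> l" by (simp add: l_def)
      have "- ln (R * a) = (- ln T + - ln dt) / 2" unfolding lnRa by (simp add: field_simps)
      also have "\<dots> \<le> ((l + A) + l) / 2" using lnT lndt by (intro divide_right_mono add_mono) auto
      also have "\<dots> \<le> l + A" using A by simp
      finally have "max 0 (- ln (R * a)) \<le> l + A" using A lk by simp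
      then show ?thesis using 2 by (simp add: hscale_def)
    qed
    have cs: "c = sqrt \<delta>" using 2 \<delta>0 by (simp add: c_def powr_half_sqrt)
    \<comment> \<open>The rate contains sqrt dx only with the factor |ln \<delta>|; a bare sqrt dx
      is covered by sqrt \<delta>.\<close>
    have bc: "b \<le> c" unfolding b_def cs using dx by simp
    have aA: "a \<le> A"
    proof -
      have "dt \<le> A\<^sup>2" using dt T A13 by linarith
      then have "sqrt dt \<le> sqrt (A\<^sup>2)" by (rule real_sqrt_le_mono)
      then show ?thesis using A by (simp add: a_def)
    qed
    \<comment> \<open>The rate contains no bare sqrt dt, and |ln \<delta>| vanishes at \<delta> = 1.
      Either \<delta> \<le> 1/2 and |ln \<delta>| \<ge> 1/2, or sqrt \<delta> \<ge> 1/2 and a \<le>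
      A is covered by it.\<close>
    have akc: "a \<le> 2 * A * (k * a + c)"
    proof (cases "\<delta> \<le> 1/2")
      case True
      have "ln \<delta> \<le> ln (1/2)" using True \<delta>0 by (subst ln_le_cancel_iff) auto
      also have "\<dots> = - ln 2" by (simp add: ln_div)
      finally have "1/2 \<le> k" using ln2_ge_two_thirds by (simp add: k_def)
      then have "(1/2) * a \<le> k * a" using pos by (intro mult_right_mono) auto
      then have ka: "(1/2) * a \<le> k * a" .
      have "a = 2 * ((1/2) * a)" by simp
      also have "\<dots> \<le> 2 * (k * a)" by (rule mult_left_mono[OF ka]) simp
      also have "\<dots> \<le> 2 * (k * a + c)" using pos(4) by simp
      finally have aa: "a \<le> 2 * (k * a + c)" .
      have "0 \<le> 2 * (k * a + c)" using aa pos(2) by (rule order_trans[OF less_imp_le, rotated])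
      from mult_right_mono[OF A this] have "a \<le> A * (2 * (k * a + c))" using aa by (simp only: mult_1_left)
      also have "\<dots> = 2 * A * (k * a + c)" by simp
      finally show ?thesis .
    next
      case False
      have "(1/2)\<^sup>2 = (1/4 :: real)" by (simp add: power2_eq_square)
      then have "(1/2)\<^sup>2 \<le> \<delta>" using False by linarith
      then have "1/2 \<le> c" unfolding cs by (rule real_le_rsqrt)
      then have kc: "1/2 \<le> k * a + c" using mult_nonneg_nonneg[OF lk(2) less_imp_le[OF pos(2)]] by linarith
      have "A = 2 * A * (1/2)" by simp
      also have "\<dots> \<le> 2 * A * (k * a + c)" by (rule mult_left_mono[OF kc]) (use A in simp)
      finally have "A \<le> 2 * A * (k * a + c)" .
      with aA show ?thesis by (rule order_trans)
    qed
    define Z where "Z = a * l + a * k + b * k + c"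
    have p: "0 \<le> a * l" "0 \<le> a * k" "0 \<le> b * k" "0 \<le> c" using pos lk by auto
    have Z0: "0 \<le> Z" unfolding Z_def using p by linarith
    have A1: "1 \<le> A\<^sup>2" using A by simp
    have "R * a + hscale \<sigma> (R * a) * (R * a) + L \<le> R * (12 * A\<^sup>2 * Z)"
    proof -
      define H where "H = hscale \<sigma> (R * a) * (R * a)"
      have "0 \<le> R * a" using pos by simp
      from mult_right_mono[OF hr this] have H: "H \<le> (1 + A + l) * (R * a)" unfolding H_def .
      define V where "V = a + (1 + A + l) * a + ((1 + k) * (A * a) + (1 + k) * b + 2 * c)"
      have "R * V = R * a + (1 + A + l) * (R * a) + R * (h * (A * a) + h * b + 2 * c)"
        unfolding V_def hk by (simp add: algebra_simps)
      then have HL: "R * a + H + L \<le> R * V" using H L by linarith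
      have V: "V \<le> 12 * A\<^sup>2 * Z"
      proof -
        define q w2 v1 v2 v3 v4 where "q = (2 + 2 * A) * a" and "w2 = A * (a * k)" and "v1 = A\<^sup>2 * (a * l)" and "v2 = A\<^sup>2 * (a * k)"
          and "v3 = A\<^sup>2 * (b * k)" and "v4 = A\<^sup>2 * c"
        have "q \<le> (4 * A) * (2 * A * (k * a + c))" unfolding q_def
          by (rule mult_mono[OF _ akc]) (use A pos in auto)
        also have "\<dots> = 8 * v2 + 8 * v4" by (simp add: v2_def v4_def power2_eq_square algebra_simps)
        finally have q: "q \<le> 8 * v2 + 8 * v4" .
        have w2: "w2 \<le> v2" unfolding w2_def v2_def by (rule mult_right_mono[OF A13(1) p(2)])
        have v: "a * l \<le> v1" "b * k \<le> v3" "c \<le> v4"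
          unfolding v1_def v3_def v4_def using mult_right_mono[OF A1 p(1)] mult_right_mono[OF A1 p(3)] mult_right_mono[OF A1 p(4)]
          by (simp_all only: mult_1_left)
        have v0: "0 \<le> v1" "0 \<le> v2" "0 \<le> v3" "0 \<le> v4" unfolding v1_def v2_def v3_def v4_def using p by auto
        have e: "V = q + a * l + w2 + b + b * k + 2 * c" unfolding V_def q_def w2_def by (simp add: algebra_simps)
        have e': "12 * A\<^sup>2 * Z = 12 * v1 + 12 * v2 + 12 * v3 + 12 * v4" unfolding Z_def v1_def v2_def v3_def v4_def by (simp add: algebra_simps)
        show ?thesis unfolding e e' using q w2 v v0 bc by linarith
      qed
      have "R * V \<le> R * (12 * A\<^sup>2 * Z)" by (rule mult_left_mono[OF V]) (use pos in simp)
      with HL show ?thesis unfolding H_def by (rule order_trans)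
    qed
    also have "\<dots> \<le> 20 * A^3 * (m * Z)" using A1 by (intro scale Z0) auto
    finally have "R * a + hscale \<sigma> (R * a) * (R * a) + L \<le> 20 * A^3 * (m * Z)" .
    moreover have "\<delta> powr (1/2) = c" using 2 by (simp add: c_def)
    ultimately show ?thesis unfolding Ra L_def[symmetric] half m_def[symmetric] l_def[symmetric] k_def[symmetric]
      using 2 pos by (intro exI[of _ "R * a"]) (simp add: Z_def)
  next
    case 3
    define p where "p = 1 / (2 * \<sigma>)"
    define D where "D = \<delta> powr (1 - \<sigma>)"
    define r0 where "r0 = (T * dt) powr p"
    have p: "0 \<le> p" "p \<le> 1" using 3 by (auto simp: p_def)
    have Tdt: "0 < T * dt" using T dt by simp
    have r00: "0 < r0" using T dt by (simp add: r0_def)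
    have D1: "1 \<le> D" unfolding D_def using powr_mono2'[of "1 - \<sigma>" \<delta> 1] 3 \<delta> \<delta>0 by simp
    have hD: "h \<le> 2 * D" using 3 D1 by (simp add: h_def hscale_def D_def)
    \<comment> \<open>The exponent p is the fixed point of p (1 - \<sigma>) + 1/2 = p, so the
      singular part of \<open>hscale\<close> reproduces r0.\<close>
    have hr: "hscale \<sigma> r0 * (R * a) = R * a + r0"
    proof -
      have "r0 powr (1 - \<sigma>) * (R * a) = (T * dt) powr (p * (1 - \<sigma>)) * (T * dt) powr (1/2)"
        unfolding Ra[symmetric] r0_def using Tdt by (simp add: powr_powr powr_half_sqrt)
      also have "\<dots> = (T * dt) powr (p * (1 - \<sigma>) + 1/2)" by (simp add: powr_add)
      also have "p * (1 - \<sigma>) + 1/2 = p" using \<sigma> by (simp add: p_def field_simps)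
      finally have "r0 powr (1 - \<sigma>) * (R * a) = r0" by (simp add: r0_def)
      moreover have "hscale \<sigma> r0 = 1 + r0 powr (1 - \<sigma>)" using 3 by (simp add: hscale_def)
      ultimately show ?thesis by (simp only: distrib_right mult_1_left)
    qed
    define Z where "Z = a * D + b * D + c"
    have 1: "R * a + L \<le> R * (5 * A * Z)"
    proof -
      have "h * (A * a) \<le> 2 * D * (A * a)" "h * b \<le> 2 * D * b" using hD pos A by (intro mult_right_mono; simp)+
      then have "h * (A * a) + h * b + 2 * c \<le> 2 * D * (A * a) + 2 * D * b + 2 * c" by linarith
      then have "R * (h * (A * a) + h * b + 2 * c) \<le> R * (2 * D * (A * a) + 2 * D * b + 2 * c)" using pos by (intro mult_left_mono) auto
      then have "R * a + L \<le> R * (a + (2 * D * (A * a) + 2 * D * b + 2 * c))" using L by (simp add: distrib_left)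
      also have "\<dots> \<le> R * (5 * A * Z)"
      proof (rule mult_left_mono)
        define u1 u2 u3 where "u1 = A * (D * a)" and "u2 = A * (D * b)" and "u3 = A * c"
        have n: "0 \<le> a" "0 \<le> b" "0 \<le> c" "0 \<le> D * a" "0 \<le> D * b" using pos D1 by auto
        have "a \<le> D * a" using mult_right_mono[OF D1 n(1)] by (simp only: mult_1_left)
        also have "\<dots> \<le> u1" unfolding u1_def using mult_right_mono[OF A n(4)] by (simp only: mult_1_left)
        finally have q1: "a \<le> u1" .
        have q2: "D * b \<le> u2" "c \<le> u3" unfolding u2_def u3_def using mult_right_mono[OF A n(5)] mult_right_mono[OF A n(3)] by (simp_all only: mult_1_left)
        have u0: "0 \<le> u1" "0 \<le> u2" "0 \<le> u3" unfolding u1_def u2_def u3_def using A n by auto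
        have e: "5 * A * Z = 5 * u1 + 5 * u2 + 5 * u3" unfolding Z_def u1_def u2_def u3_def by (simp add: algebra_simps)
        have e': "a + (2 * D * (A * a) + 2 * D * b + 2 * c) = a + 2 * u1 + 2 * (D * b) + 2 * c" unfolding u1_def by (simp add: algebra_simps)
        show "a + (2 * D * (A * a) + 2 * D * b + 2 * c) \<le> 5 * A * Z" unfolding e e' using q1 q2 u0 by linarith
      qed (use pos in simp)
      finally show ?thesis .
    qed
    have Z0: "0 \<le> Z" using pos D1 by (simp add: Z_def)
    have 2: "R * (5 * A * Z) \<le> 20 * A^3 * (m * Z)" using A A13 Z0 by (intro scale) auto
    define W where "W = (min T 1) powr p * dt powr p"
    have W0: "0 \<le> W" by (simp add: W_def)
    have rW: "r0 \<le> A^3 * W"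
    proof -
      have "T powr p \<le> (A * min T 1) powr p" using TA T p by (intro powr_mono2) auto
      also have "\<dots> = A powr p * (min T 1) powr p" using A T by (simp add: powr_mult)
      also have "\<dots> \<le> A * (min T 1) powr p"
      proof (rule mult_right_mono)
        show "A powr p \<le> A" using powr_mono[OF p(2) A] A by simp
      qed simp
      finally have TP: "T powr p \<le> A * (min T 1) powr p" .
      have "r0 = T powr p * dt powr p" using T dt by (simp add: r0_def powr_mult)
      also have "\<dots> \<le> (A * (min T 1) powr p) * dt powr p" by (rule mult_right_mono[OF TP]) simp
      also have "\<dots> = A * W" by (simp add: W_def)
      also have "\<dots> \<le> A^3 * W" by (rule mult_right_mono[OF A13(3) W0])
      finally show ?thesis .
    qed
    have "r0 + hscale \<sigma> r0 * (R * a) + L \<le> 20 * A^3 * (W + m * Z)"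
    proof -
      define v where "v = A^3 * W"
      have "0 \<le> v" using A W0 by (simp add: v_def)
      moreover have "20 * A^3 * (W + m * Z) = 20 * v + 20 * A^3 * (m * Z)" unfolding v_def by (simp add: algebra_simps)
      ultimately show ?thesis using order_trans[OF 1 2] rW[folded v_def] unfolding hr by linarith
    qed
    then show ?thesis unfolding Ra L_def[symmetric] half m_def[symmetric] p_def[symmetric] D_def[symmetric] c_def[symmetric]
      using 3 r00 by (intro exI[of _ r0]) (simp add: Z_def W_def)
  qed
qed

lemma levy_moments_mono:
  assumes "levy_moments A \<sigma> \<nu> \<rho>" "A \<le> A'"
  shows "levy_moments A' \<sigma> \<nu> \<rho>"
proof -
  have m: "x \<le> A' * y" if "x \<le> A * y" "0 \<le> y" for x y :: real
    using that mult_right_mono[OF assms(2), of y] by linarith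
  have e: "x \<le> ennreal (A' * y)" if "x \<le> ennreal (A * y)" "0 \<le> y" for x and y :: real
    using order_trans[OF that(1) ennreal_leI[OF mult_right_mono[OF assms(2) that(2)]]] .
  have h: "0 \<le> hscale \<sigma> r" for r using hscale_ge1[of \<sigma> r] by linarith
  show ?thesis
    using assms unfolding levy_moments_def by (auto intro!: m e h)
qed

theorem theorem3p2:
  fixes K \<Lambda> \<sigma> C5 cN C1 C2 T0 :: real
  assumes "K > 0" and "0 < \<sigma>" and "\<sigma> < 2" and "C5 > 0"
  shows "\<exists>C>0. \<forall>(P :: ('a::metric_space, 'b::metric_space, 'n::finite, 'm::finite) isaacs)
      (u0 :: real^'n \<Rightarrow> real) (\<rho> :: real^'m \<Rightarrow> real) (\<omega> :: int^'n \<Rightarrow> real^'n \<Rightarrow> real)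
      (T :: real) (MT :: nat) (\<Delta>t :: real) (\<Delta>x :: real) (\<delta> :: real) (\<theta> :: real) (\<theta>' :: real)
      (u :: real \<times> (real^'n) \<Rightarrow> real) (U :: real \<times> (real^'n) \<Rightarrow> real).
    0 < T \<longrightarrow> T \<le> T0 \<longrightarrow> MT > 0 \<longrightarrow> \<Delta>t = T / real MT \<longrightarrow>
    A1 P T \<longrightarrow> A2 P T u0 K \<longrightarrow> A3 P T K \<rho> \<longrightarrow> A4 P \<rho> \<Lambda> \<longrightarrow> A5 P \<sigma> C5 \<longrightarrow>
    0 < \<Delta>x \<longrightarrow> \<Delta>x \<le> \<delta> \<longrightarrow> \<delta> \<le> 1 \<longrightarrow> \<theta> \<in> {0..1} \<longrightarrow> \<theta>' \<in> {0..1} \<longrightarrow>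
    tent_basis cN C1 C2 \<Delta>x \<omega> \<longrightarrow>
    CFL P \<omega> \<delta> \<theta> \<theta>' \<Delta>t \<Delta>x MT \<longrightarrow>
    visc_sol_ivp P T u0 u \<longrightarrow>
    scheme_sol P \<omega> \<delta> \<theta> \<theta>' \<Delta>t \<Delta>x MT U \<longrightarrow>
    bounded (U ` grid \<Delta>t \<Delta>x MT) \<longrightarrow>
    (\<forall>j. U (0, lat \<Delta>x j) = u0 (lat \<Delta>x j)) \<longrightarrow>
    (\<forall>p\<in>grid \<Delta>t \<Delta>x MT. \<bar>U p - u p\<bar> \<le> C * (1 + T) *
       (if \<sigma> < 1 then
          (min T 1) powr (1/2) * (\<Delta>t powr (1/2) + \<Delta>x powr (1/2) + \<delta> powr (1 - \<sigma>/2))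
        else if \<sigma> = 1 then
          (min T 1) powr (1/2) *
            (\<Delta>t powr (1/2) * \<bar>ln \<Delta>t\<bar> + \<Delta>t powr (1/2) * \<bar>ln \<delta>\<bar> + \<Delta>x powr (1/2) * \<bar>ln \<delta>\<bar> + \<delta> powr (1/2))
        else
          (min T 1) powr (1/(2*\<sigma>)) * \<Delta>t powr (1/(2*\<sigma>)) +
          (min T 1) powr (1/2) *
            (\<Delta>t powr (1/2) * \<delta> powr (1 - \<sigma>) + \<Delta>x powr (1/2) * \<delta> powr (1 - \<sigma>) + \<delta> powr (1 - \<sigma>/2))))"
proof -
  obtain A0 where A0: "1 \<le> A0" "\<And>(P :: ('a, 'b, 'n, 'm) isaacs) T \<rho>. A3 P T K \<rho> \<Longrightarrow> A4 P \<rho> \<Lambda> \<Longrightarrow> A5 P \<sigma> C5 \<Longrightarrow> levy_moments A0 \<sigma> (levy P) \<rho>"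
    using levy_moments_exist[OF assms(1,4,2,3), of \<Lambda>, where 'a = 'a and 'b = 'b and 'n = 'n and 'm = 'm] by blast
  \<comment> \<open>Only quantities fixed before the equation and the grid enter. T0 is among them
    since the weight exp(\<open>lam\<close> t) is estimated by exp(\<open>lam\<close> A).\<close>
  define A where "A = A0 + K + real CARD('n) + \<bar>C2\<bar> + \<bar>T0\<bar>"
  have A: "1 \<le> A" "A0 \<le> A" "K \<le> A" "real CARD('n) \<le> A" "C2 \<le> A" "T0 \<le> A" "0 \<le> A"
    using A0(1) assms(1) unfolding A_def by linarith+
  define C where "C = final_const A * (20 * A^3)"
  have C: "0 < C" using final_const_pos[OF A(1)] A(1) by (simp add: C_def)
  show ?thesis
  proof (intro exI[of _ C] conjI C allI impI ballI)
    fix P :: "('a, 'b, 'n, 'm) isaacs" and u0 :: "real^'n \<Rightarrow> real" and \<rho> :: "real^'m \<Rightarrow> real" and \<omega> :: "int^'n \<Rightarrow> real^'n \<Rightarrow> real"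
      and T :: real and MT :: nat and \<Delta>t \<Delta>x \<delta> \<theta> \<theta>' :: real and u U :: "real \<times> (real^'n) \<Rightarrow> real" and p :: "real \<times> (real^'n)"
    assume T: "0 < T" "T \<le> T0" and MT: "MT > 0" and dt: "\<Delta>t = T / real MT"
      and a1: "A1 P T" and a2: "A2 P T u0 K" and a3: "A3 P T K \<rho>" and a4: "A4 P \<rho> \<Lambda>" and a5: "A5 P \<sigma> C5"
      and dx: "0 < \<Delta>x" "\<Delta>x \<le> \<delta>" "\<delta> \<le> 1" and th: "\<theta> \<in> {0..1}" "\<theta>' \<in> {0..1}"
      and tent: "tent_basis cN C1 C2 \<Delta>x \<omega>" and cfl: "CFL P \<omega> \<delta> \<theta> \<theta>' \<Delta>t \<Delta>x MT" and sol: "visc_sol_ivp P T u0 u"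
      and sch: "scheme_sol P \<omega> \<delta> \<theta> \<theta>' \<Delta>t \<Delta>x MT U" and bU: "bounded (U ` grid \<Delta>t \<Delta>x MT)"
      and U0: "\<forall>j. U (0, lat \<Delta>x j) = u0 (lat \<Delta>x j)" and p: "p \<in> grid \<Delta>t \<Delta>x MT"
    obtain B where "\<forall>x\<in>U ` grid \<Delta>t \<Delta>x MT. norm x \<le> B" using bU by (auto simp: bounded_iff)
    then have B: "\<bar>U (tm \<Delta>t n, lat \<Delta>x j)\<bar> \<le> B" if "n \<le> MT" for n j using that by (auto simp: grid_def)
    have ne: "ctrlA P \<noteq> {}" "ctrlB P \<noteq> {}" using a1 by (auto simp: A1_def)
    have K0: "0 \<le> K" using assms(1) by simp
    have n1: "norm1 T (\<lambda>(t, x). u0 x) \<le> ennreal K" "norm1 T (src P \<alpha> \<beta>) \<le> ennreal K" "norm1 T (zeroth P \<alpha> \<beta>) \<le> ennreal K" "norm1 T (drift P \<alpha> \<beta>) \<le> ennreal K"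
      if ab: "\<alpha> \<in> ctrlA P" "\<beta> \<in> ctrlB P" for \<alpha> \<beta>
    proof -
      have s: "norm1 T (\<lambda>(t, x). u0 x) + norm1 T (src P \<alpha> \<beta>) + norm1 T (zeroth P \<alpha> \<beta>) + norm1 T (drift P \<alpha> \<beta>) \<le> ennreal K"
        using a2 ab by (simp add: A2_def)
      have q: "x1 \<le> k \<and> x2 \<le> k \<and> x3 \<le> k \<and> x4 \<le> k" if "x1 + x2 + x3 + x4 \<le> k" for x1 x2 x3 x4 k :: ennreal
        by (intro conjI; rule order_trans[OF _ that]; simp add: add_increasing add_increasing2)
      show "norm1 T (\<lambda>(t, x). u0 x) \<le> ennreal K" "norm1 T (src P \<alpha> \<beta>) \<le> ennreal K" "norm1 T (zeroth P \<alpha> \<beta>) \<le> ennreal K" "norm1 T (drift P \<alpha> \<beta>) \<le> ennreal K"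
        using q[OF s] by auto
    qed
    have pd0: "0 \<le> pdist q r" for q r :: "real \<times> (real^'n)" by (simp add: pdist_def)
    have KA: "K * pdist q r \<le> A * pdist q r" for q r :: "real \<times> (real^'n)" using A(3) pd0 by (intro mult_right_mono) auto
    \<comment> \<open>(A2) bounds \<open>u0\<close> under the quantifier over the controls, so one
      pair of controls is needed to extract that bound.\<close>
    obtain \<alpha>0 \<beta>0 where ab0: "\<alpha>0 \<in> ctrlA P" "\<beta>0 \<in> ctrlB P" using ne by auto
    have z: "(0, x) \<in> cyl T" for x :: "real^'n" using T by (simp add: cyl_def)
    obtain n i where ni: "n \<le> MT" "p = (tm \<Delta>t n, lat \<Delta>x i)" using p by (auto simp: grid_def)
    let ?rate = "if \<sigma> < 1 then
          (min T 1) powr (1/2) * (\<Delta>t powr (1/2) + \<Delta>x powr (1/2) + \<delta> powr (1 - \<sigma>/2))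
        else if \<sigma> = 1 then
          (min T 1) powr (1/2) *
            (\<Delta>t powr (1/2) * \<bar>ln \<Delta>t\<bar> + \<Delta>t powr (1/2) * \<bar>ln \<delta>\<bar> + \<Delta>x powr (1/2) * \<bar>ln \<delta>\<bar> + \<delta> powr (1/2))
        else
          (min T 1) powr (1/(2*\<sigma>)) * \<Delta>t powr (1/(2*\<sigma>)) +
          (min T 1) powr (1/2) *
            (\<Delta>t powr (1/2) * \<delta> powr (1 - \<sigma>) + \<Delta>x powr (1/2) * \<delta> powr (1 - \<sigma>) + \<delta> powr (1 - \<sigma>/2))"
    have dt_pos: "0 < \<Delta>t" and dt_le: "\<Delta>t \<le> T"
    proof -
      show "0 < \<Delta>t" using T MT by (simp add: dt)
      have "1 \<le> real MT" using MT by simp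
      then show "\<Delta>t \<le> T" unfolding dt using T divide_left_mono[of 1 "real MT" T] by simp
    qed
    have TA: "T \<le> A" using T A(6) by linarith
    from rate_bound[OF A(1) T(1) TA dt_pos dt_le dx assms(2,3)]
    obtain r0 where r0: "0 < r0" "r0 + hscale \<sigma> r0 * sqrt (T * \<Delta>t)
      + sqrt (T * ((hscale \<sigma> \<delta>)\<^sup>2 * \<Delta>t\<^sup>2 + (hscale \<sigma> \<delta> * \<Delta>x + \<delta> powr (- \<sigma>) * \<Delta>x\<^sup>2) + \<delta> powr (2 - \<sigma>))) \<le> 20 * A^3 * ?rate" by blast
    interpret error_bounds P T A \<sigma> \<rho> u0 \<omega> cN C1 C2 \<delta> \<theta> \<theta>' \<Delta>t \<Delta>x MT U B u
    proof (unfold_locales, goal_cases)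
      case (9 \<alpha> \<beta> p)
      then show ?case using norm1_leD(1)[OF n1(2) K0, of \<alpha> \<beta> p] A(3) by simp
    next
      case (10 \<alpha> \<beta> p q)
      then show ?case using norm1_leD(2)[OF n1(2) K0, of \<alpha> \<beta> p q] KA[of p q] by simp
    next
      case (11 \<alpha> \<beta> p)
      moreover have "0 \<le> zeroth P \<alpha> \<beta> p" using a1 11 by (auto simp: A1_def)
      ultimately show ?case using norm1_leD(1)[OF n1(3) K0, of \<alpha> \<beta> p] A(3) by simp
    next
      case (12 \<alpha> \<beta> p q)
      then show ?case using norm1_leD(2)[OF n1(3) K0, of \<alpha> \<beta> p q] KA[of p q] by simp
    next
      case (13 \<alpha> \<beta> p)
      then show ?case using norm1_leD(1)[OF n1(4) K0, of \<alpha> \<beta> p] A(3) by simp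
    next
      case (14 \<alpha> \<beta> p q)
      then show ?case using norm1_leD(2)[OF n1(4) K0, of \<alpha> \<beta> p q] KA[of p q] by simp
    next
      case (15 x)
      show ?case using norm1_leD(1)[OF n1(1)[OF ab0] K0 z[of x]] A(3) by simp
    next
      case (16 x y)
      show ?case using norm1_leD(2)[OF n1(1)[OF ab0] K0 z[of x] z[of y]] KA[of "(0, x)" "(0, y)"] by (simp add: pdist_def)
    next
      case (17 \<alpha> \<beta> p z)
      then show ?case using a3 by (auto simp: A3_def)
    next
      case (18 \<alpha> \<beta> p q z)
      then show ?case using a3 by (auto simp: A3_def)
    next
      case (19 \<alpha> \<beta> p)
      have J: "continuous_on (ctrlA P \<times> ctrlB P \<times> cyl T \<times> - {0}) (\<lambda>(\<alpha>, \<beta>, p, z). jump P \<alpha> \<beta> p z)"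
        using a1 by (simp add: A1_def)
      have c: "continuous_on (- {0}) (\<lambda>z. (\<alpha>, \<beta>, p, z))" by (intro continuous_intros)
      have "continuous_on (- {0}) (\<lambda>z. (\<lambda>(\<alpha>, \<beta>, p, z). jump P \<alpha> \<beta> p z) (\<alpha>, \<beta>, p, z))"
        by (rule continuous_on_compose2[OF J c]) (use 19 in auto)
      then show ?case by simp
    next
      case 23
      show ?case by (rule levy_moments_mono[OF A0(2)[OF a3 a4 a5] A(2)])
    qed (use T A ne MT dt dx th tent cfl sch B U0 sol a3 a4 assms in \<open>auto simp: A3_def A4_def is_levy_def\<close>)
    have "\<bar>U p - u p\<bar> \<le> final_const A * (r0 + hscale \<sigma> r0 * sqrt (T * \<Delta>t)
      + sqrt (T * ((hscale \<sigma> \<delta>)\<^sup>2 * \<Delta>t\<^sup>2 + (hscale \<sigma> \<delta> * \<Delta>x + \<delta> powr (- \<sigma>) * \<Delta>x\<^sup>2) + \<delta> powr (2 - \<sigma>))))"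
      unfolding ni using error_estimate[OF r0(1) ni(1), of i] unfolding X1_def .
    also have "\<dots> \<le> final_const A * (20 * A^3 * ?rate)"
      using r0(2) final_const_pos[OF A(1)] by (intro mult_left_mono) auto
    also have "\<dots> = C * 1 * ?rate" unfolding C_def by (simp only: mult.assoc mult_1_left mult_1_right)
    also have "\<dots> \<le> C * (1 + T) * ?rate"
    proof (rule mult_right_mono)
      show "C * 1 \<le> C * (1 + T)" using C T by (intro mult_left_mono) auto
      show "0 \<le> ?rate" by (auto intro!: mult_nonneg_nonneg add_nonneg_nonneg)
    qed
    finally show "\<bar>U p - u p\<bar> \<le> C * (1 + T) * (?rate)" .
  qed
qed

end
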